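(* Under ReFM (threshold $a>0$), assume the regularity conditions (i)–(iii) below. For $\alpha\in(0,1)$ let $c_{1-\alpha}$ be the solution of $\lim_{n\to\infty}P\{\hat{\boldsymbol{\tau}}-\boldsymbol{\tau}\in\mathcal{O}(\boldsymbol{V}_{\tau\tau},c_{1-\alpha})\mid\mathcal{M}\}=1-\alpha$. Then $c_{1-\alpha}$ depends only on $(L,K,a)$ and the canonical correlations $\pi_1^2,\dots,\pi_F^2$, and for fixed $(L,K,a)$ it is nonincreasing in each of these canonical correlations.
   Context: Setup ($2^K$ factorial experiment, finite population). $K\ge1$ two-level factors, $Q=2^K$ treatment combinations $q=1,\dots,Q$; combination $q$ sets factor $k$ at $\iota_k(q)\in\{-1,+1\}$, bijectively onto $\{-1,+1\}^K$. $F=Q-1$ factorial effects, one per nonempty $A\subseteq\{1,\dots,K\}$, enumerated $f=1,\dots,F$, with $g_{fq}=\prod_{k\in A}\iota_k(q)$; $\boldsymbol{b}_q=(g_{1q},\dots,g_{Fq})'$. Units $i=1,\dots,n$ have fixed potential outcomes $Y_i(q)$ and covariates $\boldsymbol{x}_i\in\mathbb{R}^L$; $\bar Y(q),\bar{\boldsymbol{x}}$ means; $\boldsymbol{\tau}_i=2^{-(K-1)}\sum_q\boldsymbol{b}_qY_i(q)$, $\boldsymbol{\tau}=2^{-(K-1)}\sum_q\boldsymbol{b}_q\bar Y(q)$. Finite-population (co)variances with divisor $n-1$: $S_{qk}$ between $Y(q),Y(k)$; $\boldsymbol{S}_{\tau\tau}$ of $\boldsymbol{\tau}_i$; $\boldsymbol{S}_{xx}$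 of $\boldsymbol{x}$; $\boldsymbol{S}_{q,x}$ between $Y(q),\boldsymbol{x}$. CRFE: fixed $n_q\ge1$, $\sum n_q=n$; $\boldsymbol{Z}$ uniform over assignments with $n_q$ units in combination $q$. $\hat{\bar Y}(q),\hat{\bar{\boldsymbol{x}}}(q)$ group-$q$ means of observed outcomes $Y_i(Z_i)$ and covariates; $\hat{\boldsymbol{\tau}}=2^{-(K-1)}\sum_q\boldsymbol{b}_q\hat{\bar Y}(q)$; $\hat{\boldsymbol{\tau}}_x=(\hat{\boldsymbol{\tau}}_{x,1}',\dots,\hat{\boldsymbol{\tau}}_{x,F}')'$, $\hat{\boldsymbol{\tau}}_{x,f}=2^{-(K-1)}\sum_qg_{fq}\hat{\bar{\boldsymbol{x}}}(q)$. $\boldsymbol{V}_{\tau\tau}=2^{-2(K-1)}\sum_qn_q^{-1}\boldsymbol{b}_q\boldsymbol{b}_q'S_{qq}-n^{-1}\boldsymbol{S}_{\tau\tau}$, assumed invertible; $\boldsymbol{V}_{xx}=2^{-2(K-1)}\sum_qn_q^{-1}(\boldsymbol{b}_q\boldsymbol{b}_q')\otimes\boldsymbol{S}_{xx}$. ReFM: accept iff $\hat{\boldsymbol{\tau}}_x'\boldsymbol{V}_{xx}^{-1}\hat{\boldsymbol{\tau}}_x\le a$; $\mathcal{M}$ is this event. Projections: $Y_i^{\parallel}(q)=\bar Y(q)+\boldsymbol{S}_{q,x}\boldsymbol{S}_{xx}^{-1}(\boldsymbol{x}_i-\bar{\boldsymbol{x}})$, $\boldsymbol{\tau}_i^{\parallel}=2^{-(K-1)}\sum_q\boldsymbol{b}_qY^{\parallel}_i(q)$,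 $S^{\parallel}_{qq},\boldsymbol{S}^{\parallel}_{\tau\tau}$ their finite-population variances, $\boldsymbol{V}^{\parallel}_{\tau\tau}=2^{-2(K-1)}\sum_qn_q^{-1}\boldsymbol{b}_q\boldsymbol{b}_q'S^{\parallel}_{qq}-n^{-1}\boldsymbol{S}^{\parallel}_{\tau\tau}$. $\boldsymbol{R}=\boldsymbol{V}_{\tau\tau}^{-1/2}\boldsymbol{V}^{\parallel}_{\tau\tau}\boldsymbol{V}_{\tau\tau}^{-1/2}$ (symmetric PSD roots) has eigenvalues $\pi_1^2,\dots,\pi_F^2$, the canonical correlations between $\hat{\boldsymbol{\tau}}$ and $\hat{\boldsymbol{\tau}}_x$ under the CRFE. For positive definite $\boldsymbol{\Lambda}$ and $c\ge0$, $\mathcal{O}(\boldsymbol{\Lambda},c)=\{\boldsymbol{\mu}:\boldsymbol{\mu}'\boldsymbol{\Lambda}^{-1}\boldsymbol{\mu}\le c\}$. Regularity conditions, as $n\to\infty$, for all $q\ne k$: (i) $n_q/n$ has a positive limit; (ii) $S_{qq},S_{qk},\boldsymbol{S}_{xx},\boldsymbol{S}_{q,x}$ have limits, $\boldsymbol{S}_{xx}$ and its limit nonsingular; (iii) $\max_i|Y_i(q)-\bar Y(q)|^2/n\to0$, $\max_i\|\boldsymbol{x}_i-\bar{\boldsymbol{x}}\|_2^2/n\to0$.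
   Formalization: It is additionally assumed that n·V_ττ has a nonsingular limit (without this c_{1-α} need not exist, e.g. when one unit carries all outcome variation), and the canonical correlations are the eigenvalues of the limit of R. *)

theory Defs
  imports "Jordan_Normal_Form.Char_Poly" "HOL-Library.FuncSet"
begin

text \<open>Treatment combinations are q = 0,...,Q-1 with Q = 2^K; combination q sets factor k
  (k < K) to +1 iff bit k of q is set. Factorial effects are f = 0,...,F-1 with F = Q - 1;
  effect f corresponds to the nonempty factor set whose bit pattern is f+1.\<close>

definition nQ :: "nat \<Rightarrow> nat" where "nQ K = 2 ^ K"
definition nF :: "nat \<Rightarrow> nat" where "nF K = 2 ^ K - 1"

definition iota :: "nat \<Rightarrow> nat \<Rightarrow> real" where
  "iota q k = (if odd (q div 2 ^ k) then 1 else -1)"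

definition effset :: "nat \<Rightarrow> nat \<Rightarrow> nat set" where
  "effset K f = {k. k < K \<and> odd ((f + 1) div 2 ^ k)}"

definition gcoef :: "nat \<Rightarrow> nat \<Rightarrow> nat \<Rightarrow> real" where
  "gcoef K f q = (\<Prod>k\<in>effset K f. iota q k)"

definition fmean :: "nat \<Rightarrow> (nat \<Rightarrow> real) \<Rightarrow> real" where
  "fmean n h = (\<Sum>i<n. h i) / real n"

definition fcov :: "nat \<Rightarrow> (nat \<Rightarrow> real) \<Rightarrow> (nat \<Rightarrow> real) \<Rightarrow> real" where
  "fcov n h1 h2 = (\<Sum>i<n. (h1 i - fmean n h1) * (h2 i - fmean n h2)) / (real n - 1)"

definition minv :: "nat \<Rightarrow> real mat \<Rightarrow> real mat" where
  "minv d A = (THE B. B \<in> carrier_mat d d \<and> A * B = 1\<^sub>m d \<and> B * A = 1\<^sub>m d)"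

definition psd_sqrt :: "nat \<Rightarrow> real mat \<Rightarrow> real mat" where
  "psd_sqrt d A = (THE B. B \<in> carrier_mat d d \<and> B\<^sup>T = B \<and>
      (\<forall>v\<in>carrier_vec d. 0 \<le> v \<bullet> (B *\<^sub>v v)) \<and> B * B = A)"

text \<open>Y i q : potential outcome of unit i under combination q; X i l : covariate l of unit i.\<close>

definition Smat_x :: "nat \<Rightarrow> nat \<Rightarrow> (nat \<Rightarrow> nat \<Rightarrow> real) \<Rightarrow> real mat" where
  "Smat_x L n X = mat L L (\<lambda>(l, l'). fcov n (\<lambda>i. X i l) (\<lambda>i. X i l'))"

definition Svec_qx :: "nat \<Rightarrow> nat \<Rightarrow> (nat \<Rightarrow> nat \<Rightarrow> real) \<Rightarrow> (nat \<Rightarrow> nat \<Rightarrow> real)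
    \<Rightarrow> nat \<Rightarrow> real vec" where
  "Svec_qx L n Y X q = vec L (\<lambda>l. fcov n (\<lambda>i. Y i q) (\<lambda>i. X i l))"

definition tau_ind :: "nat \<Rightarrow> (nat \<Rightarrow> nat \<Rightarrow> real) \<Rightarrow> nat \<Rightarrow> nat \<Rightarrow> real" where
  "tau_ind K Y i f = (\<Sum>q<nQ K. gcoef K f q * Y i q) / 2 ^ (K - 1)"

definition tau_avg :: "nat \<Rightarrow> nat \<Rightarrow> (nat \<Rightarrow> nat \<Rightarrow> real) \<Rightarrow> real vec" where
  "tau_avg K n Y = vec (nF K) (\<lambda>f. (\<Sum>q<nQ K. gcoef K f q * fmean n (\<lambda>i. Y i q)) / 2 ^ (K - 1))"

definition Vtt :: "nat \<Rightarrow> nat \<Rightarrow> (nat \<Rightarrow> nat) \<Rightarrow> (nat \<Rightarrow> nat \<Rightarrow> real) \<Rightarrow> real mat" where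
  "Vtt K n nq Y = mat (nF K) (nF K) (\<lambda>(f, f').
     (\<Sum>q<nQ K. gcoef K f q * gcoef K f' q * fcov n (\<lambda>i. Y i q) (\<lambda>i. Y i q) / real (nq q))
        / 2 ^ (2 * (K - 1))
     - fcov n (\<lambda>i. tau_ind K Y i f) (\<lambda>i. tau_ind K Y i f') / real n)"

text \<open>V_xx, an (L F) x (L F) matrix; index f * L + l corresponds to block f, coordinate l.\<close>
definition Vxx :: "nat \<Rightarrow> nat \<Rightarrow> nat \<Rightarrow> (nat \<Rightarrow> nat) \<Rightarrow> (nat \<Rightarrow> nat \<Rightarrow> real) \<Rightarrow> real mat" where
  "Vxx K L n nq X = mat (nF K * L) (nF K * L) (\<lambda>(j, j').
     ((\<Sum>q<nQ K. gcoef K (j div L) q * gcoef K (j' div L) q / real (nq q)) / 2 ^ (2 * (K - 1)))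
       * Smat_x L n X $$ (j mod L, j' mod L))"

definition Ypar :: "nat \<Rightarrow> nat \<Rightarrow> (nat \<Rightarrow> nat \<Rightarrow> real) \<Rightarrow> (nat \<Rightarrow> nat \<Rightarrow> real)
    \<Rightarrow> nat \<Rightarrow> nat \<Rightarrow> real" where
  "Ypar L n Y X i q = fmean n (\<lambda>j. Y j q)
     + Svec_qx L n Y X q \<bullet> (minv L (Smat_x L n X) *\<^sub>v vec L (\<lambda>l. X i l - fmean n (\<lambda>j. X j l)))"

text \<open>R = V_tautau^(-1/2) V^par_tautau V_tautau^(-1/2); its eigenvalues are the squared
  canonical correlations.\<close>
definition Rmat :: "nat \<Rightarrow> nat \<Rightarrow> nat \<Rightarrow> (nat \<Rightarrow> nat) \<Rightarrow> (nat \<Rightarrow> nat \<Rightarrow> real)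
    \<Rightarrow> (nat \<Rightarrow> nat \<Rightarrow> real) \<Rightarrow> real mat" where
  "Rmat K L n nq Y X =
     (let W = psd_sqrt (nF K) (minv (nF K) (Vtt K n nq Y))
      in W * Vtt K n nq (Ypar L n Y X) * W)"

definition assignments :: "nat \<Rightarrow> nat \<Rightarrow> (nat \<Rightarrow> nat) \<Rightarrow> (nat \<Rightarrow> nat) set" where
  "assignments K n nq = {Z \<in> {..<n} \<rightarrow>\<^sub>E {..<nQ K}. \<forall>q<nQ K. card {i. i < n \<and> Z i = q} = nq q}"

definition grp_mean :: "nat \<Rightarrow> (nat \<Rightarrow> nat) \<Rightarrow> (nat \<Rightarrow> nat) \<Rightarrow> (nat \<Rightarrow> real) \<Rightarrow> nat \<Rightarrow> real" where
  "grp_mean n nq Z h q = (\<Sum>i | i < n \<and> Z i = q. h i) / real (nq q)"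

definition tau_hat :: "nat \<Rightarrow> nat \<Rightarrow> (nat \<Rightarrow> nat) \<Rightarrow> (nat \<Rightarrow> nat \<Rightarrow> real) \<Rightarrow> (nat \<Rightarrow> nat) \<Rightarrow> real vec" where
  "tau_hat K n nq Y Z = vec (nF K) (\<lambda>f.
     (\<Sum>q<nQ K. gcoef K f q * grp_mean n nq Z (\<lambda>i. Y i (Z i)) q) / 2 ^ (K - 1))"

definition tau_hat_x :: "nat \<Rightarrow> nat \<Rightarrow> nat \<Rightarrow> (nat \<Rightarrow> nat) \<Rightarrow> (nat \<Rightarrow> nat \<Rightarrow> real) \<Rightarrow> (nat \<Rightarrow> nat) \<Rightarrow> real vec" where
  "tau_hat_x K L n nq X Z = vec (nF K * L) (\<lambda>j.
     (\<Sum>q<nQ K. gcoef K (j div L) q * grp_mean n nq Z (\<lambda>i. X i (j mod L)) q) / 2 ^ (K - 1))"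

definition accept :: "nat \<Rightarrow> nat \<Rightarrow> nat \<Rightarrow> (nat \<Rightarrow> nat) \<Rightarrow> (nat \<Rightarrow> nat \<Rightarrow> real) \<Rightarrow> real
    \<Rightarrow> (nat \<Rightarrow> nat) \<Rightarrow> bool" where
  "accept K L n nq X a Z =
     (tau_hat_x K L n nq X Z \<bullet> (minv (nF K * L) (Vxx K L n nq X) *\<^sub>v tau_hat_x K L n nq X Z) \<le> a)"

definition cover_prob :: "nat \<Rightarrow> nat \<Rightarrow> nat \<Rightarrow> (nat \<Rightarrow> nat) \<Rightarrow> (nat \<Rightarrow> nat \<Rightarrow> real)
    \<Rightarrow> (nat \<Rightarrow> nat \<Rightarrow> real) \<Rightarrow> real \<Rightarrow> real \<Rightarrow> real" where
  "cover_prob K L n nq Y X a c =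
     (let D = tau_hat K n nq Y; t = tau_avg K n Y; Vi = minv (nF K) (Vtt K n nq Y);
          A = {Z \<in> assignments K n nq. accept K L n nq X a Z}
      in real (card {Z \<in> A. (D Z - t) \<bullet> (Vi *\<^sub>v (D Z - t)) \<le> c}) / real (card A))"

text \<open>A sequence indexed by m of populations: size N m, group sizes nq m q,
  outcomes Y m i q, covariates X m i l.\<close>

definition design_ok :: "nat \<Rightarrow> nat \<Rightarrow> (nat \<Rightarrow> nat) \<Rightarrow> (nat \<Rightarrow> nat \<Rightarrow> nat)
    \<Rightarrow> (nat \<Rightarrow> nat \<Rightarrow> nat \<Rightarrow> real) \<Rightarrow> (nat \<Rightarrow> nat \<Rightarrow> nat \<Rightarrow> real) \<Rightarrow> bool" where
  "design_ok K L N nq Y X =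
     (filterlim N at_top sequentially \<and>
      (\<forall>m. (\<forall>q<nQ K. 1 \<le> nq m q) \<and> (\<Sum>q<nQ K. nq m q) = N m \<and>
           invertible_mat (Vtt K (N m) (nq m) (Y m)) \<and>
           invertible_mat (Smat_x L (N m) (X m))))"

definition cond_i :: "nat \<Rightarrow> (nat \<Rightarrow> nat) \<Rightarrow> (nat \<Rightarrow> nat \<Rightarrow> nat) \<Rightarrow> bool" where
  "cond_i K N nq = (\<forall>q<nQ K. \<exists>r>0. (\<lambda>m. real (nq m q) / real (N m)) \<longlonglongrightarrow> r)"

definition cond_ii :: "nat \<Rightarrow> nat \<Rightarrow> (nat \<Rightarrow> nat) \<Rightarrow> (nat \<Rightarrow> nat \<Rightarrow> nat \<Rightarrow> real)
    \<Rightarrow> (nat \<Rightarrow> nat \<Rightarrow> nat \<Rightarrow> real) \<Rightarrow> bool" where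
  "cond_ii K L N Y X =
     ((\<forall>q<nQ K. \<forall>k<nQ K. convergent (\<lambda>m. fcov (N m) (\<lambda>i. Y m i q) (\<lambda>i. Y m i k))) \<and>
      (\<exists>S\<in>carrier_mat L L. det S \<noteq> 0 \<and>
         (\<forall>l<L. \<forall>l'<L. (\<lambda>m. Smat_x L (N m) (X m) $$ (l, l')) \<longlonglongrightarrow> S $$ (l, l'))) \<and>
      (\<forall>q<nQ K. \<forall>l<L. convergent (\<lambda>m. Svec_qx L (N m) (Y m) (X m) q $ l)))"

definition cond_iii :: "nat \<Rightarrow> nat \<Rightarrow> (nat \<Rightarrow> nat) \<Rightarrow> (nat \<Rightarrow> nat \<Rightarrow> nat \<Rightarrow> real)
    \<Rightarrow> (nat \<Rightarrow> nat \<Rightarrow> nat \<Rightarrow> real) \<Rightarrow> bool" where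
  "cond_iii K L N Y X =
     ((\<forall>q<nQ K. (\<lambda>m. Max ((\<lambda>i. (Y m i q - fmean (N m) (\<lambda>j. Y m j q))\<^sup>2) ` {..<N m}) / real (N m))
                  \<longlonglongrightarrow> 0) \<and>
      (\<lambda>m. Max ((\<lambda>i. \<Sum>l<L. (X m i l - fmean (N m) (\<lambda>j. X m j l))\<^sup>2) ` {..<N m}) / real (N m))
         \<longlonglongrightarrow> 0)"

text \<open>Additional (standard) requirement: n V_tautau has a nonsingular limit.\<close>
definition Vlim_nonsingular :: "nat \<Rightarrow> (nat \<Rightarrow> nat) \<Rightarrow> (nat \<Rightarrow> nat \<Rightarrow> nat)
    \<Rightarrow> (nat \<Rightarrow> nat \<Rightarrow> nat \<Rightarrow> real) \<Rightarrow> bool" where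
  "Vlim_nonsingular K N nq Y =
     (\<exists>W\<in>carrier_mat (nF K) (nF K). det W \<noteq> 0 \<and>
        (\<forall>f<nF K. \<forall>f'<nF K. (\<lambda>m. real (N m) * Vtt K (N m) (nq m) (Y m) $$ (f, f')) \<longlonglongrightarrow> W $$ (f, f')))"

text \<open>p lists (with multiplicity) the limiting squared canonical correlations pi_1^2..pi_F^2,
  i.e. the eigenvalues of the limit of R.\<close>
definition canon_corr_limit :: "nat \<Rightarrow> nat \<Rightarrow> (nat \<Rightarrow> nat) \<Rightarrow> (nat \<Rightarrow> nat \<Rightarrow> nat)
    \<Rightarrow> (nat \<Rightarrow> nat \<Rightarrow> nat \<Rightarrow> real) \<Rightarrow> (nat \<Rightarrow> nat \<Rightarrow> nat \<Rightarrow> real) \<Rightarrow> real list \<Rightarrow> bool" where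
  "canon_corr_limit K L N nq Y X p =
     (length p = nF K \<and>
      (\<exists>R\<in>carrier_mat (nF K) (nF K).
         (\<forall>f<nF K. \<forall>f'<nF K. (\<lambda>m. Rmat K L (N m) (nq m) (Y m) (X m) $$ (f, f')) \<longlonglongrightarrow> R $$ (f, f')) \<and>
         char_poly R = (\<Prod>x\<leftarrow>p. [:- x, 1:])))"

end

theory Submission
  imports Defs "HOL-Probability.Probability" "Jordan_Normal_Form.Schur_Decomposition"
begin

text \<open>
  Rotate and standardize the estimation error to \<open>U = \<Omega> V\<^sub>\<tau>\<^sub>\<tau>\<^sup>-\<^sup>1\<^sup>/\<^sup>2 (\<tau>\<^sub>e\<^sub>s\<^sub>t - \<tau>)\<close> and the covariate imbalance to
  \<open>X = V\<^sub>x\<^sub>x\<^sup>-\<^sup>1\<^sup>/\<^sup>2 \<tau>\<^sub>x\<close>, where the orthogonal matrix \<open>\<Omega>\<close> diagonalizes the limit of \<open>R\<close>. The regions of the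
  theorem are \<open>|U|\<^sup>2 \<le> c\<close> and \<open>|X|\<^sup>2 \<le> a\<close>, and the cross covariance \<open>C\<close> of \<open>(U, X)\<close> satisfies \<open>C C\<^sup>T = \<Omega> R \<Omega>\<^sup>T\<close>.
  Linear combinations of \<open>U\<close> and \<open>X\<close> are asymptotically normal by a combinatorial central limit theorem, proved
  by Stein's method with the exchangeable pair that swaps the treatments of two units. Although \<open>C\<close> itself need
  not converge, averaging the characteristic function over normal arguments shows that the joint Laplace transform
  of \<open>(|U|\<^sup>2, |X|\<^sup>2)\<close> has a limit depending only on the eigenvalues \<open>p\<^sub>f\<close> of the limit of \<open>R\<close>: it is that of
  \<open>\<Sum>\<^sub>f (\<surd>(1 - p\<^sub>f) \<epsilon>\<^sub>f + \<surd>p\<^sub>f \<eta>\<^sub>f)\<^sup>2\<close> and \<open>\<Sum>\<^sub>j \<eta>\<^sub>j\<^sup>2\<close> for independent standard normal \<open>\<epsilon>\<^sub>f\<close>, \<open>\<eta>\<^sub>j\<close>.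
  This law has no atoms, and shrinking both coordinates by a common factor distorts it only boundedly, so that its
  distribution function in \<open>c\<close> is strictly increasing up to its supremum: the critical value exists and is unique.
  Raising one \<open>p\<^sub>f\<close> increases every quadrant probability because, conditionally on the other variables, two
  symmetric Gaussian slabs are jointly more likely the larger their correlation.
\<close>

unbundle no inner_syntax
unbundle no vec_syntax
hide_type (open) Finite_Cartesian_Product.vec
hide_const (open) Finite_Cartesian_Product.vec Finite_Cartesian_Product.mat Determinants.det
  Finite_Cartesian_Product.row Finite_Cartesian_Product.transpose

section \<open>The combinatorial central limit theorem\<close>

definition avg :: "'a set \<Rightarrow> ('a \<Rightarrow> 'b) \<Rightarrow> 'b::real_normed_field" where
  "avg S f = (\<Sum>Z\<in>S. f Z) / of_nat (card S)"

lemma avg_add: "avg S (\<lambda>Z. f Z + g Z) = avg S f + avg S g"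
  by (simp add: avg_def sum.distrib add_divide_distrib)

lemma avg_diff: "avg S (\<lambda>Z. f Z - g Z) = avg S f - avg S g"
  by (simp add: avg_def sum_subtractf diff_divide_distrib)

lemma avg_cmult: "avg S (\<lambda>Z. c * f Z) = c * avg S f"
  by (simp add: avg_def sum_distrib_left)

lemma avg_sum: "avg S (\<lambda>Z. \<Sum>i\<in>I. f i Z) = (\<Sum>i\<in>I. avg S (f i))"
  unfolding avg_def by (subst sum.swap) (simp add: sum_divide_distrib)

lemma avg_const: "finite S \<Longrightarrow> S \<noteq> {} \<Longrightarrow> avg S (\<lambda>Z. c) = c"
  by (simp add: avg_def)

lemma avg_mono:
  fixes f g :: "'a \<Rightarrow> real"
  assumes "\<And>Z. Z \<in> S \<Longrightarrow> f Z \<le> g Z"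
  shows "avg S f \<le> avg S g"
  by (simp add: avg_def divide_right_mono sum_mono assms)

lemma avg_cong: "(\<And>Z. Z \<in> S \<Longrightarrow> f Z = g Z) \<Longrightarrow> avg S f = avg S g"
  by (simp add: avg_def)

lemma norm_avg_le: "norm (avg S f) \<le> avg S (\<lambda>Z. norm (f Z))"
  by (simp add: avg_def norm_divide divide_right_mono norm_sum)

lemma norm_avg_le_bound:
  assumes "\<And>Z. Z \<in> S \<Longrightarrow> norm (f Z) \<le> b" "finite S" "S \<noteq> {}"
  shows "norm (avg S f) \<le> b"
  using order_trans[OF norm_avg_le avg_mono[of S "\<lambda>Z. norm (f Z)" "\<lambda>_. b"]] assms avg_const[of S b]
  by auto

definition lin_stat :: "nat \<Rightarrow> (nat \<Rightarrow> nat \<Rightarrow> real) \<Rightarrow> (nat \<Rightarrow> nat) \<Rightarrow> real" where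
  "lin_stat n a Z = (\<Sum>i<n. a i (Z i))"

definition centred :: "nat \<Rightarrow> nat \<Rightarrow> (nat \<Rightarrow> nat \<Rightarrow> real) \<Rightarrow> bool" where
  "centred K n a = (\<forall>q<nQ K. (\<Sum>i<n. a i q) = 0)"

definition sqsum :: "nat \<Rightarrow> nat \<Rightarrow> (nat \<Rightarrow> nat \<Rightarrow> real) \<Rightarrow> real" where
  "sqsum K n a = (\<Sum>i<n. \<Sum>q<nQ K. (a i q)\<^sup>2)"

definition swap_effect :: "(nat \<Rightarrow> nat \<Rightarrow> real) \<Rightarrow> (nat \<Rightarrow> nat) \<Rightarrow> nat \<Rightarrow> nat \<Rightarrow> real" where
  "swap_effect a Z i j = a i (Z j) + a j (Z i) - a i (Z i) - a j (Z j)"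

definition lim_var :: "nat \<Rightarrow> nat \<Rightarrow> (nat \<Rightarrow> nat) \<Rightarrow> (nat \<Rightarrow> nat \<Rightarrow> real) \<Rightarrow> real" where
  "lim_var K n nq a = (\<Sum>i<n. (\<Sum>q<nQ K. real (nq q) / real n * (a i q)\<^sup>2)
      - ((\<Sum>q<nQ K. real (nq q) * a i q) / real n)\<^sup>2)"

lemma finite_assignments: "finite (assignments K n nq)"
  unfolding assignments_def
  by (rule finite_subset[of _ "{..<n} \<rightarrow>\<^sub>E {..<nQ K}"]) (auto intro: finite_PiE)

lemma assignments_nonempty:
  assumes "(\<Sum>q<nQ K. nq q) = n"
  shows "assignments K n nq \<noteq> {}"
proof -
  have "card (SIGMA q:{..<nQ K}. {..<nq q}) = n"
    using assms by (subst card_SigmaI) auto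
  then obtain h where h: "bij_betw h {..<n} (SIGMA q:{..<nQ K}. {..<nq q})"
    by (metis finite_same_card_bij finite_SigmaI finite_lessThan card_lessThan)
  define Z where "Z = restrict (fst \<circ> h) {..<n}"
  have "Z \<in> {..<n} \<rightarrow>\<^sub>E {..<nQ K}"
    using bij_betw_apply[OF h] by (force simp: Z_def)
  moreover have "card {i. i < n \<and> Z i = q} = nq q" if q: "q < nQ K" for q
  proof -
    have "bij_betw h {i. i < n \<and> Z i = q} ({q} \<times> {..<nq q})"
    proof (rule bij_betw_subset[OF h, THEN bij_betw_cong[THEN iffD1, rotated]])
      show "{i. i < n \<and> Z i = q} \<subseteq> {..<n}" by auto
    next
      show "h ` {i. i < n \<and> Z i = q} = {q} \<times> {..<nq q}"
      proof (intro equalityI subsetI)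
        fix y assume "y \<in> h ` {i. i < n \<and> Z i = q}"
        then obtain i where i: "i < n" "Z i = q" "y = h i" by auto
        then have "h i \<in> (SIGMA q:{..<nQ K}. {..<nq q})" using bij_betw_apply[OF h] by auto
        with i show "y \<in> {q} \<times> {..<nq q}" by (auto simp: Z_def)
      next
        fix y assume y: "y \<in> {q} \<times> {..<nq q}"
        then have "y \<in> (SIGMA q:{..<nQ K}. {..<nq q})" using q by auto
        then obtain i where "i < n" "h i = y"
          using h by (metis bij_betw_def imageE lessThan_iff)
        with y show "y \<in> h ` {i. i < n \<and> Z i = q}"
          by (auto simp: Z_def image_iff intro!: exI[of _ i])
      qed
    qed auto
    from bij_betw_same_card[OF this] show ?thesis by simp
  qed
  ultimately show ?thesis unfolding assignments_def by blast
qed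

lemma assignments_less: "Z \<in> assignments K n nq \<Longrightarrow> i < n \<Longrightarrow> Z i < nQ K"
  by (auto simp: assignments_def)

lemma sum_by_group:
  fixes c :: "nat \<Rightarrow> nat \<Rightarrow> 'a::comm_monoid_add"
  assumes "Z \<in> assignments K n nq"
  shows "(\<Sum>i<n. c i (Z i)) = (\<Sum>q<nQ K. \<Sum>i | i < n \<and> Z i = q. c i q)"
proof -
  have "(\<Sum>q<nQ K. \<Sum>i | i \<in> {..<n} \<and> Z i = q. c i (Z i)) = (\<Sum>i<n. c i (Z i))"
    by (rule sum.group) (use assms in \<open>auto simp: assignments_def\<close>)
  then show ?thesis by (auto intro!: sum.cong simp: eq_commute)
qed

lemma sum_group_sizes:
  fixes c :: "nat \<Rightarrow> real"
  assumes "Z \<in> assignments K n nq"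
  shows "(\<Sum>i<n. c (Z i)) = (\<Sum>q<nQ K. real (nq q) * c q)"
  using sum_by_group[OF assms, of "\<lambda>_. c"] assms by (simp add: assignments_def)

lemma swap_assignment:
  assumes "Z \<in> assignments K n nq" "i < n" "j < n"
  shows "Z \<circ> Transposition.transpose i j \<in> assignments K n nq"
proof -
  let ?t = "Transposition.transpose i j"
  have lt: "?t k < n \<longleftrightarrow> k < n" for k
    using assms by (auto simp: Transposition.transpose_def)
  have "Z \<circ> ?t \<in> {..<n} \<rightarrow>\<^sub>E {..<nQ K}"
    using assms lt by (auto simp: assignments_def PiE_def Pi_def extensional_def)
  moreover have "card {k. k < n \<and> (Z \<circ> ?t) k = q} = nq q" if "q < nQ K" for q
  proof -
    have "{k. k < n \<and> (Z \<circ> ?t) k = q} = ?t ` {k. k < n \<and> Z k = q}"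
    proof (intro equalityI subsetI)
      fix k assume "k \<in> {k. k < n \<and> (Z \<circ> ?t) k = q}"
      then show "k \<in> ?t ` {k. k < n \<and> Z k = q}"
        using lt by (intro image_eqI[of _ _ "?t k"]) auto
    next
      fix k assume "k \<in> ?t ` {k. k < n \<and> Z k = q}"
      then obtain k' where k': "k = ?t k'" "k' < n" "Z k' = q" by auto
      then have "k < n" using lt by blast
      with k' show "k \<in> {k. k < n \<and> (Z \<circ> ?t) k = q}" by simp
    qed
    then show ?thesis
      using assms that by (simp add: card_image assignments_def)
  qed
  ultimately show ?thesis by (simp add: assignments_def)
qed

lemma lin_stat_swap:
  assumes "i < n" "j < n"
  shows "lin_stat n a (Z \<circ> Transposition.transpose i j) = lin_stat n a Z + swap_effect a Z i j"
proof (cases "i = j")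
  case False
  have split: "(\<Sum>k<n. f k) = f i + f j + (\<Sum>k\<in>{..<n} - {i, j}. f k)" for f :: "nat \<Rightarrow> real"
  proof -
    have "(\<Sum>k<n. f k) = f i + (\<Sum>k\<in>{..<n} - {i}. f k)"
      using assms by (simp add: sum.remove)
    also have "(\<Sum>k\<in>{..<n} - {i}. f k) = f j + (\<Sum>k\<in>{..<n} - {i} - {j}. f k)"
      using assms False by (intro sum.remove) auto
    also have "{..<n} - {i} - {j} = {..<n} - {i, j}" by auto
    finally show ?thesis by simp
  qed
  have "(\<Sum>k\<in>{..<n} - {i, j}. a k ((Z \<circ> Transposition.transpose i j) k)) = (\<Sum>k\<in>{..<n} - {i, j}. a k (Z k))"
    by (rule sum.cong) (auto simp: Transposition.transpose_def)
  then show ?thesis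
    unfolding lin_stat_def swap_effect_def
    by (subst (1 2) split) simp
qed (simp add: lin_stat_def swap_effect_def)

lemma swap_effect_swap:
  "swap_effect a (Z \<circ> Transposition.transpose i j) i j = - swap_effect a Z i j"
  by (simp add: swap_effect_def)

lemma swap_antisymmetry:
  fixes G :: "real \<Rightarrow> 'b::real_normed_field"
  assumes "i < n" "j < n"
  shows "avg (assignments K n nq) (\<lambda>Z. of_real (swap_effect a Z i j) * G (lin_stat n a Z + swap_effect a Z i j))
       = - avg (assignments K n nq) (\<lambda>Z. of_real (swap_effect a Z i j) * G (lin_stat n a Z))"
proof -
  let ?t = "Transposition.transpose i j"
  let ?A = "assignments K n nq"
  have inv: "(Z \<circ> ?t) \<circ> ?t = Z" for Z :: "nat \<Rightarrow> nat" by (simp add: comp_assoc)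
  have "(\<Sum>Z\<in>?A. of_real (swap_effect a Z i j) * G (lin_stat n a Z))
      = (\<Sum>Z\<in>?A. of_real (swap_effect a (Z \<circ> ?t) i j) * G (lin_stat n a (Z \<circ> ?t)))"
    by (rule sum.reindex_bij_witness[of _ "\<lambda>Z. Z \<circ> ?t" "\<lambda>Z. Z \<circ> ?t"])
       (use inv swap_assignment assms in auto)
  also have "\<dots> = (\<Sum>Z\<in>?A. - (of_real (swap_effect a Z i j) * G (lin_stat n a Z + swap_effect a Z i j)))"
    by (simp only: swap_effect_swap lin_stat_swap[OF assms] of_real_minus mult_minus_left)
  finally show ?thesis
    unfolding avg_def by (simp add: sum_negf)
qed

lemma sum_swap_effect:
  assumes "Z \<in> assignments K n nq" "centred K n a"
  shows "(\<Sum>i<n. \<Sum>j<n. swap_effect a Z i j) = - 2 * real n * lin_stat n a Z"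
proof -
  have z: "(\<Sum>j<n. \<Sum>i<n. a i (Z j)) = 0"
    using assms assignments_less[OF assms(1)] by (intro sum.neutral) (auto simp: centred_def)
  then have z': "(\<Sum>i<n. \<Sum>j<n. a i (Z j)) = 0" by (subst sum.swap)
  show ?thesis
    unfolding swap_effect_def sum_subtractf sum.distrib lin_stat_def
    using z z' by (simp add: sum_distrib_left mult.assoc sum_negf)
qed

text \<open>Stein's identity for the exchangeable pair obtained by swapping two random units.\<close>

lemma exchangeable_pair_identity:
  fixes G :: "real \<Rightarrow> 'b::real_normed_field"
  assumes "centred K n a"
  shows "of_real (4 * real n) * avg (assignments K n nq) (\<lambda>Z. of_real (lin_stat n a Z) * G (lin_stat n a Z))
    = avg (assignments K n nq) (\<lambda>Z. \<Sum>i<n. \<Sum>j<n. of_real (swap_effect a Z i j) *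
        (G (lin_stat n a Z + swap_effect a Z i j) - G (lin_stat n a Z)))" (is "?l = ?r")
proof -
  let ?A = "assignments K n nq"
  let ?E = "\<lambda>i j. avg ?A (\<lambda>Z. of_real (swap_effect a Z i j) * G (lin_stat n a Z))"
  have "?r = (\<Sum>i<n. \<Sum>j<n. - 2 * ?E i j)"
    unfolding avg_sum
  proof (intro sum.cong refl)
    fix i j assume ij: "i \<in> {..<n}" "j \<in> {..<n}"
    show "avg ?A (\<lambda>Z. of_real (swap_effect a Z i j) *
        (G (lin_stat n a Z + swap_effect a Z i j) - G (lin_stat n a Z))) = - 2 * ?E i j"
      using swap_antisymmetry[of i n j K nq a G] ij by (simp add: right_diff_distrib avg_diff)
  qed
  also have "\<dots> = - 2 * avg ?A (\<lambda>Z. \<Sum>i<n. \<Sum>j<n. of_real (swap_effect a Z i j) * G (lin_stat n a Z))"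
    by (simp add: avg_sum sum_distrib_left)
  also have "avg ?A (\<lambda>Z. \<Sum>i<n. \<Sum>j<n. of_real (swap_effect a Z i j) * G (lin_stat n a Z))
     = avg ?A (\<lambda>Z. of_real (- 2 * real n) * (of_real (lin_stat n a Z) * G (lin_stat n a Z)))"
  proof (rule avg_cong)
    fix Z assume Z: "Z \<in> ?A"
    have "(\<Sum>i<n. \<Sum>j<n. of_real (swap_effect a Z i j) * G (lin_stat n a Z))
        = of_real (\<Sum>i<n. \<Sum>j<n. swap_effect a Z i j) * G (lin_stat n a Z)"
      by (simp add: sum_distrib_right)
    then show "(\<Sum>i<n. \<Sum>j<n. of_real (swap_effect a Z i j) * G (lin_stat n a Z))
      = of_real (- 2 * real n) * (of_real (lin_stat n a Z) * G (lin_stat n a Z))"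
      using sum_swap_effect[OF Z assms] by (simp add: mult_ac)
  qed
  finally show ?thesis unfolding avg_cmult by (simp add: mult_ac)
qed

lemma sum_group_sizes_le:
  fixes f :: "nat \<Rightarrow> real"
  assumes "(\<Sum>q<nQ K. nq q) = n" "\<And>q. 0 \<le> f q"
  shows "(\<Sum>q<nQ K. real (nq q) * f q) \<le> real n * (\<Sum>q<nQ K. f q)"
proof -
  have "nq q \<le> n" if "q < nQ K" for q
    using member_le_sum[of q "{..<nQ K}" nq] that assms(1) by auto
  then show ?thesis
    unfolding sum_distrib_left using assms(2) by (intro sum_mono mult_right_mono) auto
qed

lemma centred_residual:
  assumes "n \<ge> 1"
  shows "centred K n (\<lambda>i q. h i q - (\<Sum>k<n. h k q) / real n)"
  using assms by (simp add: centred_def sum_subtractf)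

lemma sqsum_nonneg: "0 \<le> sqsum K n a"
  by (simp add: sqsum_def sum_nonneg)

lemma sqsum_residual_le:
  assumes "n \<ge> 1"
  shows "sqsum K n (\<lambda>i q. h i q - (\<Sum>k<n. h k q) / real n) \<le> sqsum K n h"
proof -
  have "(\<Sum>i<n. (h i q - (\<Sum>k<n. h k q) / real n)\<^sup>2) \<le> (\<Sum>i<n. (h i q)\<^sup>2)" for q
  proof -
    define m where "m = (\<Sum>k<n. h k q) / real n"
    have s: "(\<Sum>k<n. h k q) = real n * m" using assms by (simp add: m_def)
    have "(\<Sum>i<n. (h i q - m)\<^sup>2) = (\<Sum>i<n. (h i q)\<^sup>2) - 2 * m * (\<Sum>i<n. h i q) + real n * m\<^sup>2"
      by (simp add: power2_diff sum.distrib sum_subtractf sum_distrib_left mult_ac)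
    also have "\<dots> = (\<Sum>i<n. (h i q)\<^sup>2) - real n * m\<^sup>2"
      unfolding s by (simp add: power2_eq_square)
    also have "\<dots> \<le> (\<Sum>i<n. (h i q)\<^sup>2)" by simp
    finally show ?thesis by (simp add: m_def)
  qed
  then show ?thesis
    unfolding sqsum_def by (subst (1 2) sum.swap) (rule sum_mono)
qed

context
  fixes K n :: nat and nq :: "nat \<Rightarrow> nat"
  assumes sizes: "(\<Sum>q<nQ K. nq q) = n" and npos: "n \<ge> 1"
begin

abbreviation "asg \<equiv> assignments K n nq"

lemma asg_finite_nonempty: "finite asg" "asg \<noteq> {}"
  using finite_assignments assignments_nonempty[OF sizes] by auto

lemma avg_lin_stat_centred: "centred K n a \<Longrightarrow> avg asg (lin_stat n a) = 0"
  using exchangeable_pair_identity[of K n a nq "\<lambda>_. 1 :: real"] npos by (simp add: avg_def)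

lemma lin_stat_residual:
  assumes "Z \<in> asg"
  shows "lin_stat n (\<lambda>i q. h i q - (\<Sum>k<n. h k q) / real n) Z
    = lin_stat n h Z - (\<Sum>i<n. \<Sum>q<nQ K. real (nq q) / real n * h i q)"
proof -
  have "(\<Sum>i<n. (\<Sum>k<n. h k (Z i)) / real n) = (\<Sum>q<nQ K. real (nq q) * ((\<Sum>k<n. h k q) / real n))"
    by (rule sum_group_sizes[OF assms])
  also have "\<dots> = (\<Sum>q<nQ K. \<Sum>i<n. real (nq q) / real n * h i q)"
    by (simp add: sum_distrib_left sum_divide_distrib)
  also have "\<dots> = (\<Sum>i<n. \<Sum>q<nQ K. real (nq q) / real n * h i q)" by (rule sum.swap)
  finally show ?thesis by (simp add: lin_stat_def sum_subtractf)
qed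

lemma avg_lin_stat: "avg asg (lin_stat n h) = (\<Sum>i<n. \<Sum>q<nQ K. real (nq q) / real n * h i q)"
proof -
  have "0 = avg asg (lin_stat n (\<lambda>i q. h i q - (\<Sum>k<n. h k q) / real n))"
    using avg_lin_stat_centred[OF centred_residual[OF npos]] by simp
  also have "\<dots> = avg asg (\<lambda>Z. lin_stat n h Z - (\<Sum>i<n. \<Sum>q<nQ K. real (nq q) / real n * h i q))"
    by (intro avg_cong lin_stat_residual)
  finally show ?thesis
    by (simp add: avg_diff avg_const[OF asg_finite_nonempty])
qed

lemma weighted_sqsum_le: "(\<Sum>i<n. \<Sum>q<nQ K. real (nq q) / real n * (a i q)\<^sup>2) \<le> sqsum K n a"
  unfolding sqsum_def
proof (rule sum_mono)
  fix i
  have "(\<Sum>q<nQ K. real (nq q) * (a i q)\<^sup>2) \<le> real n * (\<Sum>q<nQ K. (a i q)\<^sup>2)"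
    by (rule sum_group_sizes_le[OF sizes]) simp
  then have "(\<Sum>q<nQ K. real (nq q) * (a i q)\<^sup>2) / real n \<le> (\<Sum>q<nQ K. (a i q)\<^sup>2)"
    using npos by (simp add: divide_le_eq mult.commute)
  then show "(\<Sum>q<nQ K. real (nq q) / real n * (a i q)\<^sup>2) \<le> (\<Sum>q<nQ K. (a i q)\<^sup>2)"
    by (simp add: sum_divide_distrib)
qed

lemma avg_swap_effect_sq_le:
  "avg asg (\<lambda>Z. \<Sum>i<n. \<Sum>j<n. (swap_effect a Z i j)\<^sup>2) \<le> 16 * real n * sqsum K n a"
proof -
  let ?w = "\<Sum>i<n. \<Sum>q<nQ K. real (nq q) / real n * (a i q)\<^sup>2"
  let ?G = "lin_stat n (\<lambda>i q. (a i q)\<^sup>2)"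
  have "(\<Sum>i<n. \<Sum>j<n. (swap_effect a Z i j)\<^sup>2) \<le> 8 * real n * ?w + 8 * real n * ?G Z" if Z: "Z \<in> asg" for Z
  proof -
    have four: "(w + x - y - z)\<^sup>2 \<le> 4 * (w\<^sup>2 + x\<^sup>2 + y\<^sup>2 + z\<^sup>2)" for w x y z :: real
    proof -
      have "4 * (w\<^sup>2 + x\<^sup>2 + y\<^sup>2 + z\<^sup>2) - (w + x - y - z)\<^sup>2
        = (w - x)\<^sup>2 + (w + y)\<^sup>2 + (w + z)\<^sup>2 + (x + y)\<^sup>2 + (x + z)\<^sup>2 + (y - z)\<^sup>2"
        by (simp add: power2_eq_square algebra_simps)
      also have "\<dots> \<ge> 0" by simp
      finally show ?thesis by simp
    qed
    have w: "(\<Sum>i<n. \<Sum>j<n. (a i (Z j))\<^sup>2) = real n * ?w"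
    proof -
      have "(\<Sum>i<n. \<Sum>j<n. (a i (Z j))\<^sup>2) = (\<Sum>i<n. \<Sum>q<nQ K. real (nq q) * (a i q)\<^sup>2)"
        by (intro sum.cong refl sum_group_sizes[OF Z])
      then show ?thesis using npos by (simp add: sum_distrib_left)
    qed
    then have w': "(\<Sum>i<n. \<Sum>j<n. (a j (Z i))\<^sup>2) = real n * ?w" by (subst sum.swap)
    have "(\<Sum>i<n. \<Sum>j<n. (swap_effect a Z i j)\<^sup>2)
      \<le> (\<Sum>i<n. \<Sum>j<n. 4 * ((a i (Z j))\<^sup>2 + (a j (Z i))\<^sup>2 + (a i (Z i))\<^sup>2 + (a j (Z j))\<^sup>2))"
      unfolding swap_effect_def by (intro sum_mono four)
    also have "\<dots> = 4 * ((\<Sum>i<n. \<Sum>j<n. (a i (Z j))\<^sup>2) + (\<Sum>i<n. \<Sum>j<n. (a j (Z i))\<^sup>2)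
         + real n * ?G Z + real n * ?G Z)"
      by (simp add: sum.distrib sum_distrib_left lin_stat_def algebra_simps)
    finally show ?thesis unfolding w w' by simp
  qed
  then have "avg asg (\<lambda>Z. \<Sum>i<n. \<Sum>j<n. (swap_effect a Z i j)\<^sup>2)
     \<le> avg asg (\<lambda>Z. 8 * real n * ?w + 8 * real n * ?G Z)"
    by (intro avg_mono)
  also have "\<dots> = 16 * real n * ?w"
    using avg_lin_stat[of "\<lambda>i q. (a i q)\<^sup>2"]
    by (simp add: avg_add avg_cmult avg_const[OF asg_finite_nonempty])
  also have "\<dots> \<le> 16 * real n * sqsum K n a"
    by (intro mult_left_mono weighted_sqsum_le) simp
  finally show ?thesis .
qed

lemma avg_lin_stat_sq_le:
  assumes "centred K n a"
  shows "avg asg (\<lambda>Z. (lin_stat n a Z)\<^sup>2) \<le> 4 * sqsum K n a"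
proof -
  have "4 * real n * avg asg (\<lambda>Z. (lin_stat n a Z)\<^sup>2) \<le> 16 * real n * sqsum K n a"
    using exchangeable_pair_identity[OF assms, of nq "\<lambda>x. x"] avg_swap_effect_sq_le[of a]
    by (simp add: power2_eq_square)
  then show ?thesis using npos by simp
qed

lemma avg_abs_deviation_le:
  assumes M: "M > 0" and h: "\<And>i q. i < n \<Longrightarrow> q < nQ K \<Longrightarrow> \<bar>h i q\<bar> \<le> M * \<bar>a i q\<bar>"
  shows "avg asg (\<lambda>Z. \<bar>lin_stat n h Z - (\<Sum>i<n. \<Sum>q<nQ K. real (nq q) / real n * h i q)\<bar>)
     \<le> 2 * M * sqsum K n a + M / 2"
proof -
  let ?m = "\<Sum>i<n. \<Sum>q<nQ K. real (nq q) / real n * h i q"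
  have hs: "sqsum K n h \<le> M\<^sup>2 * sqsum K n a"
    unfolding sqsum_def sum_distrib_left
  proof (intro sum_mono)
    fix i q assume "i \<in> {..<n}" "q \<in> {..<nQ K}"
    then have "\<bar>h i q\<bar>\<^sup>2 \<le> (M * \<bar>a i q\<bar>)\<^sup>2" by (intro power_mono h) auto
    then show "(h i q)\<^sup>2 \<le> M\<^sup>2 * (a i q)\<^sup>2" by (simp add: power_mult_distrib)
  qed
  have "avg asg (\<lambda>Z. (lin_stat n h Z - ?m)\<^sup>2)
     = avg asg (\<lambda>Z. (lin_stat n (\<lambda>i q. h i q - (\<Sum>k<n. h k q) / real n) Z)\<^sup>2)"
    by (intro avg_cong) (simp add: lin_stat_residual)
  also have "\<dots> \<le> 4 * sqsum K n (\<lambda>i q. h i q - (\<Sum>k<n. h k q) / real n)"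
    by (rule avg_lin_stat_sq_le[OF centred_residual[OF npos]])
  also have "\<dots> \<le> 4 * (M\<^sup>2 * sqsum K n a)"
    using sqsum_residual_le[OF npos, of K h] hs by linarith
  finally have v: "avg asg (\<lambda>Z. (lin_stat n h Z - ?m)\<^sup>2) \<le> 4 * (M\<^sup>2 * sqsum K n a)" .
  have "\<bar>x\<bar> \<le> 1 / (2 * M) * x\<^sup>2 + M / 2" for x :: real
  proof -
    have "0 \<le> (\<bar>x\<bar> - M)\<^sup>2" by simp
    then have "2 * M * \<bar>x\<bar> \<le> x\<^sup>2 + M\<^sup>2" by (simp add: power2_diff mult_ac)
    then show ?thesis using M by (simp add: field_simps power2_eq_square)
  qed
  then have "avg asg (\<lambda>Z. \<bar>lin_stat n h Z - ?m\<bar>)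
      \<le> avg asg (\<lambda>Z. 1 / (2 * M) * (lin_stat n h Z - ?m)\<^sup>2 + M / 2)"
    by (intro avg_mono)
  also have "\<dots> = 1 / (2 * M) * avg asg (\<lambda>Z. (lin_stat n h Z - ?m)\<^sup>2) + M / 2"
    by (simp add: avg_add avg_const[OF asg_finite_nonempty] avg_cmult del: times_divide_eq_left)
  also have "\<dots> \<le> 1 / (2 * M) * (4 * (M\<^sup>2 * sqsum K n a)) + M / 2"
    using M by (intro add_right_mono mult_left_mono v) auto
  also have "\<dots> = 2 * M * sqsum K n a + M / 2" using M by (simp add: power2_eq_square)
  finally show ?thesis .
qed

lemma avg_cross_term_le:
  assumes c: "centred K n a"
  shows "avg asg (\<lambda>Z. \<bar>\<Sum>i<n. \<Sum>j<n. a i (Z j) * a j (Z i)\<bar>) \<le> 4 * real (nQ K) * sqsum K n a"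
proof -
  define b where "b q r i k = (if k = r then a i q else 0)" for q r i k :: nat
  let ?T = "\<lambda>q r. lin_stat n (b q r)"
  have cb: "centred K n (b q r)" if "q < nQ K" for q r
  proof -
    have "(\<Sum>i<n. b q r i k) = (if k = r then \<Sum>i<n. a i q else 0)" for k by (simp add: b_def)
    then show ?thesis using c that by (simp add: centred_def)
  qed
  have sb: "sqsum K n (b q r) = (\<Sum>i<n. (a i q)\<^sup>2)" if "r < nQ K" for q r
    using that by (simp add: sqsum_def b_def if_distrib[of "\<lambda>x. x\<^sup>2"] cong: if_cong)
  have "\<bar>\<Sum>i<n. \<Sum>j<n. a i (Z j) * a j (Z i)\<bar> \<le> (\<Sum>q<nQ K. \<Sum>r<nQ K. (?T q r Z)\<^sup>2)" if Z: "Z \<in> asg" for Z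
  proof -
    have "(\<Sum>i<n. \<Sum>j<n. a i (Z j) * a j (Z i))
      = (\<Sum>i<n. \<Sum>j<n. \<Sum>q<nQ K. \<Sum>r<nQ K. b q r i (Z i) * b r q j (Z j))"
    proof (intro sum.cong refl)
      fix i j assume ij: "i \<in> {..<n}" "j \<in> {..<n}"
      have "(\<Sum>q<nQ K. \<Sum>r<nQ K. b q r i (Z i) * b r q j (Z j))
         = (\<Sum>q<nQ K. \<Sum>r<nQ K. if r = Z i then (if q = Z j then a i q * a j r else 0) else 0)"
        by (intro sum.cong refl) (auto simp: b_def)
      also have "\<dots> = a i (Z j) * a j (Z i)"
        using ij assignments_less[OF Z] by (simp add: sum.delta)
      finally show "a i (Z j) * a j (Z i) = (\<Sum>q<nQ K. \<Sum>r<nQ K. b q r i (Z i) * b r q j (Z j))" by simp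
    qed
    also have "\<dots> = (\<Sum>q<nQ K. \<Sum>r<nQ K. \<Sum>i<n. \<Sum>j<n. b q r i (Z i) * b r q j (Z j))"
    proof -
      have "(\<Sum>i<n. \<Sum>j<n. \<Sum>q<nQ K. \<Sum>r<nQ K. b q r i (Z i) * b r q j (Z j))
        = (\<Sum>i<n. \<Sum>q<nQ K. \<Sum>j<n. \<Sum>r<nQ K. b q r i (Z i) * b r q j (Z j))"
        by (intro sum.cong refl sum.swap)
      also have "\<dots> = (\<Sum>q<nQ K. \<Sum>i<n. \<Sum>j<n. \<Sum>r<nQ K. b q r i (Z i) * b r q j (Z j))"
        by (rule sum.swap)
      also have "\<dots> = (\<Sum>q<nQ K. \<Sum>i<n. \<Sum>r<nQ K. \<Sum>j<n. b q r i (Z i) * b r q j (Z j))"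
        by (intro sum.cong refl sum.swap)
      also have "\<dots> = (\<Sum>q<nQ K. \<Sum>r<nQ K. \<Sum>i<n. \<Sum>j<n. b q r i (Z i) * b r q j (Z j))"
        by (intro sum.cong refl sum.swap)
      finally show ?thesis .
    qed
    also have "\<dots> = (\<Sum>q<nQ K. \<Sum>r<nQ K. ?T q r Z * ?T r q Z)"
      by (simp add: lin_stat_def sum_product)
    finally have "\<bar>\<Sum>i<n. \<Sum>j<n. a i (Z j) * a j (Z i)\<bar> = \<bar>\<Sum>q<nQ K. \<Sum>r<nQ K. ?T q r Z * ?T r q Z\<bar>" by simp
    also have "\<dots> \<le> (\<Sum>q<nQ K. \<Sum>r<nQ K. \<bar>?T q r Z * ?T r q Z\<bar>)"
      by (intro order_trans[OF sum_abs] sum_mono sum_abs)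
    also have "\<dots> \<le> (\<Sum>q<nQ K. \<Sum>r<nQ K. (?T q r Z)\<^sup>2 / 2 + (?T r q Z)\<^sup>2 / 2)"
    proof (intro sum_mono)
      fix q r
      have "0 \<le> (\<bar>?T q r Z\<bar> - \<bar>?T r q Z\<bar>)\<^sup>2" by simp
      then show "\<bar>?T q r Z * ?T r q Z\<bar> \<le> (?T q r Z)\<^sup>2 / 2 + (?T r q Z)\<^sup>2 / 2"
        by (simp add: power2_diff abs_mult)
    qed
    also have "\<dots> = (\<Sum>q<nQ K. \<Sum>r<nQ K. (?T q r Z)\<^sup>2 / 2) + (\<Sum>q<nQ K. \<Sum>r<nQ K. (?T r q Z)\<^sup>2 / 2)"
      by (simp add: sum.distrib)
    also have "(\<Sum>q<nQ K. \<Sum>r<nQ K. (?T r q Z)\<^sup>2 / 2) = (\<Sum>q<nQ K. \<Sum>r<nQ K. (?T q r Z)\<^sup>2 / 2)"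
      by (rule sum.swap)
    finally show ?thesis by (simp add: sum_divide_distrib[symmetric])
  qed
  then have "avg asg (\<lambda>Z. \<bar>\<Sum>i<n. \<Sum>j<n. a i (Z j) * a j (Z i)\<bar>)
     \<le> avg asg (\<lambda>Z. \<Sum>q<nQ K. \<Sum>r<nQ K. (?T q r Z)\<^sup>2)" by (rule avg_mono)
  also have "\<dots> = (\<Sum>q<nQ K. \<Sum>r<nQ K. avg asg (\<lambda>Z. (?T q r Z)\<^sup>2))" by (simp add: avg_sum)
  also have "\<dots> \<le> (\<Sum>q<nQ K. \<Sum>r<nQ K. 4 * (\<Sum>i<n. (a i q)\<^sup>2))"
  proof (intro sum_mono)
    fix q r assume "q \<in> {..<nQ K}" "r \<in> {..<nQ K}"
    then show "avg asg (\<lambda>Z. (?T q r Z)\<^sup>2) \<le> 4 * (\<Sum>i<n. (a i q)\<^sup>2)"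
      using avg_lin_stat_sq_le[OF cb, of q r] sb[of r q] by simp
  qed
  also have "\<dots> = 4 * real (nQ K) * (\<Sum>q<nQ K. \<Sum>i<n. (a i q)\<^sup>2)"
    by (simp add: sum_distrib_left mult_ac)
  also have "(\<Sum>q<nQ K. \<Sum>i<n. (a i q)\<^sup>2) = sqsum K n a" unfolding sqsum_def by (rule sum.swap)
  finally show ?thesis .
qed

lemma weighted_mean_sq_le:
  "((\<Sum>q<nQ K. real (nq q) * x q) / real n)\<^sup>2 \<le> (\<Sum>q<nQ K. real (nq q) / real n * (x q)\<^sup>2)"
proof -
  define m where "m = (\<Sum>q<nQ K. real (nq q) * x q) / real n"
  have n0: "real n > 0" using npos by simp
  have s1: "(\<Sum>q<nQ K. real (nq q) / real n) = 1"
    using n0 sizes by (simp flip: sum_divide_distrib of_nat_sum)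
  have s2: "(\<Sum>q<nQ K. real (nq q) / real n * x q) = m" by (simp add: m_def sum_divide_distrib)
  have "0 \<le> (\<Sum>q<nQ K. real (nq q) / real n * (x q - m)\<^sup>2)" by (intro sum_nonneg) auto
  also have "\<dots> = (\<Sum>q<nQ K. real (nq q) / real n * (x q)\<^sup>2 - 2 * m * (real (nq q) / real n * x q)
      + m\<^sup>2 * (real (nq q) / real n))"
    using n0 by (intro sum.cong refl) (simp add: power2_eq_square field_simps)
  also have "\<dots> = (\<Sum>q<nQ K. real (nq q) / real n * (x q)\<^sup>2) - 2 * m * m + m\<^sup>2 * 1"
    by (simp only: sum.distrib sum_subtractf sum_distrib_left[symmetric] s1 s2)
  finally show ?thesis by (simp add: power2_eq_square flip: m_def)
qed

lemma lim_var_nonneg: "0 \<le> lim_var K n nq a"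
  unfolding lim_var_def using weighted_mean_sq_le by (intro sum_nonneg) simp

lemma sum_swap_effect_sq:
  assumes Z: "Z \<in> asg" and c: "centred K n a"
  defines "m \<equiv> \<lambda>i. \<Sum>q<nQ K. real (nq q) * a i q"
  shows "(\<Sum>i<n. \<Sum>j<n. (swap_effect a Z i j)\<^sup>2)
    = 2 * (\<Sum>i<n. \<Sum>q<nQ K. real (nq q) * (a i q)\<^sup>2) + 2 * real n * lin_stat n (\<lambda>i q. (a i q)\<^sup>2) Z
      + 2 * (\<Sum>i<n. \<Sum>j<n. a i (Z j) * a j (Z i)) + 2 * (lin_stat n a Z)\<^sup>2
      - 4 * lin_stat n (\<lambda>i q. m i * a i q) Z"
proof -
  have w: "(\<Sum>i<n. \<Sum>j<n. (a i (Z j))\<^sup>2) = (\<Sum>i<n. \<Sum>q<nQ K. real (nq q) * (a i q)\<^sup>2)"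
    by (intro sum.cong refl sum_group_sizes[OF Z])
  then have w': "(\<Sum>i<n. \<Sum>j<n. (a j (Z i))\<^sup>2) = (\<Sum>i<n. \<Sum>q<nQ K. real (nq q) * (a i q)\<^sup>2)"
    by (subst sum.swap)
  have m: "(\<Sum>j<n. a i (Z j)) = m i" for i
    unfolding m_def by (rule sum_group_sizes[OF Z])
  have z: "(\<Sum>i<n. a i (Z j)) = 0" if "j < n" for j
    using c assignments_less[OF Z that] by (simp add: centred_def)
  have c1: "(\<Sum>i<n. \<Sum>j<n. a i (Z j) * a i (Z i)) = lin_stat n (\<lambda>i q. m i * a i q) Z"
    by (simp add: sum_distrib_right[symmetric] m lin_stat_def)
  then have c4: "(\<Sum>i<n. \<Sum>j<n. a j (Z i) * a j (Z j)) = lin_stat n (\<lambda>i q. m i * a i q) Z"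
    by (subst sum.swap)
  have c3: "(\<Sum>i<n. \<Sum>j<n. a j (Z i) * a i (Z i)) = 0"
    by (simp add: sum_distrib_right[symmetric] z)
  then have c2: "(\<Sum>i<n. \<Sum>j<n. a i (Z j) * a j (Z j)) = 0"
    by (subst sum.swap)
  have t: "(\<Sum>i<n. \<Sum>j<n. a i (Z i) * a j (Z j)) = (lin_stat n a Z)\<^sup>2"
    by (simp add: lin_stat_def power2_eq_square sum_product)
  have "(swap_effect a Z i j)\<^sup>2 = (a i (Z j))\<^sup>2 + (a j (Z i))\<^sup>2 + (a i (Z i))\<^sup>2 + (a j (Z j))\<^sup>2
     + 2 * (a i (Z j) * a j (Z i)) + 2 * (a i (Z i) * a j (Z j)) - 2 * (a i (Z j) * a i (Z i))
     - 2 * (a i (Z j) * a j (Z j)) - 2 * (a j (Z i) * a i (Z i)) - 2 * (a j (Z i) * a j (Z j))" for i j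
    by (simp add: swap_effect_def power2_eq_square algebra_simps)
  then have "(\<Sum>i<n. \<Sum>j<n. (swap_effect a Z i j)\<^sup>2)
    = (\<Sum>i<n. \<Sum>j<n. (a i (Z j))\<^sup>2) + (\<Sum>i<n. \<Sum>j<n. (a j (Z i))\<^sup>2)
      + (\<Sum>i<n. \<Sum>j<n. (a i (Z i))\<^sup>2) + (\<Sum>i<n. \<Sum>j<n. (a j (Z j))\<^sup>2)
      + 2 * (\<Sum>i<n. \<Sum>j<n. a i (Z j) * a j (Z i)) + 2 * (\<Sum>i<n. \<Sum>j<n. a i (Z i) * a j (Z j))
      - 2 * (\<Sum>i<n. \<Sum>j<n. a i (Z j) * a i (Z i)) - 2 * (\<Sum>i<n. \<Sum>j<n. a i (Z j) * a j (Z j))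
      - 2 * (\<Sum>i<n. \<Sum>j<n. a j (Z i) * a i (Z i)) - 2 * (\<Sum>i<n. \<Sum>j<n. a j (Z i) * a j (Z j))"
    by (simp only: sum.distrib sum_subtractf sum_distrib_left)
  also have "(\<Sum>i<n. \<Sum>j<n. (a i (Z i))\<^sup>2) = real n * lin_stat n (\<lambda>i q. (a i q)\<^sup>2) Z"
    by (simp add: lin_stat_def sum_distrib_left)
  also have "(\<Sum>i<n. \<Sum>j<n. (a j (Z j))\<^sup>2) = real n * lin_stat n (\<lambda>i q. (a i q)\<^sup>2) Z"
    by (simp add: lin_stat_def)
  finally show ?thesis
    unfolding w w' c1 c2 c3 c4 t by simp
qed

lemma avg_conditional_variance_deviation_le:
  assumes c: "centred K n a" and M: "M > 0" and aM: "\<And>i q. i < n \<Longrightarrow> q < nQ K \<Longrightarrow> \<bar>a i q\<bar> \<le> M"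
  shows "avg asg (\<lambda>Z. \<bar>(\<Sum>i<n. \<Sum>j<n. (swap_effect a Z i j)\<^sup>2) / (4 * real n) - lim_var K n nq a\<bar>)
    \<le> 3 * M * sqsum K n a + M + 4 * real (nQ K) * sqsum K n a / real n"
proof -
  define A where "A = sqsum K n a"
  define m where "m i = (\<Sum>q<nQ K. real (nq q) * a i q)" for i
  define b where "b = (\<lambda>i q. (m i / real n) * a i q)"
  define G where "G = lin_stat n (\<lambda>i q. (a i q)\<^sup>2)"
  define w where "w = (\<Sum>i<n. \<Sum>q<nQ K. real (nq q) / real n * (a i q)\<^sup>2)"
  define w2 where "w2 = (\<Sum>i<n. \<Sum>q<nQ K. real (nq q) / real n * b i q)"
  define H where "H Z = (\<Sum>i<n. \<Sum>j<n. a i (Z j) * a j (Z i))" for Z :: "nat \<Rightarrow> nat"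
  have n0: "real n > 0" using npos by simp
  have lv: "lim_var K n nq a = w - w2"
  proof -
    have "(\<Sum>q<nQ K. real (nq q) / real n * b i q) = (m i / real n)\<^sup>2" for i
    proof -
      have "(\<Sum>q<nQ K. real (nq q) / real n * b i q) = (\<Sum>q<nQ K. (m i / real n) * (real (nq q) * a i q / real n))"
        by (intro sum.cong refl) (simp add: b_def)
      also have "\<dots> = (m i / real n) * (m i / real n)"
        by (simp only: sum_distrib_left[symmetric] sum_divide_distrib[symmetric] m_def)
      finally show ?thesis by (simp add: power2_eq_square)
    qed
    then show ?thesis by (simp add: lim_var_def w_def w2_def sum_subtractf m_def)
  qed
  have dec: "(\<Sum>i<n. \<Sum>j<n. (swap_effect a Z i j)\<^sup>2) / (4 * real n) - lim_var K n nq a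
     = (1/2) * (G Z - w) - (lin_stat n b Z - w2) + (1 / (2 * real n)) * H Z + (1 / (2 * real n)) * (lin_stat n a Z)\<^sup>2"
    if Z: "Z \<in> asg" for Z
  proof -
    have 1: "(\<Sum>i<n. \<Sum>q<nQ K. real (nq q) * (a i q)\<^sup>2) = real n * w"
      using n0 by (simp add: w_def sum_distrib_left)
    have 2: "lin_stat n (\<lambda>i q. m i * a i q) Z = real n * lin_stat n b Z"
      using n0 by (simp add: lin_stat_def b_def sum_distrib_left)
    have eq: "(\<Sum>i<n. \<Sum>j<n. (swap_effect a Z i j)\<^sup>2)
       = 2 * (real n * w) + 2 * real n * G Z + 2 * H Z + 2 * (lin_stat n a Z)\<^sup>2 - 4 * (real n * lin_stat n b Z)"
      using sum_swap_effect_sq[OF Z c] unfolding 1 m_def[symmetric] 2 G_def[symmetric] H_def[symmetric] .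
    show ?thesis using n0 unfolding lv eq by (simp add: field_simps)
  qed
  have bnd: "\<bar>(1/2) * (G Z - w) - (lin_stat n b Z - w2) + (1 / (2 * real n)) * H Z + (1 / (2 * real n)) * (lin_stat n a Z)\<^sup>2\<bar>
     \<le> (1/2) * \<bar>G Z - w\<bar> + \<bar>lin_stat n b Z - w2\<bar> + (1 / (2 * real n)) * \<bar>H Z\<bar> + (1 / (2 * real n)) * (lin_stat n a Z)\<^sup>2" for Z
  proof -
    have "\<bar>(1/2) * (G Z - w)\<bar> = (1/2) * \<bar>G Z - w\<bar>" by (simp add: abs_mult)
    moreover have "\<bar>(1 / (2 * real n)) * H Z\<bar> = (1 / (2 * real n)) * \<bar>H Z\<bar>" by (simp add: abs_mult)
    moreover have "\<bar>(1 / (2 * real n)) * (lin_stat n a Z)\<^sup>2\<bar> = (1 / (2 * real n)) * (lin_stat n a Z)\<^sup>2"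
      by (simp add: abs_mult)
    ultimately show ?thesis by linarith
  qed
  have "avg asg (\<lambda>Z. \<bar>(\<Sum>i<n. \<Sum>j<n. (swap_effect a Z i j)\<^sup>2) / (4 * real n) - lim_var K n nq a\<bar>)
    \<le> avg asg (\<lambda>Z. (1/2) * \<bar>G Z - w\<bar> + \<bar>lin_stat n b Z - w2\<bar> + (1 / (2 * real n)) * \<bar>H Z\<bar>
         + (1 / (2 * real n)) * (lin_stat n a Z)\<^sup>2)"
    using dec bnd by (intro avg_mono) (simp only:)
  also have "\<dots> = (1/2) * avg asg (\<lambda>Z. \<bar>G Z - w\<bar>) + avg asg (\<lambda>Z. \<bar>lin_stat n b Z - w2\<bar>)
     + (1 / (2 * real n)) * avg asg (\<lambda>Z. \<bar>H Z\<bar>) + (1 / (2 * real n)) * avg asg (\<lambda>Z. (lin_stat n a Z)\<^sup>2)"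
    by (simp only: avg_add avg_cmult)
  also have "\<dots> \<le> (1/2) * (2 * M * A + M / 2) + (2 * M * A + M / 2) + (1 / (2 * real n)) * (4 * real (nQ K) * A)
      + (1 / (2 * real n)) * (4 * A)"
  proof (intro add_mono mult_left_mono)
    show "avg asg (\<lambda>Z. \<bar>G Z - w\<bar>) \<le> 2 * M * A + M / 2"
      unfolding G_def w_def A_def
    proof (rule avg_abs_deviation_le[OF M])
      fix i q assume "i < n" "q < nQ K"
      then have "\<bar>a i q\<bar> * \<bar>a i q\<bar> \<le> M * \<bar>a i q\<bar>" by (intro mult_right_mono aM) auto
      then show "\<bar>(a i q)\<^sup>2\<bar> \<le> M * \<bar>a i q\<bar>" by (simp add: power2_eq_square)
    qed
    show "avg asg (\<lambda>Z. \<bar>lin_stat n b Z - w2\<bar>) \<le> 2 * M * A + M / 2"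
      unfolding w2_def A_def
    proof (rule avg_abs_deviation_le[OF M])
      fix i q assume iq: "i < n" "q < nQ K"
      have "\<bar>m i\<bar> \<le> (\<Sum>q<nQ K. real (nq q) * \<bar>a i q\<bar>)"
        unfolding m_def by (rule order_trans[OF sum_abs]) (simp add: abs_mult)
      also have "\<dots> \<le> (\<Sum>q<nQ K. real (nq q) * M)" using aM iq by (intro sum_mono mult_left_mono) auto
      also have "\<dots> = real n * M" using sizes by (simp add: sum_distrib_right[symmetric] flip: of_nat_sum)
      finally have "\<bar>m i / real n\<bar> \<le> M" using n0 by (simp add: divide_le_eq mult.commute)
      then show "\<bar>b i q\<bar> \<le> M * \<bar>a i q\<bar>" unfolding b_def abs_mult by (intro mult_right_mono) auto
    qed
    show "avg asg (\<lambda>Z. \<bar>H Z\<bar>) \<le> 4 * real (nQ K) * A"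
      unfolding H_def A_def by (rule avg_cross_term_le[OF c])
    show "avg asg (\<lambda>Z. (lin_stat n a Z)\<^sup>2) \<le> 4 * A" unfolding A_def by (rule avg_lin_stat_sq_le[OF c])
  qed auto
  also have "\<dots> = 3 * M * A + 3 * M / 4 + (2 * real (nQ K) * A + 2 * A) / real n"
    using n0 by (simp add: field_simps)
  also have "\<dots> \<le> 3 * M * A + M + 4 * real (nQ K) * A / real n"
  proof -
    have "1 * A \<le> real (nQ K) * A"
      unfolding A_def using sqsum_nonneg by (intro mult_right_mono) (auto simp: nQ_def)
    then have "(2 * real (nQ K) * A + 2 * A) / real n \<le> 4 * real (nQ K) * A / real n"
      by (intro divide_right_mono) (auto simp: mult_ac)
    then show ?thesis using M by linarith
  qed
  finally show ?thesis by (simp add: A_def)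
qed

text \<open>The Stein--Tikhomirov argument: the exchangeable pair identity makes the characteristic
  function \<open>\<phi>\<close> of the statistic an approximate solution of \<open>\<phi>' s = - s \<sigma>\<^sup>2 \<phi> s\<close> on the unit interval.\<close>

lemma combinatorial_clt:
  assumes c: "centred K n a" and M: "M > 0" and aM: "\<And>i q. i < n \<Longrightarrow> q < nQ K \<Longrightarrow> \<bar>a i q\<bar> \<le> M"
  shows "cmod (avg asg (\<lambda>Z. iexp (lin_stat n a Z)) - complex_of_real (exp (- lim_var K n nq a / 2)))
    \<le> 11 * M * sqsum K n a + M + 4 * real (nQ K) * sqsum K n a / real n"
proof -
  define A where "A = sqsum K n a"
  define \<sigma> where "\<sigma> = lim_var K n nq a"
  define e where "e = 11 * M * A + M + 4 * real (nQ K) * A / real n"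
  define T where "T = lin_stat n a"
  define D where "D = swap_effect a"
  define S where "S Z = (\<Sum>i<n. \<Sum>j<n. (D Z i j)\<^sup>2)" for Z
  define \<phi> where "\<phi> s = avg asg (\<lambda>Z. iexp (s * T Z))" for s
  define \<phi>' where "\<phi>' s = \<i> * avg asg (\<lambda>Z. of_real (T Z) * iexp (s * T Z))" for s
  have n0: "real n > 0" using npos by simp
  have A0: "A \<ge> 0" by (simp add: A_def sqsum_nonneg)
  have der: "(\<phi> has_vector_derivative \<phi>' s) (at s within X)" for s X
  proof -
    have "((\<lambda>s. iexp (s * T Z)) has_vector_derivative \<i> * (of_real (T Z) * iexp (s * T Z))) (at s within X)" for Z
    proof -
      have "((\<lambda>z. exp (\<i> * (z * of_real (T Z)))) has_field_derivative
          \<i> * (of_real (T Z) * iexp (s * T Z))) (at (of_real s))"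
        by (auto intro!: derivative_eq_intros)
      from has_vector_derivative_real_field[OF this] show ?thesis by simp
    qed
    then have "((\<lambda>s. \<Sum>Z\<in>asg. iexp (s * T Z)) has_vector_derivative
       (\<Sum>Z\<in>asg. \<i> * (of_real (T Z) * iexp (s * T Z)))) (at s within X)"
      by (intro has_vector_derivative_sum)
    then have "((\<lambda>s. (\<Sum>Z\<in>asg. iexp (s * T Z)) / of_nat (card asg)) has_vector_derivative
       (\<Sum>Z\<in>asg. \<i> * (of_real (T Z) * iexp (s * T Z))) / of_nat (card asg)) (at s within X)"
      by (rule has_vector_derivative_divide)
    then show ?thesis unfolding \<phi>_def \<phi>'_def avg_def by (simp add: sum_distrib_left)
  qed
  have key: "cmod (\<phi>' s + of_real (s * \<sigma>) * \<phi> s) \<le> e" if s: "0 \<le> s" "s \<le> 1" for s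
  proof -
    define r where "r x = iexp (s * x) - 1 - \<i> * of_real (s * x)" for x
    have rb: "cmod (r x) \<le> x\<^sup>2 / 2" for x
    proof -
      have "cmod (r x) \<le> (s * x)\<^sup>2 / 2"
        using iexp_approx1[of "s * x" 1] by (simp add: r_def numeral_2_eq_2 diff_diff_eq)
      also have "\<dots> \<le> x\<^sup>2 / 2"
        using s by (simp add: power_mult_distrib mult_left_le_one_le power_le_one)
      finally show ?thesis .
    qed
    define E1 where "E1 = avg asg (\<lambda>Z. \<Sum>i<n. \<Sum>j<n. of_real (D Z i j) * (iexp (s * T Z) * r (D Z i j)))"
    define E2 where "E2 = avg asg (\<lambda>Z. iexp (s * T Z) * of_real (S Z / (4 * real n) - \<sigma>))"
    have expand: "of_real x * (iexp (s * (t + x)) - iexp (s * t))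
        = of_real x * (iexp (s * t) * r x) + \<i> * of_real s * (iexp (s * t) * of_real (x\<^sup>2))" for x t
      by (simp add: r_def distrib_left exp_add power2_eq_square algebra_simps)
    have "of_real (4 * real n) * avg asg (\<lambda>Z. of_real (T Z) * iexp (s * T Z))
      = avg asg (\<lambda>Z. \<Sum>i<n. \<Sum>j<n. of_real (D Z i j) * (iexp (s * (T Z + D Z i j)) - iexp (s * T Z)))"
      unfolding T_def D_def by (rule exchangeable_pair_identity[OF c, of nq "\<lambda>x. iexp (s * x)"])
    also have "\<dots> = avg asg (\<lambda>Z. (\<Sum>i<n. \<Sum>j<n. of_real (D Z i j) * (iexp (s * T Z) * r (D Z i j)))
         + \<i> * of_real s * (iexp (s * T Z) * of_real (S Z)))"
      unfolding expand S_def by (simp only: sum.distrib sum_distrib_left of_real_sum)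
    also have "\<dots> = E1 + \<i> * of_real s * avg asg (\<lambda>Z. iexp (s * T Z) * of_real (S Z))"
      by (simp only: avg_add avg_cmult E1_def)
    also have "avg asg (\<lambda>Z. iexp (s * T Z) * of_real (S Z))
       = avg asg (\<lambda>Z. of_real (4 * real n) * (iexp (s * T Z) * of_real (S Z / (4 * real n) - \<sigma>))
            + of_real (4 * real n * \<sigma>) * iexp (s * T Z))"
      using n0 by (intro avg_cong) (simp add: field_simps)
    also have "\<dots> = of_real (4 * real n) * (E2 + of_real \<sigma> * \<phi> s)"
      by (simp only: avg_add avg_cmult E2_def \<phi>_def) (simp add: algebra_simps)
    finally have id: "of_real (4 * real n) * avg asg (\<lambda>Z. of_real (T Z) * iexp (s * T Z))
       = E1 + \<i> * of_real s * (of_real (4 * real n) * (E2 + of_real \<sigma> * \<phi> s))" .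
    have "avg asg (\<lambda>Z. of_real (T Z) * iexp (s * T Z))
       = E1 / of_real (4 * real n) + \<i> * of_real s * (E2 + of_real \<sigma> * \<phi> s)"
    proof -
      have nz: "complex_of_real (4 * real n) \<noteq> 0" using n0 by simp
      have "avg asg (\<lambda>Z. of_real (T Z) * iexp (s * T Z))
        = (of_real (4 * real n) * avg asg (\<lambda>Z. of_real (T Z) * iexp (s * T Z))) / of_real (4 * real n)"
        by (rule nonzero_mult_div_cancel_left[OF nz, symmetric])
      also have "\<dots> = E1 / of_real (4 * real n) + \<i> * of_real s * (E2 + of_real \<sigma> * \<phi> s)"
        unfolding id using nz by (simp add: add_divide_distrib)
      finally show ?thesis .
    qed
    then have "\<phi>' s + of_real (s * \<sigma>) * \<phi> s = \<i> * (E1 / of_real (4 * real n)) - of_real s * E2"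
      unfolding \<phi>'_def by (simp add: algebra_simps)
    then have n1: "cmod (\<phi>' s + of_real (s * \<sigma>) * \<phi> s) \<le> cmod (\<i> * (E1 / of_real (4 * real n))) + cmod (of_real s * E2)"
      by (simp only: norm_triangle_ineq4)
    have n2: "cmod (\<i> * (E1 / of_real (4 * real n))) = cmod E1 / (4 * real n)"
      by (simp add: norm_mult norm_divide)
    have n3: "cmod E1 \<le> 32 * real n * M * A"
    proof -
      have "cmod E1 \<le> avg asg (\<lambda>Z. 2 * M * S Z)"
        unfolding E1_def
      proof (rule order_trans[OF norm_avg_le avg_mono])
        fix Z assume Z: "Z \<in> asg"
        show "cmod (\<Sum>i<n. \<Sum>j<n. of_real (D Z i j) * (iexp (s * T Z) * r (D Z i j))) \<le> 2 * M * S Z"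
          unfolding S_def sum_distrib_left
        proof (intro order_trans[OF norm_sum] sum_mono)
          fix i j assume ij: "i \<in> {..<n}" "j \<in> {..<n}"
          have "\<bar>a k (Z l)\<bar> \<le> M" if "k < n" "l < n" for k l
            using aM assignments_less[OF Z] that by auto
          from this[of i j] this[of j i] this[of i i] this[of j j]
          have d: "\<bar>D Z i j\<bar> \<le> 4 * M"
            using ij unfolding D_def swap_effect_def by simp
          have "cmod (of_real (D Z i j) * (iexp (s * T Z) * r (D Z i j))) = \<bar>D Z i j\<bar> * cmod (r (D Z i j))"
            by (simp add: norm_mult)
          also have "\<dots> \<le> (4 * M) * ((D Z i j)\<^sup>2 / 2)" using d rb M by (intro mult_mono) auto
          finally show "cmod (of_real (D Z i j) * (iexp (s * T Z) * r (D Z i j))) \<le> 2 * M * (D Z i j)\<^sup>2" by simp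
        qed
      qed
      also have "\<dots> = 2 * M * avg asg S" by (simp add: avg_cmult)
      also have "\<dots> \<le> 2 * M * (16 * real n * A)"
        using M avg_swap_effect_sq_le[of a] by (intro mult_left_mono) (simp_all add: S_def[abs_def] D_def A_def)
      finally show ?thesis by (simp add: mult_ac)
    qed
    have n4: "cmod (of_real s * E2) \<le> 1 * cmod E2"
      unfolding norm_mult using s by (intro mult_right_mono) auto
    have n5: "cmod E2 \<le> 3 * M * A + M + 4 * real (nQ K) * A / real n"
    proof -
      have "cmod E2 \<le> avg asg (\<lambda>Z. \<bar>S Z / (4 * real n) - \<sigma>\<bar>)"
        unfolding E2_def
        by (rule order_trans[OF norm_avg_le]) (simp add: norm_mult del: of_real_diff of_real_divide)
      also have "\<dots> \<le> 3 * M * A + M + 4 * real (nQ K) * A / real n"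
        unfolding S_def \<sigma>_def A_def D_def by (rule avg_conditional_variance_deviation_le[OF c M aM])
      finally show ?thesis .
    qed
    have n6: "cmod E1 / (4 * real n) \<le> 8 * M * A"
      using n3 n0 by (simp add: divide_le_eq mult_ac)
    show ?thesis using n1 n4 n5 n6 unfolding n2 e_def by linarith
  qed
  define \<psi> where "\<psi> s = \<phi> s * of_real (exp (\<sigma> * s\<^sup>2 / 2))" for s
  have \<sigma>0: "\<sigma> \<ge> 0" unfolding \<sigma>_def by (rule lim_var_nonneg)
  have \<psi>der: "(\<psi> has_vector_derivative ((\<phi>' s + of_real (s * \<sigma>) * \<phi> s) * of_real (exp (\<sigma> * s\<^sup>2 / 2)))) (at s within X)" for s X
  proof -
    have "((\<lambda>s. exp (\<sigma> * s\<^sup>2 / 2)) has_real_derivative (exp (\<sigma> * s\<^sup>2 / 2) * (\<sigma> * s))) (at s within X)"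
      by (auto intro!: derivative_eq_intros)
    then have "((\<lambda>s. complex_of_real (exp (\<sigma> * s\<^sup>2 / 2))) has_vector_derivative of_real (exp (\<sigma> * s\<^sup>2 / 2) * (\<sigma> * s))) (at s within X)"
      by (intro has_vector_derivative_of_real) (simp add: has_real_derivative_iff_has_vector_derivative)
    from has_vector_derivative_mult[OF der this]
    show ?thesis unfolding \<psi>_def[abs_def] by (simp add: algebra_simps)
  qed
  have "cmod (\<psi> 1 - \<psi> 0) \<le> (e * exp (\<sigma> / 2)) * 1 - (e * exp (\<sigma> / 2)) * 0"
  proof (rule differentiable_bound_general)
    show "continuous_on {0..1} \<psi>"
      using \<psi>der by (intro continuous_on_vector_derivative)
    show "continuous_on {0..1} ((*) (e * exp (\<sigma> / 2)))" by (intro continuous_intros)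
    fix s :: real assume s: "0 < s" "s < 1"
    show "(\<psi> has_vector_derivative ((\<phi>' s + of_real (s * \<sigma>) * \<phi> s) * of_real (exp (\<sigma> * s\<^sup>2 / 2)))) (at s)"
      by (rule \<psi>der)
    show "((*) (e * exp (\<sigma> / 2)) has_vector_derivative e * exp (\<sigma> / 2)) (at s)"
      by (auto intro!: derivative_eq_intros simp flip: has_real_derivative_iff_has_vector_derivative)
    have "\<sigma> * s\<^sup>2 \<le> \<sigma> * 1" using s \<sigma>0 by (intro mult_left_mono) (auto simp: power_le_one)
    then show "cmod ((\<phi>' s + of_real (s * \<sigma>) * \<phi> s) * of_real (exp (\<sigma> * s\<^sup>2 / 2))) \<le> e * exp (\<sigma> / 2)"
      unfolding norm_mult using key[of s] s order_trans[OF norm_ge_zero key[of s]] by (intro mult_mono) auto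
  qed simp
  moreover have "\<psi> 0 = 1" by (simp add: \<psi>_def \<phi>_def avg_const[OF asg_finite_nonempty])
  moreover have "\<phi> 1 - of_real (exp (- \<sigma> / 2)) = of_real (exp (- \<sigma> / 2)) * (\<psi> 1 - 1)"
    by (simp add: \<psi>_def algebra_simps flip: of_real_mult exp_add)
  ultimately have "cmod (\<phi> 1 - of_real (exp (- \<sigma> / 2))) \<le> exp (- \<sigma> / 2) * (e * exp (\<sigma> / 2))"
    by (simp add: norm_mult)
  also have "\<dots> = e" by (simp add: exp_minus)
  finally show ?thesis unfolding \<phi>_def T_def \<sigma>_def e_def A_def by simp
qed

end

section \<open>Gaussian slabs\<close>

abbreviation gauss :: "real measure" (\<open>\<gamma>\<close>) where
  "\<gamma> \<equiv> std_normal_distribution"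

lemma prob_space_gauss: "prob_space \<gamma>"
  by (rule prob_space_normal_density) simp

interpretation gauss: prob_space \<gamma> by (rule prob_space_gauss)

lemma sets_gauss[simp, measurable_cong]: "sets \<gamma> = sets borel" by simp

lemma space_gauss[simp]: "space \<gamma> = UNIV" by simp

lemma nn_integral_gauss:
  assumes [measurable]: "f \<in> borel_measurable borel"
  shows "(\<integral>\<^sup>+x. f x \<partial>\<gamma>) = (\<integral>\<^sup>+x. ennreal (std_normal_density x) * f x \<partial>lborel)"
  by (rule nn_integral_density) auto

lemma gauss_laplace:
  assumes "1 + 2 * \<alpha> > 0"
  shows "(\<integral>\<^sup>+x. ennreal (exp (- \<alpha> * x\<^sup>2 + \<beta> * x)) \<partial>\<gamma>)
    = ennreal (exp (\<beta>\<^sup>2 / (2 * (1 + 2 * \<alpha>))) / sqrt (1 + 2 * \<alpha>))"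
proof -
  define d where "d = 1 + 2 * \<alpha>"
  define C where "C = exp (\<beta>\<^sup>2 / (2 * d)) / sqrt d"
  have d: "d > 0" using assms by (simp add: d_def)
  have \<alpha>: "\<alpha> = (d - 1) / 2" by (simp add: d_def)
  have pt: "std_normal_density x * exp (- \<alpha> * x\<^sup>2 + \<beta> * x) = C * normal_density (\<beta> / d) (1 / sqrt d) x" for x
  proof -
    have "- x\<^sup>2 / 2 + (- \<alpha> * x\<^sup>2 + \<beta> * x) = \<beta>\<^sup>2 / (2 * d) + - (x - \<beta> / d)\<^sup>2 / (2 * (1 / sqrt d)\<^sup>2)"
      using d unfolding \<alpha> by (simp add: power2_eq_square field_simps real_sqrt_mult[symmetric])
    moreover have "1 / sqrt (2 * pi * (1 / sqrt d)\<^sup>2) = sqrt d / sqrt (2 * pi)"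
      using d by (simp add: power_divide real_sqrt_divide real_sqrt_mult)
    ultimately show ?thesis
      using d unfolding normal_density_def C_def by (simp add: mult_exp_exp)
  qed
  have "(\<integral>\<^sup>+x. ennreal (exp (- \<alpha> * x\<^sup>2 + \<beta> * x)) \<partial>\<gamma>)
     = (\<integral>\<^sup>+x. ennreal (C * normal_density (\<beta> / d) (1 / sqrt d) x) \<partial>lborel)"
    by (subst nn_integral_gauss, measurable) (simp only: pt[symmetric] ennreal_mult[symmetric] normal_density_nonneg exp_ge_zero)
  also have "\<dots> = ennreal (\<integral>x. C * normal_density (\<beta> / d) (1 / sqrt d) x \<partial>lborel)"
    using d by (intro nn_integral_eq_integral) (auto simp: C_def)
  also have "\<dots> = ennreal C" using d by simp
  finally show ?thesis by (simp add: C_def d_def)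
qed

lemma gauss_scaling:
  assumes [measurable]: "f \<in> borel_measurable borel" and c: "0 < c" "c \<le> 1"
  shows "ennreal c * (\<integral>\<^sup>+x. f x \<partial>\<gamma>) \<le> (\<integral>\<^sup>+x. f (x / c) \<partial>\<gamma>)"
proof -
  have "(\<integral>\<^sup>+x. f (x / c) \<partial>\<gamma>) = (\<integral>\<^sup>+x. ennreal (std_normal_density x) * f (x / c) \<partial>lborel)"
    by (rule nn_integral_gauss) simp
  also have "\<dots> = ennreal c * (\<integral>\<^sup>+x. ennreal (std_normal_density (c * x)) * f x \<partial>lborel)"
    using c by (subst nn_integral_real_affine[where t = 0 and c = c]) auto
  also have "\<dots> \<ge> ennreal c * (\<integral>\<^sup>+x. ennreal (std_normal_density x) * f x \<partial>lborel)"
  proof (intro mult_left_mono nn_integral_mono mult_right_mono ennreal_leI)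
    fix x :: real
    have "(c * x)\<^sup>2 \<le> 1 * x\<^sup>2"
      unfolding power_mult_distrib using c by (intro mult_right_mono) (auto simp: power_le_one)
    then show "std_normal_density x \<le> std_normal_density (c * x)"
      unfolding std_normal_density_def by (intro mult_left_mono) auto
  qed auto
  finally show ?thesis by (simp add: nn_integral_gauss)
qed

lemma distr_gauss_combination:
  assumes "\<alpha>\<^sup>2 + \<beta>\<^sup>2 = 1"
  shows "distr (\<gamma> \<Otimes>\<^sub>M \<gamma>) borel (\<lambda>(x, y). \<alpha> * x + \<beta> * y) = \<gamma>"
proof -
  interpret p: pair_prob_space \<gamma> \<gamma> ..
  let ?D = "distr (\<gamma> \<Otimes>\<^sub>M \<gamma>) borel (\<lambda>(x, y). \<alpha> * x + \<beta> * y)"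
  have D: "real_distribution ?D"
    by (intro p.real_distribution_distr) measurable
  have ch: "char ?D t = char \<gamma> t" for t
  proof -
    have "char ?D t = (CLINT z|\<gamma> \<Otimes>\<^sub>M \<gamma>. iexp (t * (\<alpha> * fst z + \<beta> * snd z)))"
      unfolding char_def by (subst integral_distr) (auto simp: split_beta)
    also have "\<dots> = (CLINT z|\<gamma> \<Otimes>\<^sub>M \<gamma>. iexp (t * \<alpha> * fst z) * iexp (t * \<beta> * snd z))"
      by (simp add: algebra_simps flip: exp_add)
    also have "\<dots> = (CLINT x|\<gamma>. CLINT y|\<gamma>. iexp (t * \<alpha> * x) * iexp (t * \<beta> * y))"
      by (subst p.integral_fst'[symmetric])
         (auto intro!: p.integrable_const_bound[where B=1] simp: norm_mult)
    also have "\<dots> = char \<gamma> (t * \<alpha>) * char \<gamma> (t * \<beta>)"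
      by (simp add: char_def mult.assoc)
    also have "\<dots> = complex_of_real (exp (- (t\<^sup>2 * (\<alpha>\<^sup>2 + \<beta>\<^sup>2)) / 2))"
      unfolding char_std_normal_distribution of_real_mult[symmetric] exp_add[symmetric]
      by (simp add: power_mult_distrib algebra_simps add_divide_distrib)
    finally show ?thesis using assms by (simp add: char_std_normal_distribution)
  qed
  show ?thesis
    by (rule Levy_uniqueness[OF D real_dist_normal_dist]) (use ch in auto)
qed

lemma nn_integral_gauss_combination:
  assumes "\<alpha>\<^sup>2 + \<beta>\<^sup>2 = 1" and [measurable]: "f \<in> borel_measurable borel"
  shows "(\<integral>\<^sup>+x. \<integral>\<^sup>+y. f (\<alpha> * x + \<beta> * y) \<partial>\<gamma> \<partial>\<gamma>) = (\<integral>\<^sup>+x. f x \<partial>\<gamma>)"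
proof -
  have "(\<integral>\<^sup>+x. f x \<partial>\<gamma>) = (\<integral>\<^sup>+x. f x \<partial>distr (\<gamma> \<Otimes>\<^sub>M \<gamma>) borel (\<lambda>(x, y). \<alpha> * x + \<beta> * y))"
    by (simp only: distr_gauss_combination[OF assms(1)])
  also have "\<dots> = (\<integral>\<^sup>+z. f (\<alpha> * fst z + \<beta> * snd z) \<partial>(\<gamma> \<Otimes>\<^sub>M \<gamma>))"
    by (subst nn_integral_distr) (auto simp: split_beta)
  also have "\<dots> = (\<integral>\<^sup>+x. \<integral>\<^sup>+y. f (\<alpha> * x + \<beta> * y) \<partial>\<gamma> \<partial>\<gamma>)"
    by (subst gauss.nn_integral_fst[symmetric]) auto
  finally show ?thesis by simp
qed

lemma gauss_reflect:
  assumes "A \<in> sets borel"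
  shows "emeasure \<gamma> {x. - x \<in> A} = emeasure \<gamma> A"
proof -
  have [measurable]: "A \<in> sets borel" by fact
  have "emeasure \<gamma> A = (\<integral>\<^sup>+x. ennreal (std_normal_density x) * indicator A x \<partial>lborel)"
    by (subst emeasure_density) auto
  also have "\<dots> = (\<integral>\<^sup>+x. ennreal (std_normal_density x) * indicator {x. - x \<in> A} x \<partial>lborel)"
    by (subst nn_integral_real_affine[where t = 0 and c = "-1"])
       (auto intro!: nn_integral_cong simp: indicator_def std_normal_density_def)
  also have "\<dots> = emeasure \<gamma> {x. - x \<in> A}"
    by (subst emeasure_density) auto
  finally show ?thesis by simp
qed

lemma gauss_interval_decreasing_nonneg:
  assumes c: "0 \<le> c" "c \<le> c'"
  shows "emeasure \<gamma> {c' - r..c' + r} \<le> emeasure \<gamma> {c - r..c + r}"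
proof -
  define A B where "A = {c - r..c + r}" and "B = {c' - r..c' + r}"
  define m where "m = c + c'"
  have [measurable]: "A \<in> sets borel" "B \<in> sets borel" by (auto simp: A_def B_def)
  have "emeasure \<gamma> (B - A) = (\<integral>\<^sup>+x. ennreal (std_normal_density x) * indicator (B - A) x \<partial>lborel)"
    by (subst emeasure_density) auto
  also have "\<dots> = (\<integral>\<^sup>+x. ennreal (std_normal_density (m - x)) * indicator (B - A) (m - x) \<partial>lborel)"
    by (subst nn_integral_real_affine[where t = m and c = "-1"]) auto
  also have "\<dots> \<le> (\<integral>\<^sup>+x. ennreal (std_normal_density x) * indicator (A - B) x \<partial>lborel)"
  proof (rule nn_integral_mono)
    fix x
    show "ennreal (std_normal_density (m - x)) * indicator (B - A) (m - x)
       \<le> ennreal (std_normal_density x) * indicator (A - B) x"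
    proof (cases "x \<in> A - B")
      case True
      then have "2 * x \<le> m" using c by (auto simp: A_def B_def m_def)
      then have "0 \<le> m * (m - 2 * x)" using c by (intro mult_nonneg_nonneg) (auto simp: m_def)
      then have "x\<^sup>2 \<le> (m - x)\<^sup>2" by (simp add: power2_eq_square algebra_simps)
      then have "std_normal_density (m - x) \<le> std_normal_density x"
        unfolding std_normal_density_def by (intro mult_left_mono) auto
      then show ?thesis using True by (auto simp: indicator_def intro!: ennreal_leI)
    next
      case False
      then have "m - x \<notin> B - A" by (auto simp: A_def B_def m_def)
      then show ?thesis by simp
    qed
  qed
  also have "\<dots> = emeasure \<gamma> (A - B)" by (subst emeasure_density) auto
  finally have "emeasure \<gamma> (B - A) + emeasure \<gamma> (A \<inter> B) \<le> emeasure \<gamma> (A - B) + emeasure \<gamma> (A \<inter> B)"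
    by (rule add_right_mono)
  moreover have "emeasure \<gamma> (B - A) + emeasure \<gamma> (A \<inter> B) = emeasure \<gamma> B"
    by (subst plus_emeasure) (auto intro!: arg_cong[where f = "emeasure \<gamma>"])
  moreover have "emeasure \<gamma> (A - B) + emeasure \<gamma> (A \<inter> B) = emeasure \<gamma> A"
    by (subst plus_emeasure) (auto intro!: arg_cong[where f = "emeasure \<gamma>"])
  ultimately show ?thesis by (simp only: A_def B_def)
qed

lemma gauss_interval_decreasing:
  assumes "\<bar>c\<bar> \<le> \<bar>c'\<bar>"
  shows "emeasure \<gamma> {c' - r..c' + r} \<le> emeasure \<gamma> {c - r..c + r}"
proof -
  have sym: "emeasure \<gamma> {c - r..c + r} = emeasure \<gamma> {\<bar>c\<bar> - r..\<bar>c\<bar> + r}" for c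
  proof (cases "c \<ge> 0")
    case False
    have "{x. - x \<in> {\<bar>c\<bar> - r..\<bar>c\<bar> + r}} = {c - r..c + r}" using False by auto
    then show ?thesis using gauss_reflect[of "{\<bar>c\<bar> - r..\<bar>c\<bar> + r}"] by simp
  qed simp
  show ?thesis
    unfolding sym[of c] sym[of c'] by (rule gauss_interval_decreasing_nonneg) (use assms in auto)
qed

lemma conditional_slab_decreasing:
  assumes \<rho>: "0 \<le> \<rho>" "\<rho> \<le> 1" and xy: "\<bar>x\<bar> \<le> \<bar>y\<bar>"
  shows "emeasure \<gamma> {e. (sqrt (1 - \<rho>\<^sup>2) * e + \<rho> * y)\<^sup>2 \<le> b} \<le> emeasure \<gamma> {e. (sqrt (1 - \<rho>\<^sup>2) * e + \<rho> * x)\<^sup>2 \<le> b}"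
proof (cases "b < 0")
  case True
  then have "{e. (sqrt (1 - \<rho>\<^sup>2) * e + \<rho> * y)\<^sup>2 \<le> b} = {}"
    by (auto simp: not_le intro: less_le_trans)
  then show ?thesis by simp
next
  case False
  define s where "s = sqrt b"
  define \<beta> where "\<beta> = sqrt (1 - \<rho>\<^sup>2)"
  have sq: "z\<^sup>2 \<le> b \<longleftrightarrow> \<bar>z\<bar> \<le> s" for z
    unfolding s_def using real_sqrt_le_iff[of "z\<^sup>2" b] by simp
  show ?thesis
  proof (cases "\<rho> = 1")
    case True
    then show ?thesis using xy by (auto simp: sq intro!: emeasure_mono)
  next
    case False
    then have "\<rho>\<^sup>2 < 1" using \<rho> by (simp add: abs_square_less_1)
    then have \<beta>: "\<beta> > 0" by (simp add: \<beta>_def)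
    have eq: "{e. (\<beta> * e + \<rho> * z)\<^sup>2 \<le> b} = {- (\<rho> * z / \<beta>) - s / \<beta>..- (\<rho> * z / \<beta>) + s / \<beta>}" for z
      using \<beta> by (auto simp: sq abs_le_iff field_simps)
    have "\<bar>- (\<rho> * x / \<beta>)\<bar> \<le> \<bar>- (\<rho> * y / \<beta>)\<bar>"
      using \<beta> \<rho> xy by (simp add: abs_mult divide_right_mono mult_left_mono)
    from gauss_interval_decreasing[OF this, of "s / \<beta>"] show ?thesis
      unfolding \<beta>_def[symmetric] eq .
  qed
qed

section \<open>The limit law\<close>

lemma slab_probability_mono:
  assumes \<rho>: "0 \<le> \<rho>" "\<rho> \<le> \<rho>'" "\<rho>' \<le> 1"
  shows "(\<integral>\<^sup>+x. indicator {x. x\<^sup>2 \<le> a} x * emeasure \<gamma> {e. (sqrt (1 - \<rho>\<^sup>2) * e + \<rho> * x)\<^sup>2 \<le> b} \<partial>\<gamma>)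
    \<le> (\<integral>\<^sup>+x. indicator {x. x\<^sup>2 \<le> a} x * emeasure \<gamma> {e. (sqrt (1 - \<rho>'\<^sup>2) * e + \<rho>' * x)\<^sup>2 \<le> b} \<partial>\<gamma>)"
    (is "?l \<le> ?r")
proof (cases "\<rho> = \<rho>' \<or> a < 0")
  case True
  then show ?thesis
  proof
    assume "a < 0"
    then have "indicator {x. x\<^sup>2 \<le> a} x = (0 :: ennreal)" for x :: real
      using less_le_trans[OF _ zero_le_power2[of x]] by (simp add: indicator_def not_le)
    then show ?thesis by simp
  qed simp
next
  case False
  then have lt: "\<rho> < \<rho>'" and a: "a \<ge> 0" using \<rho> by auto
  define \<kappa> where "\<kappa> = \<rho> / \<rho>'"
  define H where "H x = (\<integral>\<^sup>+e. indicator {e. (sqrt (1 - \<rho>'\<^sup>2) * e + \<rho>' * x)\<^sup>2 \<le> b} e \<partial>\<gamma>)" for x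
  define Y where "Y x e = \<kappa> * x + sqrt (1 - \<kappa>\<^sup>2) * e" for x e :: real
  let ?T = "indicator {x::real. x\<^sup>2 \<le> a} :: real \<Rightarrow> ennreal"
  have r1: "\<rho>\<^sup>2 < 1" "\<rho>\<^sup>2 \<le> \<rho>'\<^sup>2" "\<rho>'\<^sup>2 \<le> 1" "\<rho>' > 0"
    using \<rho> lt by (auto simp: abs_square_less_1 power_mono power_le_one)
  have k: "0 \<le> \<kappa>" "\<kappa> \<le> 1" "\<rho>' * \<kappa> = \<rho>" using \<rho> lt by (auto simp: \<kappa>_def)
  then have k2: "\<kappa>\<^sup>2 \<le> 1" by (simp add: power_le_one)
  have rk: "\<rho>'\<^sup>2 * \<kappa>\<^sup>2 = \<rho>\<^sup>2" using k(3) by (metis power_mult_distrib)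
  have m: "emeasure \<gamma> {e. (c * e + d)\<^sup>2 \<le> b} = (\<integral>\<^sup>+e. indicator {e. (c * e + d)\<^sup>2 \<le> b} e \<partial>\<gamma>)" for c d b :: real
    by (rule nn_integral_indicator[symmetric]) simp
  have [measurable]: "H \<in> borel_measurable borel"
  proof -
    have "(\<lambda>x. \<integral>\<^sup>+e. indicator {z. (sqrt (1 - \<rho>'\<^sup>2) * snd z + \<rho>' * fst z)\<^sup>2 \<le> b} (x, e) \<partial>\<gamma>) \<in> borel_measurable borel"
      by measurable
    then show ?thesis unfolding H_def[abs_def] by (simp add: indicator_def)
  qed
  have [measurable]: "(\<lambda>z. Y (fst z) (snd z)) \<in> borel_measurable (borel \<Otimes>\<^sub>M borel)"
    unfolding Y_def by measurable
  have [measurable]: "Y x \<in> borel_measurable borel" for x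
    unfolding Y_def by measurable
  have semi: "emeasure \<gamma> {e. (sqrt (1 - \<rho>\<^sup>2) * e + \<rho> * x)\<^sup>2 \<le> b} = (\<integral>\<^sup>+e. H (Y x e) \<partial>\<gamma>)" for x
  proof -
    define s where "s = sqrt (1 - \<rho>\<^sup>2)"
    define \<alpha> where "\<alpha> = \<rho>' * sqrt (1 - \<kappa>\<^sup>2) / s"
    define \<beta> where "\<beta> = sqrt (1 - \<rho>'\<^sup>2) / s"
    have s: "s > 0" "s\<^sup>2 = 1 - \<rho>\<^sup>2" using r1 by (auto simp: s_def)
    have "\<alpha>\<^sup>2 + \<beta>\<^sup>2 = (\<rho>'\<^sup>2 * (1 - \<kappa>\<^sup>2) + (1 - \<rho>'\<^sup>2)) / s\<^sup>2"
      using r1 k2 by (simp add: \<alpha>_def \<beta>_def power_divide power_mult_distrib add_divide_distrib)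
    also have "\<dots> = 1" using s r1 rk by (simp add: algebra_simps)
    finally have ab: "\<alpha>\<^sup>2 + \<beta>\<^sup>2 = 1" .
    have "emeasure \<gamma> {e. (s * e + \<rho> * x)\<^sup>2 \<le> b} = (\<integral>\<^sup>+e. indicator {e. (s * e + \<rho> * x)\<^sup>2 \<le> b} e \<partial>\<gamma>)"
      by (rule m)
    also have "\<dots> = (\<integral>\<^sup>+e2. \<integral>\<^sup>+e. indicator {e. (s * e + \<rho> * x)\<^sup>2 \<le> b} (\<alpha> * e2 + \<beta> * e) \<partial>\<gamma> \<partial>\<gamma>)"
      by (rule nn_integral_gauss_combination[OF ab, symmetric]) measurable
    also have "\<dots> = (\<integral>\<^sup>+e2. H (Y x e2) \<partial>\<gamma>)"
    proof (intro nn_integral_cong)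
      fix e2
      have "s * (\<alpha> * e2 + \<beta> * e) + \<rho> * x = sqrt (1 - \<rho>'\<^sup>2) * e + \<rho>' * Y x e2" for e
        using s unfolding \<alpha>_def \<beta>_def Y_def k(3)[symmetric] by (simp add: field_simps)
      then show "(\<integral>\<^sup>+e. indicator {e. (s * e + \<rho> * x)\<^sup>2 \<le> b} (\<alpha> * e2 + \<beta> * e) \<partial>\<gamma>) = H (Y x e2)"
        unfolding H_def by (intro nn_integral_cong) (simp add: indicator_def)
    qed
    finally show ?thesis by (simp add: s_def)
  qed
  have law: "(\<integral>\<^sup>+x. \<integral>\<^sup>+e. f (Y x e) \<partial>\<gamma> \<partial>\<gamma>) = (\<integral>\<^sup>+x. f x \<partial>\<gamma>)" if "f \<in> borel_measurable borel" for f
    unfolding Y_def by (rule nn_integral_gauss_combination[OF _ that]) (use k2 in simp)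
  define H0 where "H0 = H (sqrt a)"
  have Hmono: "H y \<le> H x" if "\<bar>x\<bar> \<le> \<bar>y\<bar>" for x y
    using conditional_slab_decreasing[of \<rho>' x y b] \<rho> that unfolding H_def m[symmetric] by simp
  have pt: "?T x * H y + ?T y * H0 \<le> ?T y * H y + ?T x * H0" for x y
  proof -
    have T: "z\<^sup>2 \<le> a \<longleftrightarrow> \<bar>z\<bar> \<le> \<bar>sqrt a\<bar>" for z :: real
      using real_sqrt_le_iff[of "z\<^sup>2" a] a by simp
    consider "x\<^sup>2 \<le> a" "y\<^sup>2 \<le> a" | "\<not> x\<^sup>2 \<le> a" "\<not> y\<^sup>2 \<le> a" | "x\<^sup>2 \<le> a" "\<not> y\<^sup>2 \<le> a" | "\<not> x\<^sup>2 \<le> a" "y\<^sup>2 \<le> a"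
      by blast
    then show ?thesis
    proof cases
      case 3
      then have "H y \<le> H0" unfolding H0_def by (intro Hmono) (auto simp: T)
      then show ?thesis using 3 by (simp add: indicator_def)
    next
      case 4
      then have "H0 \<le> H y" unfolding H0_def by (intro Hmono) (auto simp: T)
      then show ?thesis using 4 by (simp add: indicator_def)
    qed (simp_all add: indicator_def)
  qed
  let ?t = "\<integral>\<^sup>+x. ?T x * H0 \<partial>\<gamma>"
  have H1: "H x \<le> 1" for x
    unfolding H_def m[symmetric] by (rule gauss.emeasure_le_1)
  have "?l + ?t = (\<integral>\<^sup>+x. \<integral>\<^sup>+e. ?T x * H (Y x e) \<partial>\<gamma> \<partial>\<gamma>) + (\<integral>\<^sup>+x. \<integral>\<^sup>+e. ?T (Y x e) * H0 \<partial>\<gamma> \<partial>\<gamma>)"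
    by (subst law[where f = "\<lambda>y. ?T y * H0"]) (simp_all add: semi nn_integral_cmult)
  also have "\<dots> = (\<integral>\<^sup>+x. \<integral>\<^sup>+e. ?T x * H (Y x e) + ?T (Y x e) * H0 \<partial>\<gamma> \<partial>\<gamma>)"
    by (simp add: nn_integral_add)
  also have "\<dots> \<le> (\<integral>\<^sup>+x. \<integral>\<^sup>+e. ?T (Y x e) * H (Y x e) + ?T x * H0 \<partial>\<gamma> \<partial>\<gamma>)"
    by (intro nn_integral_mono pt)
  also have "\<dots> = (\<integral>\<^sup>+x. \<integral>\<^sup>+e. ?T (Y x e) * H (Y x e) \<partial>\<gamma> \<partial>\<gamma>) + (\<integral>\<^sup>+x. \<integral>\<^sup>+e. ?T x * H0 \<partial>\<gamma> \<partial>\<gamma>)"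
    by (simp add: nn_integral_add)
  also have "\<dots> = ?r + ?t"
  proof -
    have "(\<integral>\<^sup>+e. k \<partial>\<gamma>) = k" for k :: ennreal using gauss.emeasure_space_1 by simp
    moreover have "(\<integral>\<^sup>+x. \<integral>\<^sup>+e. ?T (Y x e) * H (Y x e) \<partial>\<gamma> \<partial>\<gamma>) = (\<integral>\<^sup>+y. ?T y * H y \<partial>\<gamma>)"
      by (rule law[where f = "\<lambda>y. ?T y * H y"]) measurable
    ultimately show ?thesis unfolding H_def m by (simp only:)
  qed
  finally have "?t + ?l \<le> ?t + ?r" by (simp only: add.commute)
  moreover have "?t \<noteq> \<infinity>"
  proof -
    have "?t \<le> (\<integral>\<^sup>+x. 1 \<partial>\<gamma>)"
      by (intro nn_integral_mono) (auto simp: indicator_def H0_def H1)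
    also have "\<dots> = 1" using gauss.emeasure_space_1 by simp
    finally show ?thesis by (auto simp: top_unique)
  qed
  ultimately show ?thesis
    unfolding ennreal_add_left_cancel_le by blast
qed

text \<open>The joint law of \<open>\<Sum>\<^sub>f w\<^sub>f (\<surd>(1 - p\<^sub>f) \<epsilon>\<^sub>f + \<surd>p\<^sub>f \<eta>\<^sub>f)\<^sup>2\<close> and \<open>\<Sum>\<^sub>f \<eta>\<^sub>f\<^sup>2\<close> for independent standard normal
  \<open>\<epsilon>\<^sub>f\<close>, \<open>\<eta>\<^sub>f\<close>, given the list of the pairs \<open>(w\<^sub>f, p\<^sub>f)\<close>.\<close>

fun qlaw :: "(real \<times> real) list \<Rightarrow> (real \<times> real) measure" where
  "qlaw [] = return (borel \<Otimes>\<^sub>M borel) (0, 0)"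
| "qlaw ((w, p) # l) = distr (\<gamma> \<Otimes>\<^sub>M (\<gamma> \<Otimes>\<^sub>M qlaw l)) (borel \<Otimes>\<^sub>M borel)
     (\<lambda>(e, h, u, v). (u + w * (sqrt (1 - p) * e + sqrt p * h)\<^sup>2, v + h\<^sup>2))"

lemma sets_qlaw[simp, measurable_cong]: "sets (qlaw l) = sets (borel \<Otimes>\<^sub>M borel)"
  by (induction l rule: qlaw.induct) auto

lemma space_qlaw[simp]: "space (qlaw l) = UNIV"
  using sets_eq_imp_space_eq[OF sets_qlaw[of l]] by (simp add: space_pair_measure)

lemma prob_space_qlaw: "prob_space (qlaw l)"
proof (induction l rule: qlaw.induct)
  case 1
  then show ?case by (auto intro!: prob_space_return simp: space_pair_measure)
next
  case (2 w p l)
  interpret q: prob_space "qlaw l" by (rule 2)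
  interpret a: pair_prob_space \<gamma> "qlaw l" ..
  interpret b: pair_prob_space \<gamma> "\<gamma> \<Otimes>\<^sub>M qlaw l" ..
  show ?case by (simp, rule b.prob_space_distr) measurable
qed

interpretation qlaw: prob_space "qlaw l" for l by (rule prob_space_qlaw)

lemma nn_integral_qlaw_Nil:
  assumes [measurable]: "g \<in> borel_measurable (borel \<Otimes>\<^sub>M borel)"
  shows "(\<integral>\<^sup>+x. g x \<partial>qlaw []) = g (0, 0)"
  by (simp add: nn_integral_return space_pair_measure)

lemma nn_integral_qlaw_Cons:
  assumes [measurable]: "g \<in> borel_measurable (borel \<Otimes>\<^sub>M borel)"
  shows "(\<integral>\<^sup>+x. g x \<partial>qlaw ((w, p) # l)) = (\<integral>\<^sup>+e. \<integral>\<^sup>+h. \<integral>\<^sup>+x.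
     g (fst x + w * (sqrt (1 - p) * e + sqrt p * h)\<^sup>2, snd x + h\<^sup>2) \<partial>qlaw l \<partial>\<gamma> \<partial>\<gamma>)"
proof -
  interpret a: pair_prob_space \<gamma> "qlaw l" ..
  have mcs: "measurable (\<gamma> \<Otimes>\<^sub>M (\<gamma> \<Otimes>\<^sub>M qlaw l)) borel = measurable (borel \<Otimes>\<^sub>M (borel \<Otimes>\<^sub>M (borel \<Otimes>\<^sub>M borel))) borel"
    by (intro measurable_cong_sets sets_pair_measure_cong) auto
  have mcs': "measurable (\<gamma> \<Otimes>\<^sub>M qlaw l) borel = measurable (borel \<Otimes>\<^sub>M (borel \<Otimes>\<^sub>M borel)) borel"
    by (intro measurable_cong_sets sets_pair_measure_cong) auto
  have "(\<integral>\<^sup>+x. g x \<partial>qlaw ((w, p) # l)) = (\<integral>\<^sup>+z. g (fst (snd (snd z)) + w * (sqrt (1 - p) * fst z + sqrt p * fst (snd z))\<^sup>2,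
     snd (snd (snd z)) + (fst (snd z))\<^sup>2) \<partial>(\<gamma> \<Otimes>\<^sub>M (\<gamma> \<Otimes>\<^sub>M qlaw l)))"
    by (simp, subst nn_integral_distr) (measurable, simp add: split_beta)
  also have "\<dots> = (\<integral>\<^sup>+e. \<integral>\<^sup>+z. g (fst (snd z) + w * (sqrt (1 - p) * e + sqrt p * fst z)\<^sup>2,
     snd (snd z) + (fst z)\<^sup>2) \<partial>(\<gamma> \<Otimes>\<^sub>M qlaw l) \<partial>\<gamma>)"
    by (subst a.P.nn_integral_fst[symmetric], unfold mcs, measurable)
  also have "\<dots> = (\<integral>\<^sup>+e. \<integral>\<^sup>+h. \<integral>\<^sup>+x.
     g (fst x + w * (sqrt (1 - p) * e + sqrt p * h)\<^sup>2, snd x + h\<^sup>2) \<partial>qlaw l \<partial>\<gamma> \<partial>\<gamma>)"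
    by (intro nn_integral_cong, subst qlaw.nn_integral_fst[symmetric], unfold mcs', measurable)
  finally show ?thesis .
qed

lemma qlaw_scaling:
  assumes c: "0 < c" "c \<le> 1" and "g \<in> borel_measurable (borel \<Otimes>\<^sub>M borel)"
  shows "ennreal (c ^ (2 * length l)) * (\<integral>\<^sup>+x. g x \<partial>qlaw l) \<le> (\<integral>\<^sup>+x. g (fst x / c\<^sup>2, snd x / c\<^sup>2) \<partial>qlaw l)"
  using assms(3)
proof (induction l arbitrary: g rule: qlaw.induct)
  case 1
  then have [measurable]: "g \<in> borel_measurable (borel \<Otimes>\<^sub>M borel)" .
  show ?case by (subst (1 2) nn_integral_qlaw_Nil) auto
next
  case (2 w p l)
  then have [measurable]: "g \<in> borel_measurable (borel \<Otimes>\<^sub>M borel)" by simp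
  define G where "G e h x = g (fst x + w * (sqrt (1 - p) * e + sqrt p * h)\<^sup>2, snd x + h\<^sup>2)" for e h and x :: "real \<times> real"
  have [measurable]: "(\<lambda>z. G (fst z) (fst (snd z)) (snd (snd z))) \<in> borel_measurable (borel \<Otimes>\<^sub>M (borel \<Otimes>\<^sub>M (borel \<Otimes>\<^sub>M borel)))"
    unfolding G_def by measurable
  have [measurable]: "G e h \<in> borel_measurable (borel \<Otimes>\<^sub>M borel)" for e h
    unfolding G_def by measurable
  define k where "k = ennreal (c ^ (2 * length l))"
  have m1: "(\<lambda>h. \<integral>\<^sup>+x. G e h x \<partial>qlaw l) \<in> borel_measurable borel" for e
    unfolding G_def by measurable
  have m2: "(\<lambda>e. \<integral>\<^sup>+h. \<integral>\<^sup>+x. G e h x \<partial>qlaw l \<partial>\<gamma>) \<in> borel_measurable borel"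
    unfolding G_def by measurable
  have e1: "ennreal (c ^ (2 * length ((w, p) # l))) = ennreal c * (ennreal c * k)"
    using c by (simp add: k_def flip: ennreal_mult)
  have "ennreal (c ^ (2 * length ((w, p) # l))) * (\<integral>\<^sup>+x. g x \<partial>qlaw ((w, p) # l))
     = ennreal c * (ennreal c * k) * (\<integral>\<^sup>+e. \<integral>\<^sup>+h. \<integral>\<^sup>+x. G e h x \<partial>qlaw l \<partial>\<gamma> \<partial>\<gamma>)"
    unfolding e1 G_def by (subst nn_integral_qlaw_Cons) auto
  also have "\<dots> = k * (ennreal c * (ennreal c * (\<integral>\<^sup>+e. \<integral>\<^sup>+h. \<integral>\<^sup>+x. G e h x \<partial>qlaw l \<partial>\<gamma> \<partial>\<gamma>)))"
    by (simp add: mult_ac)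
  also have "\<dots> \<le> k * (ennreal c * (\<integral>\<^sup>+e. \<integral>\<^sup>+h. \<integral>\<^sup>+x. G (e / c) h x \<partial>qlaw l \<partial>\<gamma> \<partial>\<gamma>))"
    by (intro mult_left_mono gauss_scaling[OF m2 c]) auto
  also have "\<dots> = k * (\<integral>\<^sup>+e. ennreal c * (\<integral>\<^sup>+h. \<integral>\<^sup>+x. G (e / c) h x \<partial>qlaw l \<partial>\<gamma>) \<partial>\<gamma>)"
    by (subst nn_integral_cmult) (auto intro!: measurable_compose[OF _ m2])
  also have "\<dots> \<le> k * (\<integral>\<^sup>+e. \<integral>\<^sup>+h. \<integral>\<^sup>+x. G (e / c) (h / c) x \<partial>qlaw l \<partial>\<gamma> \<partial>\<gamma>)"
    by (intro mult_left_mono nn_integral_mono gauss_scaling[OF m1 c]) auto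
  also have "\<dots> = (\<integral>\<^sup>+e. \<integral>\<^sup>+h. k * (\<integral>\<^sup>+x. G (e / c) (h / c) x \<partial>qlaw l) \<partial>\<gamma> \<partial>\<gamma>)"
    unfolding G_def by (simp add: nn_integral_cmult)
  also have "\<dots> \<le> (\<integral>\<^sup>+e. \<integral>\<^sup>+h. \<integral>\<^sup>+x. G (e / c) (h / c) (fst x / c\<^sup>2, snd x / c\<^sup>2) \<partial>qlaw l \<partial>\<gamma> \<partial>\<gamma>)"
    unfolding k_def by (intro nn_integral_mono 2(1)) measurable
  also have "\<dots> = (\<integral>\<^sup>+x. g (fst x / c\<^sup>2, snd x / c\<^sup>2) \<partial>qlaw ((w, p) # l))"
  proof -
    have lin: "sqrt (1 - p) * (e / c) + sqrt p * (h / c) = (sqrt (1 - p) * e + sqrt p * h) / c" for e h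
      by (simp add: add_divide_distrib)
    have "G (e / c) (h / c) (fst x / c\<^sup>2, snd x / c\<^sup>2)
       = g ((fst x + w * (sqrt (1 - p) * e + sqrt p * h)\<^sup>2) / c\<^sup>2, (snd x + h\<^sup>2) / c\<^sup>2)" for e h x
      unfolding G_def lin power_divide fst_conv snd_conv
      by (simp only: add_divide_distrib[of "fst x"] add_divide_distrib[of "snd x"] times_divide_eq_right)
    then show ?thesis by (subst nn_integral_qlaw_Cons) (auto simp del: qlaw.simps)
  qed
  finally show ?case .
qed

section \<open>Laplace transforms determine quadrant probabilities\<close>

lemma avg_poly_exp_tendsto:
  fixes u v :: "nat \<Rightarrow> 'z \<Rightarrow> real"
  assumes nu: "prob_space \<nu>" and sets[measurable_cong]: "sets \<nu> = sets (borel \<Otimes>\<^sub>M borel)"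
    and nonneg: "AE x in \<nu>. 0 \<le> fst x \<and> 0 \<le> snd x"
    and lap: "\<And>j k :: nat. (\<lambda>m. avg (S m) (\<lambda>Z. exp (- real j * u m Z - real k * v m Z)))
       \<longlonglongrightarrow> (\<integral>x. exp (- real j * fst x - real k * snd x) \<partial>\<nu>)"
  shows "(\<lambda>m. avg (S m) (\<lambda>Z. (\<Sum>j\<le>a. \<alpha> j * exp (- u m Z) ^ j) * (\<Sum>k\<le>b. \<beta> k * exp (- v m Z) ^ k)))
    \<longlonglongrightarrow> (\<integral>x. (\<Sum>j\<le>a. \<alpha> j * exp (- fst x) ^ j) * (\<Sum>k\<le>b. \<beta> k * exp (- snd x) ^ k) \<partial>\<nu>)"
proof -
  interpret prob_space \<nu> by fact
  have e: "(\<Sum>j\<le>a. \<alpha> j * exp (- s) ^ j) * (\<Sum>k\<le>b. \<beta> k * exp (- t) ^ k)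
      = (\<Sum>j\<le>a. \<Sum>k\<le>b. \<alpha> j * \<beta> k * exp (- real j * s - real k * t))" for s t
  proof -
    have "exp (- real j * s - real k * t) = exp (- s) ^ j * exp (- t) ^ k" for j k
      by (simp add: exp_of_nat_mult[symmetric] exp_add[symmetric])
    then show ?thesis by (simp add: sum_product mult_ac)
  qed
  have i: "integrable \<nu> (\<lambda>x. exp (- real j * fst x - real k * snd x))" for j k :: nat
  proof (rule integrable_const_bound[where B = 1])
    show "AE x in \<nu>. norm (exp (- real j * fst x - real k * snd x)) \<le> 1"
      using nonneg
    proof eventually_elim
      case (elim x)
      then have "0 \<le> real j * fst x" "0 \<le> real k * snd x" by auto
      then show ?case by simp
    qed
  qed measurable
  have "(\<integral>x. (\<Sum>j\<le>a. \<Sum>k\<le>b. \<alpha> j * \<beta> k * exp (- real j * fst x - real k * snd x)) \<partial>\<nu>)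
    = (\<Sum>j\<le>a. \<Sum>k\<le>b. \<alpha> j * \<beta> k * (\<integral>x. exp (- real j * fst x - real k * snd x) \<partial>\<nu>))"
    by (subst Bochner_Integration.integral_sum, intro Bochner_Integration.integrable_sum integrable_mult_right i,
        subst Bochner_Integration.integral_sum, intro integrable_mult_right i) simp
  then show ?thesis
    unfolding e avg_sum avg_cmult by (simp only:) (intro tendsto_sum tendsto_mult tendsto_const lap)
qed

lemma avg_continuous_exp_tendsto:
  fixes u v :: "nat \<Rightarrow> 'z \<Rightarrow> real"
  assumes nu: "prob_space \<nu>" and sets[measurable_cong]: "sets \<nu> = sets (borel \<Otimes>\<^sub>M borel)"
    and nonneg: "AE x in \<nu>. 0 \<le> fst x \<and> 0 \<le> snd x"
    and S: "\<And>m. finite (S m)" "\<And>m. S m \<noteq> {}"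
    and uv: "\<And>m Z. Z \<in> S m \<Longrightarrow> 0 \<le> u m Z" "\<And>m Z. Z \<in> S m \<Longrightarrow> 0 \<le> v m Z"
    and lap: "\<And>j k :: nat. (\<lambda>m. avg (S m) (\<lambda>Z. exp (- real j * u m Z - real k * v m Z)))
       \<longlonglongrightarrow> (\<integral>x. exp (- real j * fst x - real k * snd x) \<partial>\<nu>)"
    and h: "continuous_on UNIV h" "\<And>x. \<bar>h x\<bar> \<le> 1" and k: "continuous_on UNIV k" "\<And>x. \<bar>k x\<bar> \<le> (1::real)"
  shows "(\<lambda>m. avg (S m) (\<lambda>Z. h (exp (- u m Z)) * k (exp (- v m Z))))
    \<longlonglongrightarrow> (\<integral>x. h (exp (- fst x)) * k (exp (- snd x)) \<partial>\<nu>)"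
proof -
  interpret prob_space \<nu> by fact
  have hm[measurable]: "h \<in> borel_measurable borel" "k \<in> borel_measurable borel"
    using h(1) k(1) by (auto intro: borel_measurable_continuous_onI)
  show ?thesis
  proof (rule LIMSEQ_I)
    fix r :: real assume r: "0 < r"
    define d where "d = min 1 (r / 9)"
    have d: "0 < d" "d \<le> 1" "3 * d \<le> r / 3" using r by (auto simp: d_def)
    have "\<exists>g. real_polynomial_function g \<and> (\<forall>x\<in>{0..1::real}. \<bar>f x - g x\<bar> < d)"
      if "continuous_on UNIV f" for f :: "real \<Rightarrow> real"
      by (rule Stone_Weierstrass_real_polynomial_function[of "{0..1::real}" f, OF compact_Icc continuous_on_subset[OF that] d(1)]) auto
    then obtain P R where P: "real_polynomial_function P" "\<And>x. x \<in> {0..1} \<Longrightarrow> \<bar>h x - P x\<bar> < d"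
      and R: "real_polynomial_function R" "\<And>x. x \<in> {0..1} \<Longrightarrow> \<bar>k x - R x\<bar> < d"
      using h(1) k(1) by metis
    obtain \<alpha> a where Pe: "P = (\<lambda>x. \<Sum>i\<le>a. \<alpha> i * x ^ i)"
      using P(1) unfolding real_polynomial_function_iff_sum by blast
    obtain \<beta> b where Re: "R = (\<lambda>x. \<Sum>i\<le>b. \<beta> i * x ^ i)"
      using R(1) unfolding real_polynomial_function_iff_sum by blast
    have Pm[measurable]: "P \<in> borel_measurable borel" "R \<in> borel_measurable borel"
      unfolding Pe Re by measurable
    have close: "\<bar>h x * k y - P x * R y\<bar> \<le> r / 3" and bd: "\<bar>P x * R y\<bar> \<le> 4"
      if "x \<in> {0..1}" "y \<in> {0..1}" for x y
    proof -
      have "\<bar>P x\<bar> \<le> 2" "\<bar>R y\<bar> \<le> 2" using P(2)[of x] R(2)[of y] h(2)[of x] k(2)[of y] that d by linarith+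
      have "h x * k y - P x * R y = h x * (k y - R y) + R y * (h x - P x)" by (simp add: algebra_simps)
      then have "\<bar>h x * k y - P x * R y\<bar> \<le> \<bar>h x\<bar> * \<bar>k y - R y\<bar> + \<bar>R y\<bar> * \<bar>h x - P x\<bar>"
        by (metis abs_mult abs_triangle_ineq)
      also have "\<dots> \<le> 1 * d + 2 * d"
        using P(2)[of x] R(2)[of y] h(2) that \<open>\<bar>R y\<bar> \<le> 2\<close>
        by (intro add_mono mult_mono) (auto intro: less_imp_le)
      finally show "\<bar>h x * k y - P x * R y\<bar> \<le> r / 3" using d by simp
      have "\<bar>P x\<bar> * \<bar>R y\<bar> \<le> 2 * 2" using \<open>\<bar>P x\<bar> \<le> 2\<close> \<open>\<bar>R y\<bar> \<le> 2\<close> by (intro mult_mono) auto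
      then show "\<bar>P x * R y\<bar> \<le> 4" by (simp add: abs_mult)
    qed
    let ?f = "\<lambda>x. h (exp (- fst x)) * k (exp (- snd x))"
    let ?g = "\<lambda>x. P (exp (- fst x)) * R (exp (- snd x))"
    have i1: "integrable \<nu> ?f"
    proof (rule integrable_const_bound[where B = 1])
      show "AE x in \<nu>. norm (?f x) \<le> 1"
        using h(2) k(2) by (auto simp: abs_mult intro!: mult_le_one AE_I2)
    qed measurable
    have i2: "integrable \<nu> ?g"
    proof (rule integrable_const_bound[where B = 4])
      show "AE x in \<nu>. norm (?g x) \<le> 4"
        using nonneg by eventually_elim (use bd in auto)
    qed measurable
    have c1: "\<bar>(\<integral>x. ?f x \<partial>\<nu>) - (\<integral>x. ?g x \<partial>\<nu>)\<bar> \<le> r / 3"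
    proof -
      have "\<bar>(\<integral>x. ?f x \<partial>\<nu>) - (\<integral>x. ?g x \<partial>\<nu>)\<bar> = \<bar>\<integral>x. ?f x - ?g x \<partial>\<nu>\<bar>"
        by (subst Bochner_Integration.integral_diff[OF i1 i2]) simp
      also have "\<dots> \<le> (\<integral>x. \<bar>?f x - ?g x\<bar> \<partial>\<nu>)" by (rule integral_abs_bound)
      also have "\<dots> \<le> (\<integral>x. r / 3 \<partial>\<nu>)"
      proof (rule integral_mono_AE)
        show "AE x in \<nu>. \<bar>?f x - ?g x\<bar> \<le> r / 3"
          using nonneg by eventually_elim (use close in auto)
      qed (use i1 i2 in auto)
      also have "\<dots> = r / 3" by (simp add: prob_space)
      finally show ?thesis .
    qed
    have c2: "\<bar>avg (S m) (\<lambda>Z. h (exp (- u m Z)) * k (exp (- v m Z))) - avg (S m) (\<lambda>Z. P (exp (- u m Z)) * R (exp (- v m Z)))\<bar> \<le> r / 3" for m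
    proof -
      have "norm (avg (S m) (\<lambda>Z. h (exp (- u m Z)) * k (exp (- v m Z)) - P (exp (- u m Z)) * R (exp (- v m Z)))) \<le> r / 3"
        by (intro norm_avg_le_bound S, unfold real_norm_def, rule close) (use uv in auto)
      then show ?thesis by (simp add: avg_diff)
    qed
    have "(\<lambda>m. avg (S m) (\<lambda>Z. P (exp (- u m Z)) * R (exp (- v m Z)))) \<longlonglongrightarrow> (\<integral>x. ?g x \<partial>\<nu>)"
      unfolding Pe Re by (rule avg_poly_exp_tendsto[OF nu sets nonneg lap])
    then obtain N where N: "\<And>m. m \<ge> N \<Longrightarrow> \<bar>avg (S m) (\<lambda>Z. P (exp (- u m Z)) * R (exp (- v m Z))) - (\<integral>x. ?g x \<partial>\<nu>)\<bar> < r / 3"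
      using LIMSEQ_D[of _ _ "r / 3"] r by fastforce
    show "\<exists>no. \<forall>m\<ge>no. norm (avg (S m) (\<lambda>Z. h (exp (- u m Z)) * k (exp (- v m Z))) - (\<integral>x. ?f x \<partial>\<nu>)) < r"
    proof (intro exI allI impI)
      fix m assume "N \<le> m"
      then show "norm (avg (S m) (\<lambda>Z. h (exp (- u m Z)) * k (exp (- v m Z))) - (\<integral>x. ?f x \<partial>\<nu>)) < r"
        using N[of m] c1 c2[of m] unfolding real_norm_def by linarith
    qed
  qed
qed

definition ramp :: "real \<Rightarrow> real \<Rightarrow> real" where
  "ramp s x = min 1 (max 0 (s + x))"

lemma ramp_bounds: "0 \<le> ramp s x" "ramp s x \<le> 1" by (auto simp: ramp_def)

lemma ramp_scaled_tendsto:
  assumes "x \<noteq> (0::real)"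
  shows "(\<lambda>n. ramp s (real n * x)) \<longlonglongrightarrow> (if 0 \<le> x then 1 else 0)"
proof -
  have large: "eventually (\<lambda>n. B \<le> real n * y) sequentially" if y: "0 < y" for y B :: real
  proof -
    obtain N where N: "B < real N * y" using reals_Archimedean3[OF y] by blast
    have "B \<le> real n * y" if "n \<ge> N" for n
      using N mult_right_mono[of "real N" "real n" y] that y by linarith
    then show ?thesis by (auto simp: eventually_sequentially)
  qed
  have "eventually (\<lambda>n. ramp s (real n * x) = (if 0 \<le> x then 1 else 0)) sequentially"
  proof (cases "x > 0")
    case True
    then show ?thesis using large[of x "1 - s"] by (auto simp: ramp_def elim!: eventually_mono)
  next
    case False
    with assms have "x < 0" by simp
    then show ?thesis using large[of "- x" s] by (auto simp: ramp_def elim!: eventually_mono)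
  qed
  then show ?thesis by (rule tendsto_eventually)
qed

text \<open>Convergence of the joint Laplace transforms of \<open>(u, v)\<close> at integer points suffices, because these
  are the moments of the variables \<open>(exp (- u), exp (- v))\<close>, which take values in a compact set.\<close>

lemma avg_quadrant_tendsto:
  fixes u v :: "nat \<Rightarrow> 'z \<Rightarrow> real"
  assumes nu: "prob_space \<nu>" and sets[measurable_cong]: "sets \<nu> = sets (borel \<Otimes>\<^sub>M borel)"
    and nonneg: "AE x in \<nu>. 0 \<le> fst x \<and> 0 \<le> snd x"
    and S: "\<And>m. finite (S m)" "\<And>m. S m \<noteq> {}"
    and uv: "\<And>m Z. Z \<in> S m \<Longrightarrow> 0 \<le> u m Z" "\<And>m Z. Z \<in> S m \<Longrightarrow> 0 \<le> v m Z"
    and lap: "\<And>j k :: nat. (\<lambda>m. avg (S m) (\<lambda>Z. exp (- real j * u m Z - real k * v m Z)))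
       \<longlonglongrightarrow> (\<integral>x. exp (- real j * fst x - real k * snd x) \<partial>\<nu>)"
    and atoms: "AE x in \<nu>. fst x \<noteq> c" "AE x in \<nu>. snd x \<noteq> a"
  shows "(\<lambda>m. real (card {Z \<in> S m. u m Z \<le> c \<and> v m Z \<le> a}) / real (card (S m)))
     \<longlonglongrightarrow> measure \<nu> {x. fst x \<le> c \<and> snd x \<le> a}"
proof -
  interpret prob_space \<nu> by fact
  define f where "f s n t x = ramp s (real n * (x - exp (- t)))" for s n t x
  define I where "I t x = (if exp (- t) \<le> x then 1 else 0 :: real)" for t x :: real
  have fb: "\<bar>f s n t x\<bar> \<le> 1" "0 \<le> f s n t x" for s n t x
    using ramp_bounds[of s "real n * (x - exp (- t))"] by (auto simp: f_def)
  have fc: "continuous_on UNIV (f s n t)" for s n t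
    unfolding f_def ramp_def by (intro continuous_intros)
  have fm[measurable]: "f s n t \<in> borel_measurable borel" for s n t
    using fc by (rule borel_measurable_continuous_onI)
  have up: "I t x \<le> f 1 n t x" for t n x
    by (auto simp: I_def f_def ramp_def)
  have lo: "f 0 n t x \<le> I t x" for t n x
    by (auto simp: I_def f_def ramp_def mult_nonneg_nonpos)
  have lim: "(\<lambda>n. f s n t x) \<longlonglongrightarrow> I t x" if "x \<noteq> exp (- t)" for s t x
    using ramp_scaled_tendsto[of "x - exp (- t)" s] that by (simp add: f_def I_def)
  have Iexp: "I t (exp (- w)) = (if w \<le> t then 1 else 0)" for t w by (simp add: I_def)
  have spc: "space \<nu> = UNIV"
    using sets_eq_imp_space_eq[OF sets] by (simp add: space_pair_measure)
  have measQ: "{x. fst x \<le> c \<and> snd x \<le> a} \<in> events"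
  proof -
    have "{x \<in> space \<nu>. fst x \<le> c \<and> snd x \<le> a} \<in> events" by measurable
    then show ?thesis by (simp add: spc)
  qed
  have intlim: "(\<lambda>n. \<integral>x. f s n c (exp (- fst x)) * f s n a (exp (- snd x)) \<partial>\<nu>)
      \<longlonglongrightarrow> measure \<nu> {x. fst x \<le> c \<and> snd x \<le> a}" for s
  proof -
    have "(\<lambda>n. \<integral>x. f s n c (exp (- fst x)) * f s n a (exp (- snd x)) \<partial>\<nu>)
      \<longlonglongrightarrow> (\<integral>x. indicator {x. fst x \<le> c \<and> snd x \<le> a} x \<partial>\<nu>)"
    proof (rule integral_dominated_convergence[where w = "\<lambda>_. 1"])
      show "AE x in \<nu>. (\<lambda>n. f s n c (exp (- fst x)) * f s n a (exp (- snd x)))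
          \<longlonglongrightarrow> indicator {x. fst x \<le> c \<and> snd x \<le> a} x"
        using atoms
      proof eventually_elim
        case (elim x)
        then have "(\<lambda>n. f s n c (exp (- fst x)) * f s n a (exp (- snd x)))
            \<longlonglongrightarrow> I c (exp (- fst x)) * I a (exp (- snd x))"
          by (intro tendsto_mult lim) auto
        then show ?case by (auto simp: Iexp indicator_def split: if_splits)
      qed
      show "AE x in \<nu>. norm (f s n c (exp (- fst x)) * f s n a (exp (- snd x))) \<le> 1" for n
        using fb(1) by (auto simp: abs_mult intro!: mult_le_one AE_I2)
    qed (use measQ in auto)
    then show ?thesis using measQ by (simp add: spc)
  qed
  define E where "E m = real (card {Z \<in> S m. u m Z \<le> c \<and> v m Z \<le> a}) / real (card (S m))" for m
  have Eavg: "E m = avg (S m) (\<lambda>Z. I c (exp (- u m Z)) * I a (exp (- v m Z)))" for m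
  proof -
    have "(\<Sum>Z\<in>S m. I c (exp (- u m Z)) * I a (exp (- v m Z))) = (\<Sum>Z\<in>S m. if u m Z \<le> c \<and> v m Z \<le> a then 1 else 0)"
      by (intro sum.cong) (auto simp: Iexp)
    also have "\<dots> = real (card {Z \<in> S m. u m Z \<le> c \<and> v m Z \<le> a})"
      using S(1)[of m] by (simp add: sum.If_cases Int_def)
    finally show ?thesis by (simp add: E_def avg_def)
  qed
  define F where "F s n m = avg (S m) (\<lambda>Z. f s n c (exp (- u m Z)) * f s n a (exp (- v m Z)))" for s n m
  have Flim: "F s n \<longlonglongrightarrow> (\<integral>x. f s n c (exp (- fst x)) * f s n a (exp (- snd x)) \<partial>\<nu>)" for s n
    unfolding F_def
    by (rule avg_continuous_exp_tendsto[OF nu sets nonneg S uv lap fc fb(1) fc fb(1)])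
  have I0: "0 \<le> I t x" for t x by (simp add: I_def)
  have EF: "F 0 n m \<le> E m" "E m \<le> F 1 n m" for n m
    unfolding Eavg F_def using up lo fb(2) I0 by (auto intro!: avg_mono mult_mono)
  show ?thesis
    unfolding E_def[symmetric]
  proof (rule LIMSEQ_I)
    fix r :: real assume r: "0 < r"
    let ?P = "measure \<nu> {x. fst x \<le> c \<and> snd x \<le> a}"
    have "\<exists>n N. \<forall>m\<ge>N. \<bar>F s n m - ?P\<bar> < r" for s
    proof -
      obtain n where n: "\<bar>(\<integral>x. f s n c (exp (- fst x)) * f s n a (exp (- snd x)) \<partial>\<nu>) - ?P\<bar> < r / 2"
        using LIMSEQ_D[OF intlim[of s], of "r / 2"] r by (auto simp: dist_real_def)
      obtain N where N: "\<And>m. m \<ge> N \<Longrightarrow> \<bar>F s n m - (\<integral>x. f s n c (exp (- fst x)) * f s n a (exp (- snd x)) \<partial>\<nu>)\<bar> < r / 2"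
        using LIMSEQ_D[OF Flim[of s n], of "r / 2"] r by auto
      have "\<bar>F s n m - ?P\<bar> < r" if "m \<ge> N" for m using N[OF that] n by linarith
      then show ?thesis by blast
    qed
    from this[of 0] this[of 1] obtain n0 N0 n1 N1 where
      N: "\<And>m. m \<ge> N0 \<Longrightarrow> \<bar>F 0 n0 m - ?P\<bar> < r" "\<And>m. m \<ge> N1 \<Longrightarrow> \<bar>F 1 n1 m - ?P\<bar> < r" by blast
    show "\<exists>no. \<forall>m\<ge>no. norm (E m - ?P) < r"
    proof (intro exI allI impI)
      fix m assume "max N0 N1 \<le> m"
      then show "norm (E m - ?P) < r"
        using N(1)[of m] N(2)[of m] EF(1)[of n0 m] EF(2)[of m n1] unfolding real_norm_def by auto
    qed
  qed
qed

section \<open>Monotonicity and quantiles of the limit law\<close>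

lemma nn_integral_qlaw_Cons_swapped:
  assumes [measurable]: "g \<in> borel_measurable (borel \<Otimes>\<^sub>M borel)"
  shows "(\<integral>\<^sup>+x. g x \<partial>qlaw ((w, p) # l)) = (\<integral>\<^sup>+x. \<integral>\<^sup>+h. \<integral>\<^sup>+e.
     g (fst x + w * (sqrt (1 - p) * e + sqrt p * h)\<^sup>2, snd x + h\<^sup>2) \<partial>\<gamma> \<partial>\<gamma> \<partial>qlaw l)"
proof -
  interpret a: pair_prob_space "qlaw l" \<gamma> ..
  interpret b: pair_prob_space \<gamma> \<gamma> ..
  define F where "F e h x = g (fst x + w * (sqrt (1 - p) * e + sqrt p * h)\<^sup>2, snd x + h\<^sup>2)" for e h x
  have "(\<integral>\<^sup>+h. \<integral>\<^sup>+x. F e h x \<partial>qlaw l \<partial>\<gamma>) = (\<integral>\<^sup>+x. \<integral>\<^sup>+h. F e h x \<partial>\<gamma> \<partial>qlaw l)" for e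
    unfolding F_def by (rule a.Fubini') measurable
  then have "(\<integral>\<^sup>+e. \<integral>\<^sup>+h. \<integral>\<^sup>+x. F e h x \<partial>qlaw l \<partial>\<gamma> \<partial>\<gamma>) = (\<integral>\<^sup>+e. \<integral>\<^sup>+x. \<integral>\<^sup>+h. F e h x \<partial>\<gamma> \<partial>qlaw l \<partial>\<gamma>)"
    by simp
  also have "\<dots> = (\<integral>\<^sup>+x. \<integral>\<^sup>+e. \<integral>\<^sup>+h. F e h x \<partial>\<gamma> \<partial>\<gamma> \<partial>qlaw l)"
    unfolding F_def by (rule a.Fubini') measurable
  also have "\<dots> = (\<integral>\<^sup>+x. \<integral>\<^sup>+h. \<integral>\<^sup>+e. F e h x \<partial>\<gamma> \<partial>\<gamma> \<partial>qlaw l)"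
    unfolding F_def by (intro nn_integral_cong b.Fubini') measurable
  finally show ?thesis unfolding F_def by (subst nn_integral_qlaw_Cons) auto
qed

lemma gauss_atomless: "emeasure \<gamma> {y. d + y\<^sup>2 = c} = 0"
proof -
  have "{y. d + y\<^sup>2 = c} \<subseteq> {sqrt (c - d), - sqrt (c - d)}"
  proof
    fix y assume "y \<in> {y. d + y\<^sup>2 = c}"
    then have "sqrt (c - d) = \<bar>y\<bar>" by (auto simp flip: real_sqrt_abs)
    then show "y \<in> {sqrt (c - d), - sqrt (c - d)}" by auto
  qed
  then have "finite {y. d + y\<^sup>2 = c}" by (rule finite_subset) simp
  then have "{y. d + y\<^sup>2 = c} \<in> null_sets lborel"
    by (intro finite_imp_null_set_lborel)
  then show ?thesis by (subst emeasure_density) (auto simp: nn_integral_null_set)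
qed

lemma qlaw_shifted_atomless:
  assumes [measurable]: "f \<in> borel_measurable (borel \<Otimes>\<^sub>M borel)"
  shows "(\<integral>\<^sup>+y. \<integral>\<^sup>+x. indicator {c} (f x + y\<^sup>2) \<partial>qlaw l \<partial>\<gamma>) = 0"
proof -
  interpret a: pair_prob_space "qlaw l" \<gamma> ..
  have "(\<integral>\<^sup>+y. \<integral>\<^sup>+x. indicator {c} (f x + y\<^sup>2) \<partial>qlaw l \<partial>\<gamma>)
     = (\<integral>\<^sup>+x. \<integral>\<^sup>+y. indicator {c} (f x + y\<^sup>2) \<partial>\<gamma> \<partial>qlaw l)"
    by (rule a.Fubini') measurable
  also have "\<dots> = (\<integral>\<^sup>+x. 0 \<partial>qlaw l)"
  proof (intro nn_integral_cong)
    fix x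
    have "(\<integral>\<^sup>+y. indicator {c} (f x + y\<^sup>2) \<partial>\<gamma>) = (\<integral>\<^sup>+y. indicator {y. f x + y\<^sup>2 = c} y \<partial>\<gamma>)"
      by (intro nn_integral_cong) (auto simp: indicator_def)
    also have "\<dots> = emeasure \<gamma> {y. f x + y\<^sup>2 = c}" by (rule nn_integral_indicator) simp
    finally show "(\<integral>\<^sup>+y. indicator {c} (f x + y\<^sup>2) \<partial>\<gamma>) = 0" by (simp add: gauss_atomless)
  qed
  finally show ?thesis by simp
qed

lemma AE_qlaw_fst_neq:
  assumes p: "0 \<le> p" "p \<le> 1"
  shows "AE x in qlaw ((1, p) # l). fst x \<noteq> c"
proof -
  define F where "F y = (\<integral>\<^sup>+x. indicator {c} (fst x + y\<^sup>2) \<partial>qlaw l)" for y :: real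
  have [measurable]: "F \<in> borel_measurable borel" unfolding F_def by measurable
  have "(\<integral>\<^sup>+x. indicator {c} (fst x) \<partial>qlaw ((1, p) # l))
     = (\<integral>\<^sup>+e. \<integral>\<^sup>+h. F (sqrt (1 - p) * e + sqrt p * h) \<partial>\<gamma> \<partial>\<gamma>)"
    unfolding F_def by (subst nn_integral_qlaw_Cons) simp_all
  also have "\<dots> = (\<integral>\<^sup>+y. F y \<partial>\<gamma>)"
    using p by (intro nn_integral_gauss_combination) auto
  also have "\<dots> = 0" unfolding F_def by (rule qlaw_shifted_atomless) simp
  finally have "AE x in qlaw ((1, p) # l). (indicator {c} (fst x) :: ennreal) = 0"
    by (subst (asm) nn_integral_0_iff_AE) auto
  then show ?thesis by eventually_elim (auto simp: indicator_def split: if_splits)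
qed

lemma AE_qlaw_snd_neq: "AE x in qlaw ((w, p) # l). snd x \<noteq> c"
proof -
  have "(\<integral>\<^sup>+x. indicator {c} (snd x) \<partial>qlaw ((w, p) # l))
     = (\<integral>\<^sup>+e. \<integral>\<^sup>+h. \<integral>\<^sup>+x. indicator {c} (snd x + h\<^sup>2) \<partial>qlaw l \<partial>\<gamma> \<partial>\<gamma>)"
    by (subst nn_integral_qlaw_Cons) simp_all
  also have "\<dots> = 0" by (subst qlaw_shifted_atomless) simp_all
  finally have "AE x in qlaw ((w, p) # l). (indicator {c} (snd x) :: ennreal) = 0"
    by (subst (asm) nn_integral_0_iff_AE) auto
  then show ?thesis by eventually_elim (auto simp: indicator_def split: if_splits)
qed

lemma AE_qlaw_nonneg:
  assumes "\<forall>(w, p)\<in>set l. 0 \<le> w"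
  shows "AE x in qlaw l. 0 \<le> fst x \<and> 0 \<le> snd x"
proof -
  let ?N = "{x :: real \<times> real. fst x < 0 \<or> snd x < 0}"
  have [measurable]: "?N \<in> sets (borel \<Otimes>\<^sub>M borel)"
  proof -
    have "{x \<in> space (borel \<Otimes>\<^sub>M borel). fst x < (0::real) \<or> snd x < (0::real)} \<in> sets (borel \<Otimes>\<^sub>M borel)" by measurable
    then show ?thesis by (simp add: space_pair_measure)
  qed
  have "(\<integral>\<^sup>+x. indicator ?N x \<partial>qlaw l) = 0"
    using assms
  proof (induction l rule: qlaw.induct)
    case 1
    show ?case by (subst nn_integral_qlaw_Nil) auto
  next
    case (2 w p l)
    have "(\<integral>\<^sup>+x. indicator ?N x \<partial>qlaw ((w, p) # l)) = (\<integral>\<^sup>+e. \<integral>\<^sup>+h. \<integral>\<^sup>+x.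
       indicator ?N (fst x + w * (sqrt (1 - p) * e + sqrt p * h)\<^sup>2, snd x + h\<^sup>2) \<partial>qlaw l \<partial>\<gamma> \<partial>\<gamma>)"
      by (rule nn_integral_qlaw_Cons) measurable
    also have "\<dots> \<le> (\<integral>\<^sup>+e. \<integral>\<^sup>+h. \<integral>\<^sup>+x. indicator ?N x \<partial>qlaw l \<partial>\<gamma> \<partial>\<gamma>)"
    proof (intro nn_integral_mono)
      fix e h and x :: "real \<times> real"
      show "indicator ?N (fst x + w * (sqrt (1 - p) * e + sqrt p * h)\<^sup>2, snd x + h\<^sup>2) \<le> (indicator ?N x :: ennreal)"
      proof (cases "x \<in> ?N")
        case False
        then have "0 \<le> fst x + w * (sqrt (1 - p) * e + sqrt p * h)\<^sup>2" "0 \<le> snd x + h\<^sup>2"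
          using 2 by (auto intro!: add_nonneg_nonneg)
        then show ?thesis by (simp add: indicator_def not_less)
      qed (simp add: indicator_def)
    qed
    also have "\<dots> = 0" using 2 by simp
    finally show ?case by simp
  qed
  then have "AE x in qlaw l. (indicator ?N x :: ennreal) = 0"
    by (subst (asm) nn_integral_0_iff_AE) auto
  then show ?thesis by eventually_elim (auto simp: indicator_def not_less split: if_splits)
qed

lemma qlaw_snd_marginal:
  assumes "length l = length l'" and "g \<in> borel_measurable borel"
  shows "(\<integral>\<^sup>+x. g (snd x) \<partial>qlaw l) = (\<integral>\<^sup>+x. g (snd x) \<partial>qlaw l')"
  using assms
proof (induction l l' arbitrary: g rule: list_induct2)
  case (Cons wp l wp' l')
  obtain w p w' p' where wp: "wp = (w, p)" "wp' = (w', p')" by (cases wp, cases wp') auto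
  have [measurable]: "g \<in> borel_measurable borel" by fact
  have "(\<integral>\<^sup>+x. g (snd x + h\<^sup>2) \<partial>qlaw l) = (\<integral>\<^sup>+x. g (snd x + h\<^sup>2) \<partial>qlaw l')" for h :: real
    by (rule Cons.IH) measurable
  then show ?case unfolding wp by (subst (1 2) nn_integral_qlaw_Cons) simp_all
qed simp

lemma gauss_pair_laplace:
  assumes p: "0 \<le> p" "p \<le> 1" and sr: "0 \<le> s" "0 \<le> r"
  shows "(\<integral>\<^sup>+h. \<integral>\<^sup>+e. ennreal (exp (- s * (sqrt (1 - p) * e + sqrt p * h)\<^sup>2 - r * h\<^sup>2)) \<partial>\<gamma> \<partial>\<gamma>)
    = ennreal (1 / sqrt ((1 + 2 * s) * (1 + 2 * r) - 4 * s * r * p))"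
proof -
  define A where "A = 1 + 2 * (s * (1 - p))"
  define B where "B = r + s * p / A"
  have A: "A \<ge> 1" using p sr by (simp add: A_def)
  have B: "B \<ge> 0" using A p sr by (simp add: B_def)
  have inner: "(\<integral>\<^sup>+e. ennreal (exp (- s * (sqrt (1 - p) * e + sqrt p * h)\<^sup>2 - r * h\<^sup>2)) \<partial>\<gamma>)
     = ennreal (1 / sqrt A) * ennreal (exp (- B * h\<^sup>2 + 0 * h))" for h
  proof -
    let ?b = "- 2 * s * sqrt (1 - p) * sqrt p * h"
    have split: "- s * (sqrt (1 - p) * e + sqrt p * h)\<^sup>2 - r * h\<^sup>2
        = (- s * p * h\<^sup>2 - r * h\<^sup>2) + (- (s * (1 - p)) * e\<^sup>2 + ?b * e)" for e
      using p by (simp add: power2_sum power_mult_distrib algebra_simps)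
    have "(\<integral>\<^sup>+e. ennreal (exp (- s * (sqrt (1 - p) * e + sqrt p * h)\<^sup>2 - r * h\<^sup>2)) \<partial>\<gamma>)
      = ennreal (exp (- s * p * h\<^sup>2 - r * h\<^sup>2)) * (\<integral>\<^sup>+e. ennreal (exp (- (s * (1 - p)) * e\<^sup>2 + ?b * e)) \<partial>\<gamma>)"
      unfolding split exp_add by (simp add: ennreal_mult nn_integral_cmult)
    also have "\<dots> = ennreal (exp (- s * p * h\<^sup>2 - r * h\<^sup>2)) * ennreal (exp (?b\<^sup>2 / (2 * A)) / sqrt A)"
      unfolding A_def by (subst gauss_laplace) (use A in \<open>auto simp: A_def\<close>)
    also have "\<dots> = ennreal (exp (- s * p * h\<^sup>2 - r * h\<^sup>2 + ?b\<^sup>2 / (2 * A)) / sqrt A)"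
      by (simp add: exp_add flip: ennreal_mult')
    also have "- s * p * h\<^sup>2 - r * h\<^sup>2 + ?b\<^sup>2 / (2 * A) = - B * h\<^sup>2 + 0 * h"
    proof -
      have "?b\<^sup>2 = 4 * s\<^sup>2 * (1 - p) * p * h\<^sup>2" using p by (simp add: power_mult_distrib)
      then have "?b\<^sup>2 / (2 * A) = (2 * s\<^sup>2 * (1 - p) * p / A) * h\<^sup>2" by simp
      moreover have "- s * p + 2 * s\<^sup>2 * (1 - p) * p / A = - (s * p / A)"
        using A by (simp add: divide_simps) (simp add: A_def power2_eq_square algebra_simps)
      then have "(- s * p + 2 * s\<^sup>2 * (1 - p) * p / A) * h\<^sup>2 = - (s * p / A) * h\<^sup>2" by simp
      ultimately have eq: "- s * p * h\<^sup>2 + ?b\<^sup>2 / (2 * A) = - (s * p / A) * h\<^sup>2"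
        by (simp only: distrib_right)
      have "- B * h\<^sup>2 = - r * h\<^sup>2 + - (s * p / A) * h\<^sup>2"
        unfolding B_def by (simp only: minus_add_distrib distrib_right)
      then show ?thesis unfolding eq[symmetric] by simp
    qed
    also have "ennreal (exp (- B * h\<^sup>2 + 0 * h) / sqrt A) = ennreal (1 / sqrt A) * ennreal (exp (- B * h\<^sup>2 + 0 * h))"
      using A by (simp flip: ennreal_mult')
    finally show ?thesis .
  qed
  have "(\<integral>\<^sup>+h. \<integral>\<^sup>+e. ennreal (exp (- s * (sqrt (1 - p) * e + sqrt p * h)\<^sup>2 - r * h\<^sup>2)) \<partial>\<gamma> \<partial>\<gamma>)
     = ennreal (1 / sqrt A) * (\<integral>\<^sup>+h. ennreal (exp (- B * h\<^sup>2 + 0 * h)) \<partial>\<gamma>)"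
    unfolding inner by (rule nn_integral_cmult) measurable
  also have "\<dots> = ennreal (1 / sqrt A) * ennreal (exp (0\<^sup>2 / (2 * (1 + 2 * B))) / sqrt (1 + 2 * B))"
    using B by (subst gauss_laplace) auto
  also have "\<dots> = ennreal (1 / sqrt (A * (1 + 2 * B)))"
    using A B by (simp add: real_sqrt_mult flip: ennreal_mult')
  also have "A * (1 + 2 * B) = (1 + 2 * s) * (1 + 2 * r) - 4 * s * r * p"
    using A unfolding B_def by (simp add: field_simps) (simp add: A_def algebra_simps)
  finally show ?thesis .
qed

lemma qlaw_laplace:
  assumes sr: "0 \<le> s" "0 \<le> r" and l: "\<forall>(w, p)\<in>set l. 0 \<le> w \<and> 0 \<le> p \<and> p \<le> 1"
  shows "(\<integral>\<^sup>+x. ennreal (exp (- s * fst x - r * snd x)) \<partial>qlaw l)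
    = ennreal (\<Prod>(w, p)\<leftarrow>l. 1 / sqrt ((1 + 2 * (s * w)) * (1 + 2 * r) - 4 * (s * w) * r * p))"
  using l
proof (induction l rule: qlaw.induct)
  case 1
  show ?case by (subst nn_integral_qlaw_Nil) auto
next
  case (2 w p l)
  let ?I = "\<integral>\<^sup>+x. ennreal (exp (- s * fst x - r * snd x)) \<partial>qlaw l"
  let ?G = "\<lambda>h e. ennreal (exp (- (s * w) * (sqrt (1 - p) * e + sqrt p * h)\<^sup>2 - r * h\<^sup>2))"
  have w: "0 \<le> w" "0 \<le> p" "p \<le> 1" using 2 by auto
  have split: "ennreal (exp (- s * (u + w * W) - r * (v + H))) = ennreal (exp (- s * u - r * v)) * ennreal (exp (- (s * w) * W - r * H))" for u v W H
    by (simp add: algebra_simps flip: ennreal_mult exp_add)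
  have "(\<integral>\<^sup>+x. ennreal (exp (- s * fst x - r * snd x)) \<partial>qlaw ((w, p) # l))
     = (\<integral>\<^sup>+x. \<integral>\<^sup>+h. \<integral>\<^sup>+e. ennreal (exp (- s * fst x - r * snd x)) * ?G h e \<partial>\<gamma> \<partial>\<gamma> \<partial>qlaw l)"
    by (subst nn_integral_qlaw_Cons_swapped) (simp_all only: split fst_conv snd_conv, measurable)
  also have "\<dots> = (\<integral>\<^sup>+x. ennreal (exp (- s * fst x - r * snd x)) * (\<integral>\<^sup>+h. \<integral>\<^sup>+e. ?G h e \<partial>\<gamma> \<partial>\<gamma>) \<partial>qlaw l)"
    by (simp add: nn_integral_cmult)
  also have "\<dots> = ?I * (\<integral>\<^sup>+h. \<integral>\<^sup>+e. ?G h e \<partial>\<gamma> \<partial>\<gamma>)"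
    by (rule nn_integral_multc) measurable
  also have "(\<integral>\<^sup>+h. \<integral>\<^sup>+e. ?G h e \<partial>\<gamma> \<partial>\<gamma>) = ennreal (1 / sqrt ((1 + 2 * (s * w)) * (1 + 2 * r) - 4 * (s * w) * r * p))"
    using w sr by (intro gauss_pair_laplace) auto
  also have "?I = ennreal (\<Prod>(w, p)\<leftarrow>l. 1 / sqrt ((1 + 2 * (s * w)) * (1 + 2 * r) - 4 * (s * w) * r * p))"
    using 2 by auto
  finally have eq: "(\<integral>\<^sup>+x. ennreal (exp (- s * fst x - r * snd x)) \<partial>qlaw ((w, p) # l)) =
      ennreal (\<Prod>(w, p)\<leftarrow>l. 1 / sqrt ((1 + 2 * (s * w)) * (1 + 2 * r) - 4 * (s * w) * r * p)) *
      ennreal (1 / sqrt ((1 + 2 * (s * w)) * (1 + 2 * r) - 4 * (s * w) * r * p))" .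
  have "(1 + 2 * (s * w)) * (1 + 2 * r) - 4 * (s * w) * r * p \<ge> 0"
  proof -
    have "4 * (s * w * r) * p \<le> 4 * (s * w * r) * 1" using w sr by (intro mult_left_mono) auto
    moreover have "0 \<le> s * w" using w sr by simp
    ultimately show ?thesis using sr by (simp add: algebra_simps)
  qed
  then have "0 \<le> 1 / sqrt ((1 + 2 * (s * w)) * (1 + 2 * r) - 4 * (s * w) * r * p)" by simp
  then show ?case unfolding eq list.map prod_list.Cons prod.case
    by (subst mult.commute) (rule ennreal_mult'[symmetric])
qed

lemma qlaw_quadrant_mono:
  assumes "list_all2 (\<lambda>(w, p) (w', p'). w = w' \<and> w \<in> {0, 1} \<and> 0 \<le> p \<and> p \<le> p' \<and> p' \<le> 1) l l'"
  shows "emeasure (qlaw l) {x. fst x \<le> c \<and> snd x \<le> a} \<le> emeasure (qlaw l') {x. fst x \<le> c \<and> snd x \<le> a}"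
  using assms
proof (induction l l' arbitrary: c a rule: list_all2_induct)
  case (Cons wp l wp' l')
  obtain w p p' where wp: "wp = (w, p)" "wp' = (w, p')" and p: "w \<in> {0, 1}" "0 \<le> p" "p \<le> p'" "p' \<le> 1"
    using Cons by (cases wp, cases wp') auto
  define Qd where "Qd c a = {x :: real \<times> real. fst x \<le> c \<and> snd x \<le> a}" for c a
  have Q[measurable]: "Qd c a \<in> sets (borel \<Otimes>\<^sub>M borel)" for c a
  proof -
    have "{x \<in> space (borel \<Otimes>\<^sub>M borel). fst x \<le> c \<and> snd x \<le> a} \<in> sets (borel \<Otimes>\<^sub>M borel)" by measurable
    then show ?thesis by (simp add: space_pair_measure Qd_def)
  qed
  have em: "emeasure (qlaw k) (Qd c a) = (\<integral>\<^sup>+x. indicator (Qd c a) x \<partial>qlaw k)" for k c a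
    by (rule nn_integral_indicator[symmetric]) simp
  have "emeasure (qlaw ((w, p) # l)) (Qd c a) = (\<integral>\<^sup>+e. \<integral>\<^sup>+h. \<integral>\<^sup>+x.
     indicator (Qd (c - w * (sqrt (1 - p) * e + sqrt p * h)\<^sup>2) (a - h\<^sup>2)) x \<partial>qlaw l \<partial>\<gamma> \<partial>\<gamma>)"
    unfolding em by (subst nn_integral_qlaw_Cons) (auto intro!: nn_integral_cong simp: indicator_def Qd_def)
  also have "\<dots> \<le> (\<integral>\<^sup>+e. \<integral>\<^sup>+h. \<integral>\<^sup>+x.
     indicator (Qd (c - w * (sqrt (1 - p) * e + sqrt p * h)\<^sup>2) (a - h\<^sup>2)) x \<partial>qlaw l' \<partial>\<gamma> \<partial>\<gamma>)"
    unfolding em[symmetric] unfolding Qd_def by (intro nn_integral_mono Cons.IH)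
  also have "\<dots> = emeasure (qlaw ((w, p) # l')) (Qd c a)"
    unfolding em by (subst nn_integral_qlaw_Cons) (auto intro!: nn_integral_cong simp: indicator_def Qd_def)
  also have "\<dots> \<le> emeasure (qlaw ((w, p') # l')) (Qd c a)"
  proof -
    have sw: "emeasure (qlaw ((w, p) # l')) (Qd c a) = (\<integral>\<^sup>+x. \<integral>\<^sup>+h. indicator {h. h\<^sup>2 \<le> a - snd x} h *
        emeasure \<gamma> {e. w * (sqrt (1 - p) * e + sqrt p * h)\<^sup>2 \<le> c - fst x} \<partial>\<gamma> \<partial>qlaw l')" for p
    proof -
      have "emeasure (qlaw ((w, p) # l')) (Qd c a) = (\<integral>\<^sup>+x. \<integral>\<^sup>+h. \<integral>\<^sup>+e.
        indicator (Qd c a) (fst x + w * (sqrt (1 - p) * e + sqrt p * h)\<^sup>2, snd x + h\<^sup>2) \<partial>\<gamma> \<partial>\<gamma> \<partial>qlaw l')"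
        unfolding em by (rule nn_integral_qlaw_Cons_swapped) measurable
      also have "\<dots> = (\<integral>\<^sup>+x. \<integral>\<^sup>+h. \<integral>\<^sup>+e. indicator {h. h\<^sup>2 \<le> a - snd x} h *
         indicator {e. w * (sqrt (1 - p) * e + sqrt p * h)\<^sup>2 \<le> c - fst x} e \<partial>\<gamma> \<partial>\<gamma> \<partial>qlaw l')"
        by (intro nn_integral_cong) (auto simp: indicator_def Qd_def)
      finally show ?thesis by (simp add: nn_integral_cmult)
    qed
    show ?thesis
    proof (cases "w = 0")
      case True
      then show ?thesis unfolding sw by simp
    next
      case False
      then have w: "w = 1" using p by auto
      show ?thesis unfolding sw
      proof (rule nn_integral_mono)
        fix x :: "real \<times> real"
        show "(\<integral>\<^sup>+h. indicator {h. h\<^sup>2 \<le> a - snd x} h * emeasure \<gamma> {e. w * (sqrt (1 - p) * e + sqrt p * h)\<^sup>2 \<le> c - fst x} \<partial>\<gamma>)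
          \<le> (\<integral>\<^sup>+h. indicator {h. h\<^sup>2 \<le> a - snd x} h * emeasure \<gamma> {e. w * (sqrt (1 - p') * e + sqrt p' * h)\<^sup>2 \<le> c - fst x} \<partial>\<gamma>)"
          using slab_probability_mono[of "sqrt p" "sqrt p'" "a - snd x" "c - fst x"] p unfolding w by simp
      qed
    qed
  qed
  finally show ?case unfolding wp Qd_def .
qed simp

declare qlaw.simps(2) [simp del]

lemma measurable_quadrant[measurable]: "{x :: real \<times> real. fst x \<le> c \<and> snd x \<le> a} \<in> sets (borel \<Otimes>\<^sub>M borel)"
proof -
  have "{x \<in> space (borel \<Otimes>\<^sub>M borel). fst x \<le> c \<and> snd x \<le> a} \<in> sets (borel \<Otimes>\<^sub>M borel)" by measurable
  then show ?thesis by (simp add: space_pair_measure)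
qed

lemma measurable_half_plane[measurable]: "{x :: real \<times> real. snd x \<le> a} \<in> sets (borel \<Otimes>\<^sub>M borel)"
proof -
  have "{x \<in> space (borel \<Otimes>\<^sub>M borel). snd x \<le> (a::real)} \<in> sets ((borel :: real measure) \<Otimes>\<^sub>M borel)" by measurable
  then show ?thesis by (simp add: space_pair_measure)
qed

lemma measurable_strip[measurable]: "{x :: real \<times> real. b < fst x \<and> fst x \<le> c \<and> snd x \<le> a} \<in> sets (borel \<Otimes>\<^sub>M borel)"
proof -
  have "{x \<in> space (borel \<Otimes>\<^sub>M borel). b < fst x \<and> fst x \<le> c \<and> snd x \<le> a} \<in> sets (borel \<Otimes>\<^sub>M borel)" by measurable
  then show ?thesis by (simp add: space_pair_measure)
qed

definition quad_prob :: "(real \<times> real) list \<Rightarrow> real \<Rightarrow> real \<Rightarrow> real" where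
  "quad_prob l a c = measure (qlaw l) {x. fst x \<le> c \<and> snd x \<le> a}"

definition half_prob :: "(real \<times> real) list \<Rightarrow> real \<Rightarrow> real" where
  "half_prob l a = measure (qlaw l) {x. snd x \<le> a}"

lemma half_prob_length:
  assumes "length l = length l'"
  shows "half_prob l a = half_prob l' a"
proof -
  have "emeasure (qlaw k) {x. snd x \<le> a} = (\<integral>\<^sup>+x. indicator {..a} (snd x) \<partial>qlaw k)" for k
  proof -
    have "emeasure (qlaw k) {x. snd x \<le> a} = (\<integral>\<^sup>+x. indicator {x. snd x \<le> a} x \<partial>qlaw k)"
      by (rule nn_integral_indicator[symmetric]) simp
    also have "\<dots> = (\<integral>\<^sup>+x. indicator {..a} (snd x) \<partial>qlaw k)"
      by (intro nn_integral_cong) (auto simp: indicator_def)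
    finally show ?thesis .
  qed
  then show ?thesis
    unfolding half_prob_def measure_def using qlaw_snd_marginal[OF assms, of "indicator {..a}"] by simp
qed

lemma qlaw_scaling_sets:
  assumes c: "0 < c" "c \<le> 1" and A: "A \<in> sets (borel \<Otimes>\<^sub>M borel)" "B \<in> sets (borel \<Otimes>\<^sub>M borel)"
    and sub: "\<And>x. (fst x / c\<^sup>2, snd x / c\<^sup>2) \<in> A \<Longrightarrow> x \<in> B" and B0: "emeasure (qlaw l) B = 0"
  shows "emeasure (qlaw l) A = 0"
proof -
  have [measurable]: "A \<in> sets (borel \<Otimes>\<^sub>M borel)" "B \<in> sets (borel \<Otimes>\<^sub>M borel)" by fact+
  have "ennreal (c ^ (2 * length l)) * emeasure (qlaw l) A = ennreal (c ^ (2 * length l)) * (\<integral>\<^sup>+x. indicator A x \<partial>qlaw l)"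
    using A by simp
  also have "\<dots> \<le> (\<integral>\<^sup>+x. indicator A (fst x / c\<^sup>2, snd x / c\<^sup>2) \<partial>qlaw l)"
    by (rule qlaw_scaling[OF c]) measurable
  also have "\<dots> \<le> (\<integral>\<^sup>+x. indicator B x \<partial>qlaw l)"
    using sub by (intro nn_integral_mono) (auto simp: indicator_def)
  also have "\<dots> = 0" using B0 A by simp
  finally have "ennreal (c ^ (2 * length l)) * emeasure (qlaw l) A = 0" by simp
  then show ?thesis using zero_less_power[OF c(1), of "2 * length l"] by (simp add: ennreal_eq_0_iff)
qed

lemma half_prob_pos:
  assumes a: "0 < a"
  shows "0 < half_prob l a"
proof (rule ccontr)
  assume "\<not> ?thesis"
  then have z: "emeasure (qlaw l) {x. snd x \<le> a} = 0"
    using measure_nonneg[of "qlaw l" "{x. snd x \<le> a}"] unfolding half_prob_def qlaw.emeasure_eq_measure by simp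
  have "emeasure (qlaw l) {x. snd x \<le> real n} = 0" for n
  proof -
    define c where "c = (if real n \<le> a then 1 else sqrt (a / real n))"
    have c: "0 < c" "c \<le> 1" using a by (auto simp: c_def)
    show ?thesis
    proof (rule qlaw_scaling_sets[OF c _ _ _ z])
      fix x :: "real \<times> real" assume x: "(fst x / c\<^sup>2, snd x / c\<^sup>2) \<in> {x. snd x \<le> real n}"
      show "x \<in> {x. snd x \<le> a}"
      proof (cases "real n \<le> a")
        case True
        then show ?thesis using x by (simp add: c_def)
      next
        case False
        then have "c\<^sup>2 = a / real n" "real n > 0" using a by (auto simp: c_def)
        moreover have "snd x \<le> real n * c\<^sup>2" using x c(1) by (simp add: pos_divide_le_eq)
        ultimately show ?thesis by simp
      qed
    qed auto
  qed
  then have "emeasure (qlaw l) (\<Union>n. {x. snd x \<le> real n}) = 0"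
    by (intro emeasure_UN_eq_0) auto
  moreover have "(\<Union>n. {x :: real \<times> real. snd x \<le> real n}) = UNIV"
    using real_arch_simple by auto
  ultimately show False using qlaw.emeasure_space_1[of l] by simp
qed

lemma quad_prob_mono: "c \<le> c' \<Longrightarrow> quad_prob l a c \<le> quad_prob l a c'"
  unfolding quad_prob_def by (rule qlaw.finite_measure_mono) auto

lemma quad_prob_nonpos:
  assumes l: "\<forall>(w, p)\<in>set ((1, p) # l). 0 \<le> w" and p: "0 \<le> p" "p \<le> 1" and c: "c \<le> 0"
  shows "quad_prob ((1, p) # l) a c = 0"
proof -
  have "AE x in qlaw ((1, p) # l). \<not> (fst x \<le> c \<and> snd x \<le> a)"
    using AE_qlaw_nonneg[OF l] AE_qlaw_fst_neq[OF p, where l = l and c = 0] by eventually_elim (use c in auto)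
  then have "emeasure (qlaw ((1, p) # l)) {x. fst x \<le> c \<and> snd x \<le> a} = 0"
    by (subst (asm) AE_iff_measurable[of "{x. fst x \<le> c \<and> snd x \<le> a}"]) auto
  then show ?thesis by (simp add: quad_prob_def measure_def)
qed

lemma quad_prob_strict:
  assumes a: "0 < a" and c: "0 < c" "c < c'" and eq: "quad_prob l a c = quad_prob l a c'"
  shows "quad_prob l a c = half_prob l a"
proof -
  let ?E = "\<lambda>b c. {x :: real \<times> real. b < fst x \<and> fst x \<le> c \<and> snd x \<le> a}"
  have "measure (qlaw l) (?E c c') = quad_prob l a c' - quad_prob l a c"
    unfolding quad_prob_def
    by (subst qlaw.finite_measure_Diff[symmetric]) (use c in \<open>auto intro!: arg_cong[where f = "measure (qlaw l)"]\<close>)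
  then have z: "emeasure (qlaw l) (?E c c') = 0" using eq by (simp add: qlaw.emeasure_eq_measure)
  define \<rho> where "\<rho> = c' / c"
  have \<rho>: "\<rho> > 1" using c by (simp add: \<rho>_def)
  have zk: "emeasure (qlaw l) (?E (c * \<rho> ^ k) (c * \<rho> ^ Suc k)) = 0" for k
  proof -
    define s where "s = 1 / sqrt (\<rho> ^ k)"
    have rk: "\<rho> ^ k \<ge> 1" using \<rho> by (simp add: one_le_power)
    have s: "0 < s" "s \<le> 1" "s\<^sup>2 = 1 / \<rho> ^ k" using rk by (auto simp: s_def power_divide)
    show ?thesis
    proof (rule qlaw_scaling_sets[OF s(1,2) _ _ _ z])
      fix x :: "real \<times> real" assume "(fst x / s\<^sup>2, snd x / s\<^sup>2) \<in> ?E (c * \<rho> ^ k) (c * \<rho> ^ Suc k)"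
      then have x: "c * \<rho> ^ k < fst x * \<rho> ^ k" "fst x * \<rho> ^ k \<le> c * \<rho> * \<rho> ^ k" "snd x * \<rho> ^ k \<le> a"
        by (auto simp: s(3) mult_ac)
      have "c < fst x" "fst x \<le> c'" using x(1,2) rk c by (auto simp: \<rho>_def)
      moreover have "snd x \<le> a"
      proof (cases "snd x \<le> 0")
        case False
        then have "snd x * 1 \<le> snd x * \<rho> ^ k" using rk by (intro mult_left_mono) auto
        then show ?thesis using x(3) by simp
      qed (use a in simp)
      ultimately show "x \<in> ?E c c'" by simp
    qed auto
  qed
  have "emeasure (qlaw l) (\<Union>k. ?E (c * \<rho> ^ k) (c * \<rho> ^ Suc k)) = 0"
    by (intro emeasure_UN_eq_0) (use zk in auto)
  moreover have "{x. snd x \<le> a} - {x. fst x \<le> c \<and> snd x \<le> a} \<subseteq> (\<Union>k. ?E (c * \<rho> ^ k) (c * \<rho> ^ Suc k))"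
  proof
    fix x :: "real \<times> real" assume x: "x \<in> {x. snd x \<le> a} - {x. fst x \<le> c \<and> snd x \<le> a}"
    obtain n where n: "fst x / c < \<rho> ^ n" using real_arch_pow[OF \<rho>] by blast
    define k where "k = (LEAST k. fst x \<le> c * \<rho> ^ k)"
    have ex: "fst x \<le> c * \<rho> ^ n" using n c by (simp add: divide_less_eq mult.commute less_imp_le)
    have k1: "fst x \<le> c * \<rho> ^ k" unfolding k_def by (rule LeastI[of _ n]) (rule ex)
    have "k \<noteq> 0" using k1 x by (intro notI) auto
    then obtain j where j: "k = Suc j" by (cases k) auto
    have "\<not> fst x \<le> c * \<rho> ^ j" using not_less_Least[of j "\<lambda>k. fst x \<le> c * \<rho> ^ k"] j by (simp add: k_def)
    then have "x \<in> ?E (c * \<rho> ^ j) (c * \<rho> ^ Suc j)" using x k1 j by auto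
    then show "x \<in> (\<Union>k. ?E (c * \<rho> ^ k) (c * \<rho> ^ Suc k))" by blast
  qed
  then have "emeasure (qlaw l) ({x. snd x \<le> a} - {x. fst x \<le> c \<and> snd x \<le> a})
     \<le> emeasure (qlaw l) (\<Union>k. ?E (c * \<rho> ^ k) (c * \<rho> ^ Suc k))"
    by (rule emeasure_mono) auto
  ultimately have "emeasure (qlaw l) ({x. snd x \<le> a} - {x. fst x \<le> c \<and> snd x \<le> a}) = 0" by simp
  then have "measure (qlaw l) ({x. snd x \<le> a} - {x. fst x \<le> c \<and> snd x \<le> a}) = 0" by (simp add: measure_def)
  moreover have "measure (qlaw l) ({x. snd x \<le> a} - {x. fst x \<le> c \<and> snd x \<le> a}) = half_prob l a - quad_prob l a c"
    unfolding half_prob_def quad_prob_def by (intro qlaw.finite_measure_Diff) auto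
  ultimately show ?thesis by simp
qed

lemma quad_prob_cdf:
  fixes l' :: "(real \<times> real) list"
  assumes p: "0 \<le> p" "p \<le> 1"
  defines "l \<equiv> (1, p) # l'"
  shows "isCont (quad_prob l a) c" and "(quad_prob l a \<longlongrightarrow> half_prob l a) at_top"
proof -
  define S where "S = {x :: real \<times> real. snd x \<le> a}"
  define D where "D = density (qlaw l) (indicator S)"
  define M where "M = distr D borel fst"
  have [measurable]: "S \<in> sets (borel \<Otimes>\<^sub>M borel)" unfolding S_def by measurable
  have sD: "sets D = sets (borel \<Otimes>\<^sub>M borel)" by (simp add: D_def)
  have fD: "fst \<in> measurable D borel" using measurable_cong_sets[OF sD refl] by auto
  have spD: "space D = UNIV" by (simp add: D_def)
  have em: "emeasure M A = emeasure (qlaw l) (S \<inter> {x. fst x \<in> A})" if [measurable]: "A \<in> sets borel" for A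
  proof -
    have pre: "{x :: real \<times> real. fst x \<in> A} \<in> sets (borel \<Otimes>\<^sub>M borel)"
    proof -
      have "fst -` A \<inter> space (borel \<Otimes>\<^sub>M (borel :: real measure)) \<in> sets (borel \<Otimes>\<^sub>M borel)" by measurable
      moreover have "fst -` A \<inter> space (borel \<Otimes>\<^sub>M (borel :: real measure)) = {x. fst x \<in> A}" by (auto simp: space_pair_measure)
      ultimately show ?thesis by simp
    qed
    have "emeasure M A = emeasure D (fst -` A \<inter> space D)" unfolding M_def by (rule emeasure_distr[OF fD that])
    also have "fst -` A \<inter> space D = {x. fst x \<in> A}" by (auto simp: spD)
    also have "emeasure D {x. fst x \<in> A} = (\<integral>\<^sup>+x. indicator S x * indicator {x. fst x \<in> A} x \<partial>qlaw l)"
      unfolding D_def by (rule emeasure_density) (use pre in auto)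
    also have "\<dots> = (\<integral>\<^sup>+x. indicator (S \<inter> {x. fst x \<in> A}) x \<partial>qlaw l)"
      by (intro nn_integral_cong) (auto simp: indicator_def)
    also have "\<dots> = emeasure (qlaw l) (S \<inter> {x. fst x \<in> A})"
      using pre by (intro nn_integral_indicator) auto
    finally show ?thesis .
  qed
  have spM: "space M = UNIV" and setM: "sets M = sets borel" by (simp_all add: M_def)
  have "finite_measure M"
    by (rule finite_measureI) (simp add: spM em)
  then interpret fm: finite_borel_measure M
    by (simp add: finite_borel_measure_def finite_borel_measure_axioms_def setM)
  have cdf: "cdf M = quad_prob l a"
  proof
    fix c
    have "S \<inter> {x. fst x \<in> {..c}} = {x. fst x \<le> c \<and> snd x \<le> a}" by (auto simp: S_def)
    then show "cdf M c = quad_prob l a c"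
      using em[of "{..c}"] by (simp add: cdf_def quad_prob_def measure_def)
  qed
  have "emeasure (qlaw l) (S \<inter> {x. fst x \<in> {c}}) = 0"
  proof -
    have "AE x in qlaw l. x \<notin> S \<inter> {x. fst x \<in> {c}}"
      using AE_qlaw_fst_neq[OF p, where l = l' and c = c] unfolding l_def by eventually_elim auto
    moreover have "S \<inter> {x. fst x \<in> {c}} \<in> sets (qlaw l)"
    proof -
      have "{x \<in> space (borel \<Otimes>\<^sub>M borel). snd x \<le> a \<and> fst x = c} \<in> sets (borel \<Otimes>\<^sub>M borel)" by measurable
      moreover have "{x \<in> space (borel \<Otimes>\<^sub>M borel). snd x \<le> a \<and> fst x = c} = S \<inter> {x. fst x \<in> {c}}"
        by (auto simp: space_pair_measure S_def)
      ultimately show ?thesis by simp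
    qed
    ultimately show ?thesis by (subst (asm) AE_iff_measurable[of "S \<inter> {x. fst x \<in> {c}}"]) auto
  qed
  then have "measure M {c} = 0" using em[of "{c}"] by (simp add: measure_def)
  then show "isCont (quad_prob l a) c" unfolding cdf[symmetric] by (simp add: fm.isCont_cdf)
  have "measure M (space M) = half_prob l a"
    using em[of UNIV] by (simp add: spM half_prob_def measure_def S_def)
  then show "(quad_prob l a \<longlongrightarrow> half_prob l a) at_top" using fm.cdf_lim_at_top unfolding cdf by simp
qed

lemma quad_prob_quantile:
  fixes l' :: "(real \<times> real) list"
  assumes l: "\<forall>(w, p)\<in>set ((1, p) # l'). 0 \<le> w" and p: "0 \<le> p" "p \<le> 1" and a: "0 < a" and \<beta>: "0 < \<beta>" "\<beta> < 1"
  defines "l \<equiv> (1, p) # l'"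
  shows "\<exists>c. quad_prob l a c = \<beta> * half_prob l a"
    and "quad_prob l a c1 = \<beta> * half_prob l a \<Longrightarrow> quad_prob l a c2 = \<beta> * half_prob l a \<Longrightarrow> c1 = c2"
proof -
  have k: "half_prob l a > 0" by (rule half_prob_pos[OF a])
  have k\<beta>: "0 < \<beta> * half_prob l a" "\<beta> * half_prob l a < half_prob l a" using k \<beta> by simp_all
  have "eventually (\<lambda>c. \<beta> * half_prob l a < quad_prob l a c) at_top"
    by (rule order_tendstoD(1)[OF quad_prob_cdf(2)[OF p, where l' = l' and a = a, folded l_def] k\<beta>(2)])
  then obtain B where B: "\<And>c. c \<ge> B \<Longrightarrow> \<beta> * half_prob l a < quad_prob l a c"
    unfolding eventually_at_top_linorder by blast
  have "\<exists>c\<ge>0. c \<le> max B 0 \<and> quad_prob l a c = \<beta> * half_prob l a"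
  proof (rule IVT)
    show "quad_prob l a 0 \<le> \<beta> * half_prob l a"
      using quad_prob_nonpos[OF l p, where c = 0 and a = a] k\<beta> by (simp add: l_def)
    show "\<beta> * half_prob l a \<le> quad_prob l a (max B 0)" using B[of "max B 0"] by simp
    show "\<forall>x. 0 \<le> x \<and> x \<le> max B 0 \<longrightarrow> isCont (quad_prob l a) x"
      using quad_prob_cdf(1)[OF p, where l' = l' and a = a] by (simp add: l_def)
  qed simp
  then show "\<exists>c. quad_prob l a c = \<beta> * half_prob l a" by blast
  have le: "\<not> c1 < c2" if e: "quad_prob l a c1 = \<beta> * half_prob l a" "quad_prob l a c2 = \<beta> * half_prob l a" for c1 c2
  proof
    assume lt: "c1 < c2"
    have "c1 > 0"
    proof (rule ccontr)
      assume "\<not> 0 < c1"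
      then have "quad_prob l a c1 = 0" unfolding l_def by (intro quad_prob_nonpos[OF l p]) simp
      then show False using e(1) k\<beta>(1) by linarith
    qed
    moreover have "quad_prob l a c1 = quad_prob l a c2" unfolding e ..
    ultimately have "quad_prob l a c1 = half_prob l a" by (intro quad_prob_strict[OF a _ lt])
    then show False using e(1) k\<beta>(2) by linarith
  qed
  show "quad_prob l a c1 = \<beta> * half_prob l a \<Longrightarrow> quad_prob l a c2 = \<beta> * half_prob l a \<Longrightarrow> c1 = c2"
    using le[of c1 c2] le[of c2 c1] by (cases c1 c2 rule: linorder_cases) simp_all
qed

section \<open>Gaussian averages of characteristic functions\<close>

lemma gauss_laplace_integral:
  assumes "1 + 2 * \<alpha> > 0"
  shows "integrable \<gamma> (\<lambda>x. exp (- \<alpha> * x\<^sup>2 + \<beta> * x))"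
    and "(\<integral>x. exp (- \<alpha> * x\<^sup>2 + \<beta> * x) \<partial>\<gamma>) = exp (\<beta>\<^sup>2 / (2 * (1 + 2 * \<alpha>))) / sqrt (1 + 2 * \<alpha>)"
proof -
  show i: "integrable \<gamma> (\<lambda>x. exp (- \<alpha> * x\<^sup>2 + \<beta> * x))"
    by (rule integrableI_nonneg) (use gauss_laplace[OF assms, of \<beta>] in auto)
  have "ennreal (\<integral>x. exp (- \<alpha> * x\<^sup>2 + \<beta> * x) \<partial>\<gamma>) = ennreal (exp (\<beta>\<^sup>2 / (2 * (1 + 2 * \<alpha>))) / sqrt (1 + 2 * \<alpha>))"
    unfolding gauss_laplace[OF assms, symmetric] by (rule nn_integral_eq_integral[OF i, symmetric]) simp
  then show "(\<integral>x. exp (- \<alpha> * x\<^sup>2 + \<beta> * x) \<partial>\<gamma>) = exp (\<beta>\<^sup>2 / (2 * (1 + 2 * \<alpha>))) / sqrt (1 + 2 * \<alpha>)"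
    by (subst (asm) ennreal_inj) (use assms in auto)
qed

definition gauss_prod :: "nat \<Rightarrow> (nat \<Rightarrow> real) measure" where
  "gauss_prod d = Pi\<^sub>M {..<d} (\<lambda>_. \<gamma>)"

lemma prob_space_gauss_prod: "prob_space (gauss_prod d)"
  unfolding gauss_prod_def by (rule prob_space_PiM) (rule prob_space_gauss)

interpretation gauss_prod: prob_space "gauss_prod d" for d by (rule prob_space_gauss_prod)

lemma gauss_prod_component[measurable]: "i < d \<Longrightarrow> (\<lambda>x. x i) \<in> borel_measurable (gauss_prod d)"
proof -
  assume "i < d"
  then have "(\<lambda>x. x i) \<in> measurable (gauss_prod d) \<gamma>"
    unfolding gauss_prod_def by (intro measurable_component_singleton) auto
  then show ?thesis by simp
qed

lemma gauss_prod_integral_prod: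
  fixes f :: "nat \<Rightarrow> real \<Rightarrow> 'b::{real_normed_field, banach, second_countable_topology}"
  assumes "\<And>i. i < d \<Longrightarrow> integrable \<gamma> (f i)"
  shows "integrable (gauss_prod d) (\<lambda>x. \<Prod>i<d. f i (x i))"
    and "(\<integral>x. (\<Prod>i<d. f i (x i)) \<partial>gauss_prod d) = (\<Prod>i<d. \<integral>x. f i x \<partial>\<gamma>)"
proof -
  interpret product_sigma_finite "\<lambda>_ :: nat. \<gamma>" by standard
  show "integrable (gauss_prod d) (\<lambda>x. \<Prod>i<d. f i (x i))"
    unfolding gauss_prod_def by (rule product_integrable_prod) (use assms in auto)
  show "(\<integral>x. (\<Prod>i<d. f i (x i)) \<partial>gauss_prod d) = (\<Prod>i<d. \<integral>x. f i x \<partial>\<gamma>)"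
    unfolding gauss_prod_def by (rule product_integral_prod) (use assms in auto)
qed

lemma gauss_prod_char:
  "(CLINT x|gauss_prod d. iexp (\<Sum>i<d. t i * x i)) = complex_of_real (exp (- (\<Sum>i<d. (t i)\<^sup>2) / 2))"
proof -
  have e: "iexp (\<Sum>i<d. t i * x i) = (\<Prod>i<d. iexp (t i * x i))" for x :: "nat \<Rightarrow> real"
    by (simp add: exp_sum[symmetric] sum_distrib_left)
  have "(CLINT x|gauss_prod d. iexp (\<Sum>i<d. t i * x i)) = (\<Prod>i<d. char \<gamma> (t i))"
    unfolding e char_def
    by (rule gauss_prod_integral_prod(2)) (auto intro!: gauss.integrable_const_bound[where B = 1])
  also have "\<dots> = complex_of_real (\<Prod>i<d. exp (- (t i)\<^sup>2 / 2))"
    by (simp add: char_std_normal_distribution)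
  also have "(\<Prod>i<d. exp (- (t i)\<^sup>2 / 2)) = exp (- (\<Sum>i<d. (t i)\<^sup>2) / 2)"
    by (simp add: exp_sum[symmetric] sum_negf sum_divide_distrib)
  finally show ?thesis .
qed

lemma gauss_prod_laplace:
  assumes "\<And>i. i < d \<Longrightarrow> 1 + 2 * \<alpha> i > 0"
  shows "(\<integral>x. exp (\<Sum>i<d. - \<alpha> i * (x i)\<^sup>2 + \<beta> i * x i) \<partial>gauss_prod d)
    = (\<Prod>i<d. exp ((\<beta> i)\<^sup>2 / (2 * (1 + 2 * \<alpha> i))) / sqrt (1 + 2 * \<alpha> i))"
proof -
  have "(\<integral>x. exp (\<Sum>i<d. - \<alpha> i * (x i)\<^sup>2 + \<beta> i * x i) \<partial>gauss_prod d)
     = (\<integral>x. (\<Prod>i<d. exp (- \<alpha> i * (x i)\<^sup>2 + \<beta> i * x i)) \<partial>gauss_prod d)"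
    by (simp only: exp_sum[OF finite_lessThan])
  also have "\<dots> = (\<Prod>i<d. \<integral>x. exp (- \<alpha> i * x\<^sup>2 + \<beta> i * x) \<partial>\<gamma>)"
    by (rule gauss_prod_integral_prod(2)[of d "\<lambda>i x. exp (- \<alpha> i * x\<^sup>2 + \<beta> i * x)"])
       (rule gauss_laplace_integral(1)[OF assms])
  also have "\<dots> = (\<Prod>i<d. exp ((\<beta> i)\<^sup>2 / (2 * (1 + 2 * \<alpha> i))) / sqrt (1 + 2 * \<alpha> i))"
    by (intro prod.cong refl gauss_laplace_integral(2) assms) auto
  finally show ?thesis .
qed

text \<open>The exponent below is half the variance of \<open>\<surd>(2s) \<Sum>\<^sub>f x\<^sub>f U\<^sub>f + \<surd>(2r) \<Sum>\<^sub>j y\<^sub>j X\<^sub>j\<close> when \<open>U\<close> and \<open>X\<close> are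
  standardised with cross covariance matrix \<open>C\<close>.\<close>

definition pair_form :: "nat \<Rightarrow> nat \<Rightarrow> (nat \<Rightarrow> nat \<Rightarrow> real) \<Rightarrow> real \<Rightarrow> real \<Rightarrow> (nat \<Rightarrow> real) \<Rightarrow> (nat \<Rightarrow> real) \<Rightarrow> real" where
  "pair_form d e C s r x y = s * (\<Sum>f<d. (x f)\<^sup>2) + 2 * sqrt s * sqrt r * (\<Sum>j<e. (\<Sum>f<d. C f j * x f) * y j) + r * (\<Sum>j<e. (y j)\<^sup>2)"

lemma pair_form_nonneg:
  assumes "0 \<le> s" "0 \<le> r" and C: "(\<Sum>j<e. (\<Sum>f<d. C f j * x f)\<^sup>2) \<le> (\<Sum>f<d. (x f)\<^sup>2)"
  shows "0 \<le> pair_form d e C s r x y"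
proof -
  have "0 \<le> (\<Sum>j<e. (sqrt s * (\<Sum>f<d. C f j * x f) + sqrt r * y j)\<^sup>2)" by (intro sum_nonneg) simp
  also have "\<dots> = (\<Sum>j<e. s * (\<Sum>f<d. C f j * x f)\<^sup>2 + 2 * sqrt s * sqrt r * ((\<Sum>f<d. C f j * x f) * y j) + r * (y j)\<^sup>2)"
    using assms by (intro sum.cong refl) (simp add: power2_sum power_mult_distrib)
  also have "\<dots> = s * (\<Sum>j<e. (\<Sum>f<d. C f j * x f)\<^sup>2) + 2 * sqrt s * sqrt r * (\<Sum>j<e. (\<Sum>f<d. C f j * x f) * y j) + r * (\<Sum>j<e. (y j)\<^sup>2)"
    by (simp only: sum.distrib sum_distrib_left)
  also have "\<dots> \<le> pair_form d e C s r x y"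
    unfolding pair_form_def using C assms by (simp add: mult_left_mono)
  finally show ?thesis .
qed

lemma integral_pair_form:
  assumes sr: "0 \<le> s" "0 \<le> r" and C: "\<And>x. (\<Sum>j<e. (\<Sum>f<d. C f j * x f)\<^sup>2) \<le> (\<Sum>f<d. (x f)\<^sup>2)"
  shows "(\<integral>z. exp (- pair_form d e C s r (fst z) (snd z)) \<partial>(gauss_prod d \<Otimes>\<^sub>M gauss_prod e))
    = (1 / sqrt (1 + 2 * r)) ^ e * (\<integral>x. exp (- s * (\<Sum>f<d. (x f)\<^sup>2)
        + 2 * s * r / (1 + 2 * r) * (\<Sum>j<e. (\<Sum>f<d. C f j * x f)\<^sup>2)) \<partial>gauss_prod d)"
proof -
  interpret P: pair_prob_space "gauss_prod d" "gauss_prod e" ..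
  have meas[measurable]: "(\<lambda>z. pair_form d e C s r (fst z) (snd z)) \<in> borel_measurable (gauss_prod d \<Otimes>\<^sub>M gauss_prod e)"
    unfolding pair_form_def by measurable
  have int: "integrable (gauss_prod d \<Otimes>\<^sub>M gauss_prod e) (\<lambda>z. exp (- pair_form d e C s r (fst z) (snd z)))"
    by (rule P.integrable_const_bound[where B = 1]) (auto simp: pair_form_nonneg[OF sr C])
  have inner: "(\<integral>y. exp (- pair_form d e C s r x y) \<partial>gauss_prod e)
     = (1 / sqrt (1 + 2 * r)) ^ e * exp (- s * (\<Sum>f<d. (x f)\<^sup>2)
        + 2 * s * r / (1 + 2 * r) * (\<Sum>j<e. (\<Sum>f<d. C f j * x f)\<^sup>2))" for x
  proof -
    define c where "c j = (\<Sum>f<d. C f j * x f)" for j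
    define b where "b j = - 2 * sqrt s * sqrt r * c j" for j
    have "- pair_form d e C s r x y = - s * (\<Sum>f<d. (x f)\<^sup>2) + (\<Sum>j<e. - r * (y j)\<^sup>2 + b j * y j)" for y
      by (simp add: pair_form_def b_def c_def sum.distrib sum_subtractf sum_distrib_left sum_negf mult_ac)
    then have "(\<integral>y. exp (- pair_form d e C s r x y) \<partial>gauss_prod e)
       = exp (- s * (\<Sum>f<d. (x f)\<^sup>2)) * (\<integral>y. exp (\<Sum>j<e. - r * (y j)\<^sup>2 + b j * y j) \<partial>gauss_prod e)"
      by (simp only: exp_add integral_mult_right_zero)
    also have "(\<integral>y. exp (\<Sum>j<e. - r * (y j)\<^sup>2 + b j * y j) \<partial>gauss_prod e)
       = (\<Prod>j<e. exp ((b j)\<^sup>2 / (2 * (1 + 2 * r))) / sqrt (1 + 2 * r))"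
      using sr by (intro gauss_prod_laplace) auto
    also have "\<dots> = (1 / sqrt (1 + 2 * r)) ^ e * exp (\<Sum>j<e. (b j)\<^sup>2 / (2 * (1 + 2 * r)))"
      by (simp add: prod_dividef exp_sum power_divide)
    also have "(\<Sum>j<e. (b j)\<^sup>2 / (2 * (1 + 2 * r))) = 2 * s * r / (1 + 2 * r) * (\<Sum>j<e. (c j)\<^sup>2)"
      unfolding sum_distrib_left
    proof (intro sum.cong refl)
      fix j
      have "(b j)\<^sup>2 = 4 * s * r * (c j)\<^sup>2" using sr by (simp add: b_def power_mult_distrib)
      then show "(b j)\<^sup>2 / (2 * (1 + 2 * r)) = 2 * s * r / (1 + 2 * r) * (c j)\<^sup>2"
        using sr by (simp add: field_simps)
    qed
    finally show ?thesis by (simp only: c_def exp_add mult_ac)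
  qed
  have "(\<integral>z. exp (- pair_form d e C s r (fst z) (snd z)) \<partial>(gauss_prod d \<Otimes>\<^sub>M gauss_prod e))
     = (\<integral>x. \<integral>y. exp (- pair_form d e C s r x y) \<partial>gauss_prod e \<partial>gauss_prod d)"
    using P.integral_fst'[OF int] by simp
  then show ?thesis unfolding inner by simp
qed

lemma integral_pair_form_tendsto:
  assumes sr: "0 \<le> s" "0 \<le> r" and C: "\<And>m x. (\<Sum>j<e. (\<Sum>f<d. C m f j * x f)\<^sup>2) \<le> (\<Sum>f<d. (x f)\<^sup>2)"
    and lim: "\<And>f g. f < d \<Longrightarrow> g < d \<Longrightarrow> (\<lambda>m. \<Sum>j<e. C m f j * C m g j) \<longlonglongrightarrow> (if f = g then p f else 0)"
    and p: "\<And>f. f < d \<Longrightarrow> p f \<le> 1"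
  shows "(\<lambda>m. \<integral>z. exp (- pair_form d e (C m) s r (fst z) (snd z)) \<partial>(gauss_prod d \<Otimes>\<^sub>M gauss_prod e))
    \<longlonglongrightarrow> (1 / sqrt (1 + 2 * r)) ^ e * (\<Prod>f<d. 1 / sqrt (1 + 2 * s - 4 * s * r / (1 + 2 * r) * p f))"
proof -
  define k where "k = 2 * s * r / (1 + 2 * r)"
  have k: "0 \<le> k" "k \<le> s"
  proof -
    show "0 \<le> k" using sr by (simp add: k_def)
    have "2 * s * r \<le> s * (1 + 2 * r)" using sr by (simp add: algebra_simps)
    then show "k \<le> s" unfolding k_def using sr by (simp add: divide_le_eq)
  qed
  have sq: "(\<Sum>j<e. (\<Sum>f<d. C m f j * x f)\<^sup>2) = (\<Sum>f<d. \<Sum>g<d. x f * x g * (\<Sum>j<e. C m f j * C m g j))" for m x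
  proof -
    have "(\<Sum>j<e. (\<Sum>f<d. C m f j * x f)\<^sup>2) = (\<Sum>j<e. \<Sum>f<d. \<Sum>g<d. x f * x g * (C m f j * C m g j))"
      by (simp add: power2_eq_square sum_product mult_ac)
    also have "\<dots> = (\<Sum>f<d. \<Sum>j<e. \<Sum>g<d. x f * x g * (C m f j * C m g j))" by (rule sum.swap)
    also have "\<dots> = (\<Sum>f<d. \<Sum>g<d. \<Sum>j<e. x f * x g * (C m f j * C m g j))"
      by (intro sum.cong refl sum.swap)
    finally show ?thesis by (simp only: sum_distrib_left)
  qed
  have slim: "(\<lambda>m. \<Sum>j<e. (\<Sum>f<d. C m f j * x f)\<^sup>2) \<longlonglongrightarrow> (\<Sum>f<d. p f * (x f)\<^sup>2)" for x
  proof -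
    have "(\<lambda>m. \<Sum>j<e. (\<Sum>f<d. C m f j * x f)\<^sup>2) \<longlonglongrightarrow> (\<Sum>f<d. \<Sum>g<d. x f * x g * (if f = g then p f else 0))"
      unfolding sq by (intro tendsto_sum tendsto_mult tendsto_const lim) auto
    also have "(\<Sum>f<d. \<Sum>g<d. x f * x g * (if f = g then p f else 0)) = (\<Sum>f<d. p f * (x f)\<^sup>2)"
    proof (intro sum.cong refl)
      fix f assume "f \<in> {..<d}"
      have "(\<Sum>g<d. x f * x g * (if f = g then p f else 0)) = (\<Sum>g<d. if f = g then x f * x g * p f else 0)"
        by (intro sum.cong) auto
      also have "\<dots> = p f * (x f)\<^sup>2" using \<open>f \<in> {..<d}\<close> by (simp add: power2_eq_square)
      finally show "(\<Sum>g<d. x f * x g * (if f = g then p f else 0)) = p f * (x f)\<^sup>2" .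
    qed
    finally show ?thesis .
  qed
  have "(\<lambda>m. \<integral>x. exp (- s * (\<Sum>f<d. (x f)\<^sup>2) + k * (\<Sum>j<e. (\<Sum>f<d. C m f j * x f)\<^sup>2)) \<partial>gauss_prod d)
     \<longlonglongrightarrow> (\<integral>x. exp (- s * (\<Sum>f<d. (x f)\<^sup>2) + k * (\<Sum>f<d. p f * (x f)\<^sup>2)) \<partial>gauss_prod d)"
  proof (rule integral_dominated_convergence[where w = "\<lambda>_. 1"])
    show "AE x in gauss_prod d. (\<lambda>m. exp (- s * (\<Sum>f<d. (x f)\<^sup>2) + k * (\<Sum>j<e. (\<Sum>f<d. C m f j * x f)\<^sup>2)))
        \<longlonglongrightarrow> exp (- s * (\<Sum>f<d. (x f)\<^sup>2) + k * (\<Sum>f<d. p f * (x f)\<^sup>2))"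
      by (intro AE_I2 tendsto_exp tendsto_add tendsto_mult tendsto_const slim)
    show "AE x in gauss_prod d. norm (exp (- s * (\<Sum>f<d. (x f)\<^sup>2) + k * (\<Sum>j<e. (\<Sum>f<d. C m f j * x f)\<^sup>2))) \<le> 1" for m
    proof (intro AE_I2)
      fix x
      have "k * (\<Sum>j<e. (\<Sum>f<d. C m f j * x f)\<^sup>2) \<le> s * (\<Sum>f<d. (x f)\<^sup>2)"
        using k C[of m x] by (intro mult_mono) (auto intro: sum_nonneg)
      then show "norm (exp (- s * (\<Sum>f<d. (x f)\<^sup>2) + k * (\<Sum>j<e. (\<Sum>f<d. C m f j * x f)\<^sup>2))) \<le> 1" by simp
    qed
  qed measurable
  also have "(\<integral>x. exp (- s * (\<Sum>f<d. (x f)\<^sup>2) + k * (\<Sum>f<d. p f * (x f)\<^sup>2)) \<partial>gauss_prod d)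
     = (\<integral>x. exp (\<Sum>f<d. - (s - k * p f) * (x f)\<^sup>2 + 0 * x f) \<partial>gauss_prod d)"
    by (simp add: sum_distrib_left sum.distrib[symmetric] sum_negf[symmetric] algebra_simps)
  also have "\<dots> = (\<Prod>f<d. exp (0\<^sup>2 / (2 * (1 + 2 * (s - k * p f)))) / sqrt (1 + 2 * (s - k * p f)))"
  proof (rule gauss_prod_laplace)
    fix f assume "f < d"
    then have "k * p f \<le> k * 1" using p k by (intro mult_left_mono) auto
    then show "0 < 1 + 2 * (s - k * p f)" using k by simp
  qed
  also have "\<dots> = (\<Prod>f<d. 1 / sqrt (1 + 2 * s - 4 * s * r / (1 + 2 * r) * p f))"
    by (simp add: k_def algebra_simps)
  finally show ?thesis
    unfolding integral_pair_form[OF sr C] k_def[symmetric] by (intro tendsto_mult tendsto_const)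
qed

lemma avg_laplace_randomization:
  fixes U :: "nat \<Rightarrow> 'z \<Rightarrow> real" and X :: "nat \<Rightarrow> 'z \<Rightarrow> real"
  assumes S: "finite S" and sr: "0 \<le> s" "0 \<le> r"
  shows "integrable (gauss_prod d \<Otimes>\<^sub>M gauss_prod e) (\<lambda>z. avg S (\<lambda>Z. iexp ((\<Sum>f<d. sqrt (2 * s) * fst z f * U f Z) + (\<Sum>j<e. sqrt (2 * r) * snd z j * X j Z))))"
    and "(CLINT z|gauss_prod d \<Otimes>\<^sub>M gauss_prod e.
      avg S (\<lambda>Z. iexp ((\<Sum>f<d. sqrt (2 * s) * fst z f * U f Z) + (\<Sum>j<e. sqrt (2 * r) * snd z j * X j Z))))
    = complex_of_real (avg S (\<lambda>Z. exp (- s * (\<Sum>f<d. (U f Z)\<^sup>2) - r * (\<Sum>j<e. (X j Z)\<^sup>2))))"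
proof -
  interpret P: pair_prob_space "gauss_prod d" "gauss_prod e" ..
  let ?M = "gauss_prod d \<Otimes>\<^sub>M gauss_prod e"
  define g where "g Z z = iexp ((\<Sum>f<d. sqrt (2 * s) * fst z f * U f Z) + (\<Sum>j<e. sqrt (2 * r) * snd z j * X j Z))" for Z and z :: "(nat \<Rightarrow> real) \<times> (nat \<Rightarrow> real)"
  have gm[measurable]: "g Z \<in> borel_measurable ?M" for Z unfolding g_def by measurable
  have gi: "integrable ?M (g Z)" for Z
    by (rule P.integrable_const_bound[where B = 1]) (auto simp: g_def simp del: of_real_add of_real_sum)
  have gI: "(CLINT z|?M. g Z z) = complex_of_real (exp (- s * (\<Sum>f<d. (U f Z)\<^sup>2) - r * (\<Sum>j<e. (X j Z)\<^sup>2)))" for Z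
  proof -
    have "(CLINT z|?M. g Z z) = (CLINT x|gauss_prod d. CLINT y|gauss_prod e. g Z (x, y))"
      by (rule P.integral_fst'[OF gi, symmetric])
    also have "\<dots> = (CLINT x|gauss_prod d. CLINT y|gauss_prod e. iexp (\<Sum>f<d. (sqrt (2 * s) * U f Z) * x f) * iexp (\<Sum>j<e. (sqrt (2 * r) * X j Z) * y j))"
      by (simp only: g_def fst_conv snd_conv of_real_add distrib_left exp_add mult_ac)
    also have "\<dots> = complex_of_real (exp (- (\<Sum>f<d. (sqrt (2 * s) * U f Z)\<^sup>2) / 2)) * complex_of_real (exp (- (\<Sum>j<e. (sqrt (2 * r) * X j Z)\<^sup>2) / 2))"
      by (simp only: integral_mult_right_zero integral_mult_left_zero gauss_prod_char)
    also have "\<dots> = complex_of_real (exp (- s * (\<Sum>f<d. (U f Z)\<^sup>2) - r * (\<Sum>j<e. (X j Z)\<^sup>2)))"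
      using sr unfolding of_real_mult[symmetric] exp_add[symmetric]
      by (simp add: power_mult_distrib sum_distrib_left[symmetric])
    finally show ?thesis .
  qed
  show "integrable ?M (\<lambda>z. avg S (\<lambda>Z. iexp ((\<Sum>f<d. sqrt (2 * s) * fst z f * U f Z) + (\<Sum>j<e. sqrt (2 * r) * snd z j * X j Z))))"
    unfolding g_def[symmetric] avg_def by (intro Bochner_Integration.integrable_sum integrable_divide gi)
  have "(CLINT z|?M. avg S (\<lambda>Z. g Z z)) = avg S (\<lambda>Z. CLINT z|?M. g Z z)"
    unfolding avg_def using gi by (simp add: Bochner_Integration.integral_sum)
  also have "\<dots> = complex_of_real (avg S (\<lambda>Z. exp (- s * (\<Sum>f<d. (U f Z)\<^sup>2) - r * (\<Sum>j<e. (X j Z)\<^sup>2))))"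
    unfolding gI avg_def by simp
  finally show "(CLINT z|?M.
      avg S (\<lambda>Z. iexp ((\<Sum>f<d. sqrt (2 * s) * fst z f * U f Z) + (\<Sum>j<e. sqrt (2 * r) * snd z j * X j Z))))
    = complex_of_real (avg S (\<lambda>Z. exp (- s * (\<Sum>f<d. (U f Z)\<^sup>2) - r * (\<Sum>j<e. (X j Z)\<^sup>2))))"
    unfolding g_def .
qed

text \<open>Averaging the characteristic function of \<open>(U, X)\<close> over independent normal arguments turns it into
  the Laplace transform of the squared norms, whose limit only involves \<open>C C\<^sup>T\<close>.\<close>

lemma avg_laplace_tendsto:
  fixes U :: "nat \<Rightarrow> nat \<Rightarrow> 'z \<Rightarrow> real" and X :: "nat \<Rightarrow> nat \<Rightarrow> 'z \<Rightarrow> real"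
  assumes S: "\<And>m. finite (S m)" "\<And>m. S m \<noteq> {}" and sr: "0 \<le> s" "0 \<le> r"
    and cf: "\<And>x y. (\<lambda>m. avg (S m) (\<lambda>Z. iexp ((\<Sum>f<d. x f * U m f Z) + (\<Sum>j<e. y j * X m j Z)))
       - complex_of_real (exp (- pair_form d e (C m) (1 / 2) (1 / 2) x y))) \<longlonglongrightarrow> 0"
    and C: "\<And>m x. (\<Sum>j<e. (\<Sum>f<d. C m f j * x f)\<^sup>2) \<le> (\<Sum>f<d. (x f)\<^sup>2)"
    and lim: "\<And>f g. f < d \<Longrightarrow> g < d \<Longrightarrow> (\<lambda>m. \<Sum>j<e. C m f j * C m g j) \<longlonglongrightarrow> (if f = g then p f else 0)"
    and p: "\<And>f. f < d \<Longrightarrow> p f \<le> 1"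
  shows "(\<lambda>m. avg (S m) (\<lambda>Z. exp (- s * (\<Sum>f<d. (U m f Z)\<^sup>2) - r * (\<Sum>j<e. (X m j Z)\<^sup>2))))
    \<longlonglongrightarrow> (1 / sqrt (1 + 2 * r)) ^ e * (\<Prod>f<d. 1 / sqrt (1 + 2 * s - 4 * s * r / (1 + 2 * r) * p f))"
proof -
  interpret P: pair_prob_space "gauss_prod d" "gauss_prod e" ..
  let ?M = "gauss_prod d \<Otimes>\<^sub>M gauss_prod e"
  define A where "A m z = avg (S m) (\<lambda>Z. iexp ((\<Sum>f<d. sqrt (2 * s) * fst z f * U m f Z) + (\<Sum>j<e. sqrt (2 * r) * snd z j * X m j Z)))" for m and z :: "(nat \<Rightarrow> real) \<times> (nat \<Rightarrow> real)"
  define B where "B m z = complex_of_real (exp (- pair_form d e (C m) s r (fst z) (snd z)))" for m z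
  have pf: "pair_form d e (C m) (1 / 2) (1 / 2) (\<lambda>f. sqrt (2 * s) * x f) (\<lambda>j. sqrt (2 * r) * y j) = pair_form d e (C m) s r x y" for m x y
  proof -
    have 1: "(\<Sum>f<d. C m f j * (sqrt (2 * s) * x f)) = sqrt (2 * s) * (\<Sum>f<d. C m f j * x f)" for j
      by (simp add: sum_distrib_left mult_ac)
    have "(\<Sum>j<e. sqrt (2 * s) * (\<Sum>f<d. C m f j * x f) * (sqrt (2 * r) * y j)) = 2 * sqrt s * sqrt r * (\<Sum>j<e. (\<Sum>f<d. C m f j * x f) * y j)"
      by (simp add: sum_distrib_left mult_ac real_sqrt_mult)
    then show ?thesis using sr unfolding pair_form_def 1
      by (simp add: power_mult_distrib sum_distrib_left[symmetric] real_sqrt_divide)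
  qed
  have Ai: "integrable ?M (A m)" for m
    unfolding A_def by (rule avg_laplace_randomization(1)[OF S(1) sr])
  have Bm[measurable]: "B m \<in> borel_measurable ?M" for m
    unfolding B_def pair_form_def by measurable
  have Bb: "norm (B m z) \<le> 1" for m z
    using pair_form_nonneg[OF sr C, of m "fst z" "snd z"] by (simp add: B_def)
  have Bi: "integrable ?M (B m)" for m
    by (rule P.integrable_const_bound[where B = 1]) (auto simp: Bb)
  have Ab: "norm (A m z) \<le> 1" for m z
    unfolding A_def by (rule norm_avg_le_bound[OF _ S]) (simp del: of_real_add of_real_sum)
  have "(\<lambda>m. CLINT z|?M. A m z - B m z) \<longlonglongrightarrow> (CLINT z|?M. 0)"
  proof (rule integral_dominated_convergence[where w = "\<lambda>_. 2"])
    show "AE z in ?M. (\<lambda>m. A m z - B m z) \<longlonglongrightarrow> 0"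
      using cf unfolding A_def B_def pf[symmetric] by (intro AE_I2)
    show "AE z in ?M. norm (A m z - B m z) \<le> 2" for m
      using norm_triangle_ineq4[of "A m _" "B m _"] Ab[of m] Bb[of m] by (intro AE_I2) (smt (verit, best))
    show "(\<lambda>z. A m z - B m z) \<in> borel_measurable ?M" for m
      using Ai[of m] Bi[of m] by (intro borel_measurable_diff) (auto dest: borel_measurable_integrable)
  qed auto
  moreover have "(CLINT z|?M. A m z - B m z) = complex_of_real (avg (S m) (\<lambda>Z. exp (- s * (\<Sum>f<d. (U m f Z)\<^sup>2) - r * (\<Sum>j<e. (X m j Z)\<^sup>2)))
      - (\<integral>z. exp (- pair_form d e (C m) s r (fst z) (snd z)) \<partial>?M))" for m
    unfolding Bochner_Integration.integral_diff[OF Ai Bi]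
    unfolding A_def avg_laplace_randomization(2)[OF S(1) sr] B_def integral_complex_of_real of_real_diff ..
  ultimately have "(\<lambda>m. complex_of_real (avg (S m) (\<lambda>Z. exp (- s * (\<Sum>f<d. (U m f Z)\<^sup>2) - r * (\<Sum>j<e. (X m j Z)\<^sup>2)))
      - (\<integral>z. exp (- pair_form d e (C m) s r (fst z) (snd z)) \<partial>?M))) \<longlonglongrightarrow> complex_of_real 0"
    by simp
  then have "(\<lambda>m. avg (S m) (\<lambda>Z. exp (- s * (\<Sum>f<d. (U m f Z)\<^sup>2) - r * (\<Sum>j<e. (X m j Z)\<^sup>2)))
      - (\<integral>z. exp (- pair_form d e (C m) s r (fst z) (snd z)) \<partial>?M)) \<longlonglongrightarrow> 0"
    unfolding tendsto_of_real_iff .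
  from tendsto_add[OF this integral_pair_form_tendsto[OF sr C lim p]]
  show ?thesis by simp
qed

section \<open>Positive definite matrices\<close>

lemma scalar_prod_sum:
  "w \<in> carrier_vec d \<Longrightarrow> v \<bullet> w = (\<Sum>i<d. v $ i * w $ i)"
  by (simp add: scalar_prod_def atLeast0LessThan)

lemma mult_mat_vec_sum:
  "A \<in> carrier_mat d e \<Longrightarrow> v \<in> carrier_vec e \<Longrightarrow> i < d \<Longrightarrow> (A *\<^sub>v v) $ i = (\<Sum>j<e. A $$ (i, j) * v $ j)"
  by (simp add: scalar_prod_def atLeast0LessThan)

lemma mult_mat_sum:
  "A \<in> carrier_mat d e \<Longrightarrow> B \<in> carrier_mat e g \<Longrightarrow> i < d \<Longrightarrow> k < g \<Longrightarrow>
    (A * B) $$ (i, k) = (\<Sum>j<e. A $$ (i, j) * B $$ (j, k))"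
  by (simp add: scalar_prod_def atLeast0LessThan)

lemma bilinear_transpose:
  fixes A :: "'a::comm_semiring_0 mat"
  assumes "A \<in> carrier_mat d e" "v \<in> carrier_vec d" "w \<in> carrier_vec e"
  shows "v \<bullet> (A *\<^sub>v w) = (A\<^sup>T *\<^sub>v v) \<bullet> w"
proof -
  have "v \<bullet> (A *\<^sub>v w) = (\<Sum>i<d. v $ i * (\<Sum>j<e. A $$ (i, j) * w $ j))"
    using assms by (subst scalar_prod_sum[of _ d]) (auto simp: mult_mat_vec_sum simp del: index_mult_mat_vec intro!: sum.cong)
  also have "\<dots> = (\<Sum>i<d. \<Sum>j<e. A $$ (i, j) * v $ i * w $ j)" by (simp add: sum_distrib_left mult_ac)
  also have "\<dots> = (\<Sum>j<e. \<Sum>i<d. A $$ (i, j) * v $ i * w $ j)" by (rule sum.swap)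
  also have "\<dots> = (\<Sum>j<e. (A\<^sup>T *\<^sub>v v) $ j * w $ j)"
    using assms by (intro sum.cong refl)
      (auto simp: mult_mat_vec_sum[of "A\<^sup>T" e d] sum_distrib_right simp del: index_mult_mat_vec intro!: sum.cong)
  finally show ?thesis using assms by (simp add: scalar_prod_sum[of _ e])
qed

lemma sq_norm_pos: "(v :: real vec) \<in> carrier_vec d \<Longrightarrow> v \<noteq> 0\<^sub>v d \<Longrightarrow> 0 < v \<bullet> v"
proof -
  assume v: "v \<in> carrier_vec d" "v \<noteq> 0\<^sub>v d"
  then obtain i where i: "i < d" "v $ i \<noteq> 0" by (metis carrier_vecD eq_vecI index_zero_vec)
  then have "0 < v $ i * v $ i" by (simp add: zero_less_mult_iff) linarith
  also have "\<dots> \<le> (\<Sum>i<d. v $ i * v $ i)" using i by (intro member_le_sum) auto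
  finally show ?thesis using v by (simp add: scalar_prod_sum)
qed

lemma symmetric_eigenvalue_real:
  fixes A :: "real mat"
  assumes A: "A \<in> carrier_mat n n" and sym: "A\<^sup>T = A"
    and ev: "eigenvalue (map_mat complex_of_real A) k"
  shows "k = complex_of_real (Re k)"
proof -
  let ?A = "map_mat complex_of_real A"
  have symi: "A $$ (i, j) = A $$ (j, i)" if "i < n" "j < n" for i j
    using that A sym by (metis carrier_matD index_transpose_mat(1))
  from ev obtain v where v: "v \<in> carrier_vec n" "v \<noteq> 0\<^sub>v n" and Av: "?A *\<^sub>v v = k \<cdot>\<^sub>v v"
    using A unfolding eigenvalue_def eigenvector_def by auto
  define s where "s = (\<Sum>i<n. \<Sum>j<n. complex_of_real (A $$ (i, j)) * v $ j * cnj (v $ i))"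
  define t where "t = (\<Sum>i<n. (cmod (v $ i))\<^sup>2)"
  have "s = (\<Sum>i<n. (?A *\<^sub>v v) $ i * cnj (v $ i))"
    unfolding s_def using A v
    by (intro sum.cong refl) (auto simp: mult_mat_vec_sum[of ?A n n] sum_distrib_right simp del: index_mult_mat_vec intro!: sum.cong)
  also have "\<dots> = (\<Sum>i<n. k * (v $ i * cnj (v $ i)))" unfolding Av using v by (intro sum.cong) auto
  also have "\<dots> = k * complex_of_real t"
    unfolding t_def of_real_sum sum_distrib_left by (intro sum.cong refl) (simp only: complex_norm_square)
  finally have s: "s = k * complex_of_real t" .
  have "cnj s = (\<Sum>i<n. \<Sum>j<n. complex_of_real (A $$ (i, j)) * cnj (v $ j) * v $ i)" unfolding s_def by simp
  also have "\<dots> = (\<Sum>j<n. \<Sum>i<n. complex_of_real (A $$ (i, j)) * cnj (v $ j) * v $ i)" by (rule sum.swap)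
  also have "\<dots> = s" unfolding s_def by (intro sum.cong refl) (simp add: symi mult_ac)
  finally have "cnj k * complex_of_real t = k * complex_of_real t" unfolding s by simp
  moreover have "t > 0"
  proof -
    obtain i where i: "i < n" "v $ i \<noteq> 0" using v by (metis carrier_vecD eq_vecI index_zero_vec)
    have "0 < (cmod (v $ i))\<^sup>2" using i by simp
    also have "\<dots> \<le> t" unfolding t_def using i by (intro member_le_sum) auto
    finally show ?thesis .
  qed
  ultimately have "cnj k = k" by simp
  then show ?thesis by (metis Reals_cnj_iff of_real_Re)
qed

lemma symmetric_char_poly_splits:
  fixes A :: "real mat"
  assumes A: "A \<in> carrier_mat n n" and sym: "A\<^sup>T = A"
  shows "\<exists>es. char_poly A = (\<Prod>e\<leftarrow>es. [:- e, 1:])"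
proof -
  let ?A = "map_mat complex_of_real A"
  have cA: "?A \<in> carrier_mat n n" using A by auto
  obtain as where as: "char_poly ?A = (\<Prod>a\<leftarrow>as. [:- a, 1:])" using char_poly_factorized[OF cA] by auto
  have re: "a = complex_of_real (Re a)" if "a \<in> set as" for a
  proof (rule symmetric_eigenvalue_real[OF A sym])
    have "poly (\<Prod>a\<leftarrow>as. [:- a, 1:]) a = 0" using that by (induction as) auto
    then show "eigenvalue ?A a" unfolding eigenvalue_root_char_poly[OF cA] as .
  qed
  have h: "map_poly complex_of_real (\<Prod>e\<leftarrow>map Re as. [:- e, 1:]) = (\<Prod>a\<leftarrow>as. [:- a, 1:])"
    using re
  proof (induction as)
    case (Cons a as)
    interpret m: map_poly_comm_ring_hom complex_of_real ..
    have "map_poly complex_of_real ([:- Re a, 1:] * (\<Prod>e\<leftarrow>map Re as. [:- e, 1:]))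
      = map_poly complex_of_real [:- Re a, 1:] * map_poly complex_of_real (\<Prod>e\<leftarrow>map Re as. [:- e, 1:])"
      by (rule m.hom_mult)
    also have "map_poly complex_of_real [:- Re a, 1:] = [:- a, 1:]"
      using Cons.prems[of a] by (simp add: map_poly_pCons)
    finally show ?case using Cons by simp
  qed simp
  have "map_poly complex_of_real (char_poly A) = map_poly complex_of_real (\<Prod>e\<leftarrow>map Re as. [:- e, 1:])"
    unfolding h as[symmetric] by (rule of_real_hom.char_poly_hom[OF A, symmetric])
  then have "char_poly A = (\<Prod>e\<leftarrow>map Re as. [:- e, 1:])"
    by (metis (no_types, lifting) coeff_map_poly of_real_0 of_real_eq_iff poly_eqI)
  then show ?thesis by blast
qed

lemma orthonormal_extension:
  fixes v :: "real vec"
  assumes v: "v \<in> carrier_vec n" "v \<noteq> 0\<^sub>v n"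
  shows "\<exists>W\<in>carrier_mat n n. W\<^sup>T * W = 1\<^sub>m n \<and> (\<exists>c. col W 0 = c \<cdot>\<^sub>v v)"
proof -
  have n: "n \<noteq> 0" using v by (cases n) auto
  define b where "b = basis_completion v"
  define ws where "ws = gram_schmidt n b"
  interpret cof_vec_space n "TYPE(real)" .
  from basis_completion[OF v, folded b_def]
  have dist_b: "distinct b" and indep: "\<not> lin_dep (set b)" and b: "set b \<subseteq> carrier_vec n"
    and hdb: "hd b = v" and len_b: "length b = n" by auto
  from hdb len_b n obtain vs where bv: "b = v # vs" by (cases b) auto
  from gram_schmidt_result[OF b dist_b indep refl, folded ws_def]
  have ws: "set ws \<subseteq> carrier_vec n" "corthogonal ws" "length ws = n" by (auto simp: len_b)
  from gram_schmidt_hd[OF v(1), of vs, folded bv] have hdws: "hd ws = v" unfolding ws_def .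
  have w0: "ws ! 0 = v" using hdws ws(3) n by (cases ws) auto
  have wc: "ws ! i \<in> carrier_vec n" if "i < n" for i using ws that by auto
  have cr: "conjugate w = w" for w :: "real vec" by (intro eq_vecI) auto
  have orth: "(ws ! i \<bullet> ws ! j = 0) = (i \<noteq> j)" if "i < n" "j < n" for i j
    using corthogonalD[OF ws(2), of i j] that ws(3) by (simp add: cr)
  have pos: "0 < ws ! i \<bullet> ws ! i" if "i < n" for i
  proof -
    have "ws ! i \<noteq> 0\<^sub>v n" using orth[OF that that] wc[OF that] by auto
    then show ?thesis by (rule sq_norm_pos[OF wc[OF that]])
  qed
  define c where "c i = 1 / sqrt (ws ! i \<bullet> ws ! i)" for i
  define W where "W = mat n n (\<lambda>(k, i). c i * ws ! i $ k)"
  have W: "W \<in> carrier_mat n n" by (simp add: W_def)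
  have colW: "col W i = c i \<cdot>\<^sub>v ws ! i" if "i < n" for i
    using that wc[OF that] by (intro eq_vecI) (auto simp: W_def)
  have "W\<^sup>T * W = 1\<^sub>m n"
  proof (rule eq_matI)
    fix i j assume ij: "i < dim_row (1\<^sub>m n)" "j < dim_col (1\<^sub>m n)"
    then have "(W\<^sup>T * W) $$ (i, j) = col W i \<bullet> col W j" using W by simp
    also have "\<dots> = c i * c j * (ws ! i \<bullet> ws ! j)"
      using ij carrier_vecD[OF wc[of i]] carrier_vecD[OF wc[of j]] by (simp add: colW)
    also have "\<dots> = 1\<^sub>m n $$ (i, j)"
      using ij orth pos[of i] by (auto simp: c_def)
    finally show "(W\<^sup>T * W) $$ (i, j) = 1\<^sub>m n $$ (i, j)" .
  qed (use W in auto)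
  moreover have "col W 0 = c 0 \<cdot>\<^sub>v v" using colW[of 0] n w0 by simp
  ultimately show ?thesis using W by blast
qed

lemma symmetric_orthogonal_diagonalization:
  fixes A :: "real mat"
  assumes "A \<in> carrier_mat n n" "A\<^sup>T = A" "char_poly A = (\<Prod>e\<leftarrow>es. [:- e, 1:])"
  shows "\<exists>P\<in>carrier_mat n n. P\<^sup>T * P = 1\<^sub>m n \<and> P\<^sup>T * A * P = mat_diag n (\<lambda>i. es ! i)"
  using assms
proof (induction es arbitrary: n A)
  case Nil
  then have "n = 0" using degree_monic_char_poly[of A n] by auto
  then show ?case using Nil by (intro bexI[of _ "1\<^sub>m 0"]) (auto intro!: eq_matI simp: mat_diag_def)
next
  case (Cons e es)
  note A = Cons.prems(1) and sym = Cons.prems(2)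
  have e: "eigenvalue A e" unfolding eigenvalue_root_char_poly[OF A] Cons.prems(3) by simp
  then obtain v where v: "v \<in> carrier_vec n" "v \<noteq> 0\<^sub>v n" and Av: "A *\<^sub>v v = e \<cdot>\<^sub>v v"
    using A unfolding eigenvalue_def eigenvector_def by auto
  have n0: "n \<noteq> 0" using v by (cases n) auto
  then obtain k where n: "n = 1 + k" by (metis Suc_eq_plus1_left not0_implies_Suc)
  obtain W c where W: "W \<in> carrier_mat n n" and WW: "W\<^sup>T * W = 1\<^sub>m n" and cW: "col W 0 = c \<cdot>\<^sub>v v"
    using orthonormal_extension[OF v] by blast
  have WT: "W\<^sup>T \<in> carrier_mat n n" using W by simp
  have WW': "W * W\<^sup>T = 1\<^sub>m n" by (rule mat_mult_left_right_inverse[OF WT W WW])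
  define A' where "A' = W\<^sup>T * A * W"
  have A': "A' \<in> carrier_mat n n" using A W by (simp add: A'_def)
  have symA': "A'\<^sup>T = A'"
    unfolding A'_def using A W sym
    by (simp add: transpose_mult[of _ n n _ n])
  have "A *\<^sub>v col W 0 = e \<cdot>\<^sub>v col W 0"
    unfolding cW using A v Av by (simp add: mult_mat_vec[of _ n n] smult_smult_assoc mult.commute)
  then have "A' *\<^sub>v unit_vec n 0 = e \<cdot>\<^sub>v unit_vec n 0"
  proof -
    assume h: "A *\<^sub>v col W 0 = e \<cdot>\<^sub>v col W 0"
    have cu: "W *\<^sub>v unit_vec n 0 = col W 0" using W n0 by (intro eq_vecI) auto
    have u: "unit_vec n 0 \<in> carrier_vec n" by simp
    have cc: "col W 0 \<in> carrier_vec n" using W n0 by auto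
    have "A' *\<^sub>v unit_vec n 0 = W\<^sup>T *\<^sub>v (A *\<^sub>v (W *\<^sub>v unit_vec n 0))"
      unfolding A'_def using W A WT u by (simp add: assoc_mult_mat_vec[of _ n n _ n])
    also have "\<dots> = e \<cdot>\<^sub>v (W\<^sup>T *\<^sub>v (W *\<^sub>v unit_vec n 0))"
      unfolding cu h using WT cc by (simp add: mult_mat_vec[of _ n n])
    also have "W\<^sup>T *\<^sub>v (W *\<^sub>v unit_vec n 0) = (W\<^sup>T * W) *\<^sub>v unit_vec n 0"
      using W WT u by (simp add: assoc_mult_mat_vec[of _ n n _ n])
    finally show ?thesis unfolding WW by simp
  qed
  moreover have "A' *\<^sub>v unit_vec n 0 = col A' 0" using A' n0 by (intro eq_vecI) auto
  ultimately have col0: "A' $$ (i, 0) = (if i = 0 then e else 0)" if "i < n" for i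
  proof -
    assume "A' *\<^sub>v unit_vec n 0 = e \<cdot>\<^sub>v unit_vec n 0" "A' *\<^sub>v unit_vec n 0 = col A' 0"
    then have "col A' 0 $ i = (e \<cdot>\<^sub>v unit_vec n 0) $ i" by simp
    then show ?thesis using that A' n0 by (auto simp: unit_vec_def)
  qed
  then have row0: "A' $$ (0, i) = (if i = 0 then e else 0)" if "i < n" for i
    using that A' symA' n0 by (metis carrier_matD gr0I index_transpose_mat(1))
  define A1 where "A1 = mat 1 1 (\<lambda>_. e)"
  define A3 where "A3 = mat k k (\<lambda>(i, j). A' $$ (Suc i, Suc j))"
  have c1: "A1 \<in> carrier_mat 1 1" and c3: "A3 \<in> carrier_mat k k" by (auto simp: A1_def A3_def)
  have blk: "A' = four_block_mat A1 (0\<^sub>m 1 k) (0\<^sub>m k 1) A3"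
    using A' col0 row0 unfolding n by (intro eq_matI) (auto simp: A1_def A3_def)
  have sym3: "A3\<^sup>T = A3"
  proof (rule eq_matI)
    fix i j assume "i < dim_row A3" "j < dim_col A3"
    then have ij: "i < k" "j < k" by (auto simp: A3_def)
    have "A' $$ (Suc j, Suc i) = A'\<^sup>T $$ (Suc i, Suc j)" using ij A' n by simp
    then show "A3\<^sup>T $$ (i, j) = A3 $$ (i, j)" using ij symA' by (simp add: A3_def)
  qed (auto simp: A3_def)
  have "similar_mat_wit A' A W\<^sup>T W"
    by (rule similar_mat_witI[of _ _ n]) (use W A A' WW WW' A'_def in auto)
  then have "similar_mat A' A"
    unfolding similar_mat_def by blast
  then have "char_poly A' = char_poly A" by (rule char_poly_similar)
  moreover have "char_poly A' = char_poly A1 * char_poly A3"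
    unfolding blk by (rule char_poly_four_block_zeros_col[OF c1 _ c3]) simp
  moreover have "char_poly A1 = [:- e, 1:]"
    by (simp add: A1_def char_poly_defs Determinant.det_def sign_def)
  ultimately have "[:- e, 1:] * char_poly A3 = [:- e, 1:] * (\<Prod>e\<leftarrow>es. [:- e, 1:])"
    using Cons.prems(3) by simp
  then have cp3: "char_poly A3 = (\<Prod>e\<leftarrow>es. [:- e, 1:])"
    by (metis mult_cancel_left pCons_eq_0_iff zero_neq_one)
  from Cons.IH[OF c3 sym3 cp3] obtain P3 where P3: "P3 \<in> carrier_mat k k"
    and PP3: "P3\<^sup>T * P3 = 1\<^sub>m k" and D3: "P3\<^sup>T * A3 * P3 = mat_diag k (\<lambda>i. es ! i)" by blast
  define F where "F = four_block_mat (1\<^sub>m 1) (0\<^sub>m 1 k) (0\<^sub>m k 1) P3"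
  have F: "F \<in> carrier_mat n n" unfolding F_def n using P3 by auto
  have FT: "F\<^sup>T = four_block_mat (1\<^sub>m 1) (0\<^sub>m 1 k) (0\<^sub>m k 1) P3\<^sup>T"
    unfolding F_def by (subst transpose_four_block_mat[OF _ _ _ P3]) auto
  have FF: "F\<^sup>T * F = 1\<^sub>m n"
    unfolding FT unfolding F_def n
    by (subst mult_four_block_mat[of _ 1 1 _ k _ k _ _ 1 _ k]) (use P3 PP3 in auto)
  have FA: "F\<^sup>T * A' * F = four_block_mat A1 (0\<^sub>m 1 k) (0\<^sub>m k 1) (P3\<^sup>T * A3 * P3)"
    unfolding FT blk unfolding F_def
    by (subst mult_four_block_mat[of _ 1 1 _ k _ k _ _ 1 _ k],
        insert P3 c1 c3, auto, subst mult_four_block_mat[of _ 1 1 _ k _ k _ _ 1 _ k], auto)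
  have dg: "F\<^sup>T * A' * F = mat_diag n (\<lambda>i. (e # es) ! i)"
    unfolding FA D3 n by (intro eq_matI) (auto simp: A1_def mat_diag_def nth_Cons')
  define P where "P = W * F"
  have P: "P \<in> carrier_mat n n" using W F by (simp add: P_def)
  have FTc: "F\<^sup>T \<in> carrier_mat n n" using F by simp
  have PT: "P\<^sup>T = F\<^sup>T * W\<^sup>T" unfolding P_def by (rule transpose_mult[OF W F])
  have "P\<^sup>T * P = F\<^sup>T * (W\<^sup>T * W) * F"
    unfolding PT unfolding P_def using W F WT FTc by (simp add: assoc_mult_mat[of _ n n _ n _ n])
  then have "P\<^sup>T * P = 1\<^sub>m n" unfolding WW using FF FTc F by simp
  moreover have "P\<^sup>T * A * P = F\<^sup>T * A' * F"
    unfolding PT A'_def unfolding P_def using A W F WT FTc by (simp add: assoc_mult_mat[of _ n n _ n _ n])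
  ultimately show ?case using P dg by auto
qed

definition spd :: "nat \<Rightarrow> real mat \<Rightarrow> bool" where
  "spd d A \<longleftrightarrow> A \<in> carrier_mat d d \<and> A\<^sup>T = A \<and> (\<forall>v\<in>carrier_vec d. v \<noteq> 0\<^sub>v d \<longrightarrow> 0 < v \<bullet> (A *\<^sub>v v))"

lemma spdD:
  assumes "spd d A"
  shows "A \<in> carrier_mat d d" "A\<^sup>T = A" "\<And>v. v \<in> carrier_vec d \<Longrightarrow> v \<noteq> 0\<^sub>v d \<Longrightarrow> 0 < v \<bullet> (A *\<^sub>v v)"
    "\<And>v. v \<in> carrier_vec d \<Longrightarrow> 0 \<le> v \<bullet> (A *\<^sub>v v)"
proof -
  show "A \<in> carrier_mat d d" "A\<^sup>T = A" and p: "\<And>v. v \<in> carrier_vec d \<Longrightarrow> v \<noteq> 0\<^sub>v d \<Longrightarrow> 0 < v \<bullet> (A *\<^sub>v v)"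
    using assms by (auto simp: spd_def)
  fix v :: "real vec" assume v: "v \<in> carrier_vec d"
  show "0 \<le> v \<bullet> (A *\<^sub>v v)"
  proof (cases "v = 0\<^sub>v d")
    case True
    have "A *\<^sub>v v \<in> carrier_vec d" using assms v by (auto simp: spd_def)
    then show ?thesis using True by simp
  next
    case False
    then show ?thesis using p[OF v] by simp
  qed
qed

lemma minv_eqI:
  assumes "A \<in> carrier_mat d d" "B \<in> carrier_mat d d" "A * B = 1\<^sub>m d" "B * A = 1\<^sub>m d"
  shows "minv d A = B"
  unfolding minv_def
proof (rule the_equality)
  fix C assume C: "C \<in> carrier_mat d d \<and> A * C = 1\<^sub>m d \<and> C * A = 1\<^sub>m d"
  then have "C = C * (A * B)" using assms right_mult_one_mat[of C d d] by simp
  also have "\<dots> = (C * A) * B" using C assms by (intro assoc_mult_mat[of _ d d _ d _ d, symmetric]) auto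
  finally show "C = B" using C assms left_mult_one_mat[of B d d] by simp
qed (use assms in simp)

lemma spd_det_pos_inverse:
  assumes "spd d A"
  shows "\<exists>B\<in>carrier_mat d d. A * B = 1\<^sub>m d \<and> B * A = 1\<^sub>m d"
proof -
  note A = spdD[OF assms]
  have "det A \<noteq> 0"
  proof
    assume "det A = 0"
    then obtain v where "v \<in> carrier_vec d" "v \<noteq> 0\<^sub>v d" "A *\<^sub>v v = 0\<^sub>v d"
      using det_0_iff_vec_prod_zero[OF A(1)] by auto
    then show False using A(3)[of v] by simp
  qed
  then show ?thesis
    using adj_mat[OF A(1)] A(1)
    by (intro bexI[of _ "(1 / det A) \<cdot>\<^sub>m adj_mat A"]) (auto simp: mult_smult_distrib[of _ d d _ d] mult_smult_assoc_mat[of _ d d _ d])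
qed

lemma spd_minv:
  assumes "spd d A"
  shows "spd d (minv d A)" "A * minv d A = 1\<^sub>m d" "minv d A * A = 1\<^sub>m d"
proof -
  note A = spdD[OF assms]
  obtain B where B: "B \<in> carrier_mat d d" "A * B = 1\<^sub>m d" "B * A = 1\<^sub>m d"
    using spd_det_pos_inverse[OF assms] by blast
  have m: "minv d A = B" by (rule minv_eqI[OF A(1) B])
  have "B\<^sup>T * A = 1\<^sub>m d"
    using transpose_mult[OF A(1) B(1)] A(2) B(2) by simp
  moreover have "B\<^sup>T * (A * B) = (B\<^sup>T * A) * B"
    using A(1) B(1) by (intro assoc_mult_mat[of _ d d _ d _ d, symmetric]) auto
  ultimately have BT: "B\<^sup>T = B"
    using B left_mult_one_mat[of B d d] right_mult_one_mat[of "B\<^sup>T" d d] by simp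
  have "0 < v \<bullet> (B *\<^sub>v v)" if v: "v \<in> carrier_vec d" "v \<noteq> 0\<^sub>v d" for v
  proof -
    define y where "y = B *\<^sub>v v"
    have y: "y \<in> carrier_vec d" using B v by (simp add: y_def)
    have Ay: "A *\<^sub>v y = v"
      unfolding y_def using A(1) B v by (simp flip: assoc_mult_mat_vec[of _ d d _ d])
    have "y \<noteq> 0\<^sub>v d"
    proof
      assume "y = 0\<^sub>v d"
      then have "A *\<^sub>v y = 0\<^sub>v d" using A(1) by (intro eq_vecI) auto
      with Ay v show False by simp
    qed
    then have "0 < y \<bullet> (A *\<^sub>v y)" using A(3) y by blast
    then show ?thesis unfolding Ay using comm_scalar_prod[OF y v(1)] by (simp add: y_def)
  qed
  then show "spd d (minv d A)" unfolding m spd_def using B BT by simp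
  show "A * minv d A = 1\<^sub>m d" "minv d A * A = 1\<^sub>m d" unfolding m using B by auto
qed

lemma col_mat_diag_mult:
  fixes P :: "real mat"
  assumes "P \<in> carrier_mat n n" "i < n"
  shows "col (P * mat_diag n f) i = f i \<cdot>\<^sub>v col P i"
  using assms by (subst mat_diag_mult_right[OF assms(1)]) (auto intro!: eq_vecI simp: mult.commute)

lemma psd_sqrt_spd:
  assumes "spd d A"
  shows "psd_sqrt d A \<in> carrier_mat d d" "(psd_sqrt d A)\<^sup>T = psd_sqrt d A" "psd_sqrt d A * psd_sqrt d A = A"
proof -
  note A = spdD[OF assms]
  obtain es where es: "char_poly A = (\<Prod>e\<leftarrow>es. [:- e, 1:])"
    using symmetric_char_poly_splits[OF A(1,2)] by blast
  obtain P where P: "P \<in> carrier_mat d d" and PP: "P\<^sup>T * P = 1\<^sub>m d" and D: "P\<^sup>T * A * P = mat_diag d (\<lambda>i. es ! i)"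
    using symmetric_orthogonal_diagonalization[OF A(1,2) es] by blast
  have PT: "P\<^sup>T \<in> carrier_mat d d" using P by simp
  have PP': "P * P\<^sup>T = 1\<^sub>m d" by (rule mat_mult_left_right_inverse[OF PT P PP])
  note assoc = assoc_mult_mat[of _ d d _ d _ d]
  have AP: "A * P = P * mat_diag d (\<lambda>i. es ! i)"
  proof -
    have "P * (P\<^sup>T * A * P) = (P * P\<^sup>T) * (A * P)" using P PT A(1) by (simp add: assoc)
    then show ?thesis unfolding D PP' using A(1) P by simp
  qed
  have pos: "0 < es ! i" if i: "i < d" for i
  proof -
    have c: "col P i \<in> carrier_vec d" using P i by auto
    have "col P i \<noteq> 0\<^sub>v d"
    proof
      assume z: "col P i = 0\<^sub>v d"
      have "(P\<^sup>T * P) $$ (i, i) = col P i \<bullet> col P i" using P i by simp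
      then show False unfolding PP z using i by simp
    qed
    then have "0 < col P i \<bullet> (A *\<^sub>v col P i)" using A(3) c by blast
    also have "A *\<^sub>v col P i = col (A * P) i" using A(1) P i by (intro eq_vecI) auto
    also have "\<dots> = es ! i \<cdot>\<^sub>v col P i" unfolding AP by (rule col_mat_diag_mult[OF P i])
    also have "col P i \<bullet> (es ! i \<cdot>\<^sub>v col P i) = es ! i * (col P i \<bullet> col P i)" by simp
    also have "col P i \<bullet> col P i = (P\<^sup>T * P) $$ (i, i)" using P i by simp
    finally show ?thesis unfolding PP using i by simp
  qed
  define \<mu> where "\<mu> i = sqrt (es ! i)" for i
  define M where "M = mat_diag d \<mu>"
  have M: "M \<in> carrier_mat d d" by (simp add: M_def)
  have MM: "M * M = mat_diag d (\<lambda>i. es ! i)"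
    unfolding M_def mat_diag_diag using pos by (intro eq_matI) (auto simp: mat_diag_def \<mu>_def less_imp_le)
  have MT: "M\<^sup>T = M" by (intro eq_matI) (auto simp: M_def mat_diag_def)
  define B where "B = P * M * P\<^sup>T"
  have B: "B \<in> carrier_mat d d" using P M by (simp add: B_def)
  have BT: "B\<^sup>T = B" unfolding B_def using P M PT MT by (simp add: transpose_mult[of _ d d _ d] assoc)
  have BB: "B * B = A"
  proof -
    have "B * B = P * (M * ((P\<^sup>T * P) * (M * P\<^sup>T)))" unfolding B_def using P M PT by (simp add: assoc)
    also have "\<dots> = P * (M * M) * P\<^sup>T" unfolding PP using P M PT by (simp add: assoc)
    also have "\<dots> = A * P * P\<^sup>T" unfolding MM AP ..
    also have "\<dots> = A * (P * P\<^sup>T)" using A(1) P PT by (simp add: assoc)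
    finally show ?thesis unfolding PP' using A(1) by simp
  qed
  have Bpsd: "0 \<le> v \<bullet> (B *\<^sub>v v)" if v: "v \<in> carrier_vec d" for v
  proof -
    define w where "w = P\<^sup>T *\<^sub>v v"
    have w: "w \<in> carrier_vec d" using PT v by (simp add: w_def)
    have "v \<bullet> (B *\<^sub>v v) = v \<bullet> (P *\<^sub>v (M *\<^sub>v w))"
      unfolding B_def w_def using P M PT v by (simp add: assoc_mult_mat_vec[of _ d d _ d])
    also have "\<dots> = w \<bullet> (M *\<^sub>v w)"
      unfolding w_def using P M v by (subst bilinear_transpose[of P d d]) auto
    also have "\<dots> = (\<Sum>i<d. w $ i * (\<mu> i * w $ i))"
    proof -
      have "(M *\<^sub>v w) $ i = \<mu> i * w $ i" if "i < d" for i
      proof -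
        have "(M *\<^sub>v w) $ i = (\<Sum>j<d. M $$ (i, j) * w $ j)" by (rule mult_mat_vec_sum[OF M w that])
        also have "\<dots> = (\<Sum>j<d. if i = j then \<mu> j * w $ j else 0)"
          using that by (intro sum.cong refl) (auto simp: M_def mat_diag_def)
        finally show ?thesis using that by simp
      qed
      then show ?thesis using M w by (subst scalar_prod_sum[of _ d]) (auto simp del: index_mult_mat_vec)
    qed
    also have "\<dots> = (\<Sum>i<d. \<mu> i * (w $ i)\<^sup>2)" by (simp add: power2_eq_square mult_ac)
    also have "\<dots> \<ge> 0" using pos by (intro sum_nonneg) (auto simp: \<mu>_def less_imp_le)
    finally show ?thesis .
  qed
  have uniq: "C = B" if C: "C \<in> carrier_mat d d" "C\<^sup>T = C" "\<forall>v\<in>carrier_vec d. 0 \<le> v \<bullet> (C *\<^sub>v v)" "C * C = A" for C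
  proof -
    have "col (C * P) i = col (P * M) i" if i: "i < d" for i
    proof -
      define x where "x = col P i"
      have x: "x \<in> carrier_vec d" using P i by (auto simp: x_def)
      have Cx: "C *\<^sub>v x \<in> carrier_vec d" using C x by simp
      define y where "y = C *\<^sub>v x - \<mu> i \<cdot>\<^sub>v x"
      have y: "y \<in> carrier_vec d" using Cx x by (simp add: y_def)
      have mu: "\<mu> i > 0" "\<mu> i * \<mu> i = es ! i" using pos[OF i] by (auto simp: \<mu>_def)
      have "A *\<^sub>v x = col (A * P) i" unfolding x_def using A(1) P i by (intro eq_vecI) auto
      then have Ax: "A *\<^sub>v x = es ! i \<cdot>\<^sub>v x" unfolding AP x_def using col_mat_diag_mult[OF P i] by simp
      have "C *\<^sub>v y = C *\<^sub>v (C *\<^sub>v x) - \<mu> i \<cdot>\<^sub>v (C *\<^sub>v x)"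
        unfolding y_def using C x Cx by (simp add: mult_minus_distrib_mat_vec[of _ d d] mult_mat_vec[of _ d d])
      also have "C *\<^sub>v (C *\<^sub>v x) = es ! i \<cdot>\<^sub>v x"
        using C x Ax by (metis assoc_mult_mat_vec)
      also have "es ! i \<cdot>\<^sub>v x - \<mu> i \<cdot>\<^sub>v (C *\<^sub>v x) = (- \<mu> i) \<cdot>\<^sub>v y"
      proof -
        have "(\<mu> i * \<mu> i) \<cdot>\<^sub>v x - \<mu> i \<cdot>\<^sub>v z = (- \<mu> i) \<cdot>\<^sub>v (z - \<mu> i \<cdot>\<^sub>v x)" if "z \<in> carrier_vec d" for z
          using x that by (intro eq_vecI) (auto simp: algebra_simps)
        from this[OF Cx] show ?thesis unfolding y_def mu(2) .
      qed
      finally have "y \<bullet> (C *\<^sub>v y) = - \<mu> i * (y \<bullet> y)" using y by simp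
      moreover have "0 \<le> y \<bullet> (C *\<^sub>v y)" using C(3) y by blast
      ultimately have "\<mu> i * (y \<bullet> y) \<le> 0" by simp
      then have "y \<bullet> y \<le> 0" using mu by (simp add: mult_le_0_iff)
      then have "y = 0\<^sub>v d" using sq_norm_pos[OF y] by force
      then have "C *\<^sub>v x = \<mu> i \<cdot>\<^sub>v x"
      proof -
        assume y0: "y = 0\<^sub>v d"
        have "(C *\<^sub>v x) $ j = (\<mu> i \<cdot>\<^sub>v x) $ j" if "j < d" for j
        proof -
          have "y $ j = (C *\<^sub>v x) $ j - (\<mu> i \<cdot>\<^sub>v x) $ j"
            unfolding y_def using that x Cx by (simp del: index_mult_mat_vec)
          then show ?thesis using y0 that by simp
        qed
        then show ?thesis using x C(1) by (intro eq_vecI) (auto simp del: index_mult_mat_vec)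
      qed
      moreover have "col (C * P) i = C *\<^sub>v x" unfolding x_def using C P i by (intro eq_vecI) auto
      moreover have "col (P * M) i = \<mu> i \<cdot>\<^sub>v x" unfolding M_def x_def by (rule col_mat_diag_mult[OF P i])
      ultimately show ?thesis by simp
    qed
    then have "C * P = P * M" using C P M by (intro mat_col_eqI) auto
    then have "C * (P * P\<^sup>T) = P * M * P\<^sup>T" using C P PT by (simp flip: assoc)
    then show ?thesis unfolding PP' B_def using C by simp
  qed
  have "psd_sqrt d A = B"
    unfolding psd_sqrt_def
  proof (rule the_equality)
    show "B \<in> carrier_mat d d \<and> B\<^sup>T = B \<and> (\<forall>v\<in>carrier_vec d. 0 \<le> v \<bullet> (B *\<^sub>v v)) \<and> B * B = A"
      using B BT BB Bpsd by blast
    fix C assume "C \<in> carrier_mat d d \<and> C\<^sup>T = C \<and> (\<forall>v\<in>carrier_vec d. 0 \<le> v \<bullet> (C *\<^sub>v v)) \<and> C * C = A"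
    then show "C = B" using uniq by blast
  qed
  then show "psd_sqrt d A \<in> carrier_mat d d" "(psd_sqrt d A)\<^sup>T = psd_sqrt d A" "psd_sqrt d A * psd_sqrt d A = A"
    using B BT BB by auto
qed

lemma psd_sqrt_minv_bound:
  assumes V: "spd d V" and c: "0 < c" "\<And>v. v \<in> carrier_vec d \<Longrightarrow> c * (v \<bullet> v) \<le> v \<bullet> (V *\<^sub>v v)"
    and fg: "f < d" "g < d"
  shows "(psd_sqrt d (minv d V) $$ (f, g))\<^sup>2 \<le> 1 / c"
proof -
  define M where "M = minv d V"
  define W where "W = psd_sqrt d M"
  note M = spd_minv[OF V, folded M_def]
  have Mc: "M \<in> carrier_mat d d" using M(1) by (rule spdD)
  note W = psd_sqrt_spd[OF M(1), folded W_def]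
  note Vc = spdD[OF V]
  define y where "y = M *\<^sub>v unit_vec d f"
  have y: "y \<in> carrier_vec d" using Mc by (simp add: y_def)
  have yf: "y $ f = M $$ (f, f)" using Mc fg by (simp add: y_def)
  have "V *\<^sub>v y = unit_vec d f"
    unfolding y_def using Vc(1) Mc M(2) by (simp flip: assoc_mult_mat_vec[of _ d d _ d])
  then have "c * (y \<bullet> y) \<le> y $ f" using c(2)[OF y] y fg by simp
  moreover have "(y $ f)\<^sup>2 \<le> y \<bullet> y"
  proof -
    have "y $ f * y $ f \<le> (\<Sum>i<d. y $ i * y $ i)" using fg by (intro member_le_sum) auto
    then show ?thesis using y by (simp add: scalar_prod_sum power2_eq_square)
  qed
  ultimately have "c * (y $ f)\<^sup>2 \<le> y $ f" using c(1) by (meson mult_left_mono order_trans less_imp_le)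
  then have yf1: "y $ f \<le> 1 / c"
  proof (cases "y $ f \<le> 0")
    case False
    then have "c * y $ f \<le> 1" using \<open>c * (y $ f)\<^sup>2 \<le> y $ f\<close> by (simp add: power2_eq_square)
    then show ?thesis using c by (simp add: field_simps)
  qed (use c in \<open>auto intro: order_trans\<close>)
  have "M $$ (f, f) = (\<Sum>j<d. W $$ (f, j) * W $$ (j, f))"
    using mult_mat_sum[OF W(1) W(1) fg(1) fg(1)] W(3) by simp
  also have "\<dots> = (\<Sum>j<d. (W $$ (f, j))\<^sup>2)"
  proof (intro sum.cong refl)
    fix j assume "j \<in> {..<d}"
    then have "W $$ (j, f) = W\<^sup>T $$ (f, j)" using W(1) fg by simp
    then show "W $$ (f, j) * W $$ (j, f) = (W $$ (f, j))\<^sup>2" unfolding W(2) by (simp add: power2_eq_square)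
  qed
  finally have "(W $$ (f, g))\<^sup>2 \<le> M $$ (f, f)"
    using member_le_sum[of g "{..<d}" "\<lambda>j. (W $$ (f, j))\<^sup>2"] fg by simp
  then show ?thesis using yf yf1 by (simp add: W_def M_def)
qed

lemma symmetric_quadratic_form:
  fixes A :: "real mat"
  assumes A: "A \<in> carrier_mat d d" "A\<^sup>T = A"
  shows "\<exists>P es. P \<in> carrier_mat d d \<and>
    (\<forall>i<d. A *\<^sub>v col P i = es ! i \<cdot>\<^sub>v col P i \<and> col P i \<bullet> col P i = (1 :: real)) \<and>
    (\<forall>v\<in>carrier_vec d. v \<bullet> (A *\<^sub>v v) = (\<Sum>i<d. es ! i * ((P\<^sup>T *\<^sub>v v) $ i)\<^sup>2) \<and>
      v \<bullet> v = (\<Sum>i<d. ((P\<^sup>T *\<^sub>v v) $ i)\<^sup>2)) \<and>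
    det A = (\<Prod>i<d. es ! i)"
proof -
  obtain es where es: "char_poly A = (\<Prod>e\<leftarrow>es. [:- e, 1:])"
    using symmetric_char_poly_splits[OF A] by blast
  obtain P where P: "P \<in> carrier_mat d d" and PP: "P\<^sup>T * P = 1\<^sub>m d" and D: "P\<^sup>T * A * P = mat_diag d (\<lambda>i. es ! i)"
    using symmetric_orthogonal_diagonalization[OF A es] by blast
  have PT: "P\<^sup>T \<in> carrier_mat d d" using P by simp
  have PP': "P * P\<^sup>T = 1\<^sub>m d" by (rule mat_mult_left_right_inverse[OF PT P PP])
  note assoc = assoc_mult_mat[of _ d d _ d _ d]
  let ?M = "mat_diag d (\<lambda>i. es ! i)"
  have M: "?M \<in> carrier_mat d d" by simp
  have AP: "A * P = P * ?M"
  proof -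
    have "P * (P\<^sup>T * A * P) = (P * P\<^sup>T) * (A * P)" using P PT A(1) by (simp add: assoc)
    then show ?thesis unfolding D PP' using A(1) P by simp
  qed
  have ev: "A *\<^sub>v col P i = es ! i \<cdot>\<^sub>v col P i" if i: "i < d" for i
  proof -
    have "A *\<^sub>v col P i = col (A * P) i" using A(1) P i by (intro eq_vecI) auto
    then show ?thesis unfolding AP using col_mat_diag_mult[OF P i] by simp
  qed
  have nrm: "col P i \<bullet> col P i = 1" if i: "i < d" for i
  proof -
    have "(P\<^sup>T * P) $$ (i, i) = col P i \<bullet> col P i" using P i by simp
    then show ?thesis unfolding PP using i by simp
  qed
  have AM: "A = P * ?M * P\<^sup>T"
  proof -
    have "A * (P * P\<^sup>T) = P * ?M * P\<^sup>T" using A P PT AP M by (simp flip: assoc)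
    then show ?thesis unfolding PP' using A by simp
  qed
  have quad: "v \<bullet> (A *\<^sub>v v) = (\<Sum>i<d. es ! i * ((P\<^sup>T *\<^sub>v v) $ i)\<^sup>2)" if v: "v \<in> carrier_vec d" for v
  proof -
    define w where "w = P\<^sup>T *\<^sub>v v"
    have w: "w \<in> carrier_vec d" using PT v by (simp add: w_def)
    have "v \<bullet> (A *\<^sub>v v) = v \<bullet> (P *\<^sub>v (?M *\<^sub>v w))"
      unfolding w_def by (subst AM) (use P M PT v in \<open>simp add: assoc_mult_mat_vec[of _ d d _ d]\<close>)
    also have "\<dots> = w \<bullet> (?M *\<^sub>v w)"
      using bilinear_transpose[OF P v mult_mat_vec_carrier[OF M w]] by (simp only: w_def)
    also have "\<dots> = (\<Sum>i<d. w $ i * (es ! i * w $ i))"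
    proof -
      have "(?M *\<^sub>v w) $ i = es ! i * w $ i" if "i < d" for i
      proof -
        have "(?M *\<^sub>v w) $ i = (\<Sum>j<d. ?M $$ (i, j) * w $ j)" by (rule mult_mat_vec_sum[OF M w that])
        also have "\<dots> = (\<Sum>j<d. if i = j then es ! j * w $ j else 0)"
          using that by (intro sum.cong refl) (auto simp: mat_diag_def)
        finally show ?thesis using that by simp
      qed
      then show ?thesis using mult_mat_vec_carrier[OF M w] by (subst scalar_prod_sum[of _ d]) (auto simp del: index_mult_mat_vec)
    qed
    finally show ?thesis by (simp add: power2_eq_square mult_ac w_def)
  qed
  have nv: "v \<bullet> v = (\<Sum>i<d. ((P\<^sup>T *\<^sub>v v) $ i)\<^sup>2)" if v: "v \<in> carrier_vec d" for v
  proof -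
    have "v = P *\<^sub>v (P\<^sup>T *\<^sub>v v)" using P PT v PP' by (simp flip: assoc_mult_mat_vec[of _ d d _ d])
    then have "v \<bullet> v = v \<bullet> (P *\<^sub>v (P\<^sup>T *\<^sub>v v))" by simp
    also have "\<dots> = (P\<^sup>T *\<^sub>v v) \<bullet> (P\<^sup>T *\<^sub>v v)" by (rule bilinear_transpose[OF P v mult_mat_vec_carrier[OF PT v]])
    finally show ?thesis using mult_mat_vec_carrier[OF PT v] by (simp add: scalar_prod_sum power2_eq_square del: index_mult_mat_vec)
  qed
  have "det A = det ?M"
  proof -
    have "det A = det P * det ?M * det P\<^sup>T" by (subst AM) (use P M PT in \<open>simp add: det_mult[of _ d]\<close>)
    also have "\<dots> = det (P * P\<^sup>T) * det ?M" using P PT by (simp add: det_mult[of _ d])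
    finally show ?thesis unfolding PP' by simp
  qed
  also have "\<dots> = prod_list (diag_mat ?M)"
    by (rule det_upper_triangular[OF _ M]) (auto simp: mat_diag_def)
  also have "\<dots> = (\<Prod>i<d. es ! i)"
    by (simp add: prod_list_diag_prod mat_diag_def atLeast0LessThan)
  finally have dt: "det A = (\<Prod>i<d. es ! i)" .
  show ?thesis using P ev nrm quad nv dt by blast
qed

lemma psd_lower_bound_spd:
  fixes A :: "real mat"
  assumes A: "A \<in> carrier_mat d d" "A\<^sup>T = A" and c: "0 < c" "\<And>v. v \<in> carrier_vec d \<Longrightarrow> c * (v \<bullet> v) \<le> v \<bullet> (A *\<^sub>v v)"
  shows "spd d A"
  unfolding spd_def using A c sq_norm_pos by (auto intro: less_le_trans[OF mult_pos_pos])

text \<open>Each eigenvalue is at most \<open>t\<close>, hence at least \<open>\<delta> / t ^ d\<close> because their product is the determinant.\<close>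

lemma psd_lower_bound:
  fixes A :: "real mat"
  assumes A: "A \<in> carrier_mat d d" "A\<^sup>T = A" and psd: "\<And>v. v \<in> carrier_vec d \<Longrightarrow> 0 \<le> v \<bullet> (A *\<^sub>v v)"
    and t: "1 \<le> t" "\<And>i j. i < d \<Longrightarrow> j < d \<Longrightarrow> \<bar>A $$ (i, j)\<bar> \<le> t / (real d)\<^sup>2"
    and dt: "0 < \<delta>" "\<delta> \<le> det A"
    and v: "v \<in> carrier_vec d"
  shows "\<delta> / t ^ d * (v \<bullet> v) \<le> v \<bullet> (A *\<^sub>v v)"
proof -
  obtain P es where P: "P \<in> carrier_mat d d"
    and ev: "\<And>i. i < d \<Longrightarrow> A *\<^sub>v col P i = es ! i \<cdot>\<^sub>v col P i" and nrm: "\<And>i. i < d \<Longrightarrow> col P i \<bullet> col P i = (1 :: real)"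
    and quad: "\<And>v. v \<in> carrier_vec d \<Longrightarrow> v \<bullet> (A *\<^sub>v v) = (\<Sum>i<d. es ! i * ((P\<^sup>T *\<^sub>v v) $ i)\<^sup>2)"
    and nv: "\<And>v. v \<in> carrier_vec d \<Longrightarrow> v \<bullet> v = (\<Sum>i<d. ((P\<^sup>T *\<^sub>v v) $ i)\<^sup>2)"
    and det: "det A = (\<Prod>i<d. es ! i)"
    using symmetric_quadratic_form[OF A] by blast
  have es: "0 \<le> es ! i \<and> es ! i \<le> t" if i: "i < d" for i
  proof -
    define x where "x = col P i"
    have x: "x \<in> carrier_vec d" using P i by (auto simp: x_def)
    have Ax: "A *\<^sub>v x \<in> carrier_vec d" using A x by simp
    have e: "es ! i = x \<bullet> (A *\<^sub>v x)" unfolding x_def ev[OF i] using nrm[OF i] by simp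
    have "\<bar>x $ k\<bar> \<le> 1" if "k < d" for k
    proof -
      have "x $ k * x $ k \<le> (\<Sum>k<d. x $ k * x $ k)" using that by (intro member_le_sum) auto
      also have "\<dots> = 1" using nrm[OF i] x by (simp add: x_def[symmetric] scalar_prod_sum)
      finally show ?thesis by (simp add: abs_square_le_1 power2_eq_square[symmetric])
    qed
    then have "\<bar>x $ k * (A $$ (k, j) * x $ j)\<bar> \<le> 1 * (t / (real d)\<^sup>2 * 1)" if "k < d" "j < d" for k j
      unfolding abs_mult using that t by (intro mult_mono) auto
    then have "(\<Sum>k<d. \<Sum>j<d. x $ k * (A $$ (k, j) * x $ j)) \<le> (\<Sum>k<d. \<Sum>j<d. t / (real d)\<^sup>2)"
      by (intro sum_mono) (auto dest: abs_le_D1)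
    also have "\<dots> = t" using i by (simp add: power2_eq_square)
    also have "(\<Sum>k<d. \<Sum>j<d. x $ k * (A $$ (k, j) * x $ j)) = x \<bullet> (A *\<^sub>v x)"
      using Ax by (simp add: scalar_prod_sum[of _ d] mult_mat_vec_sum[OF A(1) x] sum_distrib_left del: index_mult_mat_vec)
    finally show ?thesis using e psd[OF x] by simp
  qed
  have low: "\<delta> / t ^ d \<le> es ! i" if i: "i < d" for i
  proof -
    have "(\<Prod>j\<in>{..<d} - {i}. es ! j) \<le> (\<Prod>j\<in>{..<d} - {i}. t)"
      using es by (intro prod_mono) auto
    also have "\<dots> \<le> t ^ d" using i t by (simp add: power_increasing)
    finally have "es ! i * (\<Prod>j\<in>{..<d} - {i}. es ! j) \<le> es ! i * t ^ d" using es[OF i] by (intro mult_left_mono) auto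
    moreover have "es ! i * (\<Prod>j\<in>{..<d} - {i}. es ! j) = det A"
      unfolding det using i by (subst prod.remove[of "{..<d}" i]) auto
    ultimately show ?thesis using dt t by (simp add: divide_le_eq)
  qed
  show ?thesis
    unfolding quad[OF v] nv[OF v] sum_distrib_left using low by (intro sum_mono mult_right_mono) auto
qed

lemma tendsto_det:
  fixes A :: "nat \<Rightarrow> real mat"
  assumes "\<And>m. A m \<in> carrier_mat d d" "B \<in> carrier_mat d d"
    and "\<And>i j. i < d \<Longrightarrow> j < d \<Longrightarrow> (\<lambda>m. A m $$ (i, j)) \<longlonglongrightarrow> B $$ (i, j)"
  shows "(\<lambda>m. det (A m)) \<longlonglongrightarrow> det B"
proof -
  have "(\<lambda>m. \<Sum>p | p permutes {0..<d}. signof p * (\<Prod>i = 0..<d. A m $$ (i, p i)))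
     \<longlonglongrightarrow> (\<Sum>p | p permutes {0..<d}. signof p * (\<Prod>i = 0..<d. B $$ (i, p i)))"
    by (intro tendsto_sum tendsto_mult tendsto_const tendsto_prod assms) (auto dest: permutes_in_image)
  then show ?thesis using assms(1,2) by (simp add: Determinant.det_def'[of _ d])
qed

lemma psd_uniform_lower_bound:
  fixes A :: "nat \<Rightarrow> real mat"
  assumes A: "\<And>m. A m \<in> carrier_mat d d" "\<And>m. (A m)\<^sup>T = A m"
    and psd: "\<And>m v. v \<in> carrier_vec d \<Longrightarrow> 0 \<le> v \<bullet> (A m *\<^sub>v v)"
    and B: "B \<in> carrier_mat d d" "det B \<noteq> 0"
    and lim: "\<And>i j. i < d \<Longrightarrow> j < d \<Longrightarrow> (\<lambda>m. A m $$ (i, j)) \<longlonglongrightarrow> B $$ (i, j)"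
  shows "\<exists>c>0. eventually (\<lambda>m. \<forall>v\<in>carrier_vec d. c * (v \<bullet> v) \<le> v \<bullet> (A m *\<^sub>v v)) sequentially"
proof -
  have dl: "(\<lambda>m. det (A m)) \<longlonglongrightarrow> det B" by (rule tendsto_det[OF A(1) B(1) lim])
  have "0 \<le> det (A m)" for m
  proof -
    obtain P es where P: "P \<in> carrier_mat d d"
      and ev: "\<And>i. i < d \<Longrightarrow> A m *\<^sub>v col P i = es ! i \<cdot>\<^sub>v col P i" and nrm: "\<And>i. i < d \<Longrightarrow> col P i \<bullet> col P i = (1 :: real)"
      and det: "det (A m) = (\<Prod>i<d. es ! i)"
      using symmetric_quadratic_form[OF A(1)[of m] A(2)[of m]] by blast
    have "0 \<le> es ! i" if i: "i < d" for i
      using psd[of "col P i" m] P i unfolding ev[OF i] by (simp add: nrm)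
    then show ?thesis unfolding det by (intro prod_nonneg) auto
  qed
  then have "0 \<le> det B" by (intro LIMSEQ_le_const[OF dl]) auto
  with B have dB: "0 < det B" by simp
  define t where "t = 1 + (real d)\<^sup>2 * (1 + (\<Sum>i<d. \<Sum>j<d. \<bar>B $$ (i, j)\<bar>))"
  have t1: "1 \<le> t" unfolding t_def by (simp add: sum_nonneg)
  have e1: "eventually (\<lambda>m. det B / 2 < det (A m)) sequentially"
    using order_tendstoD(1)[OF dl, of "det B / 2"] dB by simp
  have e2: "eventually (\<lambda>m. \<forall>i\<in>{..<d}. \<forall>j\<in>{..<d}. \<bar>A m $$ (i, j)\<bar> < 1 + \<bar>B $$ (i, j)\<bar>) sequentially"
  proof (intro eventually_ball_finite ballI finite_lessThan)
    fix i j assume "i \<in> {..<d}" "j \<in> {..<d}"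
    then have "(\<lambda>m. \<bar>A m $$ (i, j)\<bar>) \<longlonglongrightarrow> \<bar>B $$ (i, j)\<bar>" by (intro tendsto_rabs lim) auto
    then show "eventually (\<lambda>m. \<bar>A m $$ (i, j)\<bar> < 1 + \<bar>B $$ (i, j)\<bar>) sequentially"
      by (rule order_tendstoD) simp
  qed
  have "eventually (\<lambda>m. \<forall>v\<in>carrier_vec d. (det B / 2) / t ^ d * (v \<bullet> v) \<le> v \<bullet> (A m *\<^sub>v v)) sequentially"
    using e1 e2
  proof eventually_elim
    case (elim m)
    show ?case
    proof
      fix v :: "real vec" assume v: "v \<in> carrier_vec d"
      show "(det B / 2) / t ^ d * (v \<bullet> v) \<le> v \<bullet> (A m *\<^sub>v v)"
      proof (rule psd_lower_bound[OF A psd t1 _ _ _ v])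
        fix i j assume ij: "i < d" "j < d"
        then have d: "real d > 0" by simp
        have "\<bar>A m $$ (i, j)\<bar> \<le> 1 + \<bar>B $$ (i, j)\<bar>" using elim(2) ij by (auto intro: less_imp_le)
        also have "\<bar>B $$ (i, j)\<bar> \<le> (\<Sum>j<d. \<bar>B $$ (i, j)\<bar>)" using ij by (intro member_le_sum) auto
        also have "(\<Sum>j<d. \<bar>B $$ (i, j)\<bar>) \<le> (\<Sum>i<d. \<Sum>j<d. \<bar>B $$ (i, j)\<bar>)"
          using ij by (intro member_le_sum[of i "{..<d}" "\<lambda>i. \<Sum>j<d. \<bar>B $$ (i, j)\<bar>"]) (auto intro: sum_nonneg)
        also have "1 + (\<Sum>i<d. \<Sum>j<d. \<bar>B $$ (i, j)\<bar>) \<le> t / (real d)\<^sup>2"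
          using d by (simp add: t_def le_divide_eq mult.commute)
        finally show "\<bar>A m $$ (i, j)\<bar> \<le> t / (real d)\<^sup>2" by simp
      qed (use dB elim in auto)
    qed
  qed
  moreover have "0 < (det B / 2) / t ^ d" using dB t1 by simp
  ultimately show ?thesis by blast
qed

lemma psd_invertible_lower_bound:
  fixes A :: "real mat"
  assumes A: "A \<in> carrier_mat d d" "A\<^sup>T = A"
    and psd: "\<And>v. v \<in> carrier_vec d \<Longrightarrow> 0 \<le> v \<bullet> (A *\<^sub>v v)" and inv: "invertible_mat A"
  shows "\<exists>c>0. \<forall>v\<in>carrier_vec d. c * (v \<bullet> v) \<le> v \<bullet> (A *\<^sub>v v)"
proof -
  have "det A \<noteq> 0"
  proof
    assume "det A = 0"
    then obtain v where v: "v \<in> carrier_vec d" "v \<noteq> 0\<^sub>v d" "A *\<^sub>v v = 0\<^sub>v d"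
      using det_0_iff_vec_prod_zero[OF A(1)] by auto
    obtain B where B: "A * B = 1\<^sub>m (dim_row A)" "B * A = 1\<^sub>m (dim_row B)"
      using inv unfolding invertible_mat_def inverts_mat_def by blast
    have "dim_col (B * A) = dim_row B" unfolding B(2) by simp
    moreover have "dim_col (A * B) = d" unfolding B(1) using A by simp
    ultimately have Bc: "B \<in> carrier_mat d d" using A by auto
    have "v = (B * A) *\<^sub>v v" unfolding B(2) using Bc v by simp
    also have "\<dots> = B *\<^sub>v (A *\<^sub>v v)" using Bc A v by (simp add: assoc_mult_mat_vec[of _ d d _ d])
    finally have "v = B *\<^sub>v 0\<^sub>v d" using v by simp
    also have "\<dots> = 0\<^sub>v d" using Bc by (intro eq_vecI) auto
    finally show False using v by simp
  qed
  from psd_uniform_lower_bound[of "\<lambda>_. A", OF A psd A(1) this] show ?thesis by auto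
qed

section \<open>Factorial contrasts\<close>

definition bit_char :: "nat \<Rightarrow> nat \<Rightarrow> nat \<Rightarrow> real" where
  "bit_char K s q = (\<Prod>k | k < K \<and> odd (s div 2 ^ k). iota q k)"

lemma gcoef_bit_char: "gcoef K f q = bit_char K (Suc f) q"
  by (simp add: gcoef_def effset_def bit_char_def)

lemma bit_char_0: "bit_char K 0 q = 1"
  by (simp add: bit_char_def)

lemma bit_char_abs: "\<bar>bit_char K s q\<bar> = 1"
  by (auto simp: bit_char_def abs_prod iota_def intro!: prod.neutral)

lemma bit_char_Suc:
  assumes "s < 2 ^ K"
  shows "bit_char (Suc K) s q = bit_char K s q"
    and "bit_char (Suc K) (2 ^ K + s) q = iota q K * bit_char K s q"
proof -
  have "{k. k < Suc K \<and> odd (s div 2 ^ k)} = {k. k < K \<and> odd (s div 2 ^ k)}"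
    using assms by (auto simp: less_Suc_eq)
  then show "bit_char (Suc K) s q = bit_char K s q" by (simp add: bit_char_def)
  have low: "odd ((2 ^ K + s) div 2 ^ k) \<longleftrightarrow> odd (s div 2 ^ k)" if "k < K" for k
  proof -
    have "K = k + Suc (K - Suc k)" using that by simp
    then have "(2::nat) ^ K = 2 ^ k * (2 * 2 ^ (K - Suc k))"
      by (metis power_add power_Suc)
    then have "(2 ^ K + s) div 2 ^ k = 2 * 2 ^ (K - Suc k) + s div 2 ^ k"
      by (simp add: div_mult_self4)
    then show ?thesis by simp
  qed
  have "(2 ^ K + s) div 2 ^ K = 1" using assms by simp
  then have "{k. k < Suc K \<and> odd ((2 ^ K + s) div 2 ^ k)} = insert K {k. k < K \<and> odd (s div 2 ^ k)}"
    using low by (auto simp: less_Suc_eq)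
  then show "bit_char (Suc K) (2 ^ K + s) q = iota q K * bit_char K s q"
    by (simp add: bit_char_def)
qed

lemma sum_bit_char_prod:
  "(\<Sum>s<2 ^ K. bit_char K s q * bit_char K s q') = (\<Prod>k<K. 1 + iota q k * iota q' k)"
proof (induction K)
  case (Suc K)
  have "(\<Sum>s<2 ^ Suc K. h s) = (\<Sum>s<2 ^ K. h s) + (\<Sum>s<2 ^ K. h (2 ^ K + s))" for h :: "nat \<Rightarrow> real"
  proof -
    have "(\<Sum>s<a + b. h s) = (\<Sum>s<a. h s) + (\<Sum>s<b. h (a + s))" for a b
      by (induction b) (auto simp: algebra_simps)
    from this[of "2 ^ K" "2 ^ K"] show ?thesis by (simp add: mult_2)
  qed
  then have "(\<Sum>s<2 ^ Suc K. bit_char (Suc K) s q * bit_char (Suc K) s q')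
    = (\<Sum>s<2 ^ K. bit_char K s q * bit_char K s q')
      + (\<Sum>s<2 ^ K. iota q K * iota q' K * (bit_char K s q * bit_char K s q'))"
    by (simp add: bit_char_Suc mult_ac)
  then show ?case using Suc by (simp add: sum_distrib_left[symmetric] algebra_simps)
qed (simp add: bit_char_def)

lemma bit_char_column_orthogonal:
  assumes "q < nQ K" "q' < nQ K"
  shows "(\<Sum>s<nQ K. bit_char K s q * bit_char K s q') = (if q = q' then real (nQ K) else 0)"
proof (cases "q = q'")
  case True
  have "iota q k * iota q k = 1" for k by (simp add: iota_def)
  then show ?thesis using True sum_bit_char_prod[of K q q'] by (simp add: nQ_def)
next
  case False
  have "\<exists>k<K. odd (q div 2 ^ k) \<noteq> odd (q' div 2 ^ k)"
  proof (rule ccontr)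
    assume c: "\<not> ?thesis"
    have "bit q k = bit q' k" for k
    proof (cases "k < K")
      case True
      then show ?thesis using c by (simp add: bit_iff_odd)
    next
      case F: False
      have "x div 2 ^ k = 0" if "x < nQ K" for x :: nat
      proof -
        have "x < 2 ^ K" using that by (simp add: nQ_def)
        also have "(2::nat) ^ K \<le> 2 ^ k" using F by (intro power_increasing) auto
        finally show ?thesis by simp
      qed
      then show ?thesis using assms by (simp add: bit_iff_odd)
    qed
    then show False using False by (simp add: bit_eq_iff)
  qed
  then obtain k where k: "k < K" "odd (q div 2 ^ k) \<noteq> odd (q' div 2 ^ k)" by blast
  then have "1 + iota q k * iota q' k = 0" by (auto simp: iota_def)
  then have "(\<Prod>k<K. 1 + iota q k * iota q' k) = 0" using k(1) by (intro prod_zero) auto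
  then show ?thesis using False sum_bit_char_prod[of K q q'] by (simp add: nQ_def)
qed

lemma bit_char_row_orthogonal:
  assumes "s < nQ K" "s' < nQ K"
  shows "(\<Sum>q<nQ K. bit_char K s q * bit_char K s' q) = (if s = s' then real (nQ K) else 0)"
proof -
  define n where "n = nQ K"
  define A where "A = mat n n (\<lambda>(q, s). bit_char K s q / real n)"
  define B where "B = mat n n (\<lambda>(s, q). bit_char K s q)"
  have n0: "n > 0" by (simp add: n_def nQ_def)
  have A: "A \<in> carrier_mat n n" and B: "B \<in> carrier_mat n n" by (auto simp: A_def B_def)
  have "A * B = 1\<^sub>m n"
  proof (rule eq_matI)
    fix q q' assume q: "q < dim_row (1\<^sub>m n)" "q' < dim_col (1\<^sub>m n)"
    then have "(A * B) $$ (q, q') = (\<Sum>s<n. bit_char K s q / real n * bit_char K s q')"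
      by (simp add: A_def B_def scalar_prod_def atLeast0LessThan)
    also have "\<dots> = (\<Sum>s<n. bit_char K s q * bit_char K s q') / real n" by (simp add: sum_divide_distrib)
    also have "\<dots> = 1\<^sub>m n $$ (q, q')"
      using bit_char_column_orthogonal[of q K q'] q n0 by (simp add: n_def)
    finally show "(A * B) $$ (q, q') = 1\<^sub>m n $$ (q, q')" .
  qed (auto simp: A_def B_def)
  then have "B * A = 1\<^sub>m n" by (rule mat_mult_left_right_inverse[OF A B])
  then have "(B * A) $$ (s, s') = 1\<^sub>m n $$ (s, s')" by simp
  moreover have "(B * A) $$ (s, s') = (\<Sum>q<n. bit_char K s q * bit_char K s' q) / real n"
    using assms by (simp add: A_def B_def scalar_prod_def atLeast0LessThan sum_divide_distrib n_def)
  ultimately show ?thesis using assms n0 by (auto simp: n_def split: if_splits)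
qed

lemma nQ_nF: "nQ K = Suc (nF K)"
  by (simp add: nQ_def nF_def)

lemma gcoef_abs: "\<bar>gcoef K f q\<bar> = 1"
  by (simp add: gcoef_bit_char bit_char_abs)

lemma gcoef_sum_zero: "f < nF K \<Longrightarrow> (\<Sum>q<nQ K. gcoef K f q) = 0"
  using bit_char_row_orthogonal[of "Suc f" K 0] by (simp add: gcoef_bit_char bit_char_0 nQ_nF)

lemma gcoef_row_orthogonal:
  "f < nF K \<Longrightarrow> g < nF K \<Longrightarrow> (\<Sum>q<nQ K. gcoef K f q * gcoef K g q) = (if f = g then real (nQ K) else 0)"
  using bit_char_row_orthogonal[of "Suc f" K "Suc g"] by (simp add: gcoef_bit_char nQ_nF)

lemma gcoef_column_orthogonal:
  assumes "q < nQ K" "q' < nQ K"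
  shows "(\<Sum>f<nF K. gcoef K f q * gcoef K f q') = (if q = q' then real (nQ K) else 0) - 1"
proof -
  have "(\<Sum>s<Suc (nF K). bit_char K s q * bit_char K s q') = (if q = q' then real (nQ K) else 0)"
    using bit_char_column_orthogonal[OF assms] by (simp only: nQ_nF)
  then show ?thesis
    by (subst (asm) sum.lessThan_Suc_shift) (simp add: gcoef_bit_char bit_char_0)
qed

definition cov_form :: "nat \<Rightarrow> nat \<Rightarrow> (nat \<Rightarrow> nat) \<Rightarrow> (nat \<Rightarrow> nat \<Rightarrow> real) \<Rightarrow> (nat \<Rightarrow> nat \<Rightarrow> real) \<Rightarrow> real" where
  "cov_form K n nq a b = (\<Sum>i<n. (\<Sum>q<nQ K. real (nq q) / real n * (a i q * b i q))
      - ((\<Sum>q<nQ K. real (nq q) * a i q) / real n) * ((\<Sum>q<nQ K. real (nq q) * b i q) / real n))"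

lemma lim_var_cov_form: "lim_var K n nq a = cov_form K n nq a a"
  by (simp add: lim_var_def cov_form_def power2_eq_square)

lemma cov_form_commute: "cov_form K n nq a b = cov_form K n nq b a"
  by (simp add: cov_form_def mult_ac)

lemma cov_form_add_left: "cov_form K n nq (\<lambda>i q. a i q + a' i q) b = cov_form K n nq a b + cov_form K n nq a' b"
proof -
  have 1: "(\<Sum>q<nQ K. real (nq q) * (a i q + a' i q)) = (\<Sum>q<nQ K. real (nq q) * a i q) + (\<Sum>q<nQ K. real (nq q) * a' i q)" for i
    by (simp add: distrib_left sum.distrib)
  have 2: "(\<Sum>q<nQ K. real (nq q) / real n * ((a i q + a' i q) * b i q))
    = (\<Sum>q<nQ K. real (nq q) / real n * (a i q * b i q)) + (\<Sum>q<nQ K. real (nq q) / real n * (a' i q * b i q))" for i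
    by (simp only: distrib_left distrib_right sum.distrib)
  have "(x + x') - (y + y') / m * w = (x - y / m * w) + (x' - y' / m * w)" for x x' y y' w m :: real
    by (simp add: algebra_simps add_divide_distrib)
  then show ?thesis unfolding cov_form_def 1 2 by (simp only: sum.distrib)
qed

lemma cov_form_cmult_left: "cov_form K n nq (\<lambda>i q. c * a i q) b = c * cov_form K n nq a b"
proof -
  have 1: "(\<Sum>q<nQ K. real (nq q) * (c * a i q)) = c * (\<Sum>q<nQ K. real (nq q) * a i q)" for i
    by (simp add: sum_distrib_left mult_ac)
  have 2: "(\<Sum>q<nQ K. real (nq q) / real n * (c * a i q * b i q)) = c * (\<Sum>q<nQ K. real (nq q) / real n * (a i q * b i q))" for i
    by (simp add: sum_distrib_left mult_ac)
  have 3: "c * x - c * y / m * w = c * (x - y / m * w)" for x y w m :: real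
    by (simp add: algebra_simps)
  show ?thesis unfolding cov_form_def 1 2 3 sum_distrib_left[symmetric] ..
qed

lemma cov_form_sum_left:
  "cov_form K n nq (\<lambda>i q. \<Sum>k<(d::nat). c k * a k i q) b = (\<Sum>k<d. c k * cov_form K n nq (a k) b)"
proof (induction d)
  case 0
  then show ?case by (simp add: cov_form_def)
next
  case (Suc d)
  then show ?case by (simp add: cov_form_add_left cov_form_cmult_left)
qed

lemma cov_form_sum_right:
  "cov_form K n nq a (\<lambda>i q. \<Sum>k<(d::nat). c k * b k i q) = (\<Sum>k<d. c k * cov_form K n nq a (b k))"
  by (subst (1 2) cov_form_commute) (rule cov_form_sum_left)

lemma cov_form_cong:
  assumes "\<And>i q. i < n \<Longrightarrow> q < nQ K \<Longrightarrow> a i q = a' i q"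
  shows "cov_form K n nq a b = cov_form K n nq a' b"
  unfolding cov_form_def
proof (intro sum.cong refl)
  fix i assume i: "i \<in> {..<n}"
  have "(\<Sum>q<nQ K. real (nq q) * a i q) = (\<Sum>q<nQ K. real (nq q) * a' i q)"
    "(\<Sum>q<nQ K. real (nq q) / real n * (a i q * b i q)) = (\<Sum>q<nQ K. real (nq q) / real n * (a' i q * b i q))"
    using assms i by (auto intro!: sum.cong)
  then show "(\<Sum>q<nQ K. real (nq q) / real n * (a i q * b i q))
      - ((\<Sum>q<nQ K. real (nq q) * a i q) / real n) * ((\<Sum>q<nQ K. real (nq q) * b i q) / real n)
     = (\<Sum>q<nQ K. real (nq q) / real n * (a' i q * b i q))
      - ((\<Sum>q<nQ K. real (nq q) * a' i q) / real n) * ((\<Sum>q<nQ K. real (nq q) * b i q) / real n)" by simp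
qed

lemma cov_form_treatment_constant:
  assumes "(\<Sum>q<nQ K. nq q) = n" "n \<ge> 1"
  shows "cov_form K n nq (\<lambda>i q. c i) b = 0"
proof -
  have s: "(\<Sum>q<nQ K. real (nq q)) = real n" using assms(1) by (simp flip: of_nat_sum)
  have "(\<Sum>q<nQ K. real (nq q) / real n * (c i * b i q)) = c i * ((\<Sum>q<nQ K. real (nq q) * b i q) / real n)" for i
    by (simp add: sum_distrib_left sum_divide_distrib mult_ac)
  moreover have "(\<Sum>q<nQ K. real (nq q) * c i) / real n = c i" for i
    using assms(2) by (simp add: sum_distrib_right[symmetric] s)
  ultimately show ?thesis by (simp add: cov_form_def)
qed

lemma cov_form_add_treatment_constant:
  assumes "(\<Sum>q<nQ K. nq q) = n" "n \<ge> 1"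
  shows "cov_form K n nq (\<lambda>i q. a i q + c i) b = cov_form K n nq a b"
  unfolding cov_form_add_left by (simp add: cov_form_treatment_constant[OF assms])

text \<open>The unit contributions of the contrast \<open>f\<close>: summed over the observed treatments they give
  the error of its difference-in-means estimator.\<close>

definition contrast :: "nat \<Rightarrow> nat \<Rightarrow> (nat \<Rightarrow> nat) \<Rightarrow> (nat \<Rightarrow> nat \<Rightarrow> real) \<Rightarrow> nat \<Rightarrow> nat \<Rightarrow> nat \<Rightarrow> real" where
  "contrast K n nq Y f i q = gcoef K f q / (2 ^ (K - 1) * real (nq q)) * (Y i q - fmean n (\<lambda>i. Y i q))"

lemma sum_residual: "n \<ge> 1 \<Longrightarrow> (\<Sum>i<n. h i - fmean n h) = 0"
  by (simp add: fmean_def sum_subtractf)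

lemma contrast_centred: "n \<ge> 1 \<Longrightarrow> centred K n (contrast K n nq Y f)"
  unfolding centred_def contrast_def sum_distrib_left[symmetric] by (simp only: sum_residual) simp

lemma lin_stat_contrast:
  assumes Z: "Z \<in> assignments K n nq" and nq: "\<And>q. q < nQ K \<Longrightarrow> 1 \<le> nq q"
  shows "lin_stat n (contrast K n nq Y f) Z
    = (\<Sum>q<nQ K. gcoef K f q * grp_mean n nq Z (\<lambda>i. Y i (Z i)) q) / 2 ^ (K - 1)
      - (\<Sum>q<nQ K. gcoef K f q * fmean n (\<lambda>i. Y i q)) / 2 ^ (K - 1)"
proof -
  have "lin_stat n (contrast K n nq Y f) Z = (\<Sum>q<nQ K. \<Sum>i | i < n \<and> Z i = q. contrast K n nq Y f i q)"
    unfolding lin_stat_def by (rule sum_by_group[OF Z])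
  also have "\<dots> = (\<Sum>q<nQ K. (gcoef K f q * grp_mean n nq Z (\<lambda>i. Y i (Z i)) q - gcoef K f q * fmean n (\<lambda>i. Y i q)) / 2 ^ (K - 1))"
  proof (intro sum.cong refl)
    fix q assume q: "q \<in> {..<nQ K}"
    let ?I = "{i. i < n \<and> Z i = q}"
    have c: "real (card ?I) = real (nq q)" using Z q by (simp add: assignments_def)
    have n0: "real (nq q) > 0" using nq[of q] q by simp
    have "(\<Sum>i\<in>?I. contrast K n nq Y f i q)
      = gcoef K f q / (2 ^ (K - 1) * real (nq q)) * ((\<Sum>i\<in>?I. Y i q) - real (nq q) * fmean n (\<lambda>i. Y i q))"
      unfolding contrast_def sum_distrib_left[symmetric] sum_subtractf using c by simp
    also have "(\<Sum>i\<in>?I. Y i q) = real (nq q) * grp_mean n nq Z (\<lambda>i. Y i (Z i)) q"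
      using n0 by (simp add: grp_mean_def)
    also have "g / (c * x) * (x * u - x * v) = (g * u - g * v) / c" if "x > 0" for g c x u v :: real
      using that by (cases "c = 0") (auto simp: field_simps)
    note this[OF n0]
    finally show "(\<Sum>i\<in>?I. contrast K n nq Y f i q)
       = (gcoef K f q * grp_mean n nq Z (\<lambda>i. Y i (Z i)) q - gcoef K f q * fmean n (\<lambda>i. Y i q)) / 2 ^ (K - 1)" .
  qed
  finally show ?thesis by (simp only: sum_divide_distrib[symmetric] sum_subtractf diff_divide_distrib)
qed

lemma sum_div_mod:
  fixes h :: "nat \<Rightarrow> nat \<Rightarrow> real"
  shows "(\<Sum>j<d * L. h (j div L) (j mod L)) = (\<Sum>f<d. \<Sum>l<L. h f l)"
proof (cases "L = 0")
  case False
  have "(\<Sum>j<d * L. h (j div L) (j mod L)) = (\<Sum>f<d. \<Sum>j\<in>{f * L..<f * L + L}. h (j div L) (j mod L))"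
    by (rule sum.nat_group[symmetric])
  also have "\<dots> = (\<Sum>f<d. \<Sum>l<L. h f l)"
  proof (rule sum.cong[OF refl])
    fix f
    have "(\<Sum>j\<in>{f * L..<f * L + L}. h (j div L) (j mod L)) = (\<Sum>l\<in>{0..<L}. h ((l + f * L) div L) ((l + f * L) mod L))"
      using sum.shift_bounds_nat_ivl[of "\<lambda>j. h (j div L) (j mod L)" 0 "f * L" L] by (simp add: add.commute)
    also have "\<dots> = (\<Sum>l<L. h f l)" using False by (simp add: atLeast0LessThan)
    finally show "(\<Sum>j\<in>{f * L..<f * L + L}. h (j div L) (j mod L)) = (\<Sum>l<L. h f l)" .
  qed
  finally show ?thesis .
qed simp

lemma fcov_commute: "fcov n x y = fcov n y x"
  by (simp add: fcov_def mult.commute)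

lemma fmean_sum: "fmean n (\<lambda>i. \<Sum>q\<in>I. c q * y i q) = (\<Sum>q\<in>I. c q * fmean n (\<lambda>i. y i q))"
proof -
  have "(\<Sum>i<n. \<Sum>q\<in>I. c q * y i q) = (\<Sum>q\<in>I. c q * (\<Sum>i<n. y i q))"
    by (subst sum.swap) (simp add: sum_distrib_left)
  then show ?thesis unfolding fmean_def by (simp only: sum_divide_distrib[of _ I] times_divide_eq_right)
qed

definition cov_scale :: "nat \<Rightarrow> real" where
  "cov_scale n = real n / (real n - 1)"

definition xcontrast :: "nat \<Rightarrow> nat \<Rightarrow> nat \<Rightarrow> (nat \<Rightarrow> nat) \<Rightarrow> (nat \<Rightarrow> nat \<Rightarrow> real) \<Rightarrow> nat \<Rightarrow> nat \<Rightarrow> nat \<Rightarrow> real" where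
  "xcontrast K L n nq X j = contrast K n nq (\<lambda>i q. X i (j mod L)) (j div L)"

lemma contrast_weighted:
  assumes "1 \<le> nq q"
  shows "real (nq q) * contrast K n nq Y f i q = gcoef K f q * (Y i q - fmean n (\<lambda>i. Y i q)) / 2 ^ (K - 1)"
  using assms by (simp add: contrast_def)

lemma contrast_weighted_prod:
  assumes "1 \<le> nq q"
  shows "real (nq q) / real n * (contrast K n nq Y f i q * contrast K n nq Y' g i q)
    = gcoef K f q * gcoef K g q / (real n * (2 ^ (2 * (K - 1)) * real (nq q)))
      * ((Y i q - fmean n (\<lambda>i. Y i q)) * (Y' i q - fmean n (\<lambda>i. Y' i q)))"
proof -
  have "x / m * (g / (c * x) * y * (g' / (c * x) * y')) = g * g' / (m * (c * c * x)) * (y * y')"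
    if "x > 0" for x m g c y g' y' :: real using that by (simp add: field_simps)
  from this[of "real (nq q)"] show ?thesis
    using assms by (simp add: contrast_def mult_2 power_add)
qed

context
  fixes K L n :: nat and nq :: "nat \<Rightarrow> nat"
  assumes K: "1 \<le> K" and nq: "\<And>q. q < nQ K \<Longrightarrow> 1 \<le> nq q" and sizes: "(\<Sum>q<nQ K. nq q) = n"
begin

lemma size_ge_2: "2 \<le> n"
proof -
  have "2 \<le> nQ K" using K power_increasing[of 1 K "2::nat"] by (simp add: nQ_def)
  also have "nQ K = (\<Sum>q<nQ K. 1)" by simp
  also have "\<dots> \<le> n" unfolding sizes[symmetric] using nq by (intro sum_mono) auto
  finally show ?thesis .
qed

lemma cov_scale_pos: "0 < cov_scale n" "cov_scale n / real n = 1 / (real n - 1)"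
  using size_ge_2 by (auto simp: cov_scale_def)

lemma cov_form_contrast:
  "cov_form K n nq (contrast K n nq Y f) (contrast K n nq Y' g)
    = (\<Sum>q<nQ K. gcoef K f q * gcoef K g q / (real n * (2 ^ (2 * (K - 1)) * real (nq q)))
        * (\<Sum>i<n. (Y i q - fmean n (\<lambda>i. Y i q)) * (Y' i q - fmean n (\<lambda>i. Y' i q))))
      - (\<Sum>i<n. ((\<Sum>q<nQ K. gcoef K f q * (Y i q - fmean n (\<lambda>i. Y i q)) / 2 ^ (K - 1)) / real n)
          * ((\<Sum>q<nQ K. gcoef K g q * (Y' i q - fmean n (\<lambda>i. Y' i q)) / 2 ^ (K - 1)) / real n))"
proof -
  have 1: "(\<Sum>q<nQ K. real (nq q) * contrast K n nq Y f i q)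
     = (\<Sum>q<nQ K. gcoef K f q * (Y i q - fmean n (\<lambda>i. Y i q)) / 2 ^ (K - 1))" for Y f i
    by (intro sum.cong refl contrast_weighted nq) auto
  have 2: "(\<Sum>q<nQ K. real (nq q) / real n * (contrast K n nq Y f i q * contrast K n nq Y' g i q))
     = (\<Sum>q<nQ K. gcoef K f q * gcoef K g q / (real n * (2 ^ (2 * (K - 1)) * real (nq q)))
      * ((Y i q - fmean n (\<lambda>i. Y i q)) * (Y' i q - fmean n (\<lambda>i. Y' i q))))" for i
    by (intro sum.cong refl contrast_weighted_prod nq) auto
  show ?thesis
    unfolding cov_form_def 1 2 sum_subtractf by (subst sum.swap) (simp only: sum_distrib_left)
qed

lemma Vtt_entry:
  assumes "f < nF K" "g < nF K"
  shows "Vtt K n nq Y $$ (f, g) = cov_scale n * cov_form K n nq (contrast K n nq Y f) (contrast K n nq Y g)"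
proof -
  define y where "y i q = Y i q - fmean n (\<lambda>i. Y i q)" for i q
  define t where "t f i = (\<Sum>q<nQ K. gcoef K f q * y i q / 2 ^ (K - 1))" for f i
  have n2: "real n - 1 > 0" "real n > 0" using size_ge_2 by auto
  have tau: "tau_ind K Y i f - fmean n (\<lambda>i. tau_ind K Y i f) = t f i" for i f
  proof -
    have "tau_ind K Y i f = (\<Sum>q<nQ K. (gcoef K f q / 2 ^ (K - 1)) * Y i q)" for i
      by (simp add: tau_ind_def sum_divide_distrib)
    then have "tau_ind K Y i f - fmean n (\<lambda>i. tau_ind K Y i f)
      = (\<Sum>q<nQ K. (gcoef K f q / 2 ^ (K - 1)) * Y i q) - (\<Sum>q<nQ K. (gcoef K f q / 2 ^ (K - 1)) * fmean n (\<lambda>i. Y i q))"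
      by (simp only: fmean_sum)
    then show ?thesis by (simp add: t_def y_def sum_subtractf[symmetric] right_diff_distrib diff_divide_distrib)
  qed
  have a: "cov_scale n * (\<Sum>q<nQ K. gcoef K f q * gcoef K g q / (real n * (2 ^ (2 * (K - 1)) * real (nq q))) * (\<Sum>i<n. y i q * y i q))
     = (\<Sum>q<nQ K. gcoef K f q * gcoef K g q * fcov n (\<lambda>i. Y i q) (\<lambda>i. Y i q) / real (nq q)) / 2 ^ (2 * (K - 1))"
    unfolding sum_distrib_left[where r = "cov_scale n"] sum_divide_distrib[where A = "{..<nQ K}"]
  proof (rule sum.cong[OF refl])
    fix q assume "q \<in> {..<nQ K}"
    then have q0: "real (nq q) > 0" using nq[of q] by simp
    have alg: "x / (x - 1) * (u / (x * (c * m)) * s) = u * (s / (x - 1)) / m / c" if "x > 1" "c > 0" "m > 0" for x u c m s :: real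
      using that by (simp add: field_simps)
    show "cov_scale n * (gcoef K f q * gcoef K g q / (real n * (2 ^ (2 * (K - 1)) * real (nq q))) * (\<Sum>i<n. y i q * y i q))
       = gcoef K f q * gcoef K g q * fcov n (\<lambda>i. Y i q) (\<lambda>i. Y i q) / real (nq q) / 2 ^ (2 * (K - 1))"
      unfolding fcov_def cov_scale_def y_def by (rule alg) (use n2 q0 in auto)
  qed
  have b: "cov_scale n * (\<Sum>i<n. (t f i / real n) * (t g i / real n)) = fcov n (\<lambda>i. tau_ind K Y i f) (\<lambda>i. tau_ind K Y i g) / real n"
  proof -
    have "(\<Sum>i<n. (t f i / real n) * (t g i / real n)) = (\<Sum>i<n. t f i * t g i) / (real n * real n)"
      by (simp add: sum_divide_distrib)
    moreover have "x / (x - 1) * (s / (x * x)) = s / (x - 1) / x" if "x > 1" for x s :: real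
      using that by (simp add: field_simps)
    ultimately show ?thesis using n2 unfolding fcov_def tau cov_scale_def by simp
  qed
  show ?thesis
    unfolding cov_form_contrast right_diff_distrib y_def[symmetric] t_def[symmetric] a b using assms by (simp add: Vtt_def)
qed

lemma cov_form_contrast_constant:
  assumes "g < nF K"
  shows "cov_scale n * cov_form K n nq (contrast K n nq Y f) (contrast K n nq (\<lambda>i q. x i) g)
    = (\<Sum>q<nQ K. gcoef K f q * gcoef K g q / (2 ^ (2 * (K - 1)) * real (nq q)) * fcov n (\<lambda>i. Y i q) x)"
proof -
  have n2: "real n - 1 > 0" "real n > 0" using size_ge_2 by auto
  have z: "(\<Sum>q<nQ K. gcoef K g q * (x i - fmean n x) / 2 ^ (K - 1)) = 0" for i
    using gcoef_sum_zero[OF assms] by (simp add: sum_distrib_right[symmetric] sum_divide_distrib[symmetric])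
  have e: "cov_form K n nq (contrast K n nq Y f) (contrast K n nq (\<lambda>i q. x i) g)
     = (\<Sum>q<nQ K. gcoef K f q * gcoef K g q / (real n * (2 ^ (2 * (K - 1)) * real (nq q))) *
        (\<Sum>i<n. (Y i q - fmean n (\<lambda>i. Y i q)) * (x i - fmean n x)))"
    unfolding cov_form_contrast z by simp
  show ?thesis
    unfolding e sum_distrib_left[where r = "cov_scale n"]
  proof (rule sum.cong[OF refl])
    fix q assume "q \<in> {..<nQ K}"
    then have q0: "real (nq q) > 0" using nq[of q] by simp
    have alg: "m / (m - 1) * (u / (m * (c * w)) * s) = u / (c * w) * (s / (m - 1))" if "m > 1" "c > 0" "w > 0" for m u c w s :: real
      using that by (simp add: field_simps)
    show "cov_scale n * (gcoef K f q * gcoef K g q / (real n * (2 ^ (2 * (K - 1)) * real (nq q))) *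
        (\<Sum>i<n. (Y i q - fmean n (\<lambda>i. Y i q)) * (x i - fmean n x)))
      = gcoef K f q * gcoef K g q / (2 ^ (2 * (K - 1)) * real (nq q)) * fcov n (\<lambda>i. Y i q) x"
      unfolding fcov_def cov_scale_def by (rule alg) (use n2 q0 in auto)
  qed
qed

lemma Vxx_entry:
  assumes L: "1 \<le> L" and j: "j < nF K * L" and k: "k < nF K * L"
  shows "Vxx K L n nq X $$ (j, k) = cov_scale n * cov_form K n nq (xcontrast K L n nq X j) (xcontrast K L n nq X k)"
proof -
  have kd: "k div L < nF K" using k by (simp add: less_mult_imp_div_less)
  have m: "j mod L < L" "k mod L < L" using L by auto
  show ?thesis
    unfolding xcontrast_def cov_form_contrast_constant[OF kd]
    using j k m by (simp add: Vxx_def Smat_x_def sum_distrib_left sum_distrib_right sum_divide_distrib mult_ac)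
qed

end

lemma Smat_x_carrier: "Smat_x L n X \<in> carrier_mat L L"
  by (simp add: Smat_x_def)

lemma Smat_x_sym: "(Smat_x L n X)\<^sup>T = Smat_x L n X"
  by (intro eq_matI) (auto simp: Smat_x_def fcov_commute)

lemma sum_rotate3:
  fixes f :: "'a \<Rightarrow> 'b \<Rightarrow> 'c \<Rightarrow> real"
  shows "(\<Sum>a\<in>A. \<Sum>b\<in>B. \<Sum>c\<in>C. f a b c) = (\<Sum>c\<in>C. \<Sum>a\<in>A. \<Sum>b\<in>B. f a b c)"
proof -
  have "(\<Sum>a\<in>A. \<Sum>b\<in>B. \<Sum>c\<in>C. f a b c) = (\<Sum>a\<in>A. \<Sum>c\<in>C. \<Sum>b\<in>B. f a b c)"
    by (rule sum.cong[OF refl], rule sum.swap)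
  also have "\<dots> = (\<Sum>c\<in>C. \<Sum>a\<in>A. \<Sum>b\<in>B. f a b c)" by (rule sum.swap)
  finally show ?thesis .
qed

lemma sum_rotate5:
  fixes f :: "'a \<Rightarrow> 'b \<Rightarrow> 'c \<Rightarrow> 'd \<Rightarrow> 'e \<Rightarrow> real"
  shows "(\<Sum>a\<in>A. \<Sum>b\<in>B. \<Sum>c\<in>C. \<Sum>d\<in>D. \<Sum>e\<in>E. f a b c d e)
    = (\<Sum>e\<in>E. \<Sum>a\<in>A. \<Sum>b\<in>B. \<Sum>c\<in>C. \<Sum>d\<in>D. f a b c d e)"
proof -
  have "(\<Sum>a\<in>A. \<Sum>b\<in>B. \<Sum>c\<in>C. \<Sum>d\<in>D. \<Sum>e\<in>E. f a b c d e)
      = (\<Sum>a\<in>A. \<Sum>b\<in>B. \<Sum>e\<in>E. \<Sum>c\<in>C. \<Sum>d\<in>D. f a b c d e)"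
    by (rule sum.cong[OF refl], rule sum.cong[OF refl], rule sum_rotate3)
  also have "\<dots> = (\<Sum>e\<in>E. \<Sum>a\<in>A. \<Sum>b\<in>B. \<Sum>c\<in>C. \<Sum>d\<in>D. f a b c d e)" by (rule sum_rotate3)
  finally show ?thesis .
qed

lemma Smat_x_quadratic:
  assumes v: "v \<in> carrier_vec L"
  shows "v \<bullet> (Smat_x L n X *\<^sub>v v) = (\<Sum>i<n. (\<Sum>l<L. v $ l * (X i l - fmean n (\<lambda>i. X i l)))\<^sup>2) / (real n - 1)"
proof -
  let ?x = "\<lambda>i l. X i l - fmean n (\<lambda>i. X i l)"
  have c: "Smat_x L n X *\<^sub>v v \<in> carrier_vec L" using v Smat_x_carrier by (rule mult_mat_vec_carrier[rotated])
  have "v \<bullet> (Smat_x L n X *\<^sub>v v) = (\<Sum>l<L. v $ l * (\<Sum>l'<L. Smat_x L n X $$ (l, l') * v $ l'))"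
    using mult_mat_vec_sum[OF Smat_x_carrier v] by (subst scalar_prod_sum[OF c]) (simp del: index_mult_mat_vec)
  also have "\<dots> = (\<Sum>l<L. \<Sum>l'<L. \<Sum>i<n. v $ l * ?x i l * (v $ l' * ?x i l') / (real n - 1))"
    by (simp add: Smat_x_def fcov_def sum_distrib_left sum_distrib_right sum_divide_distrib mult_ac)
  also have "\<dots> = (\<Sum>i<n. \<Sum>l<L. \<Sum>l'<L. v $ l * ?x i l * (v $ l' * ?x i l') / (real n - 1))"
    by (rule sum_rotate3)
  also have "\<dots> = (\<Sum>i<n. (\<Sum>l<L. v $ l * ?x i l)\<^sup>2) / (real n - 1)"
    by (simp add: power2_eq_square sum_product sum_divide_distrib)
  finally show ?thesis .
qed

lemma Smat_x_psd: "1 \<le> n \<Longrightarrow> v \<in> carrier_vec L \<Longrightarrow> 0 \<le> v \<bullet> (Smat_x L n X *\<^sub>v v)"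
  by (simp add: Smat_x_quadratic sum_nonneg)

lemma quadratic_form_sum:
  fixes A :: "real mat"
  assumes "A \<in> carrier_mat d d" "v \<in> carrier_vec d"
  shows "v \<bullet> (A *\<^sub>v v) = (\<Sum>i<d. \<Sum>j<d. v $ i * v $ j * A $$ (i, j))"
proof -
  have "v \<bullet> (A *\<^sub>v v) = (\<Sum>i<d. v $ i * (\<Sum>j<d. A $$ (i, j) * v $ j))"
    using mult_mat_vec_sum[OF assms] by (subst scalar_prod_sum[OF mult_mat_vec_carrier[OF assms]]) (simp del: index_mult_mat_vec)
  also have "\<dots> = (\<Sum>i<d. \<Sum>j<d. v $ i * v $ j * A $$ (i, j))"
    unfolding sum_distrib_left by (intro sum.cong refl) (simp add: mult_ac)
  finally show ?thesis .
qed

lemma Vxx_carrier: "Vxx K L n nq X \<in> carrier_mat (nF K * L) (nF K * L)"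
  by (simp add: Vxx_def)

lemma Vtt_carrier: "Vtt K n nq Y \<in> carrier_mat (nF K) (nF K)"
  by (simp add: Vtt_def)

lemma Vxx_sym: "L \<ge> 1 \<Longrightarrow> (Vxx K L n nq X)\<^sup>T = Vxx K L n nq X"
  by (intro eq_matI) (auto simp: Vxx_def Smat_x_def fcov_commute mult.commute)

lemma Vtt_sym: "(Vtt K n nq Y)\<^sup>T = Vtt K n nq Y"
  by (intro eq_matI) (auto simp: Vtt_def fcov_commute mult.commute)

context
  fixes K L n :: nat and nq :: "nat \<Rightarrow> nat" and Y :: "nat \<Rightarrow> nat \<Rightarrow> real" and X :: "nat \<Rightarrow> nat \<Rightarrow> real"
  assumes K: "1 \<le> K" and nq: "\<And>q. q < nQ K \<Longrightarrow> 1 \<le> nq q" and sizes: "(\<Sum>q<nQ K. nq q) = n"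
begin

lemma n_ge: "2 \<le> n" "1 \<le> n"
  using size_ge_2[OF K nq sizes] by auto

lemma Vtt_psd:
  assumes v: "v \<in> carrier_vec (nF K)"
  shows "0 \<le> v \<bullet> (Vtt K n nq Y *\<^sub>v v)"
proof -
  define a where "a i q = (\<Sum>f<nF K. v $ f * contrast K n nq Y f i q)" for i q
  have "v \<bullet> (Vtt K n nq Y *\<^sub>v v) = (\<Sum>f<nF K. \<Sum>g<nF K. v $ f * v $ g * (cov_scale n * cov_form K n nq (contrast K n nq Y f) (contrast K n nq Y g)))"
    unfolding quadratic_form_sum[OF Vtt_carrier v] by (intro sum.cong refl) (simp add: Vtt_entry[OF K nq sizes])
  also have "\<dots> = cov_scale n * cov_form K n nq a a"
    unfolding a_def cov_form_sum_left cov_form_sum_right sum_distrib_left by (intro sum.cong refl) (simp add: mult_ac)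
  also have "\<dots> \<ge> 0"
    using lim_var_nonneg[OF sizes n_ge(2), of a] cov_scale_pos(1)[OF K nq sizes] by (simp add: lim_var_cov_form)
  finally show ?thesis .
qed

lemma Vxx_lower_bound:
  assumes c: "0 < c" "\<And>w. w \<in> carrier_vec L \<Longrightarrow> c * (w \<bullet> w) \<le> w \<bullet> (Smat_x L n X *\<^sub>v w)"
    and v: "v \<in> carrier_vec (nF K * L)"
  shows "c * real (nQ K) / (2 ^ (2 * (K - 1)) * real n) * (v \<bullet> v) \<le> v \<bullet> (Vxx K L n nq X *\<^sub>v v)"
proof -
  let ?F = "nF K" and ?h = "2 ^ (2 * (K - 1)) :: real"
  define u where "u f l = v $ (f * L + l)" for f l
  have vu: "v $ j = u (j div L) (j mod L)" for j by (simp add: u_def)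
  define w where "w q = vec L (\<lambda>l. \<Sum>f<?F. gcoef K f q * u f l)" for q
  have w: "w q \<in> carrier_vec L" for q by (simp add: w_def)
  let ?S = "\<lambda>l l'. Smat_x L n X $$ (l, l')"
  have wS: "w q \<bullet> (Smat_x L n X *\<^sub>v w q) = (\<Sum>f<?F. \<Sum>l<L. \<Sum>f'<?F. \<Sum>l'<L. gcoef K f q * gcoef K f' q * (u f l * u f' l' * ?S l l'))" for q
  proof -
    have "w q \<bullet> (Smat_x L n X *\<^sub>v w q) = (\<Sum>l<L. \<Sum>l'<L. (\<Sum>f<?F. gcoef K f q * u f l) * (\<Sum>f'<?F. gcoef K f' q * u f' l') * ?S l l')"
      unfolding quadratic_form_sum[OF Smat_x_carrier w] by (intro sum.cong refl) (simp add: w_def)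
    also have "\<dots> = (\<Sum>l<L. \<Sum>l'<L. \<Sum>f<?F. \<Sum>f'<?F. gcoef K f q * gcoef K f' q * (u f l * u f' l' * ?S l l'))"
      unfolding sum_product unfolding sum_distrib_right by (intro sum.cong refl) (simp add: mult_ac)
    also have "\<dots> = (\<Sum>l<L. \<Sum>f<?F. \<Sum>l'<L. \<Sum>f'<?F. gcoef K f q * gcoef K f' q * (u f l * u f' l' * ?S l l'))"
      by (rule sum.cong[OF refl], rule sum.swap)
    also have "\<dots> = (\<Sum>f<?F. \<Sum>l<L. \<Sum>l'<L. \<Sum>f'<?F. gcoef K f q * gcoef K f' q * (u f l * u f' l' * ?S l l'))"
      by (rule sum.swap)
    also have "\<dots> = (\<Sum>f<?F. \<Sum>l<L. \<Sum>f'<?F. \<Sum>l'<L. gcoef K f q * gcoef K f' q * (u f l * u f' l' * ?S l l'))"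
      by (rule sum.cong[OF refl], rule sum.cong[OF refl], rule sum.swap)
    finally show ?thesis .
  qed
  have "v \<bullet> (Vxx K L n nq X *\<^sub>v v) = (\<Sum>j<?F * L. \<Sum>k<?F * L. v $ j * v $ k * Vxx K L n nq X $$ (j, k))"
    by (rule quadratic_form_sum[OF Vxx_carrier v])
  also have "\<dots> = (\<Sum>j<?F * L. \<Sum>k<?F * L. u (j div L) (j mod L) * u (k div L) (k mod L) *
      ((\<Sum>q<nQ K. gcoef K (j div L) q * gcoef K (k div L) q / real (nq q)) / ?h * ?S (j mod L) (k mod L)))"
    by (intro sum.cong refl) (simp add: Vxx_def vu)
  also have "\<dots> = (\<Sum>f<?F. \<Sum>l<L. \<Sum>f'<?F. \<Sum>l'<L. u f l * u f' l' *
      ((\<Sum>q<nQ K. gcoef K f q * gcoef K f' q / real (nq q)) / ?h * ?S l l'))"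
  proof -
    have "(\<Sum>k<?F * L. u f l * u (k div L) (k mod L) *
        ((\<Sum>q<nQ K. gcoef K f q * gcoef K (k div L) q / real (nq q)) / ?h * ?S l (k mod L)))
      = (\<Sum>f'<?F. \<Sum>l'<L. u f l * u f' l' * ((\<Sum>q<nQ K. gcoef K f q * gcoef K f' q / real (nq q)) / ?h * ?S l l'))" for f l
      by (rule sum_div_mod)
    then show ?thesis
      by (simp only: sum_div_mod[of "\<lambda>a b. \<Sum>f'<?F. \<Sum>l'<L. u a b * u f' l' * ((\<Sum>q<nQ K. gcoef K a q * gcoef K f' q / real (nq q)) / ?h * ?S b l')"])
  qed
  also have "\<dots> = (\<Sum>f<?F. \<Sum>l<L. \<Sum>f'<?F. \<Sum>l'<L. \<Sum>q<nQ K. 1 / (real (nq q) * ?h) * (gcoef K f q * gcoef K f' q * (u f l * u f' l' * ?S l l')))"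
  proof (rule sum.cong[OF refl], rule sum.cong[OF refl], rule sum.cong[OF refl], rule sum.cong[OF refl])
    fix f l f' l'
    show "u f l * u f' l' * ((\<Sum>q<nQ K. gcoef K f q * gcoef K f' q / real (nq q)) / ?h * ?S l l')
      = (\<Sum>q<nQ K. 1 / (real (nq q) * ?h) * (gcoef K f q * gcoef K f' q * (u f l * u f' l' * ?S l l')))"
      unfolding sum_divide_distrib sum_distrib_right sum_distrib_left
      by (rule sum.cong[OF refl]) (simp add: mult_ac)
  qed
  also have "\<dots> = (\<Sum>q<nQ K. \<Sum>f<?F. \<Sum>l<L. \<Sum>f'<?F. \<Sum>l'<L. 1 / (real (nq q) * ?h) * (gcoef K f q * gcoef K f' q * (u f l * u f' l' * ?S l l')))"
    by (rule sum_rotate5)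
  also have "\<dots> = (\<Sum>q<nQ K. 1 / (real (nq q) * ?h) * (w q \<bullet> (Smat_x L n X *\<^sub>v w q)))"
    unfolding wS sum_distrib_left ..
  finally have e: "v \<bullet> (Vxx K L n nq X *\<^sub>v v) = (\<Sum>q<nQ K. 1 / (real (nq q) * ?h) * (w q \<bullet> (Smat_x L n X *\<^sub>v w q)))" .
  have norms: "(\<Sum>q<nQ K. w q \<bullet> w q) = real (nQ K) * (v \<bullet> v)"
  proof -
    have "(\<Sum>q<nQ K. w q \<bullet> w q) = (\<Sum>q<nQ K. \<Sum>l<L. \<Sum>f<?F. \<Sum>f'<?F. u f l * u f' l * (gcoef K f q * gcoef K f' q))"
    proof (rule sum.cong[OF refl])
      fix q
      have "w q \<bullet> w q = (\<Sum>l<L. (\<Sum>f<?F. gcoef K f q * u f l) * (\<Sum>f'<?F. gcoef K f' q * u f' l))"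
        unfolding scalar_prod_sum[OF w] by (rule sum.cong[OF refl]) (simp add: w_def)
      also have "\<dots> = (\<Sum>l<L. \<Sum>f<?F. \<Sum>f'<?F. u f l * u f' l * (gcoef K f q * gcoef K f' q))"
        unfolding sum_product by (intro sum.cong refl) (simp add: mult_ac)
      finally show "w q \<bullet> w q = (\<Sum>l<L. \<Sum>f<?F. \<Sum>f'<?F. u f l * u f' l * (gcoef K f q * gcoef K f' q))" .
    qed
    also have "\<dots> = (\<Sum>l<L. \<Sum>f<?F. \<Sum>f'<?F. \<Sum>q<nQ K. u f l * u f' l * (gcoef K f q * gcoef K f' q))"
      by (subst sum.swap) (rule sum.cong[OF refl], rule sum_rotate3[symmetric])
    also have "\<dots> = (\<Sum>l<L. \<Sum>f<?F. \<Sum>f'<?F. if f = f' then u f l * u f' l * real (nQ K) else 0)"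
      by (rule sum.cong[OF refl], rule sum.cong[OF refl], rule sum.cong[OF refl])
        (simp add: sum_distrib_left[symmetric] gcoef_row_orthogonal)
    also have "\<dots> = (\<Sum>l<L. \<Sum>f<?F. u f l * u f l * real (nQ K))" by simp
    also have "\<dots> = (\<Sum>f<?F. \<Sum>l<L. u f l * u f l * real (nQ K))" by (rule sum.swap)
    also have "\<dots> = (\<Sum>j<?F * L. u (j div L) (j mod L) * u (j div L) (j mod L) * real (nQ K))"
      by (rule sum_div_mod[symmetric])
    also have "\<dots> = real (nQ K) * (v \<bullet> v)"
      unfolding scalar_prod_sum[OF v] sum_distrib_left by (rule sum.cong[OF refl]) (simp add: vu mult_ac)
    finally show ?thesis .
  qed
  have "c * real (nQ K) / (?h * real n) * (v \<bullet> v) = c / (?h * real n) * (\<Sum>q<nQ K. w q \<bullet> w q)"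
    unfolding norms by simp
  also have "\<dots> = (\<Sum>q<nQ K. 1 / (real n * ?h) * (c * (w q \<bullet> w q)))"
    unfolding sum_distrib_left by (rule sum.cong[OF refl]) (simp add: mult_ac)
  also have "\<dots> \<le> (\<Sum>q<nQ K. 1 / (real (nq q) * ?h) * (w q \<bullet> (Smat_x L n X *\<^sub>v w q)))"
  proof (intro sum_mono mult_mono c(2) w)
    fix q assume q: "q \<in> {..<nQ K}"
    have "nq q \<le> n" using member_le_sum[of q "{..<nQ K}" nq] q sizes by auto
    then show "1 / (real n * ?h) \<le> 1 / (real (nq q) * ?h)" using nq[of q] q by (intro divide_left_mono) auto
    show "0 \<le> c * (w q \<bullet> w q)" using c(1) scalar_prod_sum[OF w, of "w q"] by (simp add: sum_nonneg)
  qed auto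
  finally show ?thesis unfolding e .
qed

end

context
  fixes K L n :: nat and nq :: "nat \<Rightarrow> nat" and Y :: "nat \<Rightarrow> nat \<Rightarrow> real" and X :: "nat \<Rightarrow> nat \<Rightarrow> real"
  assumes K: "1 \<le> K" and L: "1 \<le> L" and nq: "\<And>q. q < nQ K \<Longrightarrow> 1 \<le> nq q" and sizes: "(\<Sum>q<nQ K. nq q) = n"
    and S: "spd L (Smat_x L n X)"
begin

definition "Sinv = minv L (Smat_x L n X)"
definition "bcoef q l = (\<Sum>l'<L. Svec_qx L n Y X q $ l' * Sinv $$ (l', l))"
definition "xres i l = X i l - fmean n (\<lambda>i. X i l)"

lemma Sinv: "Sinv \<in> carrier_mat L L" "Sinv * Smat_x L n X = 1\<^sub>m L"
  unfolding Sinv_def using spd_minv[OF S] spdD(1) by auto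

lemma Ypar_linear: "Ypar L n Y X i q = fmean n (\<lambda>j. Y j q) + (\<Sum>l<L. bcoef q l * xres i l)"
proof -
  define x where "x = vec L (\<lambda>l. X i l - fmean n (\<lambda>j. X j l))"
  have x: "x \<in> carrier_vec L" by (simp add: x_def)
  have "Svec_qx L n Y X q \<bullet> (Sinv *\<^sub>v x) = (\<Sum>l'<L. Svec_qx L n Y X q $ l' * (\<Sum>l<L. Sinv $$ (l', l) * x $ l))"
    using mult_mat_vec_sum[OF Sinv(1) x] by (subst scalar_prod_sum[OF mult_mat_vec_carrier[OF Sinv(1) x]]) (simp del: index_mult_mat_vec)
  also have "\<dots> = (\<Sum>l'<L. \<Sum>l<L. Svec_qx L n Y X q $ l' * Sinv $$ (l', l) * x $ l)"
    unfolding sum_distrib_left by (intro sum.cong refl) simp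
  also have "\<dots> = (\<Sum>l<L. \<Sum>l'<L. Svec_qx L n Y X q $ l' * Sinv $$ (l', l) * x $ l)" by (rule sum.swap)
  also have "\<dots> = (\<Sum>l<L. bcoef q l * xres i l)"
    by (intro sum.cong refl) (simp add: bcoef_def xres_def x_def sum_distrib_right)
  finally show ?thesis by (simp add: Ypar_def x_def Sinv_def)
qed

lemma xres_mean: "fmean n (\<lambda>i. xres i l) = 0"
  using sum_residual[OF n_ge(2)[OF K nq sizes], of "\<lambda>i. X i l"] by (simp add: fmean_def xres_def)

lemma Ypar_residual: "Ypar L n Y X i q - fmean n (\<lambda>i. Ypar L n Y X i q) = (\<Sum>l<L. bcoef q l * xres i l)"
proof -
  have "fmean n (\<lambda>i. Ypar L n Y X i q) = fmean n (\<lambda>j. Y j q) + fmean n (\<lambda>i. \<Sum>l<L. bcoef q l * xres i l)"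
    unfolding Ypar_linear using n_ge[OF K nq sizes] by (simp add: fmean_def sum.distrib add_divide_distrib)
  also have "fmean n (\<lambda>i. \<Sum>l<L. bcoef q l * xres i l) = 0"
    unfolding fmean_sum by (simp add: xres_mean)
  finally show ?thesis by (simp add: Ypar_linear)
qed

lemma fcov_Ypar:
  assumes l: "l < L"
  shows "fcov n (\<lambda>i. Ypar L n Y X i q) (\<lambda>i. X i l) = fcov n (\<lambda>i. Y i q) (\<lambda>i. X i l)"
proof -
  have "fcov n (\<lambda>i. Ypar L n Y X i q) (\<lambda>i. X i l) = (\<Sum>i<n. (\<Sum>l'<L. bcoef q l' * xres i l') * xres i l) / (real n - 1)"
    unfolding fcov_def Ypar_residual by (simp add: xres_def)
  also have "\<dots> = (\<Sum>i<n. \<Sum>l'<L. bcoef q l' * (xres i l' * xres i l)) / (real n - 1)"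
    unfolding sum_distrib_right by (simp add: mult_ac)
  also have "\<dots> = (\<Sum>l'<L. bcoef q l' * Smat_x L n X $$ (l', l))"
    using l by (subst sum.swap) (simp add: Smat_x_def fcov_def xres_def sum_distrib_left sum_divide_distrib)
  also have "\<dots> = (\<Sum>l'<L. \<Sum>k<L. Svec_qx L n Y X q $ k * (Sinv $$ (k, l') * Smat_x L n X $$ (l', l)))"
    unfolding bcoef_def sum_distrib_right by (intro sum.cong refl) simp
  also have "\<dots> = (\<Sum>k<L. Svec_qx L n Y X q $ k * (\<Sum>l'<L. Sinv $$ (k, l') * Smat_x L n X $$ (l', l)))"
    by (subst sum.swap) (simp add: sum_distrib_left)
  also have "\<dots> = (\<Sum>k<L. Svec_qx L n Y X q $ k * (1\<^sub>m L $$ (k, l)))"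
  proof (rule sum.cong[OF refl])
    fix k assume "k \<in> {..<L}"
    then have "(\<Sum>l'<L. Sinv $$ (k, l') * Smat_x L n X $$ (l', l)) = 1\<^sub>m L $$ (k, l)"
      using mult_mat_sum[OF Sinv(1) Smat_x_carrier[of L n X], of k l, unfolded Sinv(2)] l by simp
    then show "Svec_qx L n Y X q $ k * (\<Sum>l'<L. Sinv $$ (k, l') * Smat_x L n X $$ (l', l))
        = Svec_qx L n Y X q $ k * (1\<^sub>m L $$ (k, l))" by simp
  qed
  also have "\<dots> = Svec_qx L n Y X q $ l"
    using l by (simp add: if_distrib[of "\<lambda>x. _ * x"] cong: if_cong)
  finally show ?thesis using l by (simp add: Svec_qx_def)
qed

text \<open>The contrasts of the projected outcomes are linear in the covariate contrasts up to a term that does not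
  depend on the treatment, hence does not contribute to covariances. Subtracting the multiple \<open>ccoef\<close> of the
  group sizes makes the remaining coefficients sum to zero over the treatments, so that the vectors \<open>gcoef\<close> span them.\<close>

definition "ccoef f l = (\<Sum>q<nQ K. gcoef K f q * bcoef q l) / real n"
definition "ucoef f l q = gcoef K f q * bcoef q l - real (nq q) * ccoef f l"
definition "Gcoef f j = (\<Sum>q<nQ K. gcoef K (j div L) q * ucoef f (j mod L) q) / real (nQ K)"

lemma ucoef_sum: "(\<Sum>q<nQ K. ucoef f l q) = 0"
proof -
  have "(\<Sum>q<nQ K. real (nq q)) = real n" using sizes by (simp flip: of_nat_sum)
  then have "(\<Sum>q<nQ K. real (nq q) * ccoef f l) = real n * ccoef f l"
    by (simp only: sum_distrib_right[symmetric])
  then show ?thesis using n_ge[OF K nq sizes]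
    by (simp add: ucoef_def sum_subtractf ccoef_def)
qed

lemma Gcoef_expansion:
  assumes q: "q < nQ K"
  shows "(\<Sum>f'<nF K. (\<Sum>q'<nQ K. gcoef K f' q' * ucoef f l q') / real (nQ K) * gcoef K f' q) = ucoef f l q"
proof -
  have Q0: "real (nQ K) > 0" by (simp add: nQ_def)
  have "(\<Sum>f'<nF K. (\<Sum>q'<nQ K. gcoef K f' q' * ucoef f l q') / real (nQ K) * gcoef K f' q)
    = (\<Sum>f'<nF K. \<Sum>q'<nQ K. ucoef f l q' * (gcoef K f' q' * gcoef K f' q)) / real (nQ K)"
    unfolding sum_distrib_right sum_divide_distrib by (intro sum.cong refl) simp
  also have "\<dots> = (\<Sum>q'<nQ K. ucoef f l q' * (\<Sum>f'<nF K. gcoef K f' q' * gcoef K f' q)) / real (nQ K)"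
    by (subst sum.swap) (simp add: sum_distrib_left)
  also have "(\<Sum>q'<nQ K. ucoef f l q' * (\<Sum>f'<nF K. gcoef K f' q' * gcoef K f' q))
     = (\<Sum>q'<nQ K. (if q' = q then ucoef f l q' * real (nQ K) else 0) - ucoef f l q')"
    using q by (intro sum.cong refl) (simp add: gcoef_column_orthogonal algebra_simps)
  also have "\<dots> = ucoef f l q * real (nQ K)" using q by (simp add: sum_subtractf ucoef_sum)
  finally show ?thesis using Q0 by simp
qed

lemma contrast_Ypar:
  assumes q: "q < nQ K"
  shows "contrast K n nq (Ypar L n Y X) f i q
    = (\<Sum>j<nF K * L. Gcoef f j * xcontrast K L n nq X j i q) + (\<Sum>l<L. ccoef f l * xres i l / 2 ^ (K - 1))"
proof -
  define h where "h = (2 ^ (K - 1) :: real)"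
  have h: "h > 0" by (simp add: h_def)
  have n0: "real (nq q) > 0" using nq[OF q] by simp
  let ?g = "\<lambda>f' l. (\<Sum>q'<nQ K. gcoef K f' q' * ucoef f l q') / real (nQ K) * (gcoef K f' q / (h * real (nq q)) * xres i l)"
  have "(\<Sum>j<nF K * L. Gcoef f j * xcontrast K L n nq X j i q) = (\<Sum>j<nF K * L. ?g (j div L) (j mod L))"
    by (simp add: Gcoef_def xcontrast_def contrast_def xres_def h_def)
  also have "\<dots> = (\<Sum>f'<nF K. \<Sum>l<L. ?g f' l)" by (rule sum_div_mod)
  also have "\<dots> = (\<Sum>l<L. \<Sum>f'<nF K. ?g f' l)" by (rule sum.swap)
  also have "\<dots> = (\<Sum>l<L. ucoef f l q * (xres i l / (h * real (nq q))))"
  proof (intro sum.cong refl)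
    fix l
    have "(\<Sum>f'<nF K. ?g f' l) = (\<Sum>f'<nF K. (\<Sum>q'<nQ K. gcoef K f' q' * ucoef f l q') / real (nQ K) * gcoef K f' q) * (xres i l / (h * real (nq q)))"
      unfolding sum_distrib_right[of _ _ "xres i l / (h * real (nq q))"] by (intro sum.cong refl) simp
    then show "(\<Sum>f'<nF K. ?g f' l) = ucoef f l q * (xres i l / (h * real (nq q)))" unfolding Gcoef_expansion[OF q] .
  qed
  finally have s: "(\<Sum>j<nF K * L. Gcoef f j * xcontrast K L n nq X j i q) = (\<Sum>l<L. ucoef f l q * (xres i l / (h * real (nq q))))" .
  have "contrast K n nq (Ypar L n Y X) f i q = (\<Sum>l<L. gcoef K f q / (h * real (nq q)) * (bcoef q l * xres i l))"
    unfolding contrast_def Ypar_residual h_def by (rule sum_distrib_left)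
  also have "\<dots> = (\<Sum>l<L. ucoef f l q * (xres i l / (h * real (nq q))) + ccoef f l * xres i l / h)"
    using n0 h by (intro sum.cong refl) (simp add: ucoef_def field_simps)
  finally show ?thesis unfolding s sum.distrib h_def .
qed

lemma cov_form_contrast_Ypar:
  "cov_form K n nq (contrast K n nq (Ypar L n Y X) f) b = (\<Sum>j<nF K * L. Gcoef f j * cov_form K n nq (xcontrast K L n nq X j) b)"
proof -
  have "cov_form K n nq (contrast K n nq (Ypar L n Y X) f) b
     = cov_form K n nq (\<lambda>i q. (\<Sum>j<nF K * L. Gcoef f j * xcontrast K L n nq X j i q) + (\<Sum>l<L. ccoef f l * xres i l / 2 ^ (K - 1))) b"
    by (rule cov_form_cong) (rule contrast_Ypar)
  also have "\<dots> = cov_form K n nq (\<lambda>i q. \<Sum>j<nF K * L. Gcoef f j * xcontrast K L n nq X j i q) b"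
    by (rule cov_form_add_treatment_constant[OF sizes n_ge(2)[OF K nq sizes]])
  finally show ?thesis unfolding cov_form_sum_left .
qed

lemma cov_form_contrast_Y_xcontrast:
  assumes k: "k < nF K * L"
  shows "cov_scale n * cov_form K n nq (contrast K n nq Y f) (xcontrast K L n nq X k)
    = cov_scale n * cov_form K n nq (contrast K n nq (Ypar L n Y X) f) (xcontrast K L n nq X k)"
proof -
  have kd: "k div L < nF K" using k by (simp add: less_mult_imp_div_less)
  have m: "k mod L < L" using L by simp
  have e: "cov_scale n * cov_form K n nq (contrast K n nq Y' f) (contrast K n nq (\<lambda>i q. X i (k mod L)) (k div L))
    = (\<Sum>q<nQ K. gcoef K f q * gcoef K (k div L) q / (2 ^ (2 * (K - 1)) * real (nq q)) * fcov n (\<lambda>i. Y' i q) (\<lambda>i. X i (k mod L)))" for Y'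
    by (rule cov_form_contrast_constant[OF K nq sizes kd])
  show ?thesis unfolding xcontrast_def e fcov_Ypar[OF m] ..
qed

definition "Gmat = mat (nF K) (nF K * L) (\<lambda>(f, j). Gcoef f j)"

lemma cross_covariance_projection:
  assumes f: "f < nF K" and k: "k < nF K * L"
  shows "cov_scale n * cov_form K n nq (contrast K n nq Y f) (xcontrast K L n nq X k) = (Gmat * Vxx K L n nq X) $$ (f, k)"
proof -
  have G: "Gmat \<in> carrier_mat (nF K) (nF K * L)" by (simp add: Gmat_def)
  show ?thesis
    unfolding cov_form_contrast_Y_xcontrast[OF k] cov_form_contrast_Ypar mult_mat_sum[OF G Vxx_carrier f k] sum_distrib_left
    using f k by (intro sum.cong refl) (simp add: Gmat_def Vxx_entry[OF K nq sizes L] del: index_mult_mat)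
qed

lemma Vtt_Ypar: "Vtt K n nq (Ypar L n Y X) = Gmat * Vxx K L n nq X * Gmat\<^sup>T"
proof (rule eq_matI)
  have G: "Gmat \<in> carrier_mat (nF K) (nF K * L)" by (simp add: Gmat_def)
  have GT: "Gmat\<^sup>T \<in> carrier_mat (nF K * L) (nF K)" using G by simp
  have GV: "Gmat * Vxx K L n nq X \<in> carrier_mat (nF K) (nF K * L)" using G Vxx_carrier by simp
  show "dim_row (Vtt K n nq (Ypar L n Y X)) = dim_row (Gmat * Vxx K L n nq X * Gmat\<^sup>T)"
    "dim_col (Vtt K n nq (Ypar L n Y X)) = dim_col (Gmat * Vxx K L n nq X * Gmat\<^sup>T)"
    using G by (auto simp: Vtt_def)
  fix f g assume "f < dim_row (Gmat * Vxx K L n nq X * Gmat\<^sup>T)" "g < dim_col (Gmat * Vxx K L n nq X * Gmat\<^sup>T)"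
  then have fg: "f < nF K" "g < nF K" using G by auto
  have "Vtt K n nq (Ypar L n Y X) $$ (f, g)
     = cov_scale n * cov_form K n nq (contrast K n nq (Ypar L n Y X) g) (contrast K n nq (Ypar L n Y X) f)"
    by (subst cov_form_commute) (rule Vtt_entry[OF K nq sizes fg])
  also have "\<dots> = (\<Sum>k<nF K * L. Gcoef g k * (cov_scale n * cov_form K n nq (contrast K n nq (Ypar L n Y X) f) (xcontrast K L n nq X k)))"
    unfolding cov_form_contrast_Ypar[of g] by (subst cov_form_commute) (unfold sum_distrib_left, simp add: mult_ac)
  also have "\<dots> = (\<Sum>k<nF K * L. (Gmat * Vxx K L n nq X) $$ (f, k) * Gmat\<^sup>T $$ (k, g))"
  proof (intro sum.cong refl)
    fix k assume k: "k \<in> {..<nF K * L}"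
    then have k': "k < nF K * L" by simp
    have "Gmat\<^sup>T $$ (k, g) = Gcoef g k" using k fg by (simp add: Gmat_def)
    then show "Gcoef g k * (cov_scale n * cov_form K n nq (contrast K n nq (Ypar L n Y X) f) (xcontrast K L n nq X k))
       = (Gmat * Vxx K L n nq X) $$ (f, k) * Gmat\<^sup>T $$ (k, g)"
      using cross_covariance_projection[OF fg(1) k'] cov_form_contrast_Y_xcontrast[OF k'] by (simp del: index_mult_mat)
  qed
  also have "\<dots> = (Gmat * Vxx K L n nq X * Gmat\<^sup>T) $$ (f, g)" by (rule mult_mat_sum[OF GV GT fg, symmetric])
  finally show "Vtt K n nq (Ypar L n Y X) $$ (f, g) = (Gmat * Vxx K L n nq X * Gmat\<^sup>T) $$ (f, g)" .
qed

end

section \<open>Standardized contrasts\<close>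

lemma lin_stat_sum:
  "lin_stat n (\<lambda>i q. \<Sum>k<(d::nat). c k * a k i q) Z = (\<Sum>k<d. c k * lin_stat n (a k) Z)"
  unfolding lin_stat_def by (subst sum.swap) (simp add: sum_distrib_left)

lemma centred_sum:
  assumes "\<And>k. k < d \<Longrightarrow> centred K n (a k)"
  shows "centred K n (\<lambda>i q. \<Sum>k<d. c k * a k i q)"
  unfolding centred_def
proof (intro allI impI)
  fix q assume q: "q < nQ K"
  have "(\<Sum>i<n. \<Sum>k<d. c k * a k i q) = (\<Sum>k<d. c k * (\<Sum>i<n. a k i q))"
    by (subst sum.swap) (simp add: sum_distrib_left)
  also have "\<dots> = 0" using assms q by (intro sum.neutral) (auto simp: centred_def)
  finally show "(\<Sum>i<n. \<Sum>k<d. c k * a k i q) = 0" .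
qed

lemma centred_add: "centred K n a \<Longrightarrow> centred K n b \<Longrightarrow> centred K n (\<lambda>i q. a i q + b i q)"
  by (simp add: centred_def sum.distrib)

lemma cov_form_linear_images:
  assumes P: "P \<in> carrier_mat d d'" and R: "R \<in> carrier_mat e e'" and M: "M \<in> carrier_mat d' e'"
    and entry: "\<And>g k. g < d' \<Longrightarrow> k < e' \<Longrightarrow> s * cov_form K n nq (a g) (b k) = M $$ (g, k)"
    and f: "f < d" and j: "j < e"
  shows "s * cov_form K n nq (\<lambda>i q. \<Sum>g<d'. P $$ (f, g) * a g i q) (\<lambda>i q. \<Sum>k<e'. R $$ (j, k) * b k i q)
    = (P * M * R\<^sup>T) $$ (f, j)"
proof -
  have RT: "R\<^sup>T \<in> carrier_mat e' e" using R by simp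
  have PM: "P * M \<in> carrier_mat d e'" using P M by simp
  have "s * cov_form K n nq (\<lambda>i q. \<Sum>g<d'. P $$ (f, g) * a g i q) (\<lambda>i q. \<Sum>k<e'. R $$ (j, k) * b k i q)
     = (\<Sum>g<d'. \<Sum>k<e'. P $$ (f, g) * (s * cov_form K n nq (a g) (b k)) * R $$ (j, k))"
    unfolding cov_form_sum_left cov_form_sum_right sum_distrib_left by (intro sum.cong refl) (simp add: mult_ac)
  also have "\<dots> = (\<Sum>g<d'. \<Sum>k<e'. P $$ (f, g) * M $$ (g, k) * R $$ (j, k))"
    using entry by (intro sum.cong refl) simp
  also have "\<dots> = (\<Sum>k<e'. \<Sum>g<d'. P $$ (f, g) * M $$ (g, k) * R $$ (j, k))" by (rule sum.swap)
  also have "\<dots> = (\<Sum>k<e'. (P * M) $$ (f, k) * R\<^sup>T $$ (k, j))"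
    using mult_mat_sum[OF P M f] R j by (intro sum.cong refl) (simp add: sum_distrib_right del: index_mult_mat)
  also have "\<dots> = (P * M * R\<^sup>T) $$ (f, j)" by (rule mult_mat_sum[OF PM RT f j, symmetric])
  finally show ?thesis .
qed

lemma sum_squares_linear_image:
  fixes A :: "real mat"
  assumes A: "A \<in> carrier_mat d d" and D: "D \<in> carrier_vec d"
  shows "(\<Sum>f<d. (\<Sum>g<d. A $$ (f, g) * D $ g)\<^sup>2) = D \<bullet> ((A\<^sup>T * A) *\<^sub>v D)"
proof -
  have AT: "A\<^sup>T \<in> carrier_mat d d" using A by simp
  have AD: "A *\<^sub>v D \<in> carrier_vec d" using A D by simp
  have "(\<Sum>f<d. (\<Sum>g<d. A $$ (f, g) * D $ g)\<^sup>2) = (A *\<^sub>v D) \<bullet> (A *\<^sub>v D)"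
    unfolding scalar_prod_sum[OF AD] using mult_mat_vec_sum[OF A D] by (simp add: power2_eq_square del: index_mult_mat_vec)
  also have "\<dots> = D \<bullet> (A\<^sup>T *\<^sub>v (A *\<^sub>v D))"
    using bilinear_transpose[OF AT D AD] by simp
  also have "A\<^sup>T *\<^sub>v (A *\<^sub>v D) = (A\<^sup>T * A) *\<^sub>v D"
    using A AT D by (simp add: assoc_mult_mat_vec[of _ d d _ d])
  finally show ?thesis .
qed

lemma psd_sqrt_minv_whitens:
  assumes V: "spd d V"
  defines "W \<equiv> psd_sqrt d (minv d V)"
  shows "W \<in> carrier_mat d d" "W\<^sup>T = W" "W * W = minv d V" "W * V * W = 1\<^sub>m d"
proof -
  note M = spd_minv[OF V]
  note Wp = psd_sqrt_spd[OF M(1), folded W_def]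
  show W: "W \<in> carrier_mat d d" "W\<^sup>T = W" "W * W = minv d V" by (fact Wp)+
  have Vc: "V \<in> carrier_mat d d" using V by (rule spdD)
  have "W * (W * V) = 1\<^sub>m d"
    using W(1) Vc M(3) W(3) by (simp flip: assoc_mult_mat[of _ d d _ d _ d])
  moreover have "W * V \<in> carrier_mat d d" using W Vc by simp
  ultimately show "W * V * W = 1\<^sub>m d" using mat_mult_left_right_inverse[OF W(1), of "W * V"] by simp
qed

context
  fixes K L n :: nat and nq :: "nat \<Rightarrow> nat" and Y :: "nat \<Rightarrow> nat \<Rightarrow> real" and X :: "nat \<Rightarrow> nat \<Rightarrow> real"
    and Om :: "real mat"
  assumes K: "1 \<le> K" and L: "1 \<le> L" and nq: "\<And>q. q < nQ K \<Longrightarrow> 1 \<le> nq q" and sizes: "(\<Sum>q<nQ K. nq q) = n"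
    and Sinvt: "invertible_mat (Smat_x L n X)" and Vinvt: "invertible_mat (Vtt K n nq Y)"
    and Om: "Om \<in> carrier_mat (nF K) (nF K)" "Om\<^sup>T * Om = 1\<^sub>m (nF K)"
begin

lemma Om_right: "Om * Om\<^sup>T = 1\<^sub>m (nF K)"
  using mat_mult_left_right_inverse[of "Om\<^sup>T" "nF K" Om] Om by simp

lemma S_lower: "\<exists>c>0. \<forall>v\<in>carrier_vec L. c * (v \<bullet> v) \<le> v \<bullet> (Smat_x L n X *\<^sub>v v)"
  by (rule psd_invertible_lower_bound[OF Smat_x_carrier Smat_x_sym Smat_x_psd[OF n_ge(2)[OF K nq sizes]] Sinvt])

lemma S_spd: "spd L (Smat_x L n X)"
  using S_lower psd_lower_bound_spd[OF Smat_x_carrier Smat_x_sym] by blast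

lemma Vtt_spd: "spd (nF K) (Vtt K n nq Y)"
  using psd_invertible_lower_bound[OF Vtt_carrier Vtt_sym Vtt_psd[OF K nq sizes] Vinvt]
    psd_lower_bound_spd[OF Vtt_carrier Vtt_sym] by blast

lemma Vxx_spd: "spd (nF K * L) (Vxx K L n nq X)"
proof -
  obtain c where c: "c > 0" "\<And>v. v \<in> carrier_vec L \<Longrightarrow> c * (v \<bullet> v) \<le> v \<bullet> (Smat_x L n X *\<^sub>v v)"
    using S_lower by blast
  have n: "2 \<le> n" by (rule n_ge(1)[OF K nq sizes])
  have "0 < c * real (nQ K) / (2 ^ (2 * (K - 1)) * real n)" using c n by (simp add: nQ_def)
  then show ?thesis
    by (rule psd_lower_bound_spd[OF Vxx_carrier Vxx_sym[OF L]]) (rule Vxx_lower_bound[OF K nq sizes c])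
qed

definition "Umat = Om * psd_sqrt (nF K) (minv (nF K) (Vtt K n nq Y))"
definition "Xmat = psd_sqrt (nF K * L) (minv (nF K * L) (Vxx K L n nq X))"
definition "Cmat = Umat * (Gmat K L n nq Y X * Vxx K L n nq X) * Xmat\<^sup>T"
definition "ucontrast f i q = (\<Sum>g<nF K. Umat $$ (f, g) * contrast K n nq Y g i q)"
definition "vcontrast j i q = (\<Sum>k<nF K * L. Xmat $$ (j, k) * xcontrast K L n nq X k i q)"

lemmas Vtt_root = psd_sqrt_minv_whitens[OF Vtt_spd]
lemmas Vxx_root = psd_sqrt_minv_whitens[OF Vxx_spd, folded Xmat_def]

lemma Umat_carrier: "Umat \<in> carrier_mat (nF K) (nF K)"
  unfolding Umat_def using Om Vtt_root(1) by simp

lemma Umat_gram: "Umat\<^sup>T * Umat = minv (nF K) (Vtt K n nq Y)"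
proof -
  let ?W = "psd_sqrt (nF K) (minv (nF K) (Vtt K n nq Y))"
  have OT: "Om\<^sup>T \<in> carrier_mat (nF K) (nF K)" using Om by simp
  have "Umat\<^sup>T = ?W * Om\<^sup>T" unfolding Umat_def using transpose_mult[OF Om(1) Vtt_root(1)] Vtt_root(2) by simp
  then have "Umat\<^sup>T * Umat = ?W * (Om\<^sup>T * Om) * ?W"
    unfolding Umat_def using Om(1) OT Vtt_root(1) by (simp add: assoc_mult_mat[of _ "nF K" "nF K" _ "nF K" _ "nF K"])
  then show ?thesis unfolding Om(2) using Vtt_root(1,3) by simp
qed

lemma Umat_whitens: "Umat * Vtt K n nq Y * Umat\<^sup>T = 1\<^sub>m (nF K)"
proof -
  let ?W = "psd_sqrt (nF K) (minv (nF K) (Vtt K n nq Y))"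
  have OT: "Om\<^sup>T \<in> carrier_mat (nF K) (nF K)" using Om by simp
  have UT: "Umat\<^sup>T = ?W * Om\<^sup>T" unfolding Umat_def using transpose_mult[OF Om(1) Vtt_root(1)] Vtt_root(2) by simp
  have "Umat * Vtt K n nq Y * Umat\<^sup>T = Om * (?W * Vtt K n nq Y * ?W) * Om\<^sup>T"
    unfolding UT unfolding Umat_def using Om(1) OT Vtt_root(1) Vtt_carrier[of K n nq Y]
    by (simp add: assoc_mult_mat[of _ "nF K" "nF K" _ "nF K" _ "nF K"])
  then show ?thesis unfolding Vtt_root(4) using Om(1) Om_right by simp
qed

lemma Xmat_gram: "Xmat\<^sup>T * Xmat = minv (nF K * L) (Vxx K L n nq X)"
  unfolding Vxx_root(2) by (rule Vxx_root(3))

lemma Xmat_whitens: "Xmat * Vxx K L n nq X * Xmat\<^sup>T = 1\<^sub>m (nF K * L)"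
  unfolding Vxx_root(2) by (rule Vxx_root(4))

lemma ucontrast_norm:
  assumes Z: "Z \<in> assignments K n nq"
  shows "(\<Sum>f<nF K. (lin_stat n (ucontrast f) Z)\<^sup>2)
    = (tau_hat K n nq Y Z - tau_avg K n Y) \<bullet> (minv (nF K) (Vtt K n nq Y) *\<^sub>v (tau_hat K n nq Y Z - tau_avg K n Y))"
proof -
  define D where "D = tau_hat K n nq Y Z - tau_avg K n Y"
  have D: "D \<in> carrier_vec (nF K)" by (simp add: D_def tau_hat_def tau_avg_def)
  have Dg: "D $ g = lin_stat n (contrast K n nq Y g) Z" if "g < nF K" for g
    using that lin_stat_contrast[OF Z nq] by (simp add: D_def tau_hat_def tau_avg_def)
  have "lin_stat n (ucontrast f) Z = (\<Sum>g<nF K. Umat $$ (f, g) * D $ g)" for f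
    unfolding ucontrast_def lin_stat_sum by (intro sum.cong refl) (simp add: Dg)
  then show ?thesis
    using sum_squares_linear_image[OF Umat_carrier D] unfolding Umat_gram D_def by simp
qed

lemma vcontrast_norm:
  assumes Z: "Z \<in> assignments K n nq"
  shows "(\<Sum>j<nF K * L. (lin_stat n (vcontrast j) Z)\<^sup>2)
    = tau_hat_x K L n nq X Z \<bullet> (minv (nF K * L) (Vxx K L n nq X) *\<^sub>v tau_hat_x K L n nq X Z)"
proof -
  define D where "D = tau_hat_x K L n nq X Z"
  have D: "D \<in> carrier_vec (nF K * L)" by (simp add: D_def tau_hat_x_def)
  have Dg: "D $ k = lin_stat n (xcontrast K L n nq X k) Z" if k: "k < nF K * L" for k
  proof -
    have kd: "k div L < nF K" using k by (simp add: less_mult_imp_div_less)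
    have "(\<Sum>q<nQ K. gcoef K (k div L) q * fmean n (\<lambda>i. X i (k mod L))) = 0"
      using gcoef_sum_zero[OF kd] by (simp add: sum_distrib_right[symmetric])
    then show ?thesis
      using k lin_stat_contrast[OF Z nq, of "\<lambda>i q. X i (k mod L)" "k div L"] by (simp add: xcontrast_def D_def tau_hat_x_def)
  qed
  have "lin_stat n (vcontrast j) Z = (\<Sum>k<nF K * L. Xmat $$ (j, k) * D $ k)" for j
    unfolding vcontrast_def lin_stat_sum by (intro sum.cong refl) (simp add: Dg)
  then show ?thesis
    using sum_squares_linear_image[OF Vxx_root(1) D] unfolding Xmat_gram D_def by simp
qed

lemma G_carrier: "Gmat K L n nq Y X \<in> carrier_mat (nF K) (nF K * L)"
  by (simp add: Gmat_def[OF K L nq sizes S_spd])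

lemma Cmat_carrier: "Cmat \<in> carrier_mat (nF K) (nF K * L)"
proof -
  have GV: "Gmat K L n nq Y X * Vxx K L n nq X \<in> carrier_mat (nF K) (nF K * L)"
    by (rule mult_carrier_mat[OF G_carrier Vxx_carrier])
  show ?thesis
    unfolding Cmat_def Vxx_root(2) by (rule mult_carrier_mat[OF mult_carrier_mat[OF Umat_carrier GV] Vxx_root(1)])
qed

lemma Cmat_gram: "Cmat * Cmat\<^sup>T = Om * Rmat K L n nq Y X * Om\<^sup>T"
proof -
  let ?F = "nF K" and ?E = "nF K * L"
  let ?V = "Vxx K L n nq X" and ?G = "Gmat K L n nq Y X" and ?W = "psd_sqrt (nF K) (minv (nF K) (Vtt K n nq Y))"
  have V: "?V \<in> carrier_mat ?E ?E" by (rule Vxx_carrier)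
  have G: "?G \<in> carrier_mat ?F ?E" by (rule G_carrier)
  have GT: "?G\<^sup>T \<in> carrier_mat ?E ?F" using G by simp
  have U: "Umat \<in> carrier_mat ?F ?F" by (rule Umat_carrier)
  have UT: "Umat\<^sup>T \<in> carrier_mat ?F ?F" using U by simp
  have X: "Xmat \<in> carrier_mat ?E ?E" by (rule Vxx_root(1))
  have OT: "Om\<^sup>T \<in> carrier_mat ?F ?F" using Om by simp
  have GV: "?G * ?V \<in> carrier_mat ?F ?E" using G V by simp
  have UGV: "Umat * (?G * ?V) \<in> carrier_mat ?F ?E" using U GV by simp
  have M: "minv ?E ?V \<in> carrier_mat ?E ?E" using spd_minv(1)[OF Vxx_spd] by (rule spdD)
  have CT: "Cmat\<^sup>T = Xmat * (?V * (?G\<^sup>T * Umat\<^sup>T))"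
    unfolding Cmat_def Vxx_root(2)
    using transpose_mult[OF UGV X] transpose_mult[OF U GV] transpose_mult[OF G V] Vxx_root(2) Vxx_sym[OF L, of K n nq X]
      assoc_mult_mat[OF V GT UT] by simp
  have GU: "?G\<^sup>T * Umat\<^sup>T \<in> carrier_mat ?E ?F" using GT UT by simp
  have VGU: "?V * (?G\<^sup>T * Umat\<^sup>T) \<in> carrier_mat ?E ?F" using V GU by simp
  have "Cmat * Cmat\<^sup>T = (Umat * (?G * ?V)) * (Xmat * (Xmat * (?V * (?G\<^sup>T * Umat\<^sup>T))))"
    unfolding CT unfolding Cmat_def Vxx_root(2) using assoc_mult_mat[OF UGV X, of "Xmat * (?V * (?G\<^sup>T * Umat\<^sup>T))" ?F] X VGU by simp
  also have "Xmat * (Xmat * (?V * (?G\<^sup>T * Umat\<^sup>T))) = minv ?E ?V * (?V * (?G\<^sup>T * Umat\<^sup>T))"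
    using assoc_mult_mat[OF X X VGU] Vxx_root(3) by simp
  also have "\<dots> = ?G\<^sup>T * Umat\<^sup>T"
    unfolding assoc_mult_mat[OF M V GU, symmetric] spd_minv(3)[OF Vxx_spd] by (rule left_mult_one_mat[OF GU])
  also have "(Umat * (?G * ?V)) * (?G\<^sup>T * Umat\<^sup>T) = Umat * (?G * ?V * ?G\<^sup>T) * Umat\<^sup>T"
    using assoc_mult_mat[OF UGV GT UT] assoc_mult_mat[OF U GV GT] by simp
  also have "?G * ?V * ?G\<^sup>T = Vtt K n nq (Ypar L n Y X)"
    by (rule Vtt_Ypar[OF K L nq sizes S_spd, symmetric])
  also have "Umat * Vtt K n nq (Ypar L n Y X) * Umat\<^sup>T = Om * Rmat K L n nq Y X * Om\<^sup>T"
  proof -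
    have T: "Umat\<^sup>T = ?W * Om\<^sup>T" unfolding Umat_def using transpose_mult[OF Om(1) Vtt_root(1)] Vtt_root(2) by simp
    show ?thesis
      unfolding T unfolding Umat_def Rmat_def Let_def using Om(1) OT Vtt_root(1) Vtt_carrier[of K n nq "Ypar L n Y X"]
      by (simp add: assoc_mult_mat[of _ "nF K" "nF K" _ "nF K" _ "nF K"])
  qed
  finally show ?thesis .
qed

lemma lim_var_standardized:
  fixes x y :: "nat \<Rightarrow> real"
  shows "cov_scale n * lim_var K n nq (\<lambda>i q. (\<Sum>f<nF K. x f * ucontrast f i q) + (\<Sum>j<nF K * L. y j * vcontrast j i q))
    = (\<Sum>f<nF K. (x f)\<^sup>2) + 2 * (\<Sum>j<nF K * L. (\<Sum>f<nF K. Cmat $$ (f, j) * x f) * y j) + (\<Sum>j<nF K * L. (y j)\<^sup>2)"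
proof -
  let ?F = "nF K" and ?E = "nF K * L"
  let ?c = "\<lambda>a b. cov_scale n * cov_form K n nq a b"
  have uu: "?c (ucontrast f) (ucontrast g) = (if f = g then 1 else 0)" if "f < ?F" "g < ?F" for f g
    unfolding ucontrast_def
    using cov_form_linear_images[OF Umat_carrier Umat_carrier Vtt_carrier Vtt_entry[OF K nq sizes, symmetric] that] that
    by (simp add: Umat_whitens)
  have vv: "?c (vcontrast j) (vcontrast k) = (if j = k then 1 else 0)" if "j < ?E" "k < ?E" for j k
    unfolding vcontrast_def
    using cov_form_linear_images[OF Vxx_root(1) Vxx_root(1) Vxx_carrier Vxx_entry[OF K nq sizes L, symmetric] that] that
    by (simp add: Xmat_whitens)
  have GV: "Gmat K L n nq Y X * Vxx K L n nq X \<in> carrier_mat ?F ?E" using G_carrier Vxx_carrier by simp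
  have uv: "?c (ucontrast f) (vcontrast j) = Cmat $$ (f, j)" if "f < ?F" "j < ?E" for f j
    unfolding ucontrast_def vcontrast_def Cmat_def
    by (rule cov_form_linear_images[OF Umat_carrier Vxx_root(1) GV cross_covariance_projection[OF K L nq sizes S_spd] that])
  define a1 where "a1 i q = (\<Sum>f<?F. x f * ucontrast f i q)" for i q
  define a2 where "a2 i q = (\<Sum>j<?E. y j * vcontrast j i q)" for i q
  have s11: "?c a1 a1 = (\<Sum>f<?F. (x f)\<^sup>2)"
  proof -
    have "?c a1 a1 = (\<Sum>f<?F. \<Sum>g<?F. x f * x g * ?c (ucontrast f) (ucontrast g))"
      unfolding a1_def cov_form_sum_left cov_form_sum_right sum_distrib_left by (intro sum.cong refl) (simp add: mult_ac)
    also have "\<dots> = (\<Sum>f<?F. \<Sum>g<?F. if f = g then x f * x g else 0)"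
      by (intro sum.cong refl) (simp add: uu)
    finally show ?thesis by (simp add: power2_eq_square)
  qed
  have s22: "?c a2 a2 = (\<Sum>j<?E. (y j)\<^sup>2)"
  proof -
    have "?c a2 a2 = (\<Sum>j<?E. \<Sum>k<?E. y j * y k * ?c (vcontrast j) (vcontrast k))"
      unfolding a2_def cov_form_sum_left cov_form_sum_right sum_distrib_left by (intro sum.cong refl) (simp add: mult_ac)
    also have "\<dots> = (\<Sum>j<?E. \<Sum>k<?E. if j = k then y j * y k else 0)"
      by (intro sum.cong refl) (simp add: vv)
    finally show ?thesis by (simp add: power2_eq_square)
  qed
  have s12: "?c a1 a2 = (\<Sum>j<?E. (\<Sum>f<?F. Cmat $$ (f, j) * x f) * y j)"
  proof -
    have "?c a1 a2 = (\<Sum>f<?F. \<Sum>j<?E. x f * y j * ?c (ucontrast f) (vcontrast j))"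
      unfolding a1_def a2_def cov_form_sum_left cov_form_sum_right sum_distrib_left by (intro sum.cong refl) (simp add: mult_ac)
    also have "\<dots> = (\<Sum>f<?F. \<Sum>j<?E. Cmat $$ (f, j) * x f * y j)"
      by (intro sum.cong refl) (simp add: uv)
    also have "\<dots> = (\<Sum>j<?E. \<Sum>f<?F. Cmat $$ (f, j) * x f * y j)" by (rule sum.swap)
    finally show ?thesis by (simp add: sum_distrib_right)
  qed
  have add_right: "cov_form K n nq a (\<lambda>i q. b i q + c i q) = cov_form K n nq a b + cov_form K n nq a c" for a b c
    using cov_form_add_left[of K n nq b c a] by (simp add: cov_form_commute[of K n nq a])
  have "cov_scale n * lim_var K n nq (\<lambda>i q. a1 i q + a2 i q) = ?c a1 a1 + 2 * ?c a1 a2 + ?c a2 a2"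
    unfolding lim_var_cov_form cov_form_add_left add_right using cov_form_commute[of K n nq a2 a1] by (simp add: algebra_simps)
  then show ?thesis unfolding s11 s12 s22 unfolding a1_def a2_def by simp
qed

lemma Cmat_contraction:
  fixes x :: "nat \<Rightarrow> real"
  shows "(\<Sum>j<nF K * L. (\<Sum>f<nF K. Cmat $$ (f, j) * x f)\<^sup>2) \<le> (\<Sum>f<nF K. (x f)\<^sup>2)"
proof -
  define y where "y j = - (\<Sum>f<nF K. Cmat $$ (f, j) * x f)" for j
  have "0 \<le> cov_scale n * lim_var K n nq (\<lambda>i q. (\<Sum>f<nF K. x f * ucontrast f i q) + (\<Sum>j<nF K * L. y j * vcontrast j i q))"
    using lim_var_nonneg[OF sizes n_ge(2)[OF K nq sizes]] cov_scale_pos(1)[OF K nq sizes] by simp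
  also have "\<dots> = (\<Sum>f<nF K. (x f)\<^sup>2) - (\<Sum>j<nF K * L. (\<Sum>f<nF K. Cmat $$ (f, j) * x f)\<^sup>2)"
    unfolding lim_var_standardized by (simp add: y_def power2_eq_square sum_negf)
  finally show ?thesis by simp
qed

lemma Rmat_sym: "(Rmat K L n nq Y X)\<^sup>T = Rmat K L n nq Y X"
  unfolding Rmat_def Let_def using Vtt_root(1,2) Vtt_carrier[of K n nq "Ypar L n Y X"] Vtt_sym[of K n nq "Ypar L n Y X"]
  by (simp add: transpose_mult[of _ "nF K" "nF K" _ "nF K"] assoc_mult_mat[of _ "nF K" "nF K" _ "nF K" _ "nF K"])

lemma Rmat_carrier: "Rmat K L n nq Y X \<in> carrier_mat (nF K) (nF K)"
  unfolding Rmat_def Let_def using Vtt_root(1) Vtt_carrier[of K n nq "Ypar L n Y X"] by simp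

lemma standardized_centred:
  "centred K n (\<lambda>i q. (\<Sum>f<nF K. x f * ucontrast f i q) + (\<Sum>j<nF K * L. y j * vcontrast j i q))"
  unfolding ucontrast_def vcontrast_def xcontrast_def
  by (intro centred_add centred_sum contrast_centred n_ge(2)[OF K nq sizes])

lemma Umat_entry_le:
  assumes c: "0 < c" "\<And>v. v \<in> carrier_vec (nF K) \<Longrightarrow> c * (v \<bullet> v) \<le> v \<bullet> (Vtt K n nq Y *\<^sub>v v)"
    and f: "f < nF K" and g: "g < nF K"
  shows "\<bar>Umat $$ (f, g)\<bar> \<le> real (nF K) * sqrt (1 / c)"
proof -
  let ?W = "psd_sqrt (nF K) (minv (nF K) (Vtt K n nq Y))"
  have w: "\<bar>?W $$ (h, g)\<bar> \<le> sqrt (1 / c)" if "h < nF K" for h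
    using psd_sqrt_minv_bound[OF Vtt_spd c that g] by (rule real_le_rsqrt[of "\<bar>_\<bar>", unfolded power2_abs])
  have o: "\<bar>Om $$ (f, h)\<bar> \<le> 1" if h: "h < nF K" for h
  proof -
    have OT: "Om\<^sup>T \<in> carrier_mat (nF K) (nF K)" using Om by simp
    have "(\<Sum>k<nF K. (Om $$ (f, k))\<^sup>2) = (\<Sum>k<nF K. Om $$ (f, k) * Om\<^sup>T $$ (k, f))"
      using Om(1) f by (intro sum.cong refl) (simp add: power2_eq_square)
    also have "\<dots> = (Om * Om\<^sup>T) $$ (f, f)" by (rule mult_mat_sum[OF Om(1) OT f f, symmetric])
    also have "\<dots> = 1" unfolding Om_right using f by simp
    finally have "(\<Sum>k<nF K. (Om $$ (f, k))\<^sup>2) = 1" .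
    moreover have "(Om $$ (f, h))\<^sup>2 \<le> (\<Sum>k<nF K. (Om $$ (f, k))\<^sup>2)" using h by (intro member_le_sum) auto
    ultimately show ?thesis by (simp add: abs_square_le_1)
  qed
  have "Umat $$ (f, g) = (\<Sum>h<nF K. Om $$ (f, h) * ?W $$ (h, g))"
    unfolding Umat_def by (rule mult_mat_sum[OF Om(1) Vtt_root(1) f g])
  then have "\<bar>Umat $$ (f, g)\<bar> \<le> (\<Sum>h<nF K. \<bar>Om $$ (f, h) * ?W $$ (h, g)\<bar>)" by (simp only: sum_abs)
  also have "\<dots> \<le> (\<Sum>h<nF K. 1 * sqrt (1 / c))"
    unfolding abs_mult using w o c(1) by (intro sum_mono mult_mono) auto
  finally show ?thesis by simp
qed

lemma Xmat_entry_le: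
  assumes c: "0 < c" "\<And>w. w \<in> carrier_vec L \<Longrightarrow> c * (w \<bullet> w) \<le> w \<bullet> (Smat_x L n X *\<^sub>v w)"
    and j: "j < nF K * L" and k: "k < nF K * L"
  shows "\<bar>Xmat $$ (j, k)\<bar> \<le> sqrt (1 / (c * real (nQ K) / (2 ^ (2 * (K - 1)) * real n)))"
proof -
  have n: "2 \<le> n" by (rule n_ge(1)[OF K nq sizes])
  have c': "0 < c * real (nQ K) / (2 ^ (2 * (K - 1)) * real n)" using c n by (simp add: nQ_def)
  have "(Xmat $$ (j, k))\<^sup>2 \<le> 1 / (c * real (nQ K) / (2 ^ (2 * (K - 1)) * real n))"
    unfolding Xmat_def
    by (rule psd_sqrt_minv_bound[OF Vxx_spd c' _ j k]) (rule Vxx_lower_bound[OF K nq sizes c])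
  then show ?thesis by (rule real_le_rsqrt[of "\<bar>_\<bar>", unfolded power2_abs])
qed

definition "resid_sq i = (\<Sum>q<nQ K. (Y i q - fmean n (\<lambda>i. Y i q))\<^sup>2) + (\<Sum>l<L. (X i l - fmean n (\<lambda>i. X i l))\<^sup>2)"

lemma resid_sq_nonneg: "0 \<le> resid_sq i"
  unfolding resid_sq_def by (simp add: sum_nonneg)

lemma resid_sq_sum:
  "(\<Sum>i<n. resid_sq i) = (real n - 1) * ((\<Sum>q<nQ K. fcov n (\<lambda>i. Y i q) (\<lambda>i. Y i q)) + (\<Sum>l<L. Smat_x L n X $$ (l, l)))"
proof -
  have n: "real n - 1 > 0" using n_ge(1)[OF K nq sizes] by simp
  have e: "(\<Sum>i<n. (h i - fmean n h)\<^sup>2) = (real n - 1) * fcov n h h" for h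
    using n by (simp add: fcov_def power2_eq_square)
  have s1: "(\<Sum>i<n. \<Sum>q<nQ K. (Y i q - fmean n (\<lambda>i. Y i q))\<^sup>2) = (\<Sum>q<nQ K. (real n - 1) * fcov n (\<lambda>i. Y i q) (\<lambda>i. Y i q))"
    by (subst sum.swap) (rule sum.cong[OF refl], rule e)
  have s2: "(\<Sum>i<n. \<Sum>l<L. (X i l - fmean n (\<lambda>i. X i l))\<^sup>2) = (\<Sum>l<L. (real n - 1) * Smat_x L n X $$ (l, l))"
    by (subst sum.swap) (rule sum.cong[OF refl], simp add: e Smat_x_def)
  show ?thesis unfolding resid_sq_def sum.distrib s1 s2 distrib_left sum_distrib_left ..
qed

definition "standardized x y i q = (\<Sum>f<nF K. x f * ucontrast f i q) + (\<Sum>j<nF K * L. y j * vcontrast j i q)"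

lemma linear_coefficients_le:
  fixes M :: "real mat" and z :: "nat \<Rightarrow> real"
  assumes M: "\<And>f g. f < d \<Longrightarrow> g < d \<Longrightarrow> \<bar>M $$ (f, g)\<bar> \<le> A" and c: "\<And>g. g < d \<Longrightarrow> \<bar>c g\<bar> \<le> t" and t: "0 \<le> t"
  shows "\<bar>\<Sum>f<d. z f * (\<Sum>g<d. M $$ (f, g) * c g)\<bar> \<le> (\<Sum>f<d. \<bar>z f\<bar>) * (real d * (A * t))"
proof -
  have "\<bar>\<Sum>g<d. M $$ (f, g) * c g\<bar> \<le> real d * (A * t)" if "f < d" for f
  proof -
    have "\<bar>\<Sum>g<d. M $$ (f, g) * c g\<bar> \<le> (\<Sum>g<d. \<bar>M $$ (f, g) * c g\<bar>)" by (rule sum_abs)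
    also have "\<dots> \<le> (\<Sum>g<d. A * t)"
      unfolding abs_mult
    proof (rule sum_mono)
      fix g assume "g \<in> {..<d}"
      then have *: "\<bar>M $$ (f, g)\<bar> \<le> A" "\<bar>c g\<bar> \<le> t" using M[OF that] c by auto
      then have "0 \<le> A" using abs_ge_zero[of "M $$ (f, g)"] by linarith
      then show "\<bar>M $$ (f, g)\<bar> * \<bar>c g\<bar> \<le> A * t" using * by (intro mult_mono) auto
    qed
    finally show ?thesis by simp
  qed
  then have "(\<Sum>f<d. \<bar>z f * (\<Sum>g<d. M $$ (f, g) * c g)\<bar>) \<le> (\<Sum>f<d. \<bar>z f\<bar> * (real d * (A * t)))"
    unfolding abs_mult by (intro sum_mono mult_left_mono) auto
  then show ?thesis
    unfolding sum_distrib_right[where r = "real d * (A * t)"] by (rule order_trans[OF sum_abs])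
qed

lemma contrast_abs_le:
  assumes \<rho>: "0 < \<rho>" "\<rho> * real n \<le> real (nq q)"
  shows "\<bar>contrast K n nq Y' f i q\<bar> \<le> \<bar>Y' i q - fmean n (\<lambda>i. Y' i q)\<bar> / (\<rho> * real n)"
proof -
  have n: "real n > 0" using n_ge(1)[OF K nq sizes] by simp
  have \<rho>n: "0 < \<rho> * real n" using \<rho>(1) n by simp
  have "real (nq q) * 1 \<le> real (nq q) * 2 ^ (K - 1)" by (intro mult_left_mono) auto
  then have "\<rho> * real n \<le> 2 ^ (K - 1) * real (nq q)" using \<rho>(2) by (simp add: mult.commute)
  then have "\<bar>Y' i q - fmean n (\<lambda>i. Y' i q)\<bar> / (2 ^ (K - 1) * real (nq q)) \<le> \<bar>Y' i q - fmean n (\<lambda>i. Y' i q)\<bar> / (\<rho> * real n)"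
    using \<rho>(1) n less_le_trans[OF \<rho>n \<rho>(2)] by (intro divide_left_mono mult_pos_pos) auto
  then show ?thesis by (simp add: contrast_def abs_mult gcoef_abs)
qed

context
  fixes A \<rho> :: real and x y :: "nat \<Rightarrow> real"
  assumes \<rho>: "0 < \<rho>" "\<And>q. q < nQ K \<Longrightarrow> \<rho> * real n \<le> real (nq q)"
    and U: "\<And>f g. f < nF K \<Longrightarrow> g < nF K \<Longrightarrow> \<bar>Umat $$ (f, g)\<bar> \<le> A * sqrt (real n)"
    and Xb: "\<And>j k. j < nF K * L \<Longrightarrow> k < nF K * L \<Longrightarrow> \<bar>Xmat $$ (j, k)\<bar> \<le> A * sqrt (real n)"
begin

definition "std_const = ((\<Sum>f<nF K. \<bar>x f\<bar>) * real (nF K) + (\<Sum>j<nF K * L. \<bar>y j\<bar>) * real (nF K * L)) * A / \<rho>"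

lemma A_nonneg: "0 \<le> A"
proof -
  have n: "real n > 0" using n_ge(1)[OF K nq sizes] by simp
  have "0 < nF K" using K one_less_power[of "2::nat" K] by (simp add: nF_def)
  then have "0 \<le> A * sqrt (real n)" using U[of 0 0] abs_ge_zero[of "Umat $$ (0, 0)"] by linarith
  then show ?thesis using n by (simp add: zero_le_mult_iff)
qed

lemma std_const_nonneg: "0 \<le> std_const"
  unfolding std_const_def using A_nonneg \<rho>(1) by (intro divide_nonneg_pos mult_nonneg_nonneg add_nonneg_nonneg sum_nonneg) auto

lemma standardized_abs_le:
  assumes q: "q < nQ K"
  shows "\<bar>standardized x y i q\<bar> \<le> std_const * sqrt (resid_sq i / real n)"
proof -
  have n: "real n > 0" using n_ge(1)[OF K nq sizes] by simp
  define t where "t = sqrt (resid_sq i) / (\<rho> * real n)"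
  have t: "0 \<le> t" using n \<rho>(1) resid_sq_nonneg by (simp add: t_def)
  have r1: "\<bar>Y i q - fmean n (\<lambda>i. Y i q)\<bar> \<le> sqrt (resid_sq i)"
  proof (rule real_le_rsqrt)
    have "(Y i q - fmean n (\<lambda>i. Y i q))\<^sup>2 \<le> (\<Sum>q<nQ K. (Y i q - fmean n (\<lambda>i. Y i q))\<^sup>2)"
      using q by (intro member_le_sum[of q "{..<nQ K}" "\<lambda>q. (Y i q - fmean n (\<lambda>i. Y i q))\<^sup>2"]) auto
    also have "\<dots> \<le> resid_sq i" by (simp add: resid_sq_def sum_nonneg)
    finally show "\<bar>Y i q - fmean n (\<lambda>i. Y i q)\<bar>\<^sup>2 \<le> resid_sq i" by simp
  qed
  have r2: "\<bar>X i l - fmean n (\<lambda>i. X i l)\<bar> \<le> sqrt (resid_sq i)" if l: "l < L" for l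
  proof (rule real_le_rsqrt)
    have "(X i l - fmean n (\<lambda>i. X i l))\<^sup>2 \<le> (\<Sum>l<L. (X i l - fmean n (\<lambda>i. X i l))\<^sup>2)"
      using l by (intro member_le_sum[of l "{..<L}" "\<lambda>l. (X i l - fmean n (\<lambda>i. X i l))\<^sup>2"]) auto
    also have "\<dots> \<le> resid_sq i" by (simp add: resid_sq_def sum_nonneg)
    finally show "\<bar>X i l - fmean n (\<lambda>i. X i l)\<bar>\<^sup>2 \<le> resid_sq i" by simp
  qed
  have \<rho>n: "0 < \<rho> * real n" using \<rho>(1) n by simp
  have c1: "\<bar>contrast K n nq Y g i q\<bar> \<le> t" for g
    using contrast_abs_le[OF \<rho>(1) \<rho>(2)[OF q], of Y g i] divide_right_mono[OF r1, of "\<rho> * real n"] \<rho>n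
    unfolding t_def by linarith
  have c2: "\<bar>xcontrast K L n nq X k i q\<bar> \<le> t" for k
    using contrast_abs_le[OF \<rho>(1) \<rho>(2)[OF q], of "\<lambda>i q. X i (k mod L)" "k div L" i]
      divide_right_mono[OF r2[of "k mod L"], of "\<rho> * real n"] \<rho>n L
    unfolding t_def xcontrast_def by simp
  have "\<bar>standardized x y i q\<bar> \<le> (\<Sum>f<nF K. \<bar>x f\<bar>) * (real (nF K) * (A * sqrt (real n) * t))
      + (\<Sum>j<nF K * L. \<bar>y j\<bar>) * (real (nF K * L) * (A * sqrt (real n) * t))"
    unfolding standardized_def ucontrast_def vcontrast_def
    by (rule order_trans[OF abs_triangle_ineq]) (intro add_mono linear_coefficients_le U Xb c1 c2 t)
  also have "\<dots> = ((\<Sum>f<nF K. \<bar>x f\<bar>) * real (nF K) + (\<Sum>j<nF K * L. \<bar>y j\<bar>) * real (nF K * L)) * A * (sqrt (real n) * t)"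
    by (simp add: algebra_simps)
  also have "sqrt (real n) * t = sqrt (resid_sq i / real n) / \<rho>"
  proof -
    have "sqrt (real n) / real n = 1 / sqrt (real n)" using n by (simp add: real_div_sqrt divide_simps)
    moreover have "sqrt (real n) * t = sqrt (real n) / real n * (sqrt (resid_sq i) / \<rho>)" by (simp add: t_def)
    ultimately show ?thesis by (simp add: real_sqrt_divide)
  qed
  finally show ?thesis by (simp add: std_const_def)
qed

lemma standardized_sqsum_le:
  assumes v: "(\<Sum>q<nQ K. fcov n (\<lambda>i. Y i q) (\<lambda>i. Y i q)) + (\<Sum>l<L. Smat_x L n X $$ (l, l)) \<le> v"
  shows "sqsum K n (standardized x y) \<le> real (nQ K) * std_const\<^sup>2 * v"
proof -
  have n: "real n > 1" using n_ge(1)[OF K nq sizes] by simp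
  let ?V = "(\<Sum>q<nQ K. fcov n (\<lambda>i. Y i q) (\<lambda>i. Y i q)) + (\<Sum>l<L. Smat_x L n X $$ (l, l))"
  have V0: "0 \<le> ?V"
  proof -
    have "0 \<le> (real n - 1) * ?V" unfolding resid_sq_sum[symmetric] by (intro sum_nonneg resid_sq_nonneg)
    then show ?thesis using n by (simp add: zero_le_mult_iff)
  qed
  have sq: "(standardized x y i q)\<^sup>2 \<le> std_const\<^sup>2 * (resid_sq i / real n)" if "q < nQ K" for i q
  proof -
    have "(standardized x y i q)\<^sup>2 \<le> (std_const * sqrt (resid_sq i / real n))\<^sup>2"
      using power_mono[OF standardized_abs_le[OF that, of i] abs_ge_zero, of 2] by simp
    then show ?thesis using resid_sq_nonneg[of i] n by (simp add: power_mult_distrib)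
  qed
  have "sqsum K n (standardized x y) \<le> (\<Sum>i<n. \<Sum>q<nQ K. std_const\<^sup>2 * (resid_sq i / real n))"
    unfolding sqsum_def using sq by (intro sum_mono) auto
  also have "\<dots> = real (nQ K) * std_const\<^sup>2 / real n * (\<Sum>i<n. resid_sq i)"
    unfolding sum_constant sum_distrib_left by (rule sum.cong[OF refl]) simp
  also have "\<dots> = real (nQ K) * std_const\<^sup>2 * ((real n - 1) / real n * ?V)"
    unfolding resid_sq_sum by simp
  also have "\<dots> \<le> real (nQ K) * std_const\<^sup>2 * (1 * ?V)"
    using n V0 by (intro mult_left_mono mult_right_mono) auto
  also have "\<dots> \<le> real (nQ K) * std_const\<^sup>2 * v" using v by (intro mult_left_mono) auto
  finally show ?thesis .
qed

lemma standardized_clt: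
  assumes v: "(\<Sum>q<nQ K. fcov n (\<lambda>i. Y i q) (\<lambda>i. Y i q)) + (\<Sum>l<L. Smat_x L n X $$ (l, l)) \<le> v"
    and \<epsilon>: "\<And>i. i < n \<Longrightarrow> resid_sq i / real n \<le> \<epsilon>"
  defines "M \<equiv> std_const * sqrt \<epsilon> + 1 / real n" and "s \<equiv> real (nQ K) * std_const\<^sup>2 * v"
  shows "cmod (avg (assignments K n nq) (\<lambda>Z. iexp ((\<Sum>f<nF K. x f * lin_stat n (ucontrast f) Z) + (\<Sum>j<nF K * L. y j * lin_stat n (vcontrast j) Z)))
      - complex_of_real (exp (- pair_form (nF K) (nF K * L) (\<lambda>f j. Cmat $$ (f, j)) (1 / 2) (1 / 2) x y)))
    \<le> 11 * M * s + M + 4 * real (nQ K) * s / real n + ((\<Sum>f<nF K. (x f)\<^sup>2) + (\<Sum>j<nF K * L. (y j)\<^sup>2)) / real n"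
proof -
  have n: "real n > 1" using n_ge(1)[OF K nq sizes] by simp
  define p where "p = pair_form (nF K) (nF K * L) (\<lambda>f j. Cmat $$ (f, j)) (1 / 2) (1 / 2) x y"
  have p0: "0 \<le> p" unfolding p_def by (rule pair_form_nonneg) (auto intro: Cmat_contraction)
  let ?c = "\<lambda>j. \<Sum>f<nF K. Cmat $$ (f, j) * x f"
  have p_eq: "p = (\<Sum>f<nF K. (x f)\<^sup>2) / 2 + (\<Sum>j<nF K * L. ?c j * y j) + (\<Sum>j<nF K * L. (y j)\<^sup>2) / 2"
  proof -
    have "2 * sqrt (1 / 2) * sqrt (1 / 2) = (1 :: real)"
      unfolding mult.assoc real_sqrt_mult_self by simp
    then show ?thesis unfolding p_def pair_form_def by simp
  qed
  have p1: "p \<le> (\<Sum>f<nF K. (x f)\<^sup>2) + (\<Sum>j<nF K * L. (y j)\<^sup>2)"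
  proof -
    have "(\<Sum>j<nF K * L. ?c j * y j) \<le> (\<Sum>j<nF K * L. (?c j)\<^sup>2 / 2 + (y j)\<^sup>2 / 2)"
    proof (rule sum_mono)
      fix j
      have "0 \<le> (?c j - y j)\<^sup>2" by simp
      then show "?c j * y j \<le> (?c j)\<^sup>2 / 2 + (y j)\<^sup>2 / 2" by (simp add: power2_diff)
    qed
    also have "\<dots> = (\<Sum>j<nF K * L. (?c j)\<^sup>2) / 2 + (\<Sum>j<nF K * L. (y j)\<^sup>2) / 2"
      unfolding sum.distrib sum_divide_distrib ..
    finally show ?thesis unfolding p_eq using Cmat_contraction[of x] by simp
  qed
  have lv: "lim_var K n nq (standardized x y) / 2 = p - p / real n"
  proof -
    have "cov_scale n * lim_var K n nq (standardized x y) = 2 * p"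
      using lim_var_standardized[of x y] unfolding standardized_def p_eq by simp
    then show ?thesis using n by (simp add: cov_scale_def field_simps)
  qed
  have e: "\<bar>exp (- (p - p / real n)) - exp (- p)\<bar> \<le> p / real n"
  proof -
    have d0: "0 \<le> p / real n" using p0 n by simp
    have u0: "0 \<le> p - p / real n" using p0 n by (simp add: divide_le_eq mult_le_cancel_left1)
    have "exp (- p) = exp (- (p - p / real n)) * exp (- (p / real n))" by (simp flip: exp_add)
    then have "exp (- (p - p / real n)) - exp (- p) = exp (- (p - p / real n)) * (1 - exp (- (p / real n)))"
      by (simp add: algebra_simps)
    also have "\<dots> \<le> 1 * (p / real n)"
      using u0 d0 exp_ge_add_one_self[of "- (p / real n)"] by (intro mult_mono) auto
    finally have "exp (- (p - p / real n)) - exp (- p) \<le> p / real n" by simp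
    moreover have "exp (- p) \<le> exp (- (p - p / real n))" using d0 by simp
    ultimately show ?thesis by simp
  qed
  have n1: "1 \<le> n" by (rule n_ge(2)[OF K nq sizes])
  have M0: "0 < M" unfolding M_def
  proof (rule add_nonneg_pos)
    have "0 \<le> \<epsilon>" using \<epsilon>[of 0] n resid_sq_nonneg[of 0] divide_nonneg_nonneg[of "resid_sq 0" "real n"] n1 by linarith
    then show "0 \<le> std_const * sqrt \<epsilon>" using std_const_nonneg by simp
  qed (use n in simp)
  have aM: "\<bar>standardized x y i q\<bar> \<le> M" if "i < n" "q < nQ K" for i q
  proof -
    have "\<bar>standardized x y i q\<bar> \<le> std_const * sqrt (resid_sq i / real n)" by (rule standardized_abs_le[OF that(2)])
    also have "\<dots> \<le> std_const * sqrt \<epsilon>" using \<epsilon>[OF that(1)] std_const_nonneg by (intro mult_left_mono real_sqrt_le_mono) auto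
    finally show ?thesis unfolding M_def using n by (simp add: add_increasing2)
  qed
  have s: "sqsum K n (standardized x y) \<le> s" unfolding s_def by (rule standardized_sqsum_le[OF v])
  have cen: "centred K n (standardized x y)"
    unfolding standardized_def by (rule standardized_centred)
  have ls: "lin_stat n (standardized x y) Z
      = (\<Sum>f<nF K. x f * lin_stat n (ucontrast f) Z) + (\<Sum>j<nF K * L. y j * lin_stat n (vcontrast j) Z)" for Z
    unfolding standardized_def lin_stat_sum[symmetric] by (simp add: lin_stat_def sum.distrib)
  let ?a = "avg (assignments K n nq) (\<lambda>Z. iexp ((\<Sum>f<nF K. x f * lin_stat n (ucontrast f) Z) + (\<Sum>j<nF K * L. y j * lin_stat n (vcontrast j) Z)))"
  have "cmod (?a - complex_of_real (exp (- (p - p / real n))))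
      \<le> 11 * M * sqsum K n (standardized x y) + M + 4 * real (nQ K) * sqsum K n (standardized x y) / real n"
    using combinatorial_clt[OF sizes n1 cen M0 aM] unfolding ls minus_divide_left[symmetric] lv by blast
  also have "\<dots> \<le> 11 * M * s + M + 4 * real (nQ K) * s / real n"
    using s M0 by (intro add_mono mult_left_mono divide_right_mono order_refl) auto
  finally have 1: "cmod (?a - complex_of_real (exp (- (p - p / real n)))) \<le> 11 * M * s + M + 4 * real (nQ K) * s / real n" .
  have 2: "cmod (complex_of_real (exp (- (p - p / real n))) - complex_of_real (exp (- p))) \<le> p / real n"
    using e by (simp only: of_real_diff[symmetric] norm_of_real)
  have 3: "p / real n \<le> ((\<Sum>f<nF K. (x f)\<^sup>2) + (\<Sum>j<nF K * L. (y j)\<^sup>2)) / real n"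
    using p1 n by (intro divide_right_mono) auto
  have "cmod (?a - complex_of_real (exp (- p))) \<le> cmod (?a - complex_of_real (exp (- (p - p / real n))))
      + cmod (complex_of_real (exp (- (p - p / real n))) - complex_of_real (exp (- p)))"
    using dist_triangle[of ?a "complex_of_real (exp (- p))" "complex_of_real (exp (- (p - p / real n)))"]
    by (simp only: dist_norm)
  then show ?thesis using 1 2 3 unfolding p_def[symmetric] by linarith
qed

end

end

section \<open>Critical values\<close>

text \<open>A covariate direction beyond the first \<open>F\<close> is uncorrelated with the estimation error, so it has weight \<open>0\<close>.\<close>

definition padded :: "nat \<Rightarrow> real list \<Rightarrow> (real \<times> real) list" where
  "padded e p = map (Pair 1) p @ replicate (e - length p) (0, 0)"

lemma prod_list_padded:
  fixes g :: "real \<times> real \<Rightarrow> real"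
  shows "(\<Prod>x\<leftarrow>padded e p. g x) = (\<Prod>f<length p. g (1, p ! f)) * g (0, 0) ^ (e - length p)"
proof -
  have "(\<Prod>x\<leftarrow>p. g (1, x)) = (\<Prod>f<length p. g (1, p ! f))"
    by (simp add: prod.list_conv_set_nth atLeast0LessThan)
  then show ?thesis by (simp add: padded_def o_def)
qed

lemma padded_ranges:
  assumes "\<forall>x\<in>set p. 0 \<le> x \<and> x \<le> 1"
  shows "\<forall>(w, x)\<in>set (padded e p). 0 \<le> w \<and> 0 \<le> x \<and> x \<le> 1"
  using assms by (auto simp: padded_def)

lemma qlaw_padded_laplace:
  assumes p: "\<forall>x\<in>set p. 0 \<le> x \<and> x \<le> 1" and e: "length p \<le> e" and sr: "0 \<le> s" "0 \<le> r"
  shows "(\<integral>x. exp (- s * fst x - r * snd x) \<partial>qlaw (padded e p))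
    = (1 / sqrt (1 + 2 * r)) ^ e * (\<Prod>f<length p. 1 / sqrt (1 + 2 * s - 4 * s * r / (1 + 2 * r) * p ! f))"
proof -
  define P where "P = (\<Prod>(w, x)\<leftarrow>padded e p. 1 / sqrt ((1 + 2 * (s * w)) * (1 + 2 * r) - 4 * (s * w) * r * x))"
  have r1: "1 + 2 * r > 0" using sr by simp
  have fac: "1 / sqrt ((1 + 2 * s) * (1 + 2 * r) - 4 * s * r * x) = 1 / sqrt (1 + 2 * r) * (1 / sqrt (1 + 2 * s - 4 * s * r / (1 + 2 * r) * x))" for x
  proof -
    have "(1 + 2 * s) * (1 + 2 * r) - 4 * s * r * x = (1 + 2 * r) * (1 + 2 * s - 4 * s * r / (1 + 2 * r) * x)"
      using r1 by (simp add: field_simps)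
    then show ?thesis by (simp add: real_sqrt_mult)
  qed
  have "P = (\<Prod>f<length p. 1 / sqrt ((1 + 2 * s) * (1 + 2 * r) - 4 * s * r * p ! f)) * (1 / sqrt (1 + 2 * r)) ^ (e - length p)"
    unfolding P_def prod_list_padded by simp
  also have "\<dots> = (1 / sqrt (1 + 2 * r)) ^ length p * (1 / sqrt (1 + 2 * r)) ^ (e - length p)
      * (\<Prod>f<length p. 1 / sqrt (1 + 2 * s - 4 * s * r / (1 + 2 * r) * p ! f))"
    unfolding fac prod.distrib by simp
  also have "(1 / sqrt (1 + 2 * r)) ^ length p * (1 / sqrt (1 + 2 * r)) ^ (e - length p) = (1 / sqrt (1 + 2 * r)) ^ e"
    unfolding power_add[symmetric] using e by simp
  finally have P: "P = (1 / sqrt (1 + 2 * r)) ^ e * (\<Prod>f<length p. 1 / sqrt (1 + 2 * s - 4 * s * r / (1 + 2 * r) * p ! f))" .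
  have P0: "0 \<le> P" unfolding P_def prod_list_padded
  proof (intro mult_nonneg_nonneg prod_nonneg zero_le_power ballI; clarsimp)
    fix f assume f: "f < length p"
    have "s * r * p ! f \<le> s * r * 1" using p f sr by (intro mult_left_mono) auto
    moreover have "0 \<le> s * r" using sr by simp
    ultimately show "4 * s * r * p ! f \<le> (1 + 2 * s) * (1 + 2 * r)" using sr by (simp add: algebra_simps)
  qed (use r1 in simp)
  have m: "(\<lambda>x. exp (- s * fst x - r * snd x)) \<in> borel_measurable (qlaw (padded e p))"
    unfolding measurable_cong_sets[OF sets_qlaw refl] by measurable
  have "(\<integral>x. exp (- s * fst x - r * snd x) \<partial>qlaw (padded e p))
      = enn2real (\<integral>\<^sup>+x. ennreal (exp (- s * fst x - r * snd x)) \<partial>qlaw (padded e p))"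
    by (rule integral_eq_nn_integral[OF m]) simp
  also have "\<dots> = P" using qlaw_laplace[OF sr padded_ranges[OF p, of e]] P0 unfolding P_def by simp
  finally show ?thesis unfolding P .
qed

lemma conditional_quadrant_tendsto:
  fixes u v :: "nat \<Rightarrow> 'z \<Rightarrow> real"
  assumes p: "\<forall>x\<in>set p. 0 \<le> x \<and> x \<le> 1" "p \<noteq> []" and e: "length p \<le> e" and a: "0 < a"
    and S: "\<And>m. finite (S m)" "\<And>m. S m \<noteq> {}"
    and uv: "\<And>m Z. Z \<in> S m \<Longrightarrow> 0 \<le> u m Z" "\<And>m Z. Z \<in> S m \<Longrightarrow> 0 \<le> v m Z"
    and lap: "\<And>s r. 0 \<le> s \<Longrightarrow> 0 \<le> r \<Longrightarrow> (\<lambda>m. avg (S m) (\<lambda>Z. exp (- s * u m Z - r * v m Z)))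
       \<longlonglongrightarrow> (1 / sqrt (1 + 2 * r)) ^ e * (\<Prod>f<length p. 1 / sqrt (1 + 2 * s - 4 * s * r / (1 + 2 * r) * p ! f))"
  shows "(\<lambda>m. real (card {Z \<in> S m. u m Z \<le> c \<and> v m Z \<le> a}) / real (card {Z \<in> S m. v m Z \<le> a}))
     \<longlonglongrightarrow> quad_prob (padded e p) a c / half_prob (padded e p) a"
proof -
  let ?\<nu> = "qlaw (padded e p)"
  obtain x p' where xp: "p = x # p'" using p(2) by (cases p) auto
  define l' where "l' = map (Pair 1) p' @ replicate (e - length p) (0::real, 0::real)"
  have pad: "padded e p = (1, x) # l'" by (simp add: padded_def xp l'_def)
  have x: "0 \<le> x" "x \<le> 1" using p xp by auto
  have nn: "AE x in ?\<nu>. 0 \<le> fst x \<and> 0 \<le> snd x"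
    by (rule AE_qlaw_nonneg) (use padded_ranges[OF p(1), of e] in auto)
  have f: "AE y in ?\<nu>. fst y \<noteq> c" unfolding pad by (rule AE_qlaw_fst_neq[OF x])
  have s: "AE y in ?\<nu>. snd y \<noteq> a" unfolding pad by (rule AE_qlaw_snd_neq)
  have lap': "(\<lambda>m. avg (S m) (\<lambda>Z. exp (- s * u m Z - r * v m Z))) \<longlonglongrightarrow> (\<integral>x. exp (- s * fst x - r * snd x) \<partial>?\<nu>)"
    if "0 \<le> s" "0 \<le> r" for s r
    unfolding qlaw_padded_laplace[OF p(1) e that] by (rule lap[OF that])
  have quad: "(\<lambda>m. real (card {Z \<in> S m. u m Z \<le> c \<and> v m Z \<le> a}) / real (card (S m))) \<longlonglongrightarrow> quad_prob (padded e p) a c"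
    unfolding quad_prob_def
    by (rule avg_quadrant_tendsto[OF prob_space_qlaw sets_qlaw nn S uv lap' f s]) auto
  have half: "(\<lambda>m. real (card {Z \<in> S m. v m Z \<le> a}) / real (card (S m))) \<longlonglongrightarrow> half_prob (padded e p) a"
  proof -
    define T where "T x = (snd x, snd x)" for x :: "real \<times> real"
    define \<nu>' where "\<nu>' = distr ?\<nu> (borel \<Otimes>\<^sub>M borel) T"
    have T: "T \<in> measurable ?\<nu> (borel \<Otimes>\<^sub>M borel)"
      unfolding T_def measurable_cong_sets[OF sets_qlaw refl] by measurable
    have pr: "prob_space \<nu>'" unfolding \<nu>'_def by (rule prob_space.prob_space_distr[OF prob_space_qlaw T])
    have sets': "sets \<nu>' = sets (borel \<Otimes>\<^sub>M borel)" by (simp add: \<nu>'_def)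
    have n': "AE x in \<nu>'. 0 \<le> fst x \<and> 0 \<le> snd x"
      unfolding \<nu>'_def by (subst AE_distr_iff[OF T]) (measurable, use nn in \<open>auto simp: T_def\<close>)
    have f': "AE x in \<nu>'. fst x \<noteq> a"
      unfolding \<nu>'_def by (subst AE_distr_iff[OF T]) (measurable, use s in \<open>auto simp: T_def\<close>)
    have s': "AE x in \<nu>'. snd x \<noteq> a"
      unfolding \<nu>'_def by (subst AE_distr_iff[OF T]) (measurable, use s in \<open>auto simp: T_def\<close>)
    have l': "(\<lambda>m. avg (S m) (\<lambda>Z. exp (- real j * v m Z - real k * v m Z))) \<longlonglongrightarrow> (\<integral>x. exp (- real j * fst x - real k * snd x) \<partial>\<nu>')" for j k :: nat
    proof -
      have "(\<integral>x. exp (- real j * fst x - real k * snd x) \<partial>\<nu>') = (\<integral>x. exp (- real j * fst (T x) - real k * snd (T x)) \<partial>?\<nu>)"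
        unfolding \<nu>'_def by (rule integral_distr[OF T]) measurable
      also have "\<dots> = (\<integral>x. exp (- 0 * fst x - real (j + k) * snd x) \<partial>?\<nu>)"
        by (simp add: T_def algebra_simps)
      finally show ?thesis using lap'[of 0 "real (j + k)"] by (simp add: algebra_simps)
    qed
    have "(\<lambda>m. real (card {Z \<in> S m. v m Z \<le> a \<and> v m Z \<le> a}) / real (card (S m))) \<longlonglongrightarrow> measure \<nu>' {x. fst x \<le> a \<and> snd x \<le> a}"
      by (rule avg_quadrant_tendsto[OF pr sets' n' S uv(2) uv(2) l' f' s'])
    moreover have "measure \<nu>' {x. fst x \<le> a \<and> snd x \<le> a} = half_prob (padded e p) a"
      unfolding \<nu>'_def half_prob_def
      by (subst measure_distr[OF T]) (auto intro!: arg_cong[where f = "measure ?\<nu>"] simp: T_def)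
    ultimately show ?thesis by simp
  qed
  have "half_prob (padded e p) a \<noteq> 0" using half_prob_pos[OF a, of "padded e p"] by simp
  from tendsto_divide[OF quad half this] show ?thesis using S by (simp add: card_eq_0_iff)
qed

lemma padded_quantile:
  assumes p: "\<forall>x\<in>set p. 0 \<le> x \<and> x \<le> 1" "p \<noteq> []" and a: "0 < a" and \<beta>: "0 < \<beta>" "\<beta> < 1"
  shows "\<exists>!c. quad_prob (padded e p) a c / half_prob (padded e p) a = \<beta>"
proof -
  obtain x p' where xp: "p = x # p'" using p(2) by (cases p) auto
  define l' where "l' = map (Pair 1) p' @ replicate (e - length p) (0::real, 0::real)"
  have pad: "padded e p = (1, x) # l'" by (simp add: padded_def xp l'_def)
  have x: "0 \<le> x" "x \<le> 1" using p xp by auto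
  have l: "\<forall>(w, p)\<in>set ((1, x) # l'). 0 \<le> w" using padded_ranges[OF p(1), of e] unfolding pad by auto
  have h: "half_prob (padded e p) a > 0" by (rule half_prob_pos[OF a])
  have eq: "quad_prob (padded e p) a c / half_prob (padded e p) a = \<beta> \<longleftrightarrow> quad_prob (padded e p) a c = \<beta> * half_prob (padded e p) a" for c
    using h by (simp add: divide_eq_eq)
  show ?thesis
    unfolding eq using quad_prob_quantile[OF l x a \<beta>] unfolding pad by blast
qed

definition crit :: "nat \<Rightarrow> real \<Rightarrow> real \<Rightarrow> real list \<Rightarrow> real" where
  "crit e a \<beta> p = (THE c. quad_prob (padded e p) a c / half_prob (padded e p) a = \<beta>)"

lemma crit:
  assumes "\<forall>x\<in>set p. 0 \<le> x \<and> x \<le> 1" "p \<noteq> []" "0 < a" "0 < \<beta>" "\<beta> < 1"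
  shows "quad_prob (padded e p) a (crit e a \<beta> p) / half_prob (padded e p) a = \<beta>"
    and "quad_prob (padded e p) a c / half_prob (padded e p) a = \<beta> \<Longrightarrow> c = crit e a \<beta> p"
proof -
  show "quad_prob (padded e p) a (crit e a \<beta> p) / half_prob (padded e p) a = \<beta>"
    unfolding crit_def by (rule theI'[OF padded_quantile[OF assms]])
  show "c = crit e a \<beta> p" if "quad_prob (padded e p) a c / half_prob (padded e p) a = \<beta>"
    unfolding crit_def by (rule the1_equality[OF padded_quantile[OF assms] that, symmetric])
qed

lemma crit_antimono:
  assumes len: "length p = length p'" "p \<noteq> []" and le: "\<forall>f<length p. 0 \<le> p ! f \<and> p ! f \<le> p' ! f \<and> p' ! f \<le> 1"
    and a: "0 < a" and \<beta>: "0 < \<beta>" "\<beta> < 1"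
  shows "crit e a \<beta> p' \<le> crit e a \<beta> p"
proof (rule ccontr)
  assume n: "\<not> ?thesis"
  have r: "\<forall>x\<in>set p. 0 \<le> x \<and> x \<le> 1" "\<forall>x\<in>set p'. 0 \<le> x \<and> x \<le> 1" "p' \<noteq> []"
  proof -
    have "0 \<le> p ! f \<and> p ! f \<le> 1 \<and> 0 \<le> p' ! f \<and> p' ! f \<le> 1" if "f < length p" for f
      using le that order_trans[of 0 "p ! f" "p' ! f"] order_trans[of "p ! f" "p' ! f" 1] by simp
    then show "\<forall>x\<in>set p. 0 \<le> x \<and> x \<le> 1" "\<forall>x\<in>set p'. 0 \<le> x \<and> x \<le> 1"
      using len(1) by (simp_all add: all_set_conv_all_nth)
    show "p' \<noteq> []" using len by (metis length_0_conv)
  qed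
  note c = crit[OF r(1) len(2) a \<beta>, of e] and c' = crit[OF r(2,3) a \<beta>, of e]
  have h: "half_prob (padded e p) a = half_prob (padded e p') a"
    by (rule half_prob_length) (simp add: padded_def len)
  have hp: "half_prob (padded e p') a > 0" by (rule half_prob_pos[OF a])
  have "list_all2 (\<lambda>(w, p) (w', p'). w = w' \<and> w \<in> {0, 1} \<and> 0 \<le> p \<and> p \<le> p' \<and> p' \<le> 1) (padded e p) (padded e p')"
    unfolding padded_def len(1)
    by (rule list_all2_appendI) (use le len in \<open>auto simp: list_all2_conv_all_nth\<close>)
  from qlaw_quadrant_mono[OF this]
  have m: "quad_prob (padded e p) a c \<le> quad_prob (padded e p') a c" for c
    unfolding quad_prob_def qlaw.emeasure_eq_measure by simp
  have "quad_prob (padded e p) a (crit e a \<beta> p) / half_prob (padded e p) a \<le> quad_prob (padded e p') a (crit e a \<beta> p) / half_prob (padded e p') a"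
    unfolding h using m hp by (intro divide_right_mono) auto
  moreover have "quad_prob (padded e p') a (crit e a \<beta> p) / half_prob (padded e p') a \<le> quad_prob (padded e p') a (crit e a \<beta> p') / half_prob (padded e p') a"
    using quad_prob_mono n hp by (intro divide_right_mono) auto
  ultimately have "quad_prob (padded e p') a (crit e a \<beta> p) / half_prob (padded e p') a = \<beta>" using c(1) c'(1) by simp
  from c'(2)[OF this] n show False by simp
qed

section \<open>Asymptotic coverage\<close>

lemma quadratic_form_smult:
  fixes A :: "real mat"
  assumes A: "A \<in> carrier_mat d d" and v: "v \<in> carrier_vec d"
  shows "v \<bullet> ((k \<cdot>\<^sub>m A) *\<^sub>v v) = k * (v \<bullet> (A *\<^sub>v v))"
proof -
  have kA: "k \<cdot>\<^sub>m A \<in> carrier_mat d d" using A by simp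
  show ?thesis
    unfolding quadratic_form_sum[OF A v] quadratic_form_sum[OF kA v] sum_distrib_left
    using A by (intro sum.cong refl) simp
qed

context
  fixes K L :: nat and N :: "nat \<Rightarrow> nat" and nq :: "nat \<Rightarrow> nat \<Rightarrow> nat"
    and Y X :: "nat \<Rightarrow> nat \<Rightarrow> nat \<Rightarrow> real" and p :: "real list"
  assumes K: "1 \<le> K" and L: "1 \<le> L" and ok: "design_ok K L N nq Y X"
    and ci: "cond_i K N nq" and cii: "cond_ii K L N Y X" and ciii: "cond_iii K L N Y X"
    and Vl: "Vlim_nonsingular K N nq Y" and cc: "canon_corr_limit K L N nq Y X p"
begin

lemma sizes_diverge: "filterlim N at_top sequentially"
  and groups_nonempty: "q < nQ K \<Longrightarrow> 1 \<le> nq m q"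
  and group_sizes: "(\<Sum>q<nQ K. nq m q) = N m"
  and Vtt_invertible: "invertible_mat (Vtt K (N m) (nq m) (Y m))"
  and Smat_x_invertible: "invertible_mat (Smat_x L (N m) (X m))"
  using ok unfolding design_ok_def by blast+

lemma N_ge: "2 \<le> N m"
  by (rule n_ge(1)[OF K groups_nonempty group_sizes])

lemma N_pos: "0 < real (N m)"
  using N_ge[of m] by simp

lemma inverse_N: "(\<lambda>m. 1 / real (N m)) \<longlonglongrightarrow> 0"
  by (rule filterlim_compose[OF lim_1_over_n sizes_diverge])

lemma group_fraction: "\<exists>\<rho>>0. eventually (\<lambda>m. \<forall>q<nQ K. \<rho> * real (N m) \<le> real (nq m q)) sequentially"
proof -
  have "\<forall>q\<in>{..<nQ K}. \<exists>r>0. (\<lambda>m. real (nq m q) / real (N m)) \<longlonglongrightarrow> r" using ci unfolding cond_i_def by blast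
  then obtain r where r: "\<And>q. q < nQ K \<Longrightarrow> 0 < r q" "\<And>q. q < nQ K \<Longrightarrow> (\<lambda>m. real (nq m q) / real (N m)) \<longlonglongrightarrow> r q"
    unfolding bchoice_iff by (metis lessThan_iff)
  define \<rho> where "\<rho> = Min ((\<lambda>q. r q / 2) ` {..<nQ K})"
  have ne: "{..<nQ K} \<noteq> {}" by (simp add: nQ_def lessThan_empty_iff)
  have \<rho>: "0 < \<rho>" unfolding \<rho>_def using ne r(1) by (subst Min_gr_iff) auto
  have \<rho>le: "\<rho> \<le> r q / 2" if "q < nQ K" for q unfolding \<rho>_def using that by (intro Min_le) auto
  have "eventually (\<lambda>m. \<rho> * real (N m) \<le> real (nq m q)) sequentially" if q: "q < nQ K" for q
  proof -
    have "r q / 2 < r q" using r(1)[OF q] by simp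
    from order_tendstoD(1)[OF r(2)[OF q] this] show ?thesis
    proof (rule eventually_mono)
      fix m assume "r q / 2 < real (nq m q) / real (N m)"
      then have "\<rho> \<le> real (nq m q) / real (N m)" using \<rho>le[OF q] by linarith
      then show "\<rho> * real (N m) \<le> real (nq m q)" using N_pos[of m] by (simp add: pos_le_divide_eq)
    qed
  qed
  then have "eventually (\<lambda>m. \<forall>q\<in>{..<nQ K}. \<rho> * real (N m) \<le> real (nq m q)) sequentially"
    by (intro eventually_ball_finite) auto
  then show ?thesis using \<rho> by (intro exI[of _ \<rho>]) (simp add: Ball_def)
qed

lemma Vtt_lower: "\<exists>c>0. eventually (\<lambda>m. \<forall>v\<in>carrier_vec (nF K).
    c / real (N m) * (v \<bullet> v) \<le> v \<bullet> (Vtt K (N m) (nq m) (Y m) *\<^sub>v v)) sequentially"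
proof -
  define A where "A m = real (N m) \<cdot>\<^sub>m Vtt K (N m) (nq m) (Y m)" for m
  obtain B where B: "B \<in> carrier_mat (nF K) (nF K)" "det B \<noteq> 0"
      "\<And>f g. f < nF K \<Longrightarrow> g < nF K \<Longrightarrow> (\<lambda>m. real (N m) * Vtt K (N m) (nq m) (Y m) $$ (f, g)) \<longlonglongrightarrow> B $$ (f, g)"
    using Vl unfolding Vlim_nonsingular_def by blast
  have Ac: "A m \<in> carrier_mat (nF K) (nF K)" for m unfolding A_def using Vtt_carrier by simp
  have At: "(A m)\<^sup>T = A m" for m
  proof -
    have "(k \<cdot>\<^sub>m B)\<^sup>T = k \<cdot>\<^sub>m B\<^sup>T" for k :: real and B by (intro eq_matI) auto
    then show ?thesis unfolding A_def by (simp only: Vtt_sym)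
  qed
  have V0: "0 \<le> v \<bullet> (Vtt K (N m) (nq m) (Y m) *\<^sub>v v)" if "v \<in> carrier_vec (nF K)" for m v
    by (rule Vtt_psd[OF K groups_nonempty group_sizes that])
  have Aq: "v \<bullet> (A m *\<^sub>v v) = real (N m) * (v \<bullet> (Vtt K (N m) (nq m) (Y m) *\<^sub>v v))" if "v \<in> carrier_vec (nF K)" for m v
    unfolding A_def by (rule quadratic_form_smult[OF Vtt_carrier that])
  have Alim: "(\<lambda>m. A m $$ (f, g)) \<longlonglongrightarrow> B $$ (f, g)" if "f < nF K" "g < nF K" for f g
  proof -
    have "A m $$ (f, g) = real (N m) * Vtt K (N m) (nq m) (Y m) $$ (f, g)" for m
      using that carrier_matD[OF Vtt_carrier[of K "N m" "nq m" "Y m"]] by (simp add: A_def)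
    then show ?thesis using B(3)[OF that] by simp
  qed
  have "\<exists>c>0. eventually (\<lambda>m. \<forall>v\<in>carrier_vec (nF K). c * (v \<bullet> v) \<le> v \<bullet> (A m *\<^sub>v v)) sequentially"
    by (rule psd_uniform_lower_bound[OF Ac At _ B(1,2) Alim]) (use Aq V0 N_pos in \<open>auto simp: less_imp_le\<close>)
  then obtain c where c: "c > 0" "eventually (\<lambda>m. \<forall>v\<in>carrier_vec (nF K). c * (v \<bullet> v) \<le> v \<bullet> (A m *\<^sub>v v)) sequentially" by blast
  from c(2) have "eventually (\<lambda>m. \<forall>v\<in>carrier_vec (nF K). c / real (N m) * (v \<bullet> v) \<le> v \<bullet> (Vtt K (N m) (nq m) (Y m) *\<^sub>v v)) sequentially"
  proof (rule eventually_mono, intro ballI)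
    fix m and v :: "real vec" assume h: "\<forall>v\<in>carrier_vec (nF K). c * (v \<bullet> v) \<le> v \<bullet> (A m *\<^sub>v v)" and v: "v \<in> carrier_vec (nF K)"
    then have "c * (v \<bullet> v) \<le> real (N m) * (v \<bullet> (Vtt K (N m) (nq m) (Y m) *\<^sub>v v))" using Aq by simp
    then show "c / real (N m) * (v \<bullet> v) \<le> v \<bullet> (Vtt K (N m) (nq m) (Y m) *\<^sub>v v)"
      using N_pos[of m] by (simp add: pos_divide_le_eq mult.commute)
  qed
  then show ?thesis using c(1) by blast
qed

lemma Smat_x_lower: "\<exists>c>0. eventually (\<lambda>m. \<forall>v\<in>carrier_vec L. c * (v \<bullet> v) \<le> v \<bullet> (Smat_x L (N m) (X m) *\<^sub>v v)) sequentially"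
proof -
  obtain B where B: "B \<in> carrier_mat L L" "det B \<noteq> 0"
      "\<And>f g. f < L \<Longrightarrow> g < L \<Longrightarrow> (\<lambda>m. Smat_x L (N m) (X m) $$ (f, g)) \<longlonglongrightarrow> B $$ (f, g)"
    using cii unfolding cond_ii_def by blast
  have "1 \<le> N m" for m using N_ge[of m] by simp
  then show ?thesis
    by (intro psd_uniform_lower_bound[OF Smat_x_carrier Smat_x_sym _ B]) (rule Smat_x_psd)
qed

lemma variance_bound: "\<exists>v. eventually (\<lambda>m. (\<Sum>q<nQ K. fcov (N m) (\<lambda>i. Y m i q) (\<lambda>i. Y m i q)) + (\<Sum>l<L. Smat_x L (N m) (X m) $$ (l, l)) \<le> v) sequentially"
proof -
  let ?f = "\<lambda>m. (\<Sum>q<nQ K. fcov (N m) (\<lambda>i. Y m i q) (\<lambda>i. Y m i q)) + (\<Sum>l<L. Smat_x L (N m) (X m) $$ (l, l))"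
  have 1: "convergent (\<lambda>m. fcov (N m) (\<lambda>i. Y m i q) (\<lambda>i. Y m i q))" if "q < nQ K" for q
    using cii that unfolding cond_ii_def by blast
  have 2: "convergent (\<lambda>m. Smat_x L (N m) (X m) $$ (l, l))" if "l < L" for l
    using cii that unfolding cond_ii_def convergent_def by blast
  have "convergent ?f"
    by (intro convergent_add convergent_sum) (use 1 2 in auto)
  then obtain b where "?f \<longlonglongrightarrow> b" unfolding convergent_def by blast
  from order_tendstoD(2)[OF this, of "b + 1"]
  have "eventually (\<lambda>m. ?f m < b + 1) sequentially" by simp
  then have "eventually (\<lambda>m. ?f m \<le> b + 1) sequentially" by (rule eventually_mono) simp
  then show ?thesis by blast
qed

definition "max_resid m = (\<Sum>q<nQ K. Max ((\<lambda>i. (Y m i q - fmean (N m) (\<lambda>j. Y m j q))\<^sup>2) ` {..<N m}) / real (N m))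
   + Max ((\<lambda>i. \<Sum>l<L. (X m i l - fmean (N m) (\<lambda>j. X m j l))\<^sup>2) ` {..<N m}) / real (N m)"

lemma max_resid_tendsto: "max_resid \<longlonglongrightarrow> 0"
proof -
  have 1: "(\<lambda>m. Max ((\<lambda>i. (Y m i q - fmean (N m) (\<lambda>j. Y m j q))\<^sup>2) ` {..<N m}) / real (N m)) \<longlonglongrightarrow> 0" if "q < nQ K" for q
    using ciii that unfolding cond_iii_def by blast
  have 2: "(\<lambda>m. Max ((\<lambda>i. \<Sum>l<L. (X m i l - fmean (N m) (\<lambda>j. X m j l))\<^sup>2) ` {..<N m}) / real (N m)) \<longlonglongrightarrow> 0"
    using ciii unfolding cond_iii_def by blast
  have 3: "(\<lambda>m. \<Sum>q<nQ K. Max ((\<lambda>i. (Y m i q - fmean (N m) (\<lambda>j. Y m j q))\<^sup>2) ` {..<N m}) / real (N m)) \<longlonglongrightarrow> 0"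
    by (rule tendsto_null_sum) (use 1 in auto)
  show ?thesis
    unfolding max_resid_def[abs_def] using tendsto_add[OF 3 2] by simp
qed

lemma entry_limit:
  assumes B: "B \<in> carrier_mat (nF K) (nF K)" and R: "R \<in> carrier_mat (nF K) (nF K)"
    and Rm: "\<And>m. Rm m \<in> carrier_mat (nF K) (nF K)"
    and lim: "\<And>f g. f < nF K \<Longrightarrow> g < nF K \<Longrightarrow> (\<lambda>m. Rm m $$ (f, g)) \<longlonglongrightarrow> R $$ (f, g)"
    and f: "f < nF K" and g: "g < nF K"
  shows "(\<lambda>m. (B * Rm m * B\<^sup>T) $$ (f, g)) \<longlonglongrightarrow> (B * R * B\<^sup>T :: real mat) $$ (f, g)"
proof -
  have BT: "B\<^sup>T \<in> carrier_mat (nF K) (nF K)" using B by simp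
  have e: "(B * M * B\<^sup>T) $$ (f, g) = (\<Sum>k<nF K. (\<Sum>h<nF K. B $$ (f, h) * M $$ (h, k)) * B\<^sup>T $$ (k, g))"
    if M: "M \<in> carrier_mat (nF K) (nF K)" for M
  proof -
    have BM: "B * M \<in> carrier_mat (nF K) (nF K)" using B M by simp
    show ?thesis
      unfolding mult_mat_sum[OF BM BT f g]
      by (rule sum.cong[OF refl]) (use mult_mat_sum[OF B M f] in \<open>simp del: index_mult_mat\<close>)
  qed
  show ?thesis
    unfolding e[OF R] e[OF Rm] by (intro tendsto_intros lim) auto
qed

lemma rotated_limit:
  "\<exists>Om\<in>carrier_mat (nF K) (nF K). Om\<^sup>T * Om = 1\<^sub>m (nF K) \<and> (\<forall>f<nF K. \<forall>g<nF K.
     (\<lambda>m. (Om * Rmat K L (N m) (nq m) (Y m) (X m) * Om\<^sup>T) $$ (f, g)) \<longlonglongrightarrow> (if f = g then p ! f else 0))"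
proof -
  let ?F = "nF K" and ?R = "\<lambda>m. Rmat K L (N m) (nq m) (Y m) (X m)"
  obtain R where R: "R \<in> carrier_mat ?F ?F" "char_poly R = (\<Prod>x\<leftarrow>p. [:- x, 1:])"
      "\<And>f g. f < ?F \<Longrightarrow> g < ?F \<Longrightarrow> (\<lambda>m. ?R m $$ (f, g)) \<longlonglongrightarrow> R $$ (f, g)"
    using cc unfolding canon_corr_limit_def by blast
  have one: "1\<^sub>m ?F \<in> carrier_mat ?F ?F" "(1\<^sub>m ?F)\<^sup>T * 1\<^sub>m ?F = (1\<^sub>m ?F :: real mat)" by simp_all
  have Rc: "?R m \<in> carrier_mat ?F ?F" for m
    by (rule Rmat_carrier[OF K L groups_nonempty group_sizes Smat_x_invertible Vtt_invertible one])
  have Rs: "(?R m)\<^sup>T = ?R m" for m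
    by (rule Rmat_sym[OF K L groups_nonempty group_sizes Smat_x_invertible Vtt_invertible one])
  have RT: "R\<^sup>T = R"
  proof (rule eq_matI)
    fix f g assume "f < dim_row R" "g < dim_col R"
    then have fg: "f < ?F" "g < ?F" using R(1) by auto
    have "?R m $$ (f, g) = ?R m $$ (g, f)" for m
    proof -
      have "(?R m)\<^sup>T $$ (f, g) = ?R m $$ (g, f)" using Rc[of m] fg by simp
      then show ?thesis unfolding Rs .
    qed
    then have "R $$ (f, g) = R $$ (g, f)"
      using LIMSEQ_unique[OF R(3)[OF fg]] R(3)[OF fg(2,1)] by simp
    then show "R\<^sup>T $$ (f, g) = R $$ (f, g)" using R(1) fg by simp
  qed (use R(1) in auto)
  obtain P where P: "P \<in> carrier_mat ?F ?F" "P\<^sup>T * P = 1\<^sub>m ?F" "P\<^sup>T * R * P = mat_diag ?F (\<lambda>i. p ! i)"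
    using symmetric_orthogonal_diagonalization[OF R(1) RT R(2)] by blast
  have PT: "P\<^sup>T \<in> carrier_mat ?F ?F" using P by simp
  have "(P\<^sup>T)\<^sup>T * P\<^sup>T = 1\<^sub>m ?F" using mat_mult_left_right_inverse[OF PT P(1,2)] by simp
  moreover have "(\<lambda>m. (P\<^sup>T * ?R m * (P\<^sup>T)\<^sup>T) $$ (f, g)) \<longlonglongrightarrow> (if f = g then p ! f else 0)" if fg: "f < ?F" "g < ?F" for f g
  proof -
    have "(P\<^sup>T * R * (P\<^sup>T)\<^sup>T) $$ (f, g) = (if f = g then p ! f else 0)"
      using P(3) fg by (simp add: mat_diag_def)
    then show ?thesis using entry_limit[OF PT R(1) Rc R(3) fg] by simp
  qed
  ultimately show ?thesis using PT by blast
qed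

context
  fixes Om :: "real mat"
  assumes Om: "Om \<in> carrier_mat (nF K) (nF K)" "Om\<^sup>T * Om = 1\<^sub>m (nF K)"
    and Om_lim: "\<And>f g. f < nF K \<Longrightarrow> g < nF K \<Longrightarrow>
     (\<lambda>m. (Om * Rmat K L (N m) (nq m) (Y m) (X m) * Om\<^sup>T) $$ (f, g)) \<longlonglongrightarrow> (if f = g then p ! f else 0)"
begin

definition "ustat m f Z = lin_stat (N m) (ucontrast K (N m) (nq m) (Y m) Om f) Z"
definition "vstat m j Z = lin_stat (N m) (vcontrast K L (N m) (nq m) (X m) j) Z"
definition "ccorr m f j = Cmat K L (N m) (nq m) (Y m) (X m) Om $$ (f, j)"

lemma ccorr_contraction: "(\<Sum>j<nF K * L. (\<Sum>f<nF K. ccorr m f j * x f)\<^sup>2) \<le> (\<Sum>f<nF K. (x f)\<^sup>2)"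
  unfolding ccorr_def by (rule Cmat_contraction[OF K L groups_nonempty group_sizes Smat_x_invertible Vtt_invertible Om])

lemma ccorr_limit:
  assumes "f < nF K" "g < nF K"
  shows "(\<lambda>m. \<Sum>j<nF K * L. ccorr m f j * ccorr m g j) \<longlonglongrightarrow> (if f = g then p ! f else 0)"
proof -
  have "(\<Sum>j<nF K * L. ccorr m f j * ccorr m g j) = (Om * Rmat K L (N m) (nq m) (Y m) (X m) * Om\<^sup>T) $$ (f, g)" for m
  proof -
    let ?C = "Cmat K L (N m) (nq m) (Y m) (X m) Om"
    have gram: "?C * ?C\<^sup>T = Om * Rmat K L (N m) (nq m) (Y m) (X m) * Om\<^sup>T"
      by (rule Cmat_gram[OF K L groups_nonempty group_sizes Smat_x_invertible Vtt_invertible Om])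
    have Cc: "?C \<in> carrier_mat (nF K) (nF K * L)"
      by (rule Cmat_carrier[OF K L groups_nonempty group_sizes Smat_x_invertible Vtt_invertible Om])
    then have CT: "?C\<^sup>T \<in> carrier_mat (nF K * L) (nF K)" by simp
    show ?thesis
      unfolding gram[symmetric] mult_mat_sum[OF Cc CT assms] ccorr_def
      using Cc assms by (intro sum.cong refl) simp
  qed
  then show ?thesis using Om_lim[OF assms] by simp
qed

lemma p_range: "\<forall>x\<in>set p. 0 \<le> x \<and> x \<le> 1"
proof -
  have len: "length p = nF K" using cc by (simp add: canon_corr_limit_def)
  have "0 \<le> p ! f \<and> p ! f \<le> 1" if f: "f < nF K" for f
  proof -
    have lim: "(\<lambda>m. \<Sum>j<nF K * L. ccorr m f j * ccorr m f j) \<longlonglongrightarrow> p ! f" using ccorr_limit[OF f f] by simp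
    have "(\<Sum>j<nF K * L. ccorr m f j * ccorr m f j) \<le> 1" for m
    proof -
      have "(\<Sum>g<nF K. ccorr m g j * (if g = f then 1 else 0)) = ccorr m f j" for j
        using f by (simp add: if_distrib[of "\<lambda>x. _ * x"] cong: if_cong)
      moreover have "(\<Sum>g<nF K. (if g = f then 1 else 0 :: real)\<^sup>2) = 1"
        using f by (simp add: if_distrib[of "\<lambda>x. x\<^sup>2"] cong: if_cong)
      ultimately show ?thesis
        using ccorr_contraction[of m "\<lambda>g. if g = f then 1 else 0"] by (simp add: power2_eq_square)
    qed
    then have "p ! f \<le> 1" by (intro LIMSEQ_le_const2[OF lim]) auto
    moreover have "0 \<le> p ! f" by (intro LIMSEQ_le_const[OF lim]) (auto intro!: sum_nonneg exI[of _ 0])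
    ultimately show ?thesis by simp
  qed
  then show ?thesis using len by (simp add: all_set_conv_all_nth)
qed

lemma entries_bound: "\<exists>A. eventually (\<lambda>m.
    (\<forall>f<nF K. \<forall>g<nF K. \<bar>Umat K (N m) (nq m) (Y m) Om $$ (f, g)\<bar> \<le> A * sqrt (real (N m))) \<and>
    (\<forall>j<nF K * L. \<forall>k<nF K * L. \<bar>Xmat K L (N m) (nq m) (X m) $$ (j, k)\<bar> \<le> A * sqrt (real (N m)))) sequentially"
proof -
  obtain c where c: "c > 0" "eventually (\<lambda>m. \<forall>v\<in>carrier_vec (nF K).
    c / real (N m) * (v \<bullet> v) \<le> v \<bullet> (Vtt K (N m) (nq m) (Y m) *\<^sub>v v)) sequentially" using Vtt_lower by blast
  obtain b where b: "b > 0" "eventually (\<lambda>m. \<forall>v\<in>carrier_vec L. b * (v \<bullet> v) \<le> v \<bullet> (Smat_x L (N m) (X m) *\<^sub>v v)) sequentially"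
    using Smat_x_lower by blast
  define A1 where "A1 = real (nF K) * sqrt (1 / c)"
  define A2 where "A2 = sqrt (1 / (b * real (nQ K) / 2 ^ (2 * (K - 1))))"
  show ?thesis
  proof (rule exI[of _ "max A1 A2"], rule eventually_mono[OF eventually_conj[OF c(2) b(2)]], intro conjI allI impI)
    fix m f g assume h: "(\<forall>v\<in>carrier_vec (nF K). c / real (N m) * (v \<bullet> v) \<le> v \<bullet> (Vtt K (N m) (nq m) (Y m) *\<^sub>v v)) \<and>
       (\<forall>v\<in>carrier_vec L. b * (v \<bullet> v) \<le> v \<bullet> (Smat_x L (N m) (X m) *\<^sub>v v))" and fg: "f < nF K" "g < nF K"
    have cN: "0 < c / real (N m)" using c(1) N_pos by simp
    have hv: "c / real (N m) * (v \<bullet> v) \<le> v \<bullet> (Vtt K (N m) (nq m) (Y m) *\<^sub>v v)" if "v \<in> carrier_vec (nF K)" for v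
      using h that by blast
    have "\<bar>Umat K (N m) (nq m) (Y m) Om $$ (f, g)\<bar> \<le> real (nF K) * sqrt (1 / (c / real (N m)))"
      by (rule Umat_entry_le[OF K L groups_nonempty group_sizes Smat_x_invertible Vtt_invertible Om cN hv fg])
    also have "\<dots> = A1 * sqrt (real (N m))" by (simp add: A1_def real_sqrt_divide)
    also have "\<dots> \<le> max A1 A2 * sqrt (real (N m))" by (intro mult_right_mono) auto
    finally show "\<bar>Umat K (N m) (nq m) (Y m) Om $$ (f, g)\<bar> \<le> max A1 A2 * sqrt (real (N m))" .
  next
    fix m j k assume h: "(\<forall>v\<in>carrier_vec (nF K). c / real (N m) * (v \<bullet> v) \<le> v \<bullet> (Vtt K (N m) (nq m) (Y m) *\<^sub>v v)) \<and>
       (\<forall>v\<in>carrier_vec L. b * (v \<bullet> v) \<le> v \<bullet> (Smat_x L (N m) (X m) *\<^sub>v v))" and jk: "j < nF K * L" "k < nF K * L"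
    have hv: "b * (v \<bullet> v) \<le> v \<bullet> (Smat_x L (N m) (X m) *\<^sub>v v)" if "v \<in> carrier_vec L" for v
      using h that by blast
    have "\<bar>Xmat K L (N m) (nq m) (X m) $$ (j, k)\<bar> \<le> sqrt (1 / (b * real (nQ K) / (2 ^ (2 * (K - 1)) * real (N m))))"
      by (rule Xmat_entry_le[OF K L groups_nonempty group_sizes Smat_x_invertible Vtt_invertible Om b(1) hv jk])
    also have "\<dots> = A2 * sqrt (real (N m))"
      unfolding A2_def real_sqrt_mult[symmetric] by simp
    also have "\<dots> \<le> max A1 A2 * sqrt (real (N m))" by (intro mult_right_mono) auto
    finally show "\<bar>Xmat K L (N m) (nq m) (X m) $$ (j, k)\<bar> \<le> max A1 A2 * sqrt (real (N m))" .
  qed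
qed

lemma characteristic_limit:
  "(\<lambda>m. avg (assignments K (N m) (nq m)) (\<lambda>Z. iexp ((\<Sum>f<nF K. x f * ustat m f Z) + (\<Sum>j<nF K * L. y j * vstat m j Z)))
     - complex_of_real (exp (- pair_form (nF K) (nF K * L) (ccorr m) (1 / 2) (1 / 2) x y))) \<longlonglongrightarrow> 0"
proof -
  obtain \<rho> where \<rho>: "\<rho> > 0" "eventually (\<lambda>m. \<forall>q<nQ K. \<rho> * real (N m) \<le> real (nq m q)) sequentially"
    using group_fraction by blast
  obtain A where A: "eventually (\<lambda>m.
    (\<forall>f<nF K. \<forall>g<nF K. \<bar>Umat K (N m) (nq m) (Y m) Om $$ (f, g)\<bar> \<le> A * sqrt (real (N m))) \<and>
    (\<forall>j<nF K * L. \<forall>k<nF K * L. \<bar>Xmat K L (N m) (nq m) (X m) $$ (j, k)\<bar> \<le> A * sqrt (real (N m)))) sequentially"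
    using entries_bound by blast
  obtain v where v: "eventually (\<lambda>m. (\<Sum>q<nQ K. fcov (N m) (\<lambda>i. Y m i q) (\<lambda>i. Y m i q)) + (\<Sum>l<L. Smat_x L (N m) (X m) $$ (l, l)) \<le> v) sequentially"
    using variance_bound by blast
  define H where "H = std_const K L A \<rho> x y"
  define s where "s = real (nQ K) * H\<^sup>2 * v"
  define M where "M m = H * sqrt (max_resid m) + 1 / real (N m)" for m
  define B where "B = (\<Sum>f<nF K. (x f)\<^sup>2) + (\<Sum>j<nF K * L. (y j)\<^sup>2)"
  have eps: "resid_sq K L (N m) (Y m) (X m) i / real (N m) \<le> max_resid m" if i: "i < N m" for m i
  proof -
    have e: "resid_sq K L (N m) (Y m) (X m) i = (\<Sum>q<nQ K. (Y m i q - fmean (N m) (\<lambda>i. Y m i q))\<^sup>2) + (\<Sum>l<L. (X m i l - fmean (N m) (\<lambda>i. X m i l))\<^sup>2)"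
      by (rule resid_sq_def[OF K L groups_nonempty group_sizes Smat_x_invertible Vtt_invertible Om])
    have r: "max_resid m = (\<Sum>q<nQ K. Max ((\<lambda>i. (Y m i q - fmean (N m) (\<lambda>j. Y m j q))\<^sup>2) ` {..<N m}) / real (N m))
       + Max ((\<lambda>i. \<Sum>l<L. (X m i l - fmean (N m) (\<lambda>j. X m j l))\<^sup>2) ` {..<N m}) / real (N m)"
      by (rule max_resid_def)
    show ?thesis
      unfolding e r add_divide_distrib sum_divide_distrib[where A = "{..<nQ K}"]
      using i by (intro add_mono sum_mono divide_right_mono Max_ge) auto
  qed
  have bound: "eventually (\<lambda>m. cmod (avg (assignments K (N m) (nq m)) (\<lambda>Z. iexp ((\<Sum>f<nF K. x f * ustat m f Z) + (\<Sum>j<nF K * L. y j * vstat m j Z)))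
     - complex_of_real (exp (- pair_form (nF K) (nF K * L) (ccorr m) (1 / 2) (1 / 2) x y)))
     \<le> 11 * M m * s + M m + 4 * real (nQ K) * s / real (N m) + B / real (N m)) sequentially"
    using \<rho>(2) A v
  proof eventually_elim
    case (elim m)
    have C: "ccorr m = (\<lambda>f j. Cmat K L (N m) (nq m) (Y m) (X m) Om $$ (f, j))" by (intro ext) (rule ccorr_def)
    show ?case
      unfolding ustat_def vstat_def C M_def s_def H_def B_def
      by (rule standardized_clt[OF K L groups_nonempty group_sizes Smat_x_invertible Vtt_invertible Om \<rho>(1), where A = A]) (use elim eps in auto)
  qed
  have M0: "M \<longlonglongrightarrow> 0"
  proof -
    have "(\<lambda>m. sqrt (max_resid m)) \<longlonglongrightarrow> 0" using tendsto_real_sqrt[OF max_resid_tendsto] by simp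
    from tendsto_add[OF tendsto_mult_left[OF this, of H] inverse_N] show ?thesis by (simp add: M_def[abs_def])
  qed
  have kN: "(\<lambda>m. k / real (N m)) \<longlonglongrightarrow> 0" for k :: real
    using tendsto_mult_left[OF inverse_N, of k] by simp
  have "(\<lambda>m. 11 * M m * s + M m + 4 * real (nQ K) * s / real (N m) + B / real (N m)) \<longlonglongrightarrow> 11 * 0 * s + 0 + 0 + 0"
    by (intro tendsto_add tendsto_mult M0 kN tendsto_const)
  then have "(\<lambda>m. 11 * M m * s + M m + 4 * real (nQ K) * s / real (N m) + B / real (N m)) \<longlonglongrightarrow> 0" by simp
  from Lim_null_comparison[OF bound this] show ?thesis .
qed

lemma coverage_tendsto_rotated:
  assumes a: "0 < a"
  shows "(\<lambda>m. cover_prob K L (N m) (nq m) (Y m) (X m) a c)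
    \<longlonglongrightarrow> quad_prob (padded (nF K * L) p) a c / half_prob (padded (nF K * L) p) a"
proof -
  have len: "length p = nF K" using cc by (simp add: canon_corr_limit_def)
  have F: "0 < nF K" using K one_less_power[of "2::nat" K] by (simp add: nF_def)
  then have ne: "p \<noteq> []" using len by auto
  have le: "length p \<le> nF K * L" using len L by simp
  let ?S = "\<lambda>m. assignments K (N m) (nq m)"
  define u where "u m Z = (\<Sum>f<nF K. (ustat m f Z)\<^sup>2)" for m Z
  define v where "v m Z = (\<Sum>j<nF K * L. (vstat m j Z)\<^sup>2)" for m Z
  have S: "finite (?S m)" "?S m \<noteq> {}" for m
    by (rule finite_assignments) (rule assignments_nonempty[OF group_sizes])
  have lap: "(\<lambda>m. avg (?S m) (\<lambda>Z. exp (- s * u m Z - r * v m Z)))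
     \<longlonglongrightarrow> (1 / sqrt (1 + 2 * r)) ^ (nF K * L) * (\<Prod>f<length p. 1 / sqrt (1 + 2 * s - 4 * s * r / (1 + 2 * r) * p ! f))"
    if sr: "0 \<le> s" "0 \<le> r" for s r
    unfolding u_def v_def len
  proof (rule avg_laplace_tendsto[OF S sr characteristic_limit ccorr_contraction ccorr_limit])
    fix f assume "f < nF K"
    then show "p ! f \<le> 1" using p_range len by simp
  qed
  have "(\<lambda>m. real (card {Z \<in> ?S m. u m Z \<le> c \<and> v m Z \<le> a}) / real (card {Z \<in> ?S m. v m Z \<le> a}))
     \<longlonglongrightarrow> quad_prob (padded (nF K * L) p) a c / half_prob (padded (nF K * L) p) a"
    by (rule conditional_quadrant_tendsto[OF p_range ne le a S _ _ lap]) (auto simp: u_def v_def sum_nonneg)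
  moreover have "real (card {Z \<in> ?S m. u m Z \<le> c \<and> v m Z \<le> a}) / real (card {Z \<in> ?S m. v m Z \<le> a})
      = cover_prob K L (N m) (nq m) (Y m) (X m) a c" for m
  proof -
    have un: "u m Z = (tau_hat K (N m) (nq m) (Y m) Z - tau_avg K (N m) (Y m)) \<bullet>
        (minv (nF K) (Vtt K (N m) (nq m) (Y m)) *\<^sub>v (tau_hat K (N m) (nq m) (Y m) Z - tau_avg K (N m) (Y m)))" if Z: "Z \<in> ?S m" for Z
      unfolding u_def ustat_def by (rule ucontrast_norm[OF K L groups_nonempty group_sizes Smat_x_invertible Vtt_invertible Om Z])
    have vn: "v m Z = tau_hat_x K L (N m) (nq m) (X m) Z \<bullet>
        (minv (nF K * L) (Vxx K L (N m) (nq m) (X m)) *\<^sub>v tau_hat_x K L (N m) (nq m) (X m) Z)" if Z: "Z \<in> ?S m" for Z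
      unfolding v_def vstat_def by (rule vcontrast_norm[OF K L groups_nonempty group_sizes Smat_x_invertible Vtt_invertible Om Z])
    have A: "{Z \<in> ?S m. v m Z \<le> a} = {Z \<in> ?S m. accept K L (N m) (nq m) (X m) a Z}"
      by (rule Collect_cong) (auto simp: accept_def vn)
    have B: "{Z \<in> ?S m. u m Z \<le> c \<and> v m Z \<le> a} = {Z \<in> {Z \<in> ?S m. accept K L (N m) (nq m) (X m) a Z}.
       (tau_hat K (N m) (nq m) (Y m) Z - tau_avg K (N m) (Y m)) \<bullet>
        (minv (nF K) (Vtt K (N m) (nq m) (Y m)) *\<^sub>v (tau_hat K (N m) (nq m) (Y m) Z - tau_avg K (N m) (Y m))) \<le> c}"
      by (rule Collect_cong) (auto simp: accept_def un vn)
    show ?thesis unfolding A B cover_prob_def Let_def ..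
  qed
  ultimately show ?thesis by simp
qed

end

lemma coverage_tendsto:
  assumes a: "0 < a"
  shows "(\<lambda>m. cover_prob K L (N m) (nq m) (Y m) (X m) a c)
    \<longlonglongrightarrow> quad_prob (padded (nF K * L) p) a c / half_prob (padded (nF K * L) p) a"
  and canonical_correlation_range: "\<forall>x\<in>set p. 0 \<le> x \<and> x \<le> 1"
proof -
  obtain Om where Om: "Om \<in> carrier_mat (nF K) (nF K)" "Om\<^sup>T * Om = 1\<^sub>m (nF K)"
    "\<And>f g. f < nF K \<Longrightarrow> g < nF K \<Longrightarrow>
     (\<lambda>m. (Om * Rmat K L (N m) (nq m) (Y m) (X m) * Om\<^sup>T) $$ (f, g)) \<longlonglongrightarrow> (if f = g then p ! f else 0)"
    using rotated_limit by blast
  show "(\<lambda>m. cover_prob K L (N m) (nq m) (Y m) (X m) a c)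
    \<longlonglongrightarrow> quad_prob (padded (nF K * L) p) a c / half_prob (padded (nF K * L) p) a"
    by (rule coverage_tendsto_rotated[OF Om a])
  show "\<forall>x\<in>set p. 0 \<le> x \<and> x \<le> 1" by (rule p_range[OF Om])
qed

end

theorem theorem5:
  fixes K L :: nat and a \<alpha> :: real
  assumes "1 \<le> K" and "1 \<le> L" and "0 < a" and "0 < \<alpha>" and "\<alpha> < 1"
  shows "\<exists>c :: real list \<Rightarrow> real.
     (\<forall>N nq Y X p.
        design_ok K L N nq Y X \<and> cond_i K N nq \<and> cond_ii K L N Y X \<and> cond_iii K L N Y X \<and>
        Vlim_nonsingular K N nq Y \<and> canon_corr_limit K L N nq Y X p \<longrightarrow>
          (\<lambda>m. cover_prob K L (N m) (nq m) (Y m) (X m) a (c p)) \<longlonglongrightarrow> 1 - \<alpha> \<and>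
          (\<forall>c'. (\<lambda>m. cover_prob K L (N m) (nq m) (Y m) (X m) a c') \<longlonglongrightarrow> 1 - \<alpha> \<longrightarrow> c' = c p)) \<and>
     (\<forall>p p'. length p = nF K \<and> length p' = nF K \<and>
        (\<forall>f<nF K. 0 \<le> p ! f \<and> p ! f \<le> p' ! f \<and> p' ! f \<le> 1) \<longrightarrow> c p' \<le> c p)"
proof -
  let ?c = "crit (nF K * L) a (1 - \<alpha>)"
  have F: "0 < nF K" using assms(1) one_less_power[of "2::nat" K] by (simp add: nF_def)
  have \<beta>: "0 < 1 - \<alpha>" "1 - \<alpha> < 1" using assms by simp_all
  have 1: "(\<lambda>m. cover_prob K L (N m) (nq m) (Y m) (X m) a (?c p)) \<longlonglongrightarrow> 1 - \<alpha> \<and>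
          (\<forall>c'. (\<lambda>m. cover_prob K L (N m) (nq m) (Y m) (X m) a c') \<longlonglongrightarrow> 1 - \<alpha> \<longrightarrow> c' = ?c p)"
    if h: "design_ok K L N nq Y X \<and> cond_i K N nq \<and> cond_ii K L N Y X \<and> cond_iii K L N Y X \<and>
        Vlim_nonsingular K N nq Y \<and> canon_corr_limit K L N nq Y X p" for N nq Y X p
  proof -
    have hs: "design_ok K L N nq Y X" "cond_i K N nq" "cond_ii K L N Y X" "cond_iii K L N Y X"
        "Vlim_nonsingular K N nq Y" "canon_corr_limit K L N nq Y X p" using h by blast+
    note lim = coverage_tendsto(1)[OF assms(1,2) hs assms(3)]
    have r: "\<forall>x\<in>set p. 0 \<le> x \<and> x \<le> 1" by (rule canonical_correlation_range[OF assms(1,2) hs assms(3)])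
    have ne: "p \<noteq> []" using F hs(6) by (auto simp: canon_corr_limit_def)
    note c = crit[OF r ne assms(3) \<beta>, where e = "nF K * L"]
    show ?thesis
    proof (intro conjI allI impI)
      show "(\<lambda>m. cover_prob K L (N m) (nq m) (Y m) (X m) a (?c p)) \<longlonglongrightarrow> 1 - \<alpha>"
        using lim[where c = "?c p"] unfolding c(1) .
      fix c' assume "(\<lambda>m. cover_prob K L (N m) (nq m) (Y m) (X m) a c') \<longlonglongrightarrow> 1 - \<alpha>"
      then show "c' = ?c p" by (intro c(2) LIMSEQ_unique[OF lim])
    qed
  qed
  have 2: "?c p' \<le> ?c p" if "length p = nF K \<and> length p' = nF K \<and>
        (\<forall>f<nF K. 0 \<le> p ! f \<and> p ! f \<le> p' ! f \<and> p' ! f \<le> 1)" for p p'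
    by (rule crit_antimono[OF _ _ _ assms(3) \<beta>]) (use that F in auto)
  show ?thesis
    by (rule exI[of _ ?c]) (use 1 2 in blast)
qed

end
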